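(* The category $\mathbf{Amp}_\star$, whose objects are ample inverse semigroupoids and whose morphisms are proper continuous covering homomorphisms, is dually equivalent to the category $\Sigma\text{-}\mathbf{Ord}$ of $\Sigma$-ordered inverse semigroups and their morphisms; that is, there is an equivalence of categories $\mathbf{Amp}_\star^{\mathrm{op}}\simeq\Sigma\text{-}\mathbf{Ord}$.
   Context: Semigroupoids. A semigroupoid is a set $\Lambda$ with $\Lambda^{[2]}\subseteq\Lambda\times\Lambda$ and a product $\Lambda^{[2]}\to\Lambda$, $(f,g)\mapsto fg$, such that for all $f,g,h$ the statements (i) $(f,g),(g,h)\in\Lambda^{[2]}$; (ii) $(f,g),(fg,h)\in\Lambda^{[2]}$; (iii) $(g,h),(f,gh)\in\Lambda^{[2]}$ are equivalent, and then $(fg)h=f(gh)$. An inverse semigroupoid $\mathcal{S}$ is a semigroupoid in which each $a$ has a unique $a^*$ with $aa^*,a^*a$ defined, $aa^*a=a$, $a^*aa^*=a^*$. It carries a (unique up to relabelling vertices) compatible graph structure: a set $\mathcal{S}^{(0)}$ and maps $\mathfrak{s},\mathfrak{r}\colon\mathcal{S}\to\mathcal{S}^{(0)}$ with $\mathcal{S}^{(0)}=\mathfrak{s}(\mathcal{S})\cup\mathfrak{r}(\mathcal{S})$, such that $ab$ is defined iff $\mathfrak{s}(a)=\mathfrak{r}(b)$, and then $\mathfrak{s}(ab)=\mathfrak{s}(b)$, $\mathfrak{r}(ab)=\mathfrak{r}(a)$. It is topological if $\mathcal{S}$ and $\mathcal{S}^{(0)}$ carry topologies making $\mathfrak{s},\mathfrak{r}$,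 the product (on $\mathcal{S}^{(2)}=\{(a,b):\mathfrak{s}(a)=\mathfrak{r}(b)\}\subseteq\mathcal{S}\times\mathcal{S}$) and $a\mapsto a^*$ continuous; it is étale if moreover $\mathfrak{s}\colon\mathcal{S}\to\mathcal{S}^{(0)}$ is a local homeomorphism; it is ample if it is étale and $\mathcal{S}^{(0)}$ is locally compact, Hausdorff and zero-dimensional (has a basis of clopen sets). Morphisms in $\mathbf{Amp}_\star$. A homomorphism is a map $\phi\colon\mathcal{S}\to\mathcal{T}$ such that if $ab$ is defined then $\phi(a)\phi(b)$ is defined and equals $\phi(ab)$. It is star-injective if $\mathfrak{s}(a)=\mathfrak{s}(b)$ and $\phi(a)=\phi(b)$ imply $a=b$; star-surjective if for all $t\in\mathcal{T}$ and $a\in\mathcal{S}$ with $\mathfrak{s}(t)=\mathfrak{s}(\phi(a))$ there is $b\in\mathcal{S}$ with $\mathfrak{s}(b)=\mathfrak{s}(a)$ and $\phi(b)=t$; covering if both. Proper means that preimages of compact sets are compact. $\Sigma$-ordered inverse semigroups. On an inverse semigroup $S$, $\leq$ is the canonical order ($a\leq b\iff a=ba^*a$) and $E(S)$ is the set of idempotents. A preorder $\subseteq$ on $S$ is compatible if $a\subseteq b$ implies $a\leq b$, and $a\subseteq b$ implies $ax\subseteq bx$ and $ya\subseteq yb$ for all $x,y\in S$. Write $a\cup b=\sup_{\subseteq}\{a,b\}$ and $a\cap b=\inf_{\subseteq}\{a,b\}$ when they exist. A $\Sigma$-ordered inverse semigroup is an inverse semigroup $S$ with zero, equipped with a compatible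 order $\subseteq$ such that: ($\Sigma$-i) $0\subseteq a$ for all $a\in S$; ($\Sigma$-ii) if $a_1,a_2\subseteq c$ then $a_1\cup a_2$ exists; ($\Sigma$-iii) if $c_1\cup c_2$ exists and $a\in S$, then $a(c_1\cup c_2)=(ac_1)\cup(ac_2)$; ($\Sigma$-iv) if $e\subseteq f$ in $E(S)$ then there exists $c\in E(S)$ with $e\cup c=f$ and $e\cap c=0$; ($\Sigma$-v) if $a^*b=ab^*=0$ then $a\cup b$ exists; ($\Sigma$-vi) if $t\leq a$ in $S$ then there exists $z$ with $t\leq z\subseteq a$ and, for all $x\in S$, $tx=0\iff zx=0$. For $t\leq a$ there is a unique $p\in S$ with $t\leq p\subseteq a$ and, for all $x\in S$, $tx=0\iff px=0$ and $xt=0\iff xp=0$; it is called the interpolator of $t$ and $a$ and denoted $a|t$. Morphisms in $\Sigma\text{-}\mathbf{Ord}$. A morphism $\theta\colon S\to T$ of $\Sigma$-ordered inverse semigroups is a semigroup homomorphism such that: (i) $\theta(0)=0$; (ii) $a\subseteq b$ implies $\theta(a)\subseteq\theta(b)$; (iii) if $a\cup b$ exists in $S$ then $\theta(a)\cup\theta(b)$ exists in $T$ and $\theta(a\cup b)=\theta(a)\cup\theta(b)$; (iv) for all $a,b\in S$ and $t\in T$ with $t\subseteq\theta(a)$ and $t\subseteq\theta(b)$, there exists $c\in S$ with $c\subseteq a$, $c\subseteq b$ and $t\subseteq\theta(c)$; (v) for every $t\in T$ there exist $t_1,\ldots,t_n\in T$ and $s_1,\ldots,s_n\in S$ with $t=\bigcup_{i=1}^n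 t_i$ and $t_i\subseteq\theta(s_i)$ for all $i$; (vi) if $a\leq b$ in $S$ then $\theta(b|a)=\theta(b)|\theta(a)$. Composition is composition of maps. *)

theory Defs
  imports "HOL-Analysis.Analysis" "HOL-Library.FuncSet" "HOL-Library.Equipollence"
begin

section \<open>Categories\<close>

text \<open>
  Categories are presented with hom-sets indexed by pairs of objects, which need not be disjoint.
  Accordingly \<open>Cmp C X Y Z g f\<close> (\<open>g\<close> after \<open>f\<close>, for \<open>f: X \<rightarrow> Y\<close> and \<open>g: Y \<rightarrow> Z\<close>) and the
  arrow part of a functor take the objects involved as arguments.
\<close>

record ('o, 'm) cat =
  Obj :: "'o set"
  Hom :: "'o \<Rightarrow> 'o \<Rightarrow> 'm set"
  Ident :: "'o \<Rightarrow> 'm"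
  Cmp :: "'o \<Rightarrow> 'o \<Rightarrow> 'o \<Rightarrow> 'm \<Rightarrow> 'm \<Rightarrow> 'm"

definition category :: "('o, 'm) cat \<Rightarrow> bool" where
  "category C \<longleftrightarrow>
    (\<forall>X\<in>Obj C. Ident C X \<in> Hom C X X) \<and>
    (\<forall>X\<in>Obj C. \<forall>Y\<in>Obj C. \<forall>Z\<in>Obj C. \<forall>f\<in>Hom C X Y. \<forall>g\<in>Hom C Y Z.
       Cmp C X Y Z g f \<in> Hom C X Z) \<and>
    (\<forall>X\<in>Obj C. \<forall>Y\<in>Obj C. \<forall>f\<in>Hom C X Y.
       Cmp C X X Y f (Ident C X) = f \<and> Cmp C X Y Y (Ident C Y) f = f) \<and>
    (\<forall>W\<in>Obj C. \<forall>X\<in>Obj C. \<forall>Y\<in>Obj C. \<forall>Z\<in>Obj C.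
       \<forall>f\<in>Hom C W X. \<forall>g\<in>Hom C X Y. \<forall>h\<in>Hom C Y Z.
         Cmp C W Y Z h (Cmp C W X Y g f) = Cmp C W X Z (Cmp C X Y Z h g) f)"

definition opposite :: "('o, 'm) cat \<Rightarrow> ('o, 'm) cat" where
  "opposite C = \<lparr>Obj = Obj C, Hom = (\<lambda>X Y. Hom C Y X), Ident = Ident C,
     Cmp = (\<lambda>X Y Z g f. Cmp C Z Y X f g)\<rparr>"

definition cat_iso :: "('o, 'm) cat \<Rightarrow> 'o \<Rightarrow> 'o \<Rightarrow> 'm \<Rightarrow> bool" where
  "cat_iso C X Y f \<longleftrightarrow> f \<in> Hom C X Y \<and>
     (\<exists>g\<in>Hom C Y X. Cmp C X Y X g f = Ident C X \<and> Cmp C Y X Y f g = Ident C Y)"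

record ('o1, 'm1, 'o2, 'm2) cat_map =
  FObj :: "'o1 \<Rightarrow> 'o2"
  FHom :: "'o1 \<Rightarrow> 'o1 \<Rightarrow> 'm1 \<Rightarrow> 'm2"

definition is_functor ::
    "('o1, 'm1) cat \<Rightarrow> ('o2, 'm2) cat \<Rightarrow> ('o1, 'm1, 'o2, 'm2) cat_map \<Rightarrow> bool" where
  "is_functor C D F \<longleftrightarrow>
    (\<forall>X\<in>Obj C. FObj F X \<in> Obj D) \<and>
    (\<forall>X\<in>Obj C. \<forall>Y\<in>Obj C. \<forall>f\<in>Hom C X Y. FHom F X Y f \<in> Hom D (FObj F X) (FObj F Y)) \<and>
    (\<forall>X\<in>Obj C. FHom F X X (Ident C X) = Ident D (FObj F X)) \<and>
    (\<forall>X\<in>Obj C. \<forall>Y\<in>Obj C. \<forall>Z\<in>Obj C. \<forall>f\<in>Hom C X Y. \<forall>g\<in>Hom C Y Z.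
       FHom F X Z (Cmp C X Y Z g f) =
         Cmp D (FObj F X) (FObj F Y) (FObj F Z) (FHom F Y Z g) (FHom F X Y f))"

definition id_functor :: "('o, 'm, 'o, 'm) cat_map" where
  "id_functor = \<lparr>FObj = (\<lambda>X. X), FHom = (\<lambda>X Y f. f)\<rparr>"

definition comp_functor ::
    "('o2, 'm2, 'o3, 'm3) cat_map \<Rightarrow> ('o1, 'm1, 'o2, 'm2) cat_map \<Rightarrow> ('o1, 'm1, 'o3, 'm3) cat_map"
  where
  "comp_functor G F = \<lparr>FObj = (\<lambda>X. FObj G (FObj F X)),
     FHom = (\<lambda>X Y f. FHom G (FObj F X) (FObj F Y) (FHom F X Y f))\<rparr>"

definition natural_iso ::
    "('o1, 'm1) cat \<Rightarrow> ('o2, 'm2) cat \<Rightarrow> ('o1, 'm1, 'o2, 'm2) cat_map \<Rightarrow>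
     ('o1, 'm1, 'o2, 'm2) cat_map \<Rightarrow> ('o1 \<Rightarrow> 'm2) \<Rightarrow> bool" where
  "natural_iso C D F G \<eta> \<longleftrightarrow>
    (\<forall>X\<in>Obj C. cat_iso D (FObj F X) (FObj G X) (\<eta> X)) \<and>
    (\<forall>X\<in>Obj C. \<forall>Y\<in>Obj C. \<forall>f\<in>Hom C X Y.
       Cmp D (FObj F X) (FObj F Y) (FObj G Y) (\<eta> Y) (FHom F X Y f) =
       Cmp D (FObj F X) (FObj G X) (FObj G Y) (FHom G X Y f) (\<eta> X))"

definition equivalent_categories :: "('o1, 'm1) cat \<Rightarrow> ('o2, 'm2) cat \<Rightarrow> bool" where
  "equivalent_categories C D \<longleftrightarrow> category C \<and> category D \<and>
    (\<exists>F G \<eta> \<epsilon>. is_functor C D F \<and> is_functor D C G \<and>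
       natural_iso C C id_functor (comp_functor G F) \<eta> \<and>
       natural_iso D D (comp_functor F G) id_functor \<epsilon>)"

text \<open>
  \<open>C 0 \<subseteq> C 1 \<subseteq> C 2\<close> and \<open>D 0 \<subseteq> D 1 \<subseteq> D 2\<close> are meant to be full subcategories consisting of the
  objects below increasing size bounds; each of the two functors is allowed to go up one step.
  For constant sequences this is literally \<^const>\<open>equivalent_categories\<close>.
\<close>

definition equivalent_up_to_size ::
    "(nat \<Rightarrow> ('o1, 'm1) cat) \<Rightarrow> (nat \<Rightarrow> ('o2, 'm2) cat) \<Rightarrow> bool" where
  "equivalent_up_to_size C D \<longleftrightarrow> (\<forall>i\<le>2. category (C i) \<and> category (D i)) \<and>
    (\<exists>F G \<eta> \<epsilon>.
       is_functor (C 0) (D 1) F \<and> is_functor (C 1) (D 2) F \<and>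
       is_functor (D 0) (C 1) G \<and> is_functor (D 1) (C 2) G \<and>
       natural_iso (C 0) (C 2) id_functor (comp_functor G F) \<eta> \<and>
       natural_iso (D 0) (D 2) (comp_functor F G) id_functor \<epsilon>)"


section \<open>Size\<close>

text \<open>
  There is no type of all sets, so a category of structures is taken relative to a collection
  \<open>U\<close> of admissible carrier sets within an ambient type. A universe is closed under power sets,
  up to equipollence, and under passing to sets that are no larger.
  Examples: the sets of size below a strong limit cardinal, and the small sets of a type that
  models ZF set theory.
\<close>

definition universe :: "'w set set \<Rightarrow> bool" where
  "universe U \<longleftrightarrow> (\<forall>A\<in>U. (\<exists>B::'w set. B \<approx> Pow A) \<and> (\<forall>B::'w set. B \<lesssim> Pow A \<longrightarrow> B \<in> U))"

text \<open>
  The sets that are no larger than the types \<open>'u\<close>, \<open>'u set\<close> and \<open>'u set set\<close>, respectively,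
  realised inside the last of these. They exist without any assumption on \<open>'u\<close>.
\<close>

definition size_level :: "nat \<Rightarrow> 'u set set set set" where
  "size_level i =
    (if i = 0 then {A. A \<lesssim> (UNIV :: 'u set)}
     else if i = 1 then {A. A \<lesssim> (UNIV :: 'u set set)}
     else UNIV)"


section \<open>Ample inverse semigroupoids\<close>

text \<open>The product is a total function in HOL; only its values on \<open>Dom2\<close> are meaningful.\<close>

record 'w semigroupoid =
  Arr :: "'w set"
  Dom2 :: "('w \<times> 'w) set"
  Mul :: "'w \<Rightarrow> 'w \<Rightarrow> 'w"

definition is_semigroupoid :: "('w, 'b) semigroupoid_scheme \<Rightarrow> bool" where
  "is_semigroupoid S \<longleftrightarrow>
    Dom2 S \<subseteq> Arr S \<times> Arr S \<and>
    (\<forall>(f, g)\<in>Dom2 S. Mul S f g \<in> Arr S) \<and>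
    (\<forall>f\<in>Arr S. \<forall>g\<in>Arr S. \<forall>h\<in>Arr S.
      (((f, g) \<in> Dom2 S \<and> (g, h) \<in> Dom2 S) \<longleftrightarrow> ((f, g) \<in> Dom2 S \<and> (Mul S f g, h) \<in> Dom2 S)) \<and>
      (((f, g) \<in> Dom2 S \<and> (g, h) \<in> Dom2 S) \<longleftrightarrow> ((g, h) \<in> Dom2 S \<and> (f, Mul S g h) \<in> Dom2 S)) \<and>
      ((f, g) \<in> Dom2 S \<and> (g, h) \<in> Dom2 S \<longrightarrow> Mul S (Mul S f g) h = Mul S f (Mul S g h)))"

definition is_sginv :: "('w, 'b) semigroupoid_scheme \<Rightarrow> 'w \<Rightarrow> 'w \<Rightarrow> bool" where
  "is_sginv S a b \<longleftrightarrow> b \<in> Arr S \<and> (a, b) \<in> Dom2 S \<and> (b, a) \<in> Dom2 S \<and>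
     Mul S (Mul S a b) a = a \<and> Mul S (Mul S b a) b = b"

definition inverse_semigroupoid :: "('w, 'b) semigroupoid_scheme \<Rightarrow> bool" where
  "inverse_semigroupoid S \<longleftrightarrow> is_semigroupoid S \<and> (\<forall>a\<in>Arr S. \<exists>!b. is_sginv S a b)"

definition sginv :: "('w, 'b) semigroupoid_scheme \<Rightarrow> 'w \<Rightarrow> 'w" where
  "sginv S a = (THE b. is_sginv S a b)"

record 'w graph_semigroupoid = "'w semigroupoid" +
  Vert :: "'w set"
  src :: "'w \<Rightarrow> 'w"
  rng :: "'w \<Rightarrow> 'w"

definition compatible_graph :: "('w, 'b) graph_semigroupoid_scheme \<Rightarrow> bool" where
  "compatible_graph S \<longleftrightarrow>
    Vert S = src S ` Arr S \<union> rng S ` Arr S \<and>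
    (\<forall>a\<in>Arr S. \<forall>b\<in>Arr S. (a, b) \<in> Dom2 S \<longleftrightarrow> src S a = rng S b) \<and>
    (\<forall>(a, b)\<in>Dom2 S. src S (Mul S a b) = src S b \<and> rng S (Mul S a b) = rng S a)"

record 'w top_semigroupoid = "'w graph_semigroupoid" +
  ArrTop :: "'w topology"
  VertTop :: "'w topology"

definition topological_inverse_semigroupoid :: "'w top_semigroupoid \<Rightarrow> bool" where
  "topological_inverse_semigroupoid S \<longleftrightarrow>
    inverse_semigroupoid S \<and> compatible_graph S \<and>
    topspace (ArrTop S) = Arr S \<and> topspace (VertTop S) = Vert S \<and>
    continuous_map (ArrTop S) (VertTop S) (src S) \<and>
    continuous_map (ArrTop S) (VertTop S) (rng S) \<and>
    continuous_map
      (subtopology (prod_topology (ArrTop S) (ArrTop S))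
         {(a, b). a \<in> Arr S \<and> b \<in> Arr S \<and> src S a = rng S b})
      (ArrTop S) (\<lambda>(a, b). Mul S a b) \<and>
    continuous_map (ArrTop S) (ArrTop S) (sginv S)"

definition local_homeomorphism_map :: "'a topology \<Rightarrow> 'b topology \<Rightarrow> ('a \<Rightarrow> 'b) \<Rightarrow> bool" where
  "local_homeomorphism_map X Y f \<longleftrightarrow>
    (\<forall>x\<in>topspace X. \<exists>U. openin X U \<and> x \<in> U \<and> openin Y (f ` U) \<and>
       homeomorphic_map (subtopology X U) (subtopology Y (f ` U)) f)"

definition etale_inverse_semigroupoid :: "'w top_semigroupoid \<Rightarrow> bool" where
  "etale_inverse_semigroupoid S \<longleftrightarrow> topological_inverse_semigroupoid S \<and>
     local_homeomorphism_map (ArrTop S) (VertTop S) (src S)"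

definition zero_dimensional_space :: "'a topology \<Rightarrow> bool" where
  "zero_dimensional_space X \<longleftrightarrow>
    (\<exists>\<B>. (\<forall>B\<in>\<B>. openin X B \<and> closedin X B) \<and> (\<forall>V. openin X V \<longrightarrow> (\<exists>\<V>\<subseteq>\<B>. V = \<Union>\<V>)))"

definition ample_inverse_semigroupoid :: "'w top_semigroupoid \<Rightarrow> bool" where
  "ample_inverse_semigroupoid S \<longleftrightarrow> etale_inverse_semigroupoid S \<and>
     locally_compact_space (VertTop S) \<and> Hausdorff_space (VertTop S) \<and>
     zero_dimensional_space (VertTop S)"

definition sgpd_hom ::
    "('v, 'b) semigroupoid_scheme \<Rightarrow> ('w, 'c) semigroupoid_scheme \<Rightarrow> ('v \<Rightarrow> 'w) \<Rightarrow> bool" where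
  "sgpd_hom S T \<phi> \<longleftrightarrow> \<phi> \<in> Arr S \<rightarrow> Arr T \<and>
     (\<forall>(a, b)\<in>Dom2 S. (\<phi> a, \<phi> b) \<in> Dom2 T \<and> Mul T (\<phi> a) (\<phi> b) = \<phi> (Mul S a b))"

definition star_injective ::
    "('v, 'b) graph_semigroupoid_scheme \<Rightarrow> ('v \<Rightarrow> 'w) \<Rightarrow> bool" where
  "star_injective S \<phi> \<longleftrightarrow>
     (\<forall>a\<in>Arr S. \<forall>b\<in>Arr S. src S a = src S b \<and> \<phi> a = \<phi> b \<longrightarrow> a = b)"

definition star_surjective ::
    "('v, 'b) graph_semigroupoid_scheme \<Rightarrow> ('w, 'c) graph_semigroupoid_scheme \<Rightarrow>
     ('v \<Rightarrow> 'w) \<Rightarrow> bool" where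
  "star_surjective S T \<phi> \<longleftrightarrow>
     (\<forall>t\<in>Arr T. \<forall>a\<in>Arr S. src T t = src T (\<phi> a) \<longrightarrow>
        (\<exists>b\<in>Arr S. src S b = src S a \<and> \<phi> b = t))"

definition covering_hom ::
    "('v, 'b) graph_semigroupoid_scheme \<Rightarrow> ('w, 'c) graph_semigroupoid_scheme \<Rightarrow>
     ('v \<Rightarrow> 'w) \<Rightarrow> bool" where
  "covering_hom S T \<phi> \<longleftrightarrow> sgpd_hom S T \<phi> \<and> star_injective S \<phi> \<and> star_surjective S T \<phi>"

definition compact_preimages :: "'a topology \<Rightarrow> 'b topology \<Rightarrow> ('a \<Rightarrow> 'b) \<Rightarrow> bool" where
  "compact_preimages X Y f \<longleftrightarrow> (\<forall>K. compactin Y K \<longrightarrow> compactin X {x \<in> topspace X. f x \<in> K})"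

text \<open>Morphisms are extensional functions, so that equality of morphisms is equality on the carrier.\<close>

definition Amp :: "'w set set \<Rightarrow> ('w top_semigroupoid, 'w \<Rightarrow> 'w) cat" where
  "Amp U =
    \<lparr>Obj = {S. ample_inverse_semigroupoid S \<and> Arr S \<in> U \<and> Vert S \<in> U},
     Hom = (\<lambda>S T. {\<phi> \<in> extensional (Arr S).
              covering_hom S T \<phi> \<and> continuous_map (ArrTop S) (ArrTop T) \<phi> \<and>
              compact_preimages (ArrTop S) (ArrTop T) \<phi>}),
     Ident = (\<lambda>S. \<lambda>a\<in>Arr S. a),
     Cmp = (\<lambda>R S T \<psi> \<phi>. compose (Arr R) \<psi> \<phi>)\<rparr>"


section \<open>Sigma-ordered inverse semigroups\<close>

record 'w ord_semigroup =
  Car :: "'w set"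
  Times :: "'w \<Rightarrow> 'w \<Rightarrow> 'w"  (infixl \<open>\<cdot>\<index>\<close> 70)
  Incl :: "'w \<Rightarrow> 'w \<Rightarrow> bool"  (infix \<open>\<sqsubseteq>\<index>\<close> 50)

definition is_inv :: "'w ord_semigroup \<Rightarrow> 'w \<Rightarrow> 'w \<Rightarrow> bool" where
  "is_inv S a b \<longleftrightarrow> b \<in> Car S \<and> a \<cdot>\<^bsub>S\<^esub> b \<cdot>\<^bsub>S\<^esub> a = a \<and> b \<cdot>\<^bsub>S\<^esub> a \<cdot>\<^bsub>S\<^esub> b = b"

definition inverse_semigroup :: "'w ord_semigroup \<Rightarrow> bool" where
  "inverse_semigroup S \<longleftrightarrow>
    (\<forall>a\<in>Car S. \<forall>b\<in>Car S. a \<cdot>\<^bsub>S\<^esub> b \<in> Car S) \<and>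
    (\<forall>a\<in>Car S. \<forall>b\<in>Car S. \<forall>c\<in>Car S. a \<cdot>\<^bsub>S\<^esub> b \<cdot>\<^bsub>S\<^esub> c = a \<cdot>\<^bsub>S\<^esub> (b \<cdot>\<^bsub>S\<^esub> c)) \<and>
    (\<forall>a\<in>Car S. \<exists>!b. is_inv S a b)"

definition sinv :: "'w ord_semigroup \<Rightarrow> 'w \<Rightarrow> 'w" where
  "sinv S a = (THE b. is_inv S a b)"

definition nat_le :: "'w ord_semigroup \<Rightarrow> 'w \<Rightarrow> 'w \<Rightarrow> bool" where
  "nat_le S a b \<longleftrightarrow> a = b \<cdot>\<^bsub>S\<^esub> sinv S a \<cdot>\<^bsub>S\<^esub> a"

definition idempotents :: "'w ord_semigroup \<Rightarrow> 'w set" where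
  "idempotents S = {e \<in> Car S. e \<cdot>\<^bsub>S\<^esub> e = e}"

definition is_zero :: "'w ord_semigroup \<Rightarrow> 'w \<Rightarrow> bool" where
  "is_zero S z \<longleftrightarrow> z \<in> Car S \<and> (\<forall>a\<in>Car S. z \<cdot>\<^bsub>S\<^esub> a = z \<and> a \<cdot>\<^bsub>S\<^esub> z = z)"

definition szero :: "'w ord_semigroup \<Rightarrow> 'w" where
  "szero S = (THE z. is_zero S z)"

definition compatible_order :: "'w ord_semigroup \<Rightarrow> bool" where
  "compatible_order S \<longleftrightarrow>
    (\<forall>a\<in>Car S. a \<sqsubseteq>\<^bsub>S\<^esub> a) \<and>
    (\<forall>a\<in>Car S. \<forall>b\<in>Car S. \<forall>c\<in>Car S. a \<sqsubseteq>\<^bsub>S\<^esub> b \<and> b \<sqsubseteq>\<^bsub>S\<^esub> c \<longrightarrow> a \<sqsubseteq>\<^bsub>S\<^esub> c) \<and>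
    (\<forall>a\<in>Car S. \<forall>b\<in>Car S. a \<sqsubseteq>\<^bsub>S\<^esub> b \<and> b \<sqsubseteq>\<^bsub>S\<^esub> a \<longrightarrow> a = b) \<and>
    (\<forall>a\<in>Car S. \<forall>b\<in>Car S. a \<sqsubseteq>\<^bsub>S\<^esub> b \<longrightarrow> nat_le S a b) \<and>
    (\<forall>a\<in>Car S. \<forall>b\<in>Car S. a \<sqsubseteq>\<^bsub>S\<^esub> b \<longrightarrow>
       (\<forall>x\<in>Car S. a \<cdot>\<^bsub>S\<^esub> x \<sqsubseteq>\<^bsub>S\<^esub> b \<cdot>\<^bsub>S\<^esub> x) \<and> (\<forall>y\<in>Car S. y \<cdot>\<^bsub>S\<^esub> a \<sqsubseteq>\<^bsub>S\<^esub> y \<cdot>\<^bsub>S\<^esub> b))"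

definition is_sup :: "'w ord_semigroup \<Rightarrow> 'w set \<Rightarrow> 'w \<Rightarrow> bool" where
  "is_sup S A c \<longleftrightarrow> c \<in> Car S \<and> (\<forall>a\<in>A. a \<sqsubseteq>\<^bsub>S\<^esub> c) \<and>
     (\<forall>d\<in>Car S. (\<forall>a\<in>A. a \<sqsubseteq>\<^bsub>S\<^esub> d) \<longrightarrow> c \<sqsubseteq>\<^bsub>S\<^esub> d)"

definition is_inf :: "'w ord_semigroup \<Rightarrow> 'w set \<Rightarrow> 'w \<Rightarrow> bool" where
  "is_inf S A c \<longleftrightarrow> c \<in> Car S \<and> (\<forall>a\<in>A. c \<sqsubseteq>\<^bsub>S\<^esub> a) \<and>
     (\<forall>d\<in>Car S. (\<forall>a\<in>A. d \<sqsubseteq>\<^bsub>S\<^esub> a) \<longrightarrow> d \<sqsubseteq>\<^bsub>S\<^esub> c)"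

text \<open>
  The conjuncts after the first three are conditions (i) to (vi) in order.
  In (iii), the existence of the join on the right-hand side is part of the requirement.
\<close>

definition sigma_ordered :: "'w ord_semigroup \<Rightarrow> bool" where
  "sigma_ordered S \<longleftrightarrow>
    inverse_semigroup S \<and> (\<exists>z. is_zero S z) \<and> compatible_order S \<and>
    (\<forall>a\<in>Car S. szero S \<sqsubseteq>\<^bsub>S\<^esub> a) \<and>
    (\<forall>a1\<in>Car S. \<forall>a2\<in>Car S. \<forall>c\<in>Car S. a1 \<sqsubseteq>\<^bsub>S\<^esub> c \<and> a2 \<sqsubseteq>\<^bsub>S\<^esub> c \<longrightarrow> (\<exists>d. is_sup S {a1, a2} d)) \<and>
    (\<forall>c1\<in>Car S. \<forall>c2\<in>Car S. \<forall>c. \<forall>a\<in>Car S. is_sup S {c1, c2} c \<longrightarrow>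
       is_sup S {a \<cdot>\<^bsub>S\<^esub> c1, a \<cdot>\<^bsub>S\<^esub> c2} (a \<cdot>\<^bsub>S\<^esub> c)) \<and>
    (\<forall>e\<in>idempotents S. \<forall>f\<in>idempotents S. e \<sqsubseteq>\<^bsub>S\<^esub> f \<longrightarrow>
       (\<exists>c\<in>idempotents S. is_sup S {e, c} f \<and> is_inf S {e, c} (szero S))) \<and>
    (\<forall>a\<in>Car S. \<forall>b\<in>Car S.
       sinv S a \<cdot>\<^bsub>S\<^esub> b = szero S \<and> a \<cdot>\<^bsub>S\<^esub> sinv S b = szero S \<longrightarrow> (\<exists>d. is_sup S {a, b} d)) \<and>
    (\<forall>t\<in>Car S. \<forall>a\<in>Car S. nat_le S t a \<longrightarrow>
       (\<exists>z\<in>Car S. nat_le S t z \<and> z \<sqsubseteq>\<^bsub>S\<^esub> a \<and>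
          (\<forall>x\<in>Car S. t \<cdot>\<^bsub>S\<^esub> x = szero S \<longleftrightarrow> z \<cdot>\<^bsub>S\<^esub> x = szero S)))"

definition is_interpolator :: "'w ord_semigroup \<Rightarrow> 'w \<Rightarrow> 'w \<Rightarrow> 'w \<Rightarrow> bool" where
  "is_interpolator S a t p \<longleftrightarrow> p \<in> Car S \<and> nat_le S t p \<and> p \<sqsubseteq>\<^bsub>S\<^esub> a \<and>
     (\<forall>x\<in>Car S. (t \<cdot>\<^bsub>S\<^esub> x = szero S \<longleftrightarrow> p \<cdot>\<^bsub>S\<^esub> x = szero S) \<and>
                 (x \<cdot>\<^bsub>S\<^esub> t = szero S \<longleftrightarrow> x \<cdot>\<^bsub>S\<^esub> p = szero S))"

text \<open>\<open>interpolator S a t\<close> is written \<open>a|t\<close> on paper; it is meaningful for \<open>t \<le> a\<close>.\<close>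

definition interpolator :: "'w ord_semigroup \<Rightarrow> 'w \<Rightarrow> 'w \<Rightarrow> 'w" where
  "interpolator S a t = (THE p. is_interpolator S a t p)"

definition sigma_morphism ::
    "'v ord_semigroup \<Rightarrow> 'w ord_semigroup \<Rightarrow> ('v \<Rightarrow> 'w) \<Rightarrow> bool" where
  "sigma_morphism S T \<theta> \<longleftrightarrow>
    \<theta> \<in> Car S \<rightarrow> Car T \<and>
    (\<forall>a\<in>Car S. \<forall>b\<in>Car S. \<theta> (a \<cdot>\<^bsub>S\<^esub> b) = \<theta> a \<cdot>\<^bsub>T\<^esub> \<theta> b) \<and>
    \<theta> (szero S) = szero T \<and>
    (\<forall>a\<in>Car S. \<forall>b\<in>Car S. a \<sqsubseteq>\<^bsub>S\<^esub> b \<longrightarrow> \<theta> a \<sqsubseteq>\<^bsub>T\<^esub> \<theta> b) \<and>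
    (\<forall>a\<in>Car S. \<forall>b\<in>Car S. \<forall>c. is_sup S {a, b} c \<longrightarrow> is_sup T {\<theta> a, \<theta> b} (\<theta> c)) \<and>
    (\<forall>a\<in>Car S. \<forall>b\<in>Car S. \<forall>t\<in>Car T. t \<sqsubseteq>\<^bsub>T\<^esub> \<theta> a \<and> t \<sqsubseteq>\<^bsub>T\<^esub> \<theta> b \<longrightarrow>
       (\<exists>c\<in>Car S. c \<sqsubseteq>\<^bsub>S\<^esub> a \<and> c \<sqsubseteq>\<^bsub>S\<^esub> b \<and> t \<sqsubseteq>\<^bsub>T\<^esub> \<theta> c)) \<and>
    (\<forall>t\<in>Car T. \<exists>n\<ge>1. \<exists>(ts :: nat \<Rightarrow> 'w) (ss :: nat \<Rightarrow> 'v).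
       (\<forall>i\<in>{1..n}. ts i \<in> Car T \<and> ss i \<in> Car S \<and> ts i \<sqsubseteq>\<^bsub>T\<^esub> \<theta> (ss i)) \<and>
       is_sup T (ts ` {1..n}) t) \<and>
    (\<forall>a\<in>Car S. \<forall>b\<in>Car S. nat_le S a b \<longrightarrow>
       \<theta> (interpolator S b a) = interpolator T (\<theta> b) (\<theta> a))"

definition SigmaOrd :: "'w set set \<Rightarrow> ('w ord_semigroup, 'w \<Rightarrow> 'w) cat" where
  "SigmaOrd U =
    \<lparr>Obj = {S. sigma_ordered S \<and> Car S \<in> U},
     Hom = (\<lambda>S T. {\<theta> \<in> extensional (Car S). sigma_morphism S T \<theta>}),
     Ident = (\<lambda>S. \<lambda>a\<in>Car S. a),
     Cmp = (\<lambda>R S T \<psi> \<theta>. compose (Car R) \<psi> \<theta>)\<rparr>"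

end

theory Submission
  imports Defs
begin

text \<open>
  The equivalence sends an ample inverse semigroupoid \<open>S\<close> to the semigroup \<open>KB S\<close> of its compact open
  bisections, the compact open sets on which source and range are injective, ordered by inclusion. A morphism
  \<open>\<phi>\<close> goes to the inverse image map. Two facts make this a duality.

  Every morphism of Sigma-ordered inverse semigroups \<open>\<theta>: KB T \<rightarrow> KB S\<close> is an inverse image. For an arrow \<open>a\<close> of
  \<open>S\<close>, the \<open>B\<close> with \<open>a \<in> \<theta> B\<close> form a prime filter of compact open bisections, and such a filter consists of
  the neighbourhoods of a unique arrow \<open>\<phi> a\<close> of \<open>T\<close> (\<open>prime_filter_point\<close>, \<open>bisection_separates\<close>). The
  clauses in the definition of a morphism then become properties of \<open>\<phi>\<close>: multiplicativity makes it a
  homomorphism, the source being injective on \<open>\<theta> B\<close> makes it injective on stars, preservation of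
  interpolators makes it surjective on stars, and compactness of \<open>\<theta> B\<close> makes it proper. Hence the functor is
  fully faithful (\<open>fully_faithful_KB\<close>).

  Every Sigma-ordered inverse semigroup \<open>S\<close> is the semigroup of bisections of its spectrum (\<open>ord_iso_hat\<close>).
  Comparing annihilators, \<open>bx = 0 \<longrightarrow> ax = 0\<close>, expresses that the source of \<open>a\<close> is contained in that of \<open>b\<close>. The
  vertices of the spectrum are the prime filters for this preorder; there are enough of them by a
  prime ideal theorem (\<open>vertex_avoiding_ideal\<close>). The semigroup acts on vertices by partial maps, and the arrows are
  the germs of this action: \<open>a\<close> and \<open>b\<close> have the same germ at \<open>v\<close> if some \<open>c \<in> v\<close> is contained in both. Interpolators
  restrict an element to a smaller source, which makes the source map of the spectrum a local
  homeomorphism; complements make the space of vertices Hausdorff and the basic sets compact.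

  Bisections and germs are sets of elements of the original carrier, so the underlying types
  change. To compare objects of different types, the opposite of the first category and the second
  category are embedded fully faithfully in the Sigma-ordered inverse semigroups whose elements are sets, by
  \<open>KB\<close> and by passing to singletons. Isomorphisms between the images assemble to an equivalence
  (\<open>equivalence_of_full_subs\<close>). Each of the two constructions uses one power set, and this accounts for the
  size bounds.
\<close>

section \<open>Equivalences from a common target\<close>

definition full_sub :: "('o, 'm) cat \<Rightarrow> 'o set \<Rightarrow> ('o, 'm) cat" where
  "full_sub C P = C\<lparr>Obj := P\<rparr>"

lemma full_sub_simps [simp]:
  "Obj (full_sub C P) = P" "Hom (full_sub C P) = Hom C"
  "Ident (full_sub C P) = Ident C" "Cmp (full_sub C P) = Cmp C"
  by (simp_all add: full_sub_def)

lemma cat_Ident: "category C \<Longrightarrow> X \<in> Obj C \<Longrightarrow> Ident C X \<in> Hom C X X"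
  by (simp add: category_def)

lemma cat_Cmp:
  "\<lbrakk>category C; X \<in> Obj C; Y \<in> Obj C; Z \<in> Obj C; f \<in> Hom C X Y; g \<in> Hom C Y Z\<rbrakk>
    \<Longrightarrow> Cmp C X Y Z g f \<in> Hom C X Z"
  unfolding category_def by blast

lemma cat_Ident_left:
  "\<lbrakk>category C; X \<in> Obj C; Y \<in> Obj C; f \<in> Hom C X Y\<rbrakk> \<Longrightarrow> Cmp C X Y Y (Ident C Y) f = f"
  unfolding category_def by blast

lemma cat_Ident_right:
  "\<lbrakk>category C; X \<in> Obj C; Y \<in> Obj C; f \<in> Hom C X Y\<rbrakk> \<Longrightarrow> Cmp C X X Y f (Ident C X) = f"
  unfolding category_def by blast

lemma cat_assoc:
  "\<lbrakk>category C; W \<in> Obj C; X \<in> Obj C; Y \<in> Obj C; Z \<in> Obj C;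
    f \<in> Hom C W X; g \<in> Hom C X Y; h \<in> Hom C Y Z\<rbrakk>
    \<Longrightarrow> Cmp C W Y Z h (Cmp C W X Y g f) = Cmp C W X Z (Cmp C X Y Z h g) f"
  unfolding category_def by blast

lemma category_full_sub: "category C \<Longrightarrow> P \<subseteq> Obj C \<Longrightarrow> category (full_sub C P)"
  unfolding category_def full_sub_simps by (simp add: subset_iff)

lemma category_opposite: "category C \<Longrightarrow> category (opposite C)"
  unfolding category_def opposite_def by simp

lemma functor_Obj: "is_functor C D F \<Longrightarrow> X \<in> Obj C \<Longrightarrow> FObj F X \<in> Obj D"
  by (simp add: is_functor_def)

lemma functor_Hom:
  "\<lbrakk>is_functor C D F; X \<in> Obj C; Y \<in> Obj C; f \<in> Hom C X Y\<rbrakk>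
    \<Longrightarrow> FHom F X Y f \<in> Hom D (FObj F X) (FObj F Y)"
  by (simp add: is_functor_def)

lemma functor_Ident:
  "is_functor C D F \<Longrightarrow> X \<in> Obj C \<Longrightarrow> FHom F X X (Ident C X) = Ident D (FObj F X)"
  by (simp add: is_functor_def)

lemma functor_Cmp:
  "\<lbrakk>is_functor C D F; X \<in> Obj C; Y \<in> Obj C; Z \<in> Obj C; f \<in> Hom C X Y; g \<in> Hom C Y Z\<rbrakk>
    \<Longrightarrow> FHom F X Z (Cmp C X Y Z g f) =
      Cmp D (FObj F X) (FObj F Y) (FObj F Z) (FHom F Y Z g) (FHom F X Y f)"
  by (simp add: is_functor_def)

definition iso_inv :: "('o, 'm) cat \<Rightarrow> 'o \<Rightarrow> 'o \<Rightarrow> 'm \<Rightarrow> 'm" where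
  "iso_inv C X Y f =
    (SOME g. g \<in> Hom C Y X \<and> Cmp C X Y X g f = Ident C X \<and> Cmp C Y X Y f g = Ident C Y)"

lemma iso_inv:
  assumes "cat_iso C X Y f"
  shows "f \<in> Hom C X Y" "iso_inv C X Y f \<in> Hom C Y X"
    "Cmp C X Y X (iso_inv C X Y f) f = Ident C X" "Cmp C Y X Y f (iso_inv C X Y f) = Ident C Y"
proof -
  have "\<exists>g. g \<in> Hom C Y X \<and> Cmp C X Y X g f = Ident C X \<and> Cmp C Y X Y f g = Ident C Y"
    using assms by (auto simp: cat_iso_def)
  from someI_ex[OF this]
  show "iso_inv C X Y f \<in> Hom C Y X" "Cmp C X Y X (iso_inv C X Y f) f = Ident C X"
    "Cmp C Y X Y f (iso_inv C X Y f) = Ident C Y"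
    by (simp_all add: iso_inv_def)
  show "f \<in> Hom C X Y" using assms by (simp add: cat_iso_def)
qed

lemma cat_iso_inv: "cat_iso C X Y f \<Longrightarrow> cat_iso C Y X (iso_inv C X Y f)"
  using iso_inv[of C X Y f] by (auto simp: cat_iso_def)

lemma iso_cancel_left:
  assumes C: "category C" and XYZ: "X \<in> Obj C" "Y \<in> Obj C" "Z \<in> Obj C"
    and f: "cat_iso C Y Z f" and g: "g \<in> Hom C X Y"
  shows "Cmp C X Z Y (iso_inv C Y Z f) (Cmp C X Y Z f g) = g"
  using cat_assoc[OF C XYZ(1,2,3,2) g iso_inv(1,2)[OF f]] iso_inv(3)[OF f]
    cat_Ident_left[OF C XYZ(1,2) g] by simp

lemma cat_iso_Cmp:
  assumes C: "category C" and XYZ: "X \<in> Obj C" "Y \<in> Obj C" "Z \<in> Obj C"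
    and f: "cat_iso C X Y f" and g: "cat_iso C Y Z g"
  shows "cat_iso C X Z (Cmp C X Y Z g f)"
proof -
  let ?f = "iso_inv C X Y f" and ?g = "iso_inv C Y Z g"
  note fi = iso_inv[OF f] and gi = iso_inv[OF g]
  note [simp] = fi gi XYZ cat_Cmp[OF C] cat_Ident_left[OF C] cat_Ident_right[OF C]
  have "Cmp C X Z X (Cmp C Z Y X ?f ?g) (Cmp C X Y Z g f) = Cmp C X Y X ?f (Cmp C X Z Y ?g (Cmp C X Y Z g f))"
    by (subst cat_assoc[OF C, of X Z Y X]) simp_all
  also have "\<dots> = Ident C X" using iso_cancel_left[OF C XYZ g fi(1)] by simp
  finally have 1: "Cmp C X Z X (Cmp C Z Y X ?f ?g) (Cmp C X Y Z g f) = Ident C X" .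
  have "Cmp C Z X Z (Cmp C X Y Z g f) (Cmp C Z Y X ?f ?g) = Cmp C Z Y Z g (Cmp C Z X Y f (Cmp C Z Y X ?f ?g))"
    by (subst cat_assoc[OF C, of Z X Y Z]) simp_all
  also have "Cmp C Z X Y f (Cmp C Z Y X ?f ?g) = ?g"
    by (subst cat_assoc[OF C, of Z Y X Y]) simp_all
  finally have 2: "Cmp C Z X Z (Cmp C X Y Z g f) (Cmp C Z Y X ?f ?g) = Ident C Z" by simp
  show ?thesis unfolding cat_iso_def using 1 2 by (auto intro!: bexI[of _ "Cmp C Z Y X ?f ?g"])
qed

lemma natural_iso_inv:
  assumes C: "category C" and D: "category D" and F: "is_functor C D F" and G: "is_functor C D G"
    and n: "natural_iso C D F G \<eta>"
  shows "natural_iso C D G F (\<lambda>X. iso_inv D (FObj F X) (FObj G X) (\<eta> X))"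
  unfolding natural_iso_def
proof (intro conjI ballI)
  fix X assume "X \<in> Obj C"
  then show "cat_iso D (FObj G X) (FObj F X) (iso_inv D (FObj F X) (FObj G X) (\<eta> X))"
    using n by (simp add: natural_iso_def cat_iso_inv)
next
  fix X Y f assume X: "X \<in> Obj C" and Y: "Y \<in> Obj C" and f: "f \<in> Hom C X Y"
  let ?x = "\<eta> X" and ?y = "\<eta> Y"
  let ?x' = "iso_inv D (FObj F X) (FObj G X) ?x" and ?y' = "iso_inv D (FObj F Y) (FObj G Y) ?y"
  have xi: "cat_iso D (FObj F X) (FObj G X) ?x" and yi: "cat_iso D (FObj F Y) (FObj G Y) ?y"
    using n X Y by (auto simp: natural_iso_def)
  note [simp] = functor_Obj[OF F] functor_Obj[OF G] X Y f functor_Hom[OF F X Y f] functor_Hom[OF G X Y f]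
    iso_inv[OF xi] iso_inv[OF yi] cat_Cmp[OF D] cat_Ident_left[OF D] cat_Ident_right[OF D]
  have e1: "Cmp D (FObj G X) (FObj F X) (FObj F Y) (FHom F X Y f) ?x' =
     Cmp D (FObj G X) (FObj G Y) (FObj F Y) ?y' (Cmp D (FObj G X) (FObj F Y) (FObj G Y) ?y
       (Cmp D (FObj G X) (FObj F X) (FObj F Y) (FHom F X Y f) ?x'))"
    by (subst iso_cancel_left[OF D _ _ _ yi]) simp_all
  have e2: "Cmp D (FObj G X) (FObj F Y) (FObj G Y) ?y
       (Cmp D (FObj G X) (FObj F X) (FObj F Y) (FHom F X Y f) ?x') =
     Cmp D (FObj G X) (FObj F X) (FObj G Y)
       (Cmp D (FObj F X) (FObj F Y) (FObj G Y) ?y (FHom F X Y f)) ?x'"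
    by (subst cat_assoc[OF D]) simp_all
  have e3: "Cmp D (FObj F X) (FObj F Y) (FObj G Y) ?y (FHom F X Y f) =
     Cmp D (FObj F X) (FObj G X) (FObj G Y) (FHom G X Y f) ?x"
    using n X Y f unfolding natural_iso_def by blast
  have e4: "Cmp D (FObj G X) (FObj F X) (FObj G Y)
     (Cmp D (FObj F X) (FObj G X) (FObj G Y) (FHom G X Y f) ?x) ?x' = FHom G X Y f"
    by (subst cat_assoc[OF D, symmetric]) simp_all
  show "Cmp D (FObj G X) (FObj G Y) (FObj F Y) ?y' (FHom G X Y f) =
    Cmp D (FObj G X) (FObj F X) (FObj F Y) (FHom F X Y f) ?x'"
    by (rule e1[unfolded e2 e3 e4, symmetric])
qed

definition fully_faithful ::
    "('o1, 'm1) cat \<Rightarrow> ('o2, 'm2) cat \<Rightarrow> ('o1, 'm1, 'o2, 'm2) cat_map \<Rightarrow> bool" where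
  "fully_faithful C D F \<longleftrightarrow> is_functor C D F \<and>
    (\<forall>X\<in>Obj C. \<forall>Y\<in>Obj C. bij_betw (FHom F X Y) (Hom C X Y) (Hom D (FObj F X) (FObj F Y)))"

text \<open>
  The inverse is the preimage of the inverse of the image; the two inverse laws come back because the
  functor is injective on hom-sets.
\<close>

lemma fully_faithful_iso:
  assumes ff: "fully_faithful C D F" and C: "category C" and X: "X \<in> Obj C" and Y: "Y \<in> Obj C"
    and f: "f \<in> Hom C X Y" and i: "cat_iso D (FObj F X) (FObj F Y) (FHom F X Y f)"
  shows "cat_iso C X Y f"
proof -
  have F: "is_functor C D F" using ff by (simp add: fully_faithful_def)
  have bij: "bij_betw (FHom F A B) (Hom C A B) (Hom D (FObj F A) (FObj F B))"
    if "A \<in> Obj C" "B \<in> Obj C" for A B using ff that by (simp add: fully_faithful_def)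
  obtain g where g: "g \<in> Hom C Y X"
    "FHom F Y X g = iso_inv D (FObj F X) (FObj F Y) (FHom F X Y f)"
    using bij_betw_imp_surj_on[OF bij[OF Y X]] iso_inv(2)[OF i] by (metis imageE)
  have "FHom F X X (Cmp C X Y X g f) = FHom F X X (Ident C X)"
    using functor_Cmp[OF F X Y X f g(1)] functor_Ident[OF F X] g(2) iso_inv(3)[OF i] by simp
  then have 1: "Cmp C X Y X g f = Ident C X"
    using bij_betw_imp_inj_on[OF bij[OF X X]] cat_Ident[OF C X] cat_Cmp[OF C X Y X f g(1)]
    by (simp add: inj_on_eq_iff)
  have "FHom F Y Y (Cmp C Y X Y f g) = FHom F Y Y (Ident C Y)"
    using functor_Cmp[OF F Y X Y g(1) f] functor_Ident[OF F Y] g(2) iso_inv(4)[OF i] by simp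
  then have "Cmp C Y X Y f g = Ident C Y"
    using bij_betw_imp_inj_on[OF bij[OF Y Y]] cat_Ident[OF C Y] cat_Cmp[OF C Y X Y g(1) f]
    by (simp add: inj_on_eq_iff)
  with 1 f g(1) show ?thesis by (auto simp: cat_iso_def)
qed

text \<open>
  Suppose that \<open>C\<close> and \<open>D\<close> both embed fully faithfully in a category \<open>E\<close>, by \<open>K\<close> and \<open>J\<close>. An assignment
  \<open>F\<close> of objects with isomorphisms \<open>\<alpha> X: K X \<rightarrow> J (F X)\<close> becomes a functor by conjugating with \<open>\<alpha>\<close>
  and applying the inverse of \<open>J\<close> on hom-sets.
\<close>

definition transported ::
    "('o2, 'm2) cat \<Rightarrow> ('o3, 'm3) cat \<Rightarrow> ('o1, 'm1, 'o3, 'm3) cat_map \<Rightarrow> ('o2, 'm2, 'o3, 'm3) cat_map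
      \<Rightarrow> ('o1 \<Rightarrow> 'o2) \<Rightarrow> ('o1 \<Rightarrow> 'm3) \<Rightarrow> ('o1, 'm1, 'o2, 'm2) cat_map" where
  "transported D E K J F \<alpha> = \<lparr>FObj = F,
     FHom = (\<lambda>X Y f. inv_into (Hom D (F X) (F Y)) (FHom J (F X) (F Y))
       (Cmp E (FObj J (F X)) (FObj K X) (FObj J (F Y))
          (Cmp E (FObj K X) (FObj K Y) (FObj J (F Y)) (\<alpha> Y) (FHom K X Y f))
          (iso_inv E (FObj K X) (FObj J (F X)) (\<alpha> X))))\<rparr>"

locale common_target =
  fixes C :: "('o1, 'm1) cat" and D :: "('o2, 'm2) cat" and E :: "('o3, 'm3) cat" and K J
  assumes C: "category C" and D: "category D" and E: "category E"
    and K: "fully_faithful C E K" and J: "fully_faithful D E J"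
begin

lemma flip: "common_target D C E J K"
  using C D E K J by (simp add: common_target_def)

lemma K_functor: "is_functor C E K" and J_functor: "is_functor D E J"
  using K J by (simp_all add: fully_faithful_def)

lemma transported_Obj [simp]: "FObj (transported D E K J F \<alpha>) = F"
  by (simp add: transported_def)

lemma transported_Hom:
  assumes X: "X \<in> Obj C" and Y: "Y \<in> Obj C" and FX: "F X \<in> Obj D" and FY: "F Y \<in> Obj D"
    and aX: "cat_iso E (FObj K X) (FObj J (F X)) (\<alpha> X)"
    and aY: "cat_iso E (FObj K Y) (FObj J (F Y)) (\<alpha> Y)" and f: "f \<in> Hom C X Y"
  shows "FHom (transported D E K J F \<alpha>) X Y f \<in> Hom D (F X) (F Y)" (is "?f \<in> _")
    and "FHom J (F X) (F Y) (FHom (transported D E K J F \<alpha>) X Y f) =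
       Cmp E (FObj J (F X)) (FObj K X) (FObj J (F Y))
          (Cmp E (FObj K X) (FObj K Y) (FObj J (F Y)) (\<alpha> Y) (FHom K X Y f))
          (iso_inv E (FObj K X) (FObj J (F X)) (\<alpha> X))" (is "_ = ?r")
    and "Cmp E (FObj K X) (FObj J (F X)) (FObj J (F Y))
        (FHom J (F X) (F Y) (FHom (transported D E K J F \<alpha>) X Y f)) (\<alpha> X) =
      Cmp E (FObj K X) (FObj K Y) (FObj J (F Y)) (\<alpha> Y) (FHom K X Y f)"
proof -
  note [simp] = X Y FX FY functor_Obj[OF K_functor] functor_Obj[OF J_functor]
    functor_Hom[OF K_functor X Y f] iso_inv[OF aX] iso_inv[OF aY] cat_Cmp[OF E]
    cat_Ident_right[OF E]
  have bij: "bij_betw (FHom J (F X) (F Y)) (Hom D (F X) (F Y)) (Hom E (FObj J (F X)) (FObj J (F Y)))"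
    using J FX FY by (simp add: fully_faithful_def)
  have r: "?r \<in> Hom E (FObj J (F X)) (FObj J (F Y))" by simp
  have "?f = inv_into (Hom D (F X) (F Y)) (FHom J (F X) (F Y)) ?r"
    by (simp add: transported_def)
  with r bij show "?f \<in> Hom D (F X) (F Y)" and e: "FHom J (F X) (F Y) ?f = ?r"
    by (metis bij_betw_def inv_into_into, metis bij_betw_inv_into_right)
  show "Cmp E (FObj K X) (FObj J (F X)) (FObj J (F Y)) (FHom J (F X) (F Y) ?f) (\<alpha> X) =
      Cmp E (FObj K X) (FObj K Y) (FObj J (F Y)) (\<alpha> Y) (FHom K X Y f)"
    unfolding e by (subst cat_assoc[OF E, symmetric]) simp_all
qed

lemma J_cancel:
  assumes "X \<in> Obj D" "Y \<in> Obj D" "f \<in> Hom D X Y" "g \<in> Hom D X Y" "FHom J X Y f = FHom J X Y g"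
  shows "f = g"
  using assms J by (metis fully_faithful_def bij_betw_def inj_onD)

lemma transported_functor:
  assumes Ob: "Ob \<subseteq> Obj C" and P: "P \<subseteq> Obj D" and F: "\<And>X. X \<in> Ob \<Longrightarrow> F X \<in> P"
    and a: "\<And>X. X \<in> Ob \<Longrightarrow> cat_iso E (FObj K X) (FObj J (F X)) (\<alpha> X)"
  shows "is_functor (full_sub C Ob) (full_sub D P) (transported D E K J F \<alpha>)"
proof -
  let ?T = "transported D E K J F \<alpha>"
  have XC: "X \<in> Obj C" and FD: "F X \<in> Obj D" if "X \<in> Ob" for X using that Ob P F by auto
  note [simp] = XC FD F functor_Obj[OF K_functor] functor_Obj[OF J_functor]
    cat_Cmp[OF E] cat_Ident_right[OF E] cat_Ident_left[OF E] iso_inv[OF a] cat_Cmp[OF C] cat_Cmp[OF D]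
    cat_Ident[OF C] cat_Ident[OF D] functor_Ident[OF K_functor] functor_Ident[OF J_functor]
    functor_Hom[OF K_functor] functor_Hom[OF J_functor]
  have T: "FHom ?T X Y f \<in> Hom D (F X) (F Y)" if "X \<in> Ob" "Y \<in> Ob" "f \<in> Hom C X Y" for X Y f
    using transported_Hom(1)[where F = F and \<alpha> = \<alpha>, OF XC XC FD FD a a] that by blast
  note [simp] = T
  have "FHom ?T X X (Ident C X) = Ident D (F X)" if X: "X \<in> Ob" for X
  proof (rule J_cancel[of "F X" "F X"])
    show "FHom J (F X) (F X) (FHom ?T X X (Ident C X)) = FHom J (F X) (F X) (Ident D (F X))"
      using X by (subst transported_Hom(2)) (simp_all add: a)
  qed (use X in simp_all)
  moreover have "FHom ?T X Z (Cmp C X Y Z g f) = Cmp D (F X) (F Y) (F Z) (FHom ?T Y Z g) (FHom ?T X Y f)"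
    if X: "X \<in> Ob" and Y: "Y \<in> Ob" and Z: "Z \<in> Ob" and f: "f \<in> Hom C X Y" and g: "g \<in> Hom C Y Z" for X Y Z f g
  proof (rule J_cancel[of "F X" "F Z"])
    note [simp] = X Y Z f g
    let ?k = "FObj K" and ?j = "\<lambda>X. FObj J (F X)"
    let ?Jf = "FHom J (F X) (F Y) (FHom ?T X Y f)" and ?Jg = "FHom J (F Y) (F Z) (FHom ?T Y Z g)"
    let ?i = "iso_inv E (?k X) (?j X) (\<alpha> X)"
    have "FHom J (F X) (F Z) (FHom ?T X Z (Cmp C X Y Z g f)) =
      Cmp E (?j X) (?k X) (?j Z) (Cmp E (?k X) (?k Z) (?j Z) (\<alpha> Z)
        (Cmp E (?k X) (?k Y) (?k Z) (FHom K Y Z g) (FHom K X Y f))) ?i"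
      by (subst transported_Hom(2)) (simp_all add: a functor_Cmp[OF K_functor])
    also have "Cmp E (?k X) (?k Z) (?j Z) (\<alpha> Z)
        (Cmp E (?k X) (?k Y) (?k Z) (FHom K Y Z g) (FHom K X Y f)) =
      Cmp E (?k X) (?k Y) (?j Z) (Cmp E (?k Y) (?k Z) (?j Z) (\<alpha> Z) (FHom K Y Z g)) (FHom K X Y f)"
      by (subst cat_assoc[OF E]) simp_all
    also have "Cmp E (?k Y) (?k Z) (?j Z) (\<alpha> Z) (FHom K Y Z g) = Cmp E (?k Y) (?j Y) (?j Z) ?Jg (\<alpha> Y)"
      by (subst transported_Hom(3)) (simp_all add: a)
    also have "Cmp E (?k X) (?k Y) (?j Z) (Cmp E (?k Y) (?j Y) (?j Z) ?Jg (\<alpha> Y)) (FHom K X Y f) =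
      Cmp E (?k X) (?j Y) (?j Z) ?Jg (Cmp E (?k X) (?k Y) (?j Y) (\<alpha> Y) (FHom K X Y f))"
      by (subst cat_assoc[OF E]) simp_all
    also have "Cmp E (?j X) (?k X) (?j Z) (Cmp E (?k X) (?j Y) (?j Z) ?Jg
        (Cmp E (?k X) (?k Y) (?j Y) (\<alpha> Y) (FHom K X Y f))) ?i =
      Cmp E (?j X) (?j Y) (?j Z) ?Jg (Cmp E (?j X) (?k X) (?j Y)
        (Cmp E (?k X) (?k Y) (?j Y) (\<alpha> Y) (FHom K X Y f)) ?i)"
      by (subst cat_assoc[OF E]) simp_all
    also have "Cmp E (?j X) (?k X) (?j Y)
        (Cmp E (?k X) (?k Y) (?j Y) (\<alpha> Y) (FHom K X Y f)) ?i = ?Jf"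
      by (subst transported_Hom(2)) (simp_all add: a)
    also have "Cmp E (?j X) (?j Y) (?j Z) ?Jg ?Jf =
       FHom J (F X) (F Z) (Cmp D (F X) (F Y) (F Z) (FHom ?T Y Z g) (FHom ?T X Y f))"
      by (simp add: functor_Cmp[OF J_functor])
    finally show "FHom J (F X) (F Z) (FHom ?T X Z (Cmp C X Y Z g f)) =
       FHom J (F X) (F Z) (Cmp D (F X) (F Y) (F Z) (FHom ?T Y Z g) (FHom ?T X Y f))" .
  qed (use that in simp_all)
  ultimately show ?thesis by (simp add: is_functor_def)
qed

text \<open>
  The component at \<open>X\<close> is the preimage under \<open>K\<close> of \<open>\<beta> (F X)\<close> after \<open>\<alpha> X\<close>. Naturality is checked after
  applying \<open>K\<close>, where the conjugations that define the two functors cancel.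
\<close>

lemma transported_unit:
  assumes Ob: "Ob \<subseteq> Obj C" and P: "P \<subseteq> Obj D" and Q: "Q \<subseteq> Obj C" and OQ: "Ob \<subseteq> Q"
    and F: "\<And>X. X \<in> Ob \<Longrightarrow> F X \<in> P" and G: "\<And>Y. Y \<in> P \<Longrightarrow> G Y \<in> Q"
    and a: "\<And>X. X \<in> Ob \<Longrightarrow> cat_iso E (FObj K X) (FObj J (F X)) (\<alpha> X)"
    and b: "\<And>Y. Y \<in> P \<Longrightarrow> cat_iso E (FObj J Y) (FObj K (G Y)) (\<beta> Y)"
  shows "\<exists>\<eta>. natural_iso (full_sub C Ob) (full_sub C Q) id_functor
    (comp_functor (transported C E J K G \<beta>) (transported D E K J F \<alpha>)) \<eta>"
proof -
  interpret fl: common_target D C E J K by (rule flip)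
  let ?S = "transported D E K J F \<alpha>" and ?T = "transported C E J K G \<beta>"
  let ?k = "FObj K" and ?j = "\<lambda>X. FObj J (F X)" and ?l = "\<lambda>X. FObj K (G (F X))"
  let ?h = "\<lambda>X. Cmp E (?k X) (?j X) (?l X) (\<beta> (F X)) (\<alpha> X)"
  define \<eta> where "\<eta> X = inv_into (Hom C X (G (F X))) (FHom K X (G (F X))) (?h X)" for X
  have XC [simp]: "X \<in> Obj C" and FD [simp]: "F X \<in> Obj D" and GC [simp]: "G (F X) \<in> Obj C"
    and FP [simp]: "F X \<in> P"
    if "X \<in> Ob" for X using that Ob P Q F G by auto
  note [simp] = functor_Obj[OF K_functor] functor_Obj[OF J_functor] a b
    cat_Cmp[OF E] iso_inv[OF a] iso_inv[OF b] cat_Cmp[OF C] cat_Cmp[OF D]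
    functor_Hom[OF K_functor] functor_Hom[OF J_functor]
  have SH [simp]: "FHom ?S X Y f \<in> Hom D (F X) (F Y)" if "X \<in> Ob" "Y \<in> Ob" "f \<in> Hom C X Y" for X Y f
    using transported_Hom(1)[where F = F and \<alpha> = \<alpha>, OF XC XC FD FD a a] that by blast
  have TH [simp]: "FHom ?T (F X) (F Y) f \<in> Hom C (G (F X)) (G (F Y))"
    if "X \<in> Ob" "Y \<in> Ob" "f \<in> Hom D (F X) (F Y)" for X Y f
    using fl.transported_Hom(1)[of "F X" "F Y"] that by (simp add: F)
  have h: "cat_iso E (?k X) (?l X) (?h X)" if "X \<in> Ob" for X
    using that by (intro cat_iso_Cmp[OF E]) auto
  have bij: "bij_betw (FHom K X (G (F X))) (Hom C X (G (F X))) (Hom E (?k X) (?l X))" if "X \<in> Ob" for X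
    using that K by (simp add: fully_faithful_def)
  have eH [simp]: "\<eta> X \<in> Hom C X (G (F X))" and Ke: "FHom K X (G (F X)) (\<eta> X) = ?h X" if "X \<in> Ob" for X
    using bij[OF that] iso_inv(1)[OF h[OF that]] unfolding \<eta>_def
    by (metis bij_betw_def inv_into_into, metis bij_betw_inv_into_right)
  have "cat_iso C X (G (F X)) (\<eta> X)" if X: "X \<in> Ob" for X
    using fully_faithful_iso[OF K C _ _ eH[OF X]] X h[OF X] Ke[OF X] by simp
  moreover have "Cmp C X Y (G (F Y)) (\<eta> Y) f = Cmp C X (G (F X)) (G (F Y)) (FHom ?T (F X) (F Y) (FHom ?S X Y f)) (\<eta> X)"
    if X: "X \<in> Ob" and Y: "Y \<in> Ob" and f: "f \<in> Hom C X Y" for X Y f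
  proof (rule fl.J_cancel[of X "G (F Y)"])
    note [simp] = X Y f
    let ?s = "FHom ?S X Y f"
    let ?t = "FHom ?T (F X) (F Y) ?s"
    have "FHom K X (G (F Y)) (Cmp C X Y (G (F Y)) (\<eta> Y) f) = Cmp E (?k X) (?k Y) (?l Y) (?h Y) (FHom K X Y f)"
      by (simp add: functor_Cmp[OF K_functor] Ke)
    also have "\<dots> = Cmp E (?k X) (?j Y) (?l Y) (\<beta> (F Y)) (Cmp E (?k X) (?k Y) (?j Y) (\<alpha> Y) (FHom K X Y f))"
      by (subst cat_assoc[OF E]) simp_all
    also have "Cmp E (?k X) (?k Y) (?j Y) (\<alpha> Y) (FHom K X Y f) =
        Cmp E (?k X) (?j X) (?j Y) (FHom J (F X) (F Y) ?s) (\<alpha> X)"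
      by (subst transported_Hom(3)) simp_all
    also have "Cmp E (?k X) (?j Y) (?l Y) (\<beta> (F Y)) \<dots> =
       Cmp E (?k X) (?j X) (?l Y) (Cmp E (?j X) (?j Y) (?l Y) (\<beta> (F Y)) (FHom J (F X) (F Y) ?s)) (\<alpha> X)"
      by (subst cat_assoc[OF E]) simp_all
    also have "Cmp E (?j X) (?j Y) (?l Y) (\<beta> (F Y)) (FHom J (F X) (F Y) ?s) =
       Cmp E (?j X) (?l X) (?l Y) (FHom K (G (F X)) (G (F Y)) ?t) (\<beta> (F X))"
      by (subst fl.transported_Hom(3)) simp_all
    also have "Cmp E (?k X) (?j X) (?l Y) \<dots> (\<alpha> X) = Cmp E (?k X) (?l X) (?l Y) (FHom K (G (F X)) (G (F Y)) ?t) (?h X)"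
      by (subst cat_assoc[OF E]) simp_all
    also have "\<dots> = FHom K X (G (F Y)) (Cmp C X (G (F X)) (G (F Y)) ?t (\<eta> X))"
      by (simp add: functor_Cmp[OF K_functor] Ke)
    finally show "FHom K X (G (F Y)) (Cmp C X Y (G (F Y)) (\<eta> Y) f) =
      FHom K X (G (F Y)) (Cmp C X (G (F X)) (G (F Y)) ?t (\<eta> X))" .
  qed (use that in simp_all)
  ultimately have "natural_iso (full_sub C Ob) (full_sub C Q) id_functor (comp_functor ?T ?S) \<eta>"
    by (simp add: natural_iso_def cat_iso_def id_functor_def comp_functor_def fl.transported_Obj)
  then show ?thesis by blast
qed

lemma functor_id_full_sub: "Ob \<subseteq> Q \<Longrightarrow> is_functor (full_sub C Ob) (full_sub C Q) id_functor"
  by (auto simp: is_functor_def id_functor_def)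

lemma functor_comp:
  assumes "is_functor A1 A2 S" "is_functor A2 A3 T"
  shows "is_functor A1 A3 (comp_functor T S)"
  using assms by (simp add: is_functor_def comp_functor_def)

text \<open>
  Each of the two object assignments is allowed to enlarge the full subcategories under
  consideration, and both round trips are naturally isomorphic to the identity because \<open>K\<close> and \<open>J\<close>
  reflect isomorphisms.
\<close>

theorem equivalence_of_full_subs:
  assumes Ob: "O0 \<subseteq> O1" "O1 \<subseteq> O2" "O2 \<subseteq> Obj C" and P: "P0 \<subseteq> P1" "P1 \<subseteq> P2" "P2 \<subseteq> Obj D"
    and F: "\<And>X. X \<in> O0 \<Longrightarrow> F X \<in> P1" "\<And>X. X \<in> O1 \<Longrightarrow> F X \<in> P2"
    and G: "\<And>Y. Y \<in> P0 \<Longrightarrow> G Y \<in> O1" "\<And>Y. Y \<in> P1 \<Longrightarrow> G Y \<in> O2"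
    and a: "\<And>X. X \<in> O1 \<Longrightarrow> cat_iso E (FObj K X) (FObj J (F X)) (\<alpha> X)"
    and b: "\<And>Y. Y \<in> P1 \<Longrightarrow> cat_iso E (FObj J Y) (FObj K (G Y)) (\<beta> Y)"
  shows "\<exists>F G \<eta> \<epsilon>.
       is_functor (full_sub C O0) (full_sub D P1) F \<and> is_functor (full_sub C O1) (full_sub D P2) F \<and>
       is_functor (full_sub D P0) (full_sub C O1) G \<and> is_functor (full_sub D P1) (full_sub C O2) G \<and>
       natural_iso (full_sub C O0) (full_sub C O2) id_functor (comp_functor G F) \<eta> \<and>
       natural_iso (full_sub D P0) (full_sub D P2) (comp_functor F G) id_functor \<epsilon>"
proof -
  interpret fl: common_target D C E J K by (rule flip)
  let ?F = "transported D E K J F \<alpha>" and ?G = "transported C E J K G \<beta>"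
  have O1: "O1 \<subseteq> Obj C" and O0: "O0 \<subseteq> Obj C" and P1: "P1 \<subseteq> Obj D" and P0: "P0 \<subseteq> Obj D"
    using Ob P by auto
  have f0: "is_functor (full_sub C O0) (full_sub D P1) ?F"
    using a F(1) Ob by (intro transported_functor[OF O0 P1]) auto
  have f1: "is_functor (full_sub C O1) (full_sub D P2) ?F"
    using a F(2) by (intro transported_functor[OF O1 P(3)]) auto
  have g0: "is_functor (full_sub D P0) (full_sub C O1) ?G"
    using b G(1) P by (intro fl.transported_functor[OF P0 O1]) auto
  have g1: "is_functor (full_sub D P1) (full_sub C O2) ?G"
    using b G(2) by (intro fl.transported_functor[OF P1 Ob(3)]) auto
  have "\<exists>\<eta>. natural_iso (full_sub C O0) (full_sub C O2) id_functor (comp_functor ?G ?F) \<eta>"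
    by (rule transported_unit[where P = P1]) (use O0 P1 Ob F(1) G(2) a b in auto)
  then obtain \<eta> where \<eta>: "natural_iso (full_sub C O0) (full_sub C O2) id_functor (comp_functor ?G ?F) \<eta>" ..
  have "\<exists>\<epsilon>. natural_iso (full_sub D P0) (full_sub D P2) id_functor (comp_functor ?F ?G) \<epsilon>"
    by (rule fl.transported_unit[where P = O1]) (use P0 O1 P F(2) G(1) a b in auto)
  then obtain \<epsilon> where \<epsilon>: "natural_iso (full_sub D P0) (full_sub D P2) id_functor (comp_functor ?F ?G) \<epsilon>" ..
  note n = natural_iso_inv[OF category_full_sub[OF D P0] category_full_sub[OF D P(3)]
      fl.functor_id_full_sub functor_comp[OF g0 f1] \<epsilon>]
  show ?thesis using f0 f1 g0 g1 \<eta> n P by blast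
qed

end

section \<open>Inverse semigroups\<close>

locale inv_semigroup =
  fixes S :: "'w ord_semigroup" (structure)
  assumes inverse_semigroup: "inverse_semigroup S"
begin

abbreviation star :: "'w \<Rightarrow> 'w" ("_\<^sup>\<star>" [1000] 999) where "a\<^sup>\<star> \<equiv> sinv S a"

lemma mult_closed [simp]: "a \<in> Car S \<Longrightarrow> b \<in> Car S \<Longrightarrow> a \<cdot> b \<in> Car S"
  and mult_assoc [simp]: "a \<in> Car S \<Longrightarrow> b \<in> Car S \<Longrightarrow> c \<in> Car S \<Longrightarrow> a \<cdot> b \<cdot> c = a \<cdot> (b \<cdot> c)"
  using inverse_semigroup by (simp_all add: inverse_semigroup_def)

lemma inverse_ex1: "a \<in> Car S \<Longrightarrow> \<exists>!b. is_inv S a b"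
  using inverse_semigroup unfolding inverse_semigroup_def by blast

lemma is_inv_star: "a \<in> Car S \<Longrightarrow> is_inv S a (a\<^sup>\<star>)"
  unfolding sinv_def by (rule theI'[OF inverse_ex1])

lemma star_unique: "a \<in> Car S \<Longrightarrow> is_inv S a b \<Longrightarrow> a\<^sup>\<star> = b"
  unfolding sinv_def by (rule the1_equality[OF inverse_ex1])

lemma star_closed [simp]: "a \<in> Car S \<Longrightarrow> a\<^sup>\<star> \<in> Car S"
  using is_inv_star[of a] by (auto simp: is_inv_def)

lemma mult_star_mult [simp]: "a \<in> Car S \<Longrightarrow> a \<cdot> (a\<^sup>\<star> \<cdot> a) = a"
  and star_mult_star [simp]: "a \<in> Car S \<Longrightarrow> a\<^sup>\<star> \<cdot> (a \<cdot> a\<^sup>\<star>) = a\<^sup>\<star>"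
  using is_inv_star[of a] by (auto simp: is_inv_def)

lemma mult_star_mult_left [simp]:
  assumes "a \<in> Car S" "x \<in> Car S" shows "a \<cdot> (a\<^sup>\<star> \<cdot> (a \<cdot> x)) = a \<cdot> x"
  using assms by (metis mult_assoc mult_closed star_closed mult_star_mult)

lemma star_mult_star_left [simp]:
  assumes "a \<in> Car S" "x \<in> Car S" shows "a\<^sup>\<star> \<cdot> (a \<cdot> (a\<^sup>\<star> \<cdot> x)) = a\<^sup>\<star> \<cdot> x"
  using assms by (metis mult_assoc mult_closed star_closed star_mult_star)

lemma star_star [simp]: "a \<in> Car S \<Longrightarrow> (a\<^sup>\<star>)\<^sup>\<star> = a"
  by (rule star_unique) (auto simp: is_inv_def)

lemma idem_Car: "e \<in> idempotents S \<Longrightarrow> e \<in> Car S"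
  and idem_idem: "e \<in> idempotents S \<Longrightarrow> e \<cdot> e = e"
  by (auto simp: idempotents_def)

lemma idemI: "a \<in> Car S \<Longrightarrow> a \<cdot> a = a \<Longrightarrow> a \<in> idempotents S"
  by (simp add: idempotents_def)

lemma idem_star: "e \<in> idempotents S \<Longrightarrow> e\<^sup>\<star> = e"
  by (rule star_unique) (simp_all add: is_inv_def idem_Car idem_idem)

lemma star_mult_idem [simp]: "a \<in> Car S \<Longrightarrow> a\<^sup>\<star> \<cdot> a \<in> idempotents S"
  and mult_star_idem [simp]: "a \<in> Car S \<Longrightarrow> a \<cdot> a\<^sup>\<star> \<in> idempotents S"
  by (simp_all add: idemI)

text \<open>
  The classical argument: for idempotents \<open>e\<close> and \<open>f\<close>, the element \<open>f (ef)\<^sup>\<star> e\<close> is an inverse of \<open>ef\<close>,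
  hence equals \<open>(ef)\<^sup>\<star>\<close>, which is therefore idempotent; so products of idempotents are idempotent, and
  then \<open>fe\<close> is an inverse of \<open>ef\<close>.
\<close>

lemma idem_mult:
  assumes e: "e \<in> idempotents S" and f: "f \<in> idempotents S"
  shows "e \<cdot> f \<in> idempotents S"
proof -
  have [simp]: "e \<in> Car S" "f \<in> Car S" using e f by (auto simp: idem_Car)
  have ee [simp]: "e \<cdot> (e \<cdot> x) = e \<cdot> x" and ff [simp]: "f \<cdot> (f \<cdot> x) = f \<cdot> x" if "x \<in> Car S" for x
    using mult_assoc[of e e x] mult_assoc[of f f x] that by (simp_all add: idem_idem[OF e] idem_idem[OF f])
  define g where "g = (e \<cdot> f)\<^sup>\<star>"
  have g [simp]: "g \<in> Car S" by (simp add: g_def)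
  have 1: "e \<cdot> (f \<cdot> (g \<cdot> (e \<cdot> f))) = e \<cdot> f"
    using mult_star_mult[of "e \<cdot> f", folded g_def] by simp
  have 2: "g \<cdot> (e \<cdot> (f \<cdot> g)) = g"
    using star_mult_star[of "e \<cdot> f", folded g_def] by simp
  have 3: "g \<cdot> (e \<cdot> (f \<cdot> (g \<cdot> x))) = g \<cdot> x" if "x \<in> Car S" for x
  proof -
    have "g \<cdot> (e \<cdot> (f \<cdot> g)) \<cdot> x = g \<cdot> x" by (simp only: 2)
    then show ?thesis using that by simp
  qed
  have "is_inv S (e \<cdot> f) (f \<cdot> (g \<cdot> e))" using 1 3 by (simp add: is_inv_def)
  then have g2: "g = f \<cdot> (g \<cdot> e)" unfolding g_def by (intro star_unique) auto
  have "g \<cdot> g = f \<cdot> (g \<cdot> e) \<cdot> (f \<cdot> (g \<cdot> e))" using g2 by simp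
  also have "\<dots> = f \<cdot> (g \<cdot> (e \<cdot> (f \<cdot> (g \<cdot> e))))" by simp
  also have "\<dots> = f \<cdot> (g \<cdot> e)" by (simp add: 3)
  finally have gg: "g \<in> idempotents S" using g2 by (simp add: idemI)
  have "e \<cdot> f = g\<^sup>\<star>" by (simp add: g_def)
  then show ?thesis using gg by (simp add: idem_star)
qed

lemma idem_comm:
  assumes e: "e \<in> idempotents S" and f: "f \<in> idempotents S"
  shows "e \<cdot> f = f \<cdot> e"
proof -
  have [simp]: "e \<in> Car S" "f \<in> Car S" using e f by (auto simp: idem_Car)
  have ee [simp]: "e \<cdot> (e \<cdot> x) = e \<cdot> x" and ff [simp]: "f \<cdot> (f \<cdot> x) = f \<cdot> x" if "x \<in> Car S" for x
    using mult_assoc[of e e x] mult_assoc[of f f x] that by (simp_all add: idem_idem[OF e] idem_idem[OF f])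
  have "is_inv S (e \<cdot> f) (f \<cdot> e)"
    using idem_idem[OF idem_mult[OF e f]] idem_idem[OF idem_mult[OF f e]] by (simp add: is_inv_def)
  then have "(e \<cdot> f)\<^sup>\<star> = f \<cdot> e" by (intro star_unique) auto
  then show ?thesis using idem_star[OF idem_mult[OF e f]] by simp
qed

lemma idem_left_comm:
  assumes e: "e \<in> idempotents S" and f: "f \<in> idempotents S" and x: "x \<in> Car S"
  shows "e \<cdot> (f \<cdot> x) = f \<cdot> (e \<cdot> x)"
proof -
  have "e \<cdot> f \<cdot> x = f \<cdot> e \<cdot> x" by (simp only: idem_comm[OF e f])
  then show ?thesis using x idem_Car[OF e] idem_Car[OF f] by simp
qed

text \<open>
  These are cases of commuting idempotents, arranged for products nested to the right, which is the
  normal form that \<open>mult_assoc\<close> produces as a rewrite rule.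
\<close>

lemma star_star_comm:
  assumes "a \<in> Car S" "b \<in> Car S" "x \<in> Car S"
  shows "a\<^sup>\<star> \<cdot> (a \<cdot> (b\<^sup>\<star> \<cdot> b)) = b\<^sup>\<star> \<cdot> (b \<cdot> (a\<^sup>\<star> \<cdot> a))"
    and "a\<^sup>\<star> \<cdot> (a \<cdot> (b\<^sup>\<star> \<cdot> (b \<cdot> x))) = b\<^sup>\<star> \<cdot> (b \<cdot> (a\<^sup>\<star> \<cdot> (a \<cdot> x)))"
    and "a\<^sup>\<star> \<cdot> (a \<cdot> (b \<cdot> b\<^sup>\<star>)) = b \<cdot> (b\<^sup>\<star> \<cdot> (a\<^sup>\<star> \<cdot> a))"
    and "a\<^sup>\<star> \<cdot> (a \<cdot> (b \<cdot> (b\<^sup>\<star> \<cdot> x))) = b \<cdot> (b\<^sup>\<star> \<cdot> (a\<^sup>\<star> \<cdot> (a \<cdot> x)))"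
  using idem_comm[of "a\<^sup>\<star> \<cdot> a" "b\<^sup>\<star> \<cdot> b"] idem_left_comm[of "a\<^sup>\<star> \<cdot> a" "b\<^sup>\<star> \<cdot> b" x]
    idem_comm[of "a\<^sup>\<star> \<cdot> a" "b \<cdot> b\<^sup>\<star>"] idem_left_comm[of "a\<^sup>\<star> \<cdot> a" "b \<cdot> b\<^sup>\<star>" x] assms
  by simp_all

lemma star_mult [simp]:
  assumes a [simp]: "a \<in> Car S" and b [simp]: "b \<in> Car S" shows "(a \<cdot> b)\<^sup>\<star> = b\<^sup>\<star> \<cdot> a\<^sup>\<star>"
proof (rule star_unique)
  have "a \<cdot> (b \<cdot> (b\<^sup>\<star> \<cdot> (a\<^sup>\<star> \<cdot> (a \<cdot> b)))) = a \<cdot> (a\<^sup>\<star> \<cdot> (a \<cdot> (b \<cdot> (b\<^sup>\<star> \<cdot> b))))"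
    by (subst star_star_comm(4)[symmetric]) simp_all
  moreover have "b\<^sup>\<star> \<cdot> (a\<^sup>\<star> \<cdot> (a \<cdot> (b \<cdot> (b\<^sup>\<star> \<cdot> a\<^sup>\<star>)))) = b\<^sup>\<star> \<cdot> (b \<cdot> (b\<^sup>\<star> \<cdot> (a\<^sup>\<star> \<cdot> (a \<cdot> a\<^sup>\<star>))))"
    by (subst star_star_comm(4)) simp_all
  ultimately show "is_inv S (a \<cdot> b) (b\<^sup>\<star> \<cdot> a\<^sup>\<star>)" by (simp add: is_inv_def)
qed simp

lemma nat_le_facts:
  assumes le: "nat_le S a b" and a [simp]: "a \<in> Car S" and b [simp]: "b \<in> Car S"
  shows nat_le_right: "b \<cdot> (a\<^sup>\<star> \<cdot> a) = a"
    and nat_le_dom: "b\<^sup>\<star> \<cdot> a = a\<^sup>\<star> \<cdot> a" "a\<^sup>\<star> \<cdot> b = a\<^sup>\<star> \<cdot> a"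
    and nat_le_left: "a \<cdot> (a\<^sup>\<star> \<cdot> b) = a"
    and nat_le_ran: "b \<cdot> a\<^sup>\<star> = a \<cdot> a\<^sup>\<star>" "a \<cdot> b\<^sup>\<star> = a \<cdot> a\<^sup>\<star>"
proof -
  show 1: "b \<cdot> (a\<^sup>\<star> \<cdot> a) = a" using le by (simp add: nat_le_def)
  have e: "a\<^sup>\<star> \<cdot> a \<in> idempotents S" by simp
  have s: "a\<^sup>\<star> = a\<^sup>\<star> \<cdot> (a \<cdot> b\<^sup>\<star>)" using arg_cong[OF 1, of "sinv S"] by simp
  have "a\<^sup>\<star> \<cdot> a = a\<^sup>\<star> \<cdot> (a \<cdot> b\<^sup>\<star>) \<cdot> (b \<cdot> (a\<^sup>\<star> \<cdot> a))" using 1 s by simp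
  also have "\<dots> = b\<^sup>\<star> \<cdot> (b \<cdot> (a\<^sup>\<star> \<cdot> a))"
    by (simp add: star_star_comm(2)[of a b "a\<^sup>\<star> \<cdot> a"])
  also have "\<dots> = b\<^sup>\<star> \<cdot> a" using 1 by simp
  finally show 2: "b\<^sup>\<star> \<cdot> a = a\<^sup>\<star> \<cdot> a" by simp
  show 3: "a\<^sup>\<star> \<cdot> b = a\<^sup>\<star> \<cdot> a" using arg_cong[OF 2, of "sinv S"] by simp
  show "a \<cdot> (a\<^sup>\<star> \<cdot> b) = a" by (simp add: 3)
  have "b \<cdot> a\<^sup>\<star> = b \<cdot> (a\<^sup>\<star> \<cdot> a) \<cdot> a\<^sup>\<star>" by simp
  also have "\<dots> = a \<cdot> a\<^sup>\<star>" by (simp only: 1)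
  finally show 4: "b \<cdot> a\<^sup>\<star> = a \<cdot> a\<^sup>\<star>" .
  show "a \<cdot> b\<^sup>\<star> = a \<cdot> a\<^sup>\<star>" using arg_cong[OF 4, of "sinv S"] by simp
qed

lemma nat_le_absorb:
  assumes le: "nat_le S a b" and a [simp]: "a \<in> Car S" and b [simp]: "b \<in> Car S"
  shows "a \<cdot> (b\<^sup>\<star> \<cdot> b) = a" and "b\<^sup>\<star> \<cdot> (b \<cdot> a\<^sup>\<star>) = a\<^sup>\<star>"
proof -
  have "a \<cdot> b\<^sup>\<star> \<cdot> b = a \<cdot> a\<^sup>\<star> \<cdot> b" by (simp only: nat_le_ran(2)[OF assms])
  then show 1: "a \<cdot> (b\<^sup>\<star> \<cdot> b) = a" using nat_le_left[OF assms] by simp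
  show "b\<^sup>\<star> \<cdot> (b \<cdot> a\<^sup>\<star>) = a\<^sup>\<star>" using arg_cong[OF 1, of "sinv S"] by simp
qed

lemma nat_leI: "a \<in> Car S \<Longrightarrow> b \<in> Car S \<Longrightarrow> b \<cdot> (a\<^sup>\<star> \<cdot> a) = a \<Longrightarrow> nat_le S a b"
  by (simp add: nat_le_def)

lemma nat_le_mult_idem:
  assumes [simp]: "a \<in> Car S" "b \<in> Car S" shows "nat_le S (a \<cdot> (b\<^sup>\<star> \<cdot> b)) a"
  by (rule nat_leI) (simp_all add: star_star_comm(1)[of b a b] star_star_comm(2)[of b a])

end

section \<open>Sigma-ordered inverse semigroups\<close>

locale sigma = inv_semigroup S for S :: "'w ord_semigroup" (structure) +
  assumes sigma_ordered: "sigma_ordered S"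

lemma sigma_orderedD: "sigma_ordered S \<Longrightarrow> sigma S"
  by (simp add: sigma_def inv_semigroup_def sigma_axioms_def sigma_ordered_def)

context sigma
begin

abbreviation zero_elem :: 'w ("\<zero>") where "\<zero> \<equiv> szero S"

lemma zero_is_zero: "is_zero S \<zero>"
proof -
  obtain z where z: "is_zero S z" using sigma_ordered by (auto simp: sigma_ordered_def)
  moreover have "y = z" if "is_zero S y" for y using z that unfolding is_zero_def by metis
  ultimately show ?thesis unfolding szero_def by (rule theI)
qed

lemma zero_Car [simp]: "\<zero> \<in> Car S"
  and zero_mult [simp]: "a \<in> Car S \<Longrightarrow> \<zero> \<cdot> a = \<zero>"
  and mult_zero [simp]: "a \<in> Car S \<Longrightarrow> a \<cdot> \<zero> = \<zero>"
  using zero_is_zero by (auto simp: is_zero_def)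

lemma zero_idem [simp]: "\<zero> \<in> idempotents S"
  by (simp add: idemI)

lemma zero_star [simp]: "\<zero>\<^sup>\<star> = \<zero>"
  by (simp add: idem_star)

lemma star_eq_zero_iff: "a \<in> Car S \<Longrightarrow> a\<^sup>\<star> = \<zero> \<longleftrightarrow> a = \<zero>"
  by (metis star_star idem_star zero_idem)

lemma mult_star_eq_zero: "a \<in> Car S \<Longrightarrow> a \<cdot> a\<^sup>\<star> = \<zero> \<Longrightarrow> a = \<zero>"
  by (metis mult_star_mult mult_assoc star_closed zero_mult)

lemma compatible: "compatible_order S"
  using sigma_ordered by (simp add: sigma_ordered_def)

lemma incl_refl [simp]: "a \<in> Car S \<Longrightarrow> a \<sqsubseteq> a"
  and incl_trans: "\<lbrakk>a \<sqsubseteq> b; b \<sqsubseteq> c; a \<in> Car S; b \<in> Car S; c \<in> Car S\<rbrakk> \<Longrightarrow> a \<sqsubseteq> c"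
  and incl_antisym: "\<lbrakk>a \<sqsubseteq> b; b \<sqsubseteq> a; a \<in> Car S; b \<in> Car S\<rbrakk> \<Longrightarrow> a = b"
  and incl_le: "\<lbrakk>a \<sqsubseteq> b; a \<in> Car S; b \<in> Car S\<rbrakk> \<Longrightarrow> nat_le S a b"
  and incl_right: "\<lbrakk>a \<sqsubseteq> b; a \<in> Car S; b \<in> Car S; x \<in> Car S\<rbrakk> \<Longrightarrow> a \<cdot> x \<sqsubseteq> b \<cdot> x"
  and incl_left: "\<lbrakk>a \<sqsubseteq> b; a \<in> Car S; b \<in> Car S; x \<in> Car S\<rbrakk> \<Longrightarrow> x \<cdot> a \<sqsubseteq> x \<cdot> b"
proof -
  show "a \<in> Car S \<Longrightarrow> a \<sqsubseteq> a"
    using compatible unfolding compatible_order_def by blast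
  show "\<lbrakk>a \<sqsubseteq> b; b \<sqsubseteq> c; a \<in> Car S; b \<in> Car S; c \<in> Car S\<rbrakk> \<Longrightarrow> a \<sqsubseteq> c"
    using compatible unfolding compatible_order_def by blast
  show "\<lbrakk>a \<sqsubseteq> b; b \<sqsubseteq> a; a \<in> Car S; b \<in> Car S\<rbrakk> \<Longrightarrow> a = b"
    using compatible unfolding compatible_order_def by blast
  show "\<lbrakk>a \<sqsubseteq> b; a \<in> Car S; b \<in> Car S\<rbrakk> \<Longrightarrow> nat_le S a b"
    using compatible unfolding compatible_order_def by blast
  show "\<lbrakk>a \<sqsubseteq> b; a \<in> Car S; b \<in> Car S; x \<in> Car S\<rbrakk> \<Longrightarrow> a \<cdot> x \<sqsubseteq> b \<cdot> x"
    using compatible unfolding compatible_order_def by blast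
  show "\<lbrakk>a \<sqsubseteq> b; a \<in> Car S; b \<in> Car S; x \<in> Car S\<rbrakk> \<Longrightarrow> x \<cdot> a \<sqsubseteq> x \<cdot> b"
    using compatible unfolding compatible_order_def by blast
qed

lemma zero_incl [simp]: "a \<in> Car S \<Longrightarrow> \<zero> \<sqsubseteq> a"
  using sigma_ordered by (simp add: sigma_ordered_def)

lemma incl_zero: "a \<in> Car S \<Longrightarrow> a \<sqsubseteq> \<zero> \<Longrightarrow> a = \<zero>"
  by (simp add: incl_antisym)

lemma sup_bounded:
  "\<lbrakk>a \<sqsubseteq> c; b \<sqsubseteq> c; a \<in> Car S; b \<in> Car S; c \<in> Car S\<rbrakk> \<Longrightarrow> \<exists>d. is_sup S {a, b} d"
  using sigma_ordered unfolding sigma_ordered_def by blast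

lemma sup_left:
  "\<lbrakk>is_sup S {a, b} c; a \<in> Car S; b \<in> Car S; x \<in> Car S\<rbrakk> \<Longrightarrow> is_sup S {x \<cdot> a, x \<cdot> b} (x \<cdot> c)"
  using sigma_ordered unfolding sigma_ordered_def by blast

lemma idem_complement:
  "\<lbrakk>e \<sqsubseteq> f; e \<in> idempotents S; f \<in> idempotents S\<rbrakk>
    \<Longrightarrow> \<exists>c\<in>idempotents S. is_sup S {e, c} f \<and> is_inf S {e, c} \<zero>"
  using sigma_ordered unfolding sigma_ordered_def by blast

lemma sup_orthogonal:
  "\<lbrakk>a\<^sup>\<star> \<cdot> b = \<zero>; a \<cdot> b\<^sup>\<star> = \<zero>; a \<in> Car S; b \<in> Car S\<rbrakk> \<Longrightarrow> \<exists>d. is_sup S {a, b} d"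
  using sigma_ordered unfolding sigma_ordered_def by blast

lemma interpolation:
  "\<lbrakk>nat_le S t a; t \<in> Car S; a \<in> Car S\<rbrakk> \<Longrightarrow>
    \<exists>z\<in>Car S. nat_le S t z \<and> z \<sqsubseteq> a \<and> (\<forall>x\<in>Car S. t \<cdot> x = \<zero> \<longleftrightarrow> z \<cdot> x = \<zero>)"
  using sigma_ordered unfolding sigma_ordered_def by blast

lemma sup_Car: "is_sup S A c \<Longrightarrow> c \<in> Car S"
  and sup_upper: "is_sup S A c \<Longrightarrow> a \<in> A \<Longrightarrow> a \<sqsubseteq> c"
  and sup_least: "is_sup S A c \<Longrightarrow> d \<in> Car S \<Longrightarrow> (\<And>a. a \<in> A \<Longrightarrow> a \<sqsubseteq> d) \<Longrightarrow> c \<sqsubseteq> d"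
  by (auto simp: is_sup_def)

lemma supI:
  "\<lbrakk>c \<in> Car S; \<And>a. a \<in> A \<Longrightarrow> a \<sqsubseteq> c; \<And>d. d \<in> Car S \<Longrightarrow> \<forall>a\<in>A. a \<sqsubseteq> d \<Longrightarrow> c \<sqsubseteq> d\<rbrakk> \<Longrightarrow> is_sup S A c"
  by (auto simp: is_sup_def)

lemma sup_unique: "is_sup S A c \<Longrightarrow> is_sup S A d \<Longrightarrow> c = d"
  by (meson incl_antisym sup_Car sup_least sup_upper)

lemma incl_star:
  assumes ab: "a \<sqsubseteq> b" and a [simp]: "a \<in> Car S" and b [simp]: "b \<in> Car S"
  shows "a\<^sup>\<star> \<sqsubseteq> b\<^sup>\<star>" and incl_dom: "a\<^sup>\<star> \<cdot> a \<sqsubseteq> b\<^sup>\<star> \<cdot> b" and incl_ran: "a \<cdot> a\<^sup>\<star> \<sqsubseteq> b \<cdot> b\<^sup>\<star>"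
proof -
  note le = nat_le_facts[OF incl_le[OF ab a b] a b]
  have "b\<^sup>\<star> \<cdot> a \<sqsubseteq> b\<^sup>\<star> \<cdot> b" by (rule incl_left[OF ab]) simp_all
  then show 1: "a\<^sup>\<star> \<cdot> a \<sqsubseteq> b\<^sup>\<star> \<cdot> b" by (simp add: le)
  have "a \<cdot> b\<^sup>\<star> \<sqsubseteq> b \<cdot> b\<^sup>\<star>" by (rule incl_right[OF ab]) simp_all
  then show "a \<cdot> a\<^sup>\<star> \<sqsubseteq> b \<cdot> b\<^sup>\<star>" by (simp add: le)
  have "a\<^sup>\<star> \<cdot> a \<cdot> b\<^sup>\<star> \<sqsubseteq> b\<^sup>\<star> \<cdot> b \<cdot> b\<^sup>\<star>" by (rule incl_right[OF 1]) simp_all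
  then show "a\<^sup>\<star> \<sqsubseteq> b\<^sup>\<star>" by (simp add: le)
qed

lemma incl_star_iff: "a \<in> Car S \<Longrightarrow> b \<in> Car S \<Longrightarrow> a\<^sup>\<star> \<sqsubseteq> b\<^sup>\<star> \<longleftrightarrow> a \<sqsubseteq> b"
  using incl_star[of a b] incl_star[of "a\<^sup>\<star>" "b\<^sup>\<star>"] by auto

text \<open>
  The star is an automorphism of the order, so it turns left distributivity into right distributivity.
\<close>

lemma sup_star:
  assumes "is_sup S {a, b} c" and [simp]: "a \<in> Car S" "b \<in> Car S"
  shows "is_sup S {a\<^sup>\<star>, b\<^sup>\<star>} (c\<^sup>\<star>)"
proof (rule supI)
  note c [simp] = sup_Car[OF assms(1)]
  show "c\<^sup>\<star> \<in> Car S" by simp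
  show "x \<sqsubseteq> c\<^sup>\<star>" if "x \<in> {a\<^sup>\<star>, b\<^sup>\<star>}" for x
    using that sup_upper[OF assms(1)] by (auto simp: incl_star_iff)
  show "c\<^sup>\<star> \<sqsubseteq> d" if "d \<in> Car S" "\<forall>x\<in>{a\<^sup>\<star>, b\<^sup>\<star>}. x \<sqsubseteq> d" for d
    using that sup_least[OF assms(1), of "d\<^sup>\<star>"] incl_star_iff[of a "d\<^sup>\<star>"] incl_star_iff[of b "d\<^sup>\<star>"]
      incl_star_iff[of c "d\<^sup>\<star>"] by auto
qed

lemma sup_right:
  assumes "is_sup S {a, b} c" and [simp]: "a \<in> Car S" "b \<in> Car S" "x \<in> Car S"
  shows "is_sup S {a \<cdot> x, b \<cdot> x} (c \<cdot> x)"
  using sup_star[OF sup_left[OF sup_star[OF assms(1)], of "x\<^sup>\<star>"]] sup_Car[OF assms(1)] by simp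

lemma sup_zero: "a \<in> Car S \<Longrightarrow> is_sup S {\<zero>, a} a"
  by (rule supI) auto

subsection \<open>Containment of sources\<close>

text \<open>
  In the semigroup of compact open bisections, \<open>bx = 0\<close> means that the source of \<open>b\<close> does not meet the
  range of \<open>x\<close>. So annihilators compare sources, and \<open>a \<cdot> b\<^sup>\<star> \<cdot> b\<close> has as its source the
  intersection of the two sources.
\<close>

definition src_le :: "'w \<Rightarrow> 'w \<Rightarrow> bool" (infix "\<preceq>" 50) where
  "a \<preceq> b \<longleftrightarrow> a \<in> Car S \<and> b \<in> Car S \<and> (\<forall>x\<in>Car S. b \<cdot> x = \<zero> \<longrightarrow> a \<cdot> x = \<zero>)"

lemma src_leI: "a \<in> Car S \<Longrightarrow> b \<in> Car S \<Longrightarrow> (\<And>x. x \<in> Car S \<Longrightarrow> b \<cdot> x = \<zero> \<Longrightarrow> a \<cdot> x = \<zero>) \<Longrightarrow> a \<preceq> b"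
  and src_le_Car: "a \<preceq> b \<Longrightarrow> a \<in> Car S" "a \<preceq> b \<Longrightarrow> b \<in> Car S"
  and src_leD: "a \<preceq> b \<Longrightarrow> b \<cdot> x = \<zero> \<Longrightarrow> x \<in> Car S \<Longrightarrow> a \<cdot> x = \<zero>"
  by (auto simp: src_le_def)

lemma src_le_refl [simp]: "a \<in> Car S \<Longrightarrow> a \<preceq> a"
  and src_le_trans [trans]: "a \<preceq> b \<Longrightarrow> b \<preceq> c \<Longrightarrow> a \<preceq> c"
  by (auto simp: src_le_def)

lemma src_le_mult [simp]: "x \<in> Car S \<Longrightarrow> a \<in> Car S \<Longrightarrow> x \<cdot> a \<preceq> a"
  by (rule src_leI) auto

lemma src_le_mult_right: "a \<preceq> b \<Longrightarrow> x \<in> Car S \<Longrightarrow> a \<cdot> x \<preceq> b \<cdot> x"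
  using src_le_Car[of a b] src_leD[of a b] by (intro src_leI) auto

lemma src_le_dom: "a \<in> Car S \<Longrightarrow> a\<^sup>\<star> \<cdot> a \<preceq> a" "a \<in> Car S \<Longrightarrow> a \<preceq> a\<^sup>\<star> \<cdot> a"
  using src_le_mult[of "a\<^sup>\<star>" a] src_le_mult[of a "a\<^sup>\<star> \<cdot> a"] by simp_all

lemma src_le_mult_idem:
  assumes [simp]: "a \<in> Car S" "b \<in> Car S"
  shows "a \<cdot> (b\<^sup>\<star> \<cdot> b) \<preceq> a" "a \<cdot> (b\<^sup>\<star> \<cdot> b) \<preceq> b"
proof -
  show "a \<cdot> (b\<^sup>\<star> \<cdot> b) \<preceq> b" using src_le_mult[of "a \<cdot> b\<^sup>\<star>" b] by simp
  have "a \<cdot> (b\<^sup>\<star> \<cdot> b) = a \<cdot> (b\<^sup>\<star> \<cdot> (b \<cdot> a\<^sup>\<star>)) \<cdot> a"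
    by (simp add: star_star_comm(1)[of b a b])
  then show "a \<cdot> (b\<^sup>\<star> \<cdot> b) \<preceq> a" using src_le_mult[of "a \<cdot> (b\<^sup>\<star> \<cdot> (b \<cdot> a\<^sup>\<star>))" a] by simp
qed

lemma src_le_meet:
  assumes "a \<preceq> b" "a \<preceq> c" shows "a \<preceq> b \<cdot> (c\<^sup>\<star> \<cdot> c)"
proof (rule src_leI)
  note [simp] = src_le_Car[OF assms(1)] src_le_Car[OF assms(2)]
  show "a \<in> Car S" "b \<cdot> (c\<^sup>\<star> \<cdot> c) \<in> Car S" by simp_all
  fix x assume [simp]: "x \<in> Car S" and 0: "b \<cdot> (c\<^sup>\<star> \<cdot> c) \<cdot> x = \<zero>"
  then have "a \<cdot> (c\<^sup>\<star> \<cdot> (c \<cdot> x)) = \<zero>" using src_leD[OF assms(1)] by simp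
  then have "c\<^sup>\<star> \<cdot> (c \<cdot> (a\<^sup>\<star> \<cdot> (a \<cdot> x))) = \<zero>" by (simp add: star_star_comm(2)[of c a x])
  then have "c \<cdot> (c\<^sup>\<star> \<cdot> (c \<cdot> (a\<^sup>\<star> \<cdot> (a \<cdot> x)))) = c \<cdot> \<zero>" by (simp only:)
  then have "c \<cdot> (a\<^sup>\<star> \<cdot> (a \<cdot> x)) = \<zero>" by simp
  then have "a \<cdot> (a\<^sup>\<star> \<cdot> (a \<cdot> x)) = \<zero>"
    using src_leD[OF assms(2), of "a\<^sup>\<star> \<cdot> (a \<cdot> x)"] by simp
  then show "a \<cdot> x = \<zero>" by simp
qed

lemma nat_le_src_le: "nat_le S a b \<Longrightarrow> a \<in> Car S \<Longrightarrow> b \<in> Car S \<Longrightarrow> a \<preceq> b"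
  using src_le_mult[of "a \<cdot> a\<^sup>\<star>" b] nat_le_left[of a b] by simp

lemma incl_src_le: "a \<sqsubseteq> b \<Longrightarrow> a \<in> Car S \<Longrightarrow> b \<in> Car S \<Longrightarrow> a \<preceq> b"
  by (simp add: nat_le_src_le incl_le)

lemma src_le_zero: "a \<preceq> \<zero> \<Longrightarrow> a = \<zero>"
  using src_leD[of a \<zero> "a\<^sup>\<star>"] src_le_Car[of a \<zero>] mult_star_eq_zero[of a] by simp

text \<open>
  Right multiplication by \<open>x\<close> distributes over the join, and the join of \<open>0\<close> and \<open>0\<close> is \<open>0\<close>.
\<close>

lemma src_le_sup:
  assumes "is_sup S {a, b} c" "a \<preceq> d" "b \<preceq> d" shows "c \<preceq> d"
proof (rule src_leI)
  note [simp] = src_le_Car[OF assms(2)] src_le_Car[OF assms(3)] sup_Car[OF assms(1)]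
  show "c \<in> Car S" "d \<in> Car S" by simp_all
  fix x assume [simp]: "x \<in> Car S" and 0: "d \<cdot> x = \<zero>"
  then have "is_sup S {\<zero>, \<zero>} (c \<cdot> x)"
    using sup_right[OF assms(1), of x] src_leD[OF assms(2)] src_leD[OF assms(3)] by simp
  then show "c \<cdot> x = \<zero>" by (metis sup_unique sup_zero zero_Car)
qed

text \<open>
  The axiom on complements only speaks of idempotents. Left multiplication by \<open>a\<close> carries a complement
  of \<open>z\<^sup>\<star> \<cdot> z\<close> in \<open>a\<^sup>\<star> \<cdot> a\<close> to a complement of \<open>z\<close> in \<open>a\<close>.
\<close>

lemma complement:
  assumes za: "z \<sqsubseteq> a" and [simp]: "z \<in> Car S" "a \<in> Car S"
  shows "\<exists>c\<in>Car S. c \<sqsubseteq> a \<and> is_sup S {z, c} a \<and> z \<cdot> c\<^sup>\<star> = \<zero>"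
proof -
  let ?e = "z\<^sup>\<star> \<cdot> z" and ?f = "a\<^sup>\<star> \<cdot> a"
  obtain c where c: "c \<in> idempotents S" "is_sup S {?e, c} ?f" "is_inf S {?e, c} \<zero>"
    using idem_complement[OF incl_dom[OF za]] by auto
  have [simp]: "c \<in> Car S" using c by (simp add: idem_Car)
  have cf: "c \<sqsubseteq> ?f" and ef: "?e \<sqsubseteq> ?f" using sup_upper[OF c(2)] by auto
  have 1: "?e \<cdot> c \<sqsubseteq> ?e"
    using incl_left[OF cf, of ?e] by (simp add: nat_le_absorb[OF incl_le[OF za]])
  have "c \<cdot> ?e \<sqsubseteq> c \<cdot> ?f" by (rule incl_left[OF ef]) simp_all
  also have "c \<cdot> ?f = c"
    using nat_le_right[OF incl_le[OF cf]] idem_comm[OF c(1), of ?f] by (simp add: idem_star[OF c(1)] idem_idem[OF c(1)])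
  finally have 2: "?e \<cdot> c \<sqsubseteq> c" by (simp only: idem_comm[OF c(1) star_mult_idem[OF \<open>z \<in> Car S\<close>]])
  have "?e \<cdot> c \<sqsubseteq> \<zero>" using c(3) 1 2 by (auto simp: is_inf_def)
  then have ec: "z\<^sup>\<star> \<cdot> (z \<cdot> c) = \<zero>" using incl_zero[of "?e \<cdot> c"] by simp
  then have "z \<cdot> (z\<^sup>\<star> \<cdot> (z \<cdot> c)) = \<zero>" by simp
  then have "z \<cdot> c = \<zero>" by simp
  then have "z \<cdot> c \<cdot> a\<^sup>\<star> = \<zero>" by simp
  then have "z \<cdot> (a \<cdot> c)\<^sup>\<star> = \<zero>" by (simp add: idem_star[OF c(1)])
  moreover have "is_sup S {z, a \<cdot> c} a"
    using sup_left[OF c(2), of a] nat_le_right[OF incl_le[OF za]] by simp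
  ultimately show ?thesis using sup_upper[of "{z, a \<cdot> c}" a "a \<cdot> c"] by (auto intro!: bexI[of _ "a \<cdot> c"])
qed

text \<open>
  Under a common bound, \<open>b \<cdot> a\<^sup>\<star> \<cdot> a\<close> plays the part of the intersection of \<open>a\<close> and \<open>b\<close>.
\<close>

lemma meet_incl:
  assumes ac: "a \<sqsubseteq> c" and bc: "b \<sqsubseteq> c" and [simp]: "a \<in> Car S" "b \<in> Car S" "c \<in> Car S"
  shows "b \<cdot> (a\<^sup>\<star> \<cdot> a) \<sqsubseteq> a" "b \<cdot> (a\<^sup>\<star> \<cdot> a) \<sqsubseteq> b"
  using incl_right[OF bc, of "a\<^sup>\<star> \<cdot> a"] nat_le_right[OF incl_le[OF ac]]
    incl_left[OF incl_dom[OF ac], of b] nat_le_absorb(1)[OF incl_le[OF bc]] by simp_all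

text \<open>
  Below a common bound, an element is determined by its source: \<open>z = b \<cdot> a\<^sup>\<star> \<cdot> a\<close> lies below \<open>a\<close> and \<open>b\<close>,
  and the complement of \<open>z\<close> in \<open>a\<close> has a source disjoint from that of \<open>b\<close>.
\<close>

lemma src_le_imp_incl:
  assumes ac: "a \<sqsubseteq> c" and bc: "b \<sqsubseteq> c" and ab: "a \<preceq> b"
    and [simp]: "a \<in> Car S" "b \<in> Car S" "c \<in> Car S"
  shows "a \<sqsubseteq> b"
proof -
  let ?z = "b \<cdot> (a\<^sup>\<star> \<cdot> a)"
  have za: "?z \<sqsubseteq> a" and zb: "?z \<sqsubseteq> b" using meet_incl[OF ac bc] by simp_all
  obtain d where [simp]: "d \<in> Car S" and d: "d \<sqsubseteq> a" "is_sup S {?z, d} a" "?z \<cdot> d\<^sup>\<star> = \<zero>"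
    using complement[OF za] by auto
  note dle = nat_le_facts[OF incl_le[OF d(1)]]
  have "a\<^sup>\<star> \<cdot> (a \<cdot> d\<^sup>\<star>) = d\<^sup>\<star>"
    by (simp add: nat_le_absorb[OF incl_le[OF d(1)]])
  then have "b \<cdot> d\<^sup>\<star> = \<zero>" using d(3) by simp
  then have "a \<cdot> d\<^sup>\<star> = \<zero>" using src_leD[OF ab] by simp
  then have "d \<cdot> d\<^sup>\<star> = \<zero>" using dle by simp
  then have "d = \<zero>" by (simp add: mult_star_eq_zero)
  then have "is_sup S {\<zero>, ?z} a" using d(2) by (simp add: insert_commute)
  then have "a = ?z" using sup_unique sup_zero by (metis \<open>a \<in> Car S\<close> \<open>b \<in> Car S\<close> mult_closed star_closed)
  then show ?thesis using zb by simp
qed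

text \<open>
  The restriction of \<open>a\<close> to the source of \<open>b\<close>: an interpolator between \<open>a \<cdot> b\<^sup>\<star> \<cdot> b\<close> and \<open>a\<close>. It is contained
  in \<open>a\<close>, while \<open>a \<cdot> b\<^sup>\<star> \<cdot> b\<close> is only below \<open>a\<close> in the canonical order.
\<close>

lemma source_restriction:
  assumes [simp]: "a \<in> Car S" "b \<in> Car S"
  shows "\<exists>c\<in>Car S. c \<sqsubseteq> a \<and> c \<preceq> a \<cdot> (b\<^sup>\<star> \<cdot> b) \<and> a \<cdot> (b\<^sup>\<star> \<cdot> b) \<preceq> c"
proof -
  let ?t = "a \<cdot> (b\<^sup>\<star> \<cdot> b)"
  have "nat_le S ?t a" by (simp add: nat_le_mult_idem)
  then obtain z where "z \<in> Car S" "z \<sqsubseteq> a" "\<forall>x\<in>Car S. ?t \<cdot> x = \<zero> \<longleftrightarrow> z \<cdot> x = \<zero>"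
    using interpolation[of ?t a] by auto
  then show ?thesis by (auto simp: src_le_def)
qed

text \<open>
  The axiom provides the condition on right annihilators. The one on left annihilators follows by
  applying it to \<open>z\<^sup>\<star> \<cdot> x\<^sup>\<star>\<close>. Two interpolators have the same source and are contained in \<open>a\<close>, so they
  are equal.
\<close>

lemma interpolator_unique:
  assumes le: "nat_le S t a" and [simp]: "t \<in> Car S" "a \<in> Car S"
  shows "\<exists>!p. is_interpolator S a t p"
proof -
  obtain z where [simp]: "z \<in> Car S" and z: "nat_le S t z" "z \<sqsubseteq> a" "\<forall>x\<in>Car S. t \<cdot> x = \<zero> \<longleftrightarrow> z \<cdot> x = \<zero>"
    using interpolation[OF le] by auto
  note f = nat_le_facts[OF z(1)]
  have "x \<cdot> t = \<zero> \<longleftrightarrow> x \<cdot> z = \<zero>" if [simp]: "x \<in> Car S" for x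
  proof
    assume "x \<cdot> z = \<zero>"
    then have "x \<cdot> z \<cdot> (t\<^sup>\<star> \<cdot> t) = \<zero>" by simp
    then show "x \<cdot> t = \<zero>" using f(1) by simp
  next
    assume "x \<cdot> t = \<zero>"
    then have "x \<cdot> t \<cdot> t\<^sup>\<star> = \<zero>" by simp
    then have "x \<cdot> (z \<cdot> t\<^sup>\<star>) = \<zero>" using f(5) by simp
    then have "(x \<cdot> (z \<cdot> t\<^sup>\<star>))\<^sup>\<star> = \<zero>" by simp
    then have "t \<cdot> (z\<^sup>\<star> \<cdot> x\<^sup>\<star>) = \<zero>" by simp
    then have "z \<cdot> (z\<^sup>\<star> \<cdot> x\<^sup>\<star>) = \<zero>" using z(3) by simp
    then have "z\<^sup>\<star> \<cdot> (z \<cdot> (z\<^sup>\<star> \<cdot> x\<^sup>\<star>)) = \<zero>" by simp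
    then have "(x \<cdot> z)\<^sup>\<star> = \<zero>" by simp
    then show "x \<cdot> z = \<zero>" using star_eq_zero_iff[of "x \<cdot> z"] by simp
  qed
  then have "is_interpolator S a t z" using z by (simp add: is_interpolator_def)
  moreover have "p = q" if "is_interpolator S a t p" "is_interpolator S a t q" for p q
  proof -
    have pq: "p \<in> Car S" "q \<in> Car S" "p \<sqsubseteq> a" "q \<sqsubseteq> a" "p \<preceq> q" "q \<preceq> p"
      using that by (auto simp: is_interpolator_def src_le_def)
    show ?thesis
      by (rule incl_antisym; (rule src_le_imp_incl[of _ a])?) (use pq in simp_all)
  qed
  ultimately show ?thesis by blast
qed

end

section \<open>Morphisms of Sigma-ordered inverse semigroups\<close>

inductive_set joins :: "'w ord_semigroup \<Rightarrow> 'w set \<Rightarrow> 'w set" for S X where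
  base: "x \<in> X \<Longrightarrow> x \<in> joins S X"
| join: "\<lbrakk>a \<in> joins S X; b \<in> joins S X; is_sup S {a, b} c\<rbrakk> \<Longrightarrow> c \<in> joins S X"

context sigma
begin

lemma is_interpolator_interpolator:
  "nat_le S t a \<Longrightarrow> t \<in> Car S \<Longrightarrow> a \<in> Car S \<Longrightarrow> is_interpolator S a t (interpolator S a t)"
  unfolding interpolator_def by (rule theI'[OF interpolator_unique])

lemma interpolator_eqI:
  "is_interpolator S a t p \<Longrightarrow> nat_le S t a \<Longrightarrow> t \<in> Car S \<Longrightarrow> a \<in> Car S \<Longrightarrow> interpolator S a t = p"
  unfolding interpolator_def by (rule the1_equality[OF interpolator_unique])

lemma interpolator_Car:
  "nat_le S t a \<Longrightarrow> t \<in> Car S \<Longrightarrow> a \<in> Car S \<Longrightarrow> interpolator S a t \<in> Car S"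
  using is_interpolator_interpolator by (simp add: is_interpolator_def)

lemma joins_Car: "X \<subseteq> Car S \<Longrightarrow> t \<in> joins S X \<Longrightarrow> t \<in> Car S"
  by (erule joins.cases) (auto dest: sup_Car)

lemma sup_Un:
  assumes "is_sup S A a" "is_sup S B b" "is_sup S {a, b} c" "A \<subseteq> Car S" "B \<subseteq> Car S"
  shows "is_sup S (A \<union> B) c"
proof (rule supI)
  show "c \<in> Car S" using assms(3) by (rule sup_Car)
  show "x \<sqsubseteq> c" if "x \<in> A \<union> B" for x
    using that sup_upper[OF assms(1), of x] sup_upper[OF assms(2), of x] sup_upper[OF assms(3)]
      incl_trans[of x a c] incl_trans[of x b c] assms sup_Car by blast
  show "c \<sqsubseteq> d" if "d \<in> Car S" "\<forall>x\<in>A \<union> B. x \<sqsubseteq> d" for d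
    using that by (intro sup_least[OF assms(3)])
      (auto intro: sup_least[OF assms(1)] sup_least[OF assms(2)])
qed

lemma sup_finite_bounded:
  assumes "finite R" "R \<noteq> {}" "R \<subseteq> Car S" "t \<in> Car S" "\<forall>x\<in>R. x \<sqsubseteq> t"
  shows "\<exists>s. is_sup S R s"
  using assms
proof (induction R rule: finite_ne_induct)
  case (singleton x)
  then have "is_sup S {x} x" by (intro supI) auto
  then show ?case ..
next
  case (insert x R)
  then obtain s where s: "is_sup S R s" by auto
  have "s \<sqsubseteq> t" using insert by (intro sup_least[OF s]) auto
  then obtain d where d: "is_sup S {x, s} d" using sup_bounded[of x t s] insert sup_Car[OF s] by auto
  have "is_sup S {x} x" using insert by (intro supI) auto
  from sup_Un[OF this s d] show ?case using insert by auto
qed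

text \<open>
  Partial suprema of a finite family with a supremum exist, as the total supremum bounds them.
\<close>

lemma finite_sup_imp_joins:
  assumes "finite R" "R \<noteq> {}" "R \<subseteq> X" "X \<subseteq> Car S" "is_sup S R t"
  shows "t \<in> joins S X"
  using assms
proof (induction R arbitrary: t rule: finite_ne_induct)
  case (singleton x)
  then have "is_sup S {x} x" by (intro supI) auto
  then have "t = x" using singleton sup_unique by blast
  then show ?case using singleton by (auto intro: joins.base)
next
  case (insert x R)
  have tC: "t \<in> Car S" using insert sup_Car by blast
  have "\<exists>s. is_sup S R s"
    by (rule sup_finite_bounded[of R t]) (use insert tC sup_upper[OF insert(7)] in auto)
  then obtain s where s: "is_sup S R s" ..
  have st: "s \<sqsubseteq> t" using sup_upper[OF insert(7)] tC by (intro sup_least[OF s]) auto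
  have "is_sup S {x, s} t"
  proof (rule supI)
    show "a \<sqsubseteq> t" if "a \<in> {x, s}" for a using that st sup_upper[OF insert(7)] by auto
    fix d assume d: "d \<in> Car S" "\<forall>a\<in>{x, s}. a \<sqsubseteq> d"
    have "y \<sqsubseteq> d" if "y \<in> R" for y
      using incl_trans[OF sup_upper[OF s that], of d] d that insert sup_Car[OF s] by auto
    then show "t \<sqsubseteq> d" using d by (intro sup_least[OF insert(7)]) auto
  qed (rule tC)
  moreover have "s \<in> joins S X" using insert s by auto
  moreover have "x \<in> joins S X" using insert by (auto intro: joins.base)
  ultimately show ?case by (blast intro: joins.join)
qed

lemma joins_imp_finite_sup:
  assumes "t \<in> joins S X" "X \<subseteq> Car S"
  shows "\<exists>R. finite R \<and> R \<noteq> {} \<and> R \<subseteq> X \<and> is_sup S R t"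
  using assms
proof (induction rule: joins.induct)
  case (base x)
  then have "is_sup S {x} x" by (intro supI) auto
  then show ?case using base by (intro exI[of _ "{x}"]) auto
next
  case (join a b c)
  then obtain R1 R2 where "finite R1" "R1 \<noteq> {}" "R1 \<subseteq> X" "is_sup S R1 a"
    "finite R2" "R2 \<noteq> {}" "R2 \<subseteq> X" "is_sup S R2 b" by auto
  then show ?case using sup_Un[of R1 a R2 b c] join by (intro exI[of _ "R1 \<union> R2"]) auto
qed

end

text \<open>
  The fifth condition on morphisms asks for a finite family; as joins of two elements with a common
  bound exist, it says that the codomain is generated under binary joins by the elements below an image.
\<close>

lemma cover_iff:
  assumes T: "sigma_ordered T"
  shows "(\<exists>n\<ge>1. \<exists>(ts :: nat \<Rightarrow> 'w) (ss :: nat \<Rightarrow> 'v).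
       (\<forall>i\<in>{1..n}. ts i \<in> Car T \<and> ss i \<in> Car S \<and> ts i \<sqsubseteq>\<^bsub>T\<^esub> \<theta> (ss i)) \<and>
       is_sup T (ts ` {1..n}) t) \<longleftrightarrow>
    t \<in> joins T {t' \<in> Car T. \<exists>s\<in>Car S. t' \<sqsubseteq>\<^bsub>T\<^esub> \<theta> s}" (is "?L \<longleftrightarrow> t \<in> joins T ?X")
proof
  interpret sigma T using T by (rule sigma_orderedD)
  assume ?L
  then obtain n :: nat and ts :: "nat \<Rightarrow> 'w" and ss :: "nat \<Rightarrow> 'v" where n: "n \<ge> 1" "is_sup T (ts ` {1..n}) t"
    "\<forall>i\<in>{1..n}. ts i \<in> Car T \<and> ss i \<in> Car S \<and> ts i \<sqsubseteq>\<^bsub>T\<^esub> \<theta> (ss i)"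
    by blast
  show "t \<in> joins T ?X"
    by (rule finite_sup_imp_joins[of "ts ` {1..n}"]) (use n in auto)
next
  interpret sigma T using T by (rule sigma_orderedD)
  assume "t \<in> joins T ?X"
  then obtain R where R: "finite R" "R \<noteq> {}" "R \<subseteq> ?X" "is_sup T R t"
    using joins_imp_finite_sup[of t ?X] by auto
  obtain ts where ts: "bij_betw ts {1..card R} R" using ex_bij_betw_nat_finite_1[OF R(1)] by auto
  have img: "ts ` {1..card R} = R" using ts by (simp add: bij_betw_def)
  have "\<forall>i\<in>{1..card R}. ts i \<in> ?X" using R(3) img by blast
  then have "\<forall>i\<in>{1..card R}. \<exists>s. ts i \<in> Car T \<and> s \<in> Car S \<and> ts i \<sqsubseteq>\<^bsub>T\<^esub> \<theta> s" by blast
  from bchoice[OF this] obtain ss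
    where "\<forall>i\<in>{1..card R}. ts i \<in> Car T \<and> ss i \<in> Car S \<and> ts i \<sqsubseteq>\<^bsub>T\<^esub> \<theta> (ss i)" by blast
  moreover have "card R \<ge> 1" using R(1,2) by (simp add: Suc_leI card_gt_0_iff)
  moreover have "is_sup T (ts ` {1..card R}) t" using R(4) img by simp
  ultimately show ?L by blast
qed

lemma sigma_morphismI:
  assumes T: "sigma_ordered T"
    and "\<And>a. a \<in> Car S \<Longrightarrow> \<theta> a \<in> Car T"
    and "\<And>a b. a \<in> Car S \<Longrightarrow> b \<in> Car S \<Longrightarrow> \<theta> (a \<cdot>\<^bsub>S\<^esub> b) = \<theta> a \<cdot>\<^bsub>T\<^esub> \<theta> b"
    and "\<theta> (szero S) = szero T"
    and "\<And>a b. a \<in> Car S \<Longrightarrow> b \<in> Car S \<Longrightarrow> a \<sqsubseteq>\<^bsub>S\<^esub> b \<Longrightarrow> \<theta> a \<sqsubseteq>\<^bsub>T\<^esub> \<theta> b"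
    and "\<And>a b c. a \<in> Car S \<Longrightarrow> b \<in> Car S \<Longrightarrow> is_sup S {a, b} c \<Longrightarrow> is_sup T {\<theta> a, \<theta> b} (\<theta> c)"
    and "\<And>a b t. \<lbrakk>a \<in> Car S; b \<in> Car S; t \<in> Car T; t \<sqsubseteq>\<^bsub>T\<^esub> \<theta> a; t \<sqsubseteq>\<^bsub>T\<^esub> \<theta> b\<rbrakk> \<Longrightarrow>
       \<exists>c\<in>Car S. c \<sqsubseteq>\<^bsub>S\<^esub> a \<and> c \<sqsubseteq>\<^bsub>S\<^esub> b \<and> t \<sqsubseteq>\<^bsub>T\<^esub> \<theta> c"
    and "\<And>t. t \<in> Car T \<Longrightarrow> t \<in> joins T {t' \<in> Car T. \<exists>s\<in>Car S. t' \<sqsubseteq>\<^bsub>T\<^esub> \<theta> s}"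
    and "\<And>a b. \<lbrakk>a \<in> Car S; b \<in> Car S; nat_le S a b\<rbrakk> \<Longrightarrow>
       \<theta> (interpolator S b a) = interpolator T (\<theta> b) (\<theta> a)"
  shows "sigma_morphism S T \<theta>"
  unfolding sigma_morphism_def cover_iff[OF T]
  using assms(2-) by (intro conjI ballI allI impI) (blast | simp)+

lemma sigma_morphismD:
  assumes T: "sigma_ordered T" and "sigma_morphism S T \<theta>"
  shows "\<And>a. a \<in> Car S \<Longrightarrow> \<theta> a \<in> Car T"
    and "\<And>a b. a \<in> Car S \<Longrightarrow> b \<in> Car S \<Longrightarrow> \<theta> (a \<cdot>\<^bsub>S\<^esub> b) = \<theta> a \<cdot>\<^bsub>T\<^esub> \<theta> b"
    and "\<theta> (szero S) = szero T"
    and "\<And>a b. a \<in> Car S \<Longrightarrow> b \<in> Car S \<Longrightarrow> a \<sqsubseteq>\<^bsub>S\<^esub> b \<Longrightarrow> \<theta> a \<sqsubseteq>\<^bsub>T\<^esub> \<theta> b"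
    and "\<And>a b c. a \<in> Car S \<Longrightarrow> b \<in> Car S \<Longrightarrow> is_sup S {a, b} c \<Longrightarrow> is_sup T {\<theta> a, \<theta> b} (\<theta> c)"
    and "\<And>a b t. \<lbrakk>a \<in> Car S; b \<in> Car S; t \<in> Car T; t \<sqsubseteq>\<^bsub>T\<^esub> \<theta> a; t \<sqsubseteq>\<^bsub>T\<^esub> \<theta> b\<rbrakk> \<Longrightarrow>
       \<exists>c\<in>Car S. c \<sqsubseteq>\<^bsub>S\<^esub> a \<and> c \<sqsubseteq>\<^bsub>S\<^esub> b \<and> t \<sqsubseteq>\<^bsub>T\<^esub> \<theta> c"
    and "\<And>t. t \<in> Car T \<Longrightarrow> t \<in> joins T {t' \<in> Car T. \<exists>s\<in>Car S. t' \<sqsubseteq>\<^bsub>T\<^esub> \<theta> s}"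
    and "\<And>a b. \<lbrakk>a \<in> Car S; b \<in> Car S; nat_le S a b\<rbrakk> \<Longrightarrow>
       \<theta> (interpolator S b a) = interpolator T (\<theta> b) (\<theta> a)"
  using assms(2) unfolding sigma_morphism_def cover_iff[OF T] by (blast | simp)+

lemma hom_star:
  assumes S: "inverse_semigroup S" and T: "inverse_semigroup T"
    and \<theta>: "\<And>a. a \<in> Car S \<Longrightarrow> \<theta> a \<in> Car T"
      "\<And>a b. a \<in> Car S \<Longrightarrow> b \<in> Car S \<Longrightarrow> \<theta> (a \<cdot>\<^bsub>S\<^esub> b) = \<theta> a \<cdot>\<^bsub>T\<^esub> \<theta> b"
    and a: "a \<in> Car S"
  shows "sinv T (\<theta> a) = \<theta> (sinv S a)"
proof -
  interpret S: inv_semigroup S by (rule inv_semigroup.intro[OF S])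
  interpret T: inv_semigroup T by (rule inv_semigroup.intro[OF T])
  have "is_inv S a (sinv S a)" by (rule S.is_inv_star[OF a])
  then have "is_inv T (\<theta> a) (\<theta> (sinv S a))"
    unfolding is_inv_def using a \<theta> by (metis S.mult_closed)
  then show ?thesis using T.star_unique \<theta>(1)[OF a] by blast
qed

lemma hom_nat_le:
  assumes "inverse_semigroup S" "inverse_semigroup T"
    and "\<And>a. a \<in> Car S \<Longrightarrow> \<theta> a \<in> Car T"
      "\<And>a b. a \<in> Car S \<Longrightarrow> b \<in> Car S \<Longrightarrow> \<theta> (a \<cdot>\<^bsub>S\<^esub> b) = \<theta> a \<cdot>\<^bsub>T\<^esub> \<theta> b"
    and "a \<in> Car S" "b \<in> Car S" "nat_le S a b"
  shows "nat_le T (\<theta> a) (\<theta> b)"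
proof -
  interpret S: inv_semigroup S by (rule inv_semigroup.intro) fact
  have "\<theta> (b \<cdot>\<^bsub>S\<^esub> sinv S a \<cdot>\<^bsub>S\<^esub> a) = \<theta> b \<cdot>\<^bsub>T\<^esub> sinv T (\<theta> a) \<cdot>\<^bsub>T\<^esub> \<theta> a"
    using assms S.star_closed S.mult_closed by (simp add: hom_star[OF assms(1-4)] del: S.mult_assoc)
  then show ?thesis using assms(7) by (simp add: nat_le_def)
qed

lemma sigma_morphism_id:
  assumes S: "sigma_ordered S"
  shows "sigma_morphism S S (\<lambda>a\<in>Car S. a)"
proof -
  interpret sigma S using S by (rule sigma_orderedD)
  show ?thesis
    by (intro sigma_morphismI[OF S]) (auto dest: sup_Car intro: joins.base incl_refl interpolator_Car)
qed

text \<open>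
  In the covering condition for a composite, a join \<open>s = a \<union> b\<close> pulls apart an element \<open>t\<close> below
  \<open>\<theta> s\<close> as the join of \<open>t t\<^sup>\<star> \<theta> a\<close> and \<open>t t\<^sup>\<star> \<theta> b\<close>.
\<close>

lemma sigma_morphism_comp:
  assumes R: "sigma_ordered R" and S: "sigma_ordered S" and T: "sigma_ordered T"
    and \<psi>: "sigma_morphism R S \<psi>" and \<theta>: "sigma_morphism S T \<theta>"
    and \<rho>: "\<And>a. a \<in> Car R \<Longrightarrow> \<rho> a = \<theta> (\<psi> a)"
  shows "sigma_morphism R T \<rho>"
proof (rule sigma_morphismI[OF T])
  interpret R: sigma R using R by (rule sigma_orderedD)
  interpret S: sigma S using S by (rule sigma_orderedD)
  interpret T: sigma T using T by (rule sigma_orderedD)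
  note p = sigma_morphismD[OF S \<psi>] and q = sigma_morphismD[OF T \<theta>]
  note [simp] = p(1) q(1) \<rho>
  show "\<rho> a \<in> Car T" if "a \<in> Car R" for a using that by simp
  show "\<rho> (a \<cdot>\<^bsub>R\<^esub> b) = \<rho> a \<cdot>\<^bsub>T\<^esub> \<rho> b" if "a \<in> Car R" "b \<in> Car R" for a b
    using that p(2) q(2) by simp
  show "\<rho> (szero R) = szero T" using p(3) q(3) by simp
  show "\<rho> a \<sqsubseteq>\<^bsub>T\<^esub> \<rho> b" if "a \<in> Car R" "b \<in> Car R" "a \<sqsubseteq>\<^bsub>R\<^esub> b" for a b
    using that p(4) q(4) by simp
  show "is_sup T {\<rho> a, \<rho> b} (\<rho> c)" if "a \<in> Car R" "b \<in> Car R" "is_sup R {a, b} c" for a b c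
    using that p(5)[OF that] q(5) R.sup_Car[OF that(3)] by simp
  show "\<exists>c\<in>Car R. c \<sqsubseteq>\<^bsub>R\<^esub> a \<and> c \<sqsubseteq>\<^bsub>R\<^esub> b \<and> t \<sqsubseteq>\<^bsub>T\<^esub> \<rho> c"
    if t: "a \<in> Car R" "b \<in> Car R" "t \<in> Car T" "t \<sqsubseteq>\<^bsub>T\<^esub> \<rho> a" "t \<sqsubseteq>\<^bsub>T\<^esub> \<rho> b" for a b t
  proof -
    obtain s where s: "s \<in> Car S" "s \<sqsubseteq>\<^bsub>S\<^esub> \<psi> a" "s \<sqsubseteq>\<^bsub>S\<^esub> \<psi> b" "t \<sqsubseteq>\<^bsub>T\<^esub> \<theta> s"
      using q(6)[of "\<psi> a" "\<psi> b" t] t by auto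
    obtain c where c: "c \<in> Car R" "c \<sqsubseteq>\<^bsub>R\<^esub> a" "c \<sqsubseteq>\<^bsub>R\<^esub> b" "s \<sqsubseteq>\<^bsub>S\<^esub> \<psi> c"
      using p(6)[of a b s] t s by auto
    have "t \<sqsubseteq>\<^bsub>T\<^esub> \<theta> (\<psi> c)"
      using T.incl_trans[OF s(4) q(4)[OF s(1) _ c(4)]] t s c by auto
    then show ?thesis using c by auto
  qed
  show "\<rho> (interpolator R b a) = interpolator T (\<rho> b) (\<rho> a)"
    if ab: "a \<in> Car R" "b \<in> Car R" "nat_le R a b" for a b
  proof -
    have "interpolator R b a \<in> Car R"
      using R.interpolator_Car[OF ab(3,1,2)] .
    moreover have "nat_le S (\<psi> a) (\<psi> b)"
      using ab by (intro hom_nat_le[OF R.inverse_semigroup S.inverse_semigroup p(1,2)])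
    ultimately show ?thesis using p(8)[OF ab] q(8) ab by simp
  qed
  let ?Z = "{t' \<in> Car T. \<exists>r\<in>Car R. t' \<sqsubseteq>\<^bsub>T\<^esub> \<rho> r}"
  have *: "t \<in> joins T ?Z"
    if "s \<in> joins S {s' \<in> Car S. \<exists>r\<in>Car R. s' \<sqsubseteq>\<^bsub>S\<^esub> \<psi> r}" "t \<in> Car T" "t \<sqsubseteq>\<^bsub>T\<^esub> \<theta> s" for s t
    using that
  proof (induction arbitrary: t rule: joins.induct)
    case (base s)
    then obtain r where r: "r \<in> Car R" "s \<sqsubseteq>\<^bsub>S\<^esub> \<psi> r" "s \<in> Car S" by auto
    then have "t \<sqsubseteq>\<^bsub>T\<^esub> \<rho> r" using T.incl_trans[OF base(3) q(4)[OF _ _ r(2)]] base by auto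
    then show ?case using r base by (intro joins.base) auto
  next
    case (join a b s)
    have C [simp]: "a \<in> Car S" "b \<in> Car S" "s \<in> Car S" "t \<in> Car T"
      using S.joins_Car[OF _ join(1)] S.joins_Car[OF _ join(2)] S.sup_Car[OF join(3)] join by auto
    let ?e = "t \<cdot>\<^bsub>T\<^esub> sinv T t"
    have sup: "is_sup T {\<theta> a, \<theta> b} (\<theta> s)" using q(5)[OF C(1,2) join(3)] .
    have "?e \<cdot>\<^bsub>T\<^esub> \<theta> s = t" using T.nat_le_left[OF T.incl_le[OF join(7)]] by simp
    then have "is_sup T {?e \<cdot>\<^bsub>T\<^esub> \<theta> a, ?e \<cdot>\<^bsub>T\<^esub> \<theta> b} t"
      using T.sup_left[OF sup, of ?e] by (simp del: T.mult_assoc)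
    moreover have le: "?e \<cdot>\<^bsub>T\<^esub> \<theta> x \<sqsubseteq>\<^bsub>T\<^esub> \<theta> x" if x: "x \<in> {a, b}" for x
    proof -
      have xs: "\<theta> x \<sqsubseteq>\<^bsub>T\<^esub> \<theta> s" using x T.sup_upper[OF sup] by blast
      have [simp]: "x \<in> Car S" using x C(1,2) by blast
      have "?e \<cdot>\<^bsub>T\<^esub> \<theta> x \<sqsubseteq>\<^bsub>T\<^esub> \<theta> s \<cdot>\<^bsub>T\<^esub> sinv T (\<theta> s) \<cdot>\<^bsub>T\<^esub> \<theta> x"
        by (rule T.incl_right[OF T.incl_ran[OF join(7)]]) simp_all
      also have "\<dots> = \<theta> x"
        using T.nat_le_dom(1)[OF T.incl_le[OF xs]] T.nat_le_right[OF T.incl_le[OF xs]] by simp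
      finally show ?thesis .
    qed
    moreover have "?e \<cdot>\<^bsub>T\<^esub> \<theta> a \<in> joins T ?Z"
      by (rule join.IH(1)[OF _ le]) simp_all
    moreover have "?e \<cdot>\<^bsub>T\<^esub> \<theta> b \<in> joins T ?Z"
      by (rule join.IH(2)[OF _ le]) simp_all
    ultimately show ?case by (blast intro: joins.join)
  qed
  show "t \<in> joins T ?Z" if "t \<in> Car T" for t
    using q(7)[OF that]
  proof (induction rule: joins.induct)
    case (base t)
    then show ?case using * p(7) by blast
  next
    case (join a b c)
    then show ?case by (blast intro: joins.join)
  qed
qed

subsection \<open>Transport along isomorphisms\<close>

definition ord_iso :: "'v ord_semigroup \<Rightarrow> 'w ord_semigroup \<Rightarrow> ('v \<Rightarrow> 'w) \<Rightarrow> bool" where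
  "ord_iso S T f \<longleftrightarrow> bij_betw f (Car S) (Car T) \<and>
    (\<forall>a\<in>Car S. \<forall>b\<in>Car S. f (a \<cdot>\<^bsub>S\<^esub> b) = f a \<cdot>\<^bsub>T\<^esub> f b \<and> (f a \<sqsubseteq>\<^bsub>T\<^esub> f b \<longleftrightarrow> a \<sqsubseteq>\<^bsub>S\<^esub> b))"

lemma ord_iso_inv_into:
  assumes f: "ord_iso S T f" and S: "sigma_ordered S"
  shows "ord_iso T S (inv_into (Car S) f)"
proof -
  interpret sigma S using S by (rule sigma_orderedD)
  have bij: "bij_betw f (Car S) (Car T)" using f by (simp add: ord_iso_def)
  then have T: "Car T = f ` Car S" and inj: "inj_on f (Car S)" by (auto simp: bij_betw_def)
  let ?g = "inv_into (Car S) f"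
  have "?g (x \<cdot>\<^bsub>T\<^esub> y) = ?g x \<cdot>\<^bsub>S\<^esub> ?g y \<and> (?g x \<sqsubseteq>\<^bsub>S\<^esub> ?g y \<longleftrightarrow> x \<sqsubseteq>\<^bsub>T\<^esub> y)"
    if "x \<in> Car T" "y \<in> Car T" for x y
  proof -
    obtain a b where ab: "a \<in> Car S" "b \<in> Car S" "x = f a" "y = f b" using \<open>x \<in> Car T\<close> \<open>y \<in> Car T\<close> T by blast
    then have "x \<cdot>\<^bsub>T\<^esub> y = f (a \<cdot>\<^bsub>S\<^esub> b)" "x \<sqsubseteq>\<^bsub>T\<^esub> y \<longleftrightarrow> a \<sqsubseteq>\<^bsub>S\<^esub> b" using f by (simp_all add: ord_iso_def)
    then show ?thesis using ab by (simp add: inv_into_f_f[OF inj])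
  qed
  then show ?thesis using bij_betw_inv_into[OF bij] by (simp add: ord_iso_def)
qed

locale iso_transport =
  fixes S :: "'v ord_semigroup" and T :: "'w ord_semigroup" and f
  assumes f: "ord_iso S T f" and S: "sigma_ordered S"
begin

sublocale S: sigma S using S by (rule sigma_orderedD)

lemma Car_T: "Car T = f ` Car S"
  using f by (simp add: ord_iso_def bij_betw_def)

lemma f_eq [simp]: "a \<in> Car S \<Longrightarrow> b \<in> Car S \<Longrightarrow> f a = f b \<longleftrightarrow> a = b"
  using f by (auto simp: ord_iso_def bij_betw_def inj_on_eq_iff)

lemma f_Car [simp]: "a \<in> Car S \<Longrightarrow> f a \<in> Car T"
  by (simp add: Car_T)

lemma f_mult [simp]: "a \<in> Car S \<Longrightarrow> b \<in> Car S \<Longrightarrow> f a \<cdot>\<^bsub>T\<^esub> f b = f (a \<cdot>\<^bsub>S\<^esub> b)"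
  and f_incl [simp]: "a \<in> Car S \<Longrightarrow> b \<in> Car S \<Longrightarrow> f a \<sqsubseteq>\<^bsub>T\<^esub> f b \<longleftrightarrow> a \<sqsubseteq>\<^bsub>S\<^esub> b"
  using f by (simp_all add: ord_iso_def)

lemma is_inv_iff: "a \<in> Car S \<Longrightarrow> b \<in> Car S \<Longrightarrow> is_inv T (f a) (f b) \<longleftrightarrow> is_inv S a b"
  by (simp add: is_inv_def)

lemma inverse_semigroup_T: "inverse_semigroup T"
  unfolding inverse_semigroup_def
proof (intro conjI ballI)
  show "\<exists>!b. is_inv T a b" if aT: "a \<in> Car T" for a
  proof -
    obtain a' where a': "a' \<in> Car S" "a = f a'" using aT Car_T by auto
    show ?thesis
    proof (rule ex1I)
      show "is_inv T a (f (sinv S a'))" using a' S.is_inv_star by (simp add: is_inv_iff)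
      fix b assume b: "is_inv T a b"
      then obtain b' where "b' \<in> Car S" "b = f b'" unfolding is_inv_def Car_T by blast
      then show "b = f (sinv S a')" using b a' S.star_unique is_inv_iff by metis
    qed
  qed
qed (auto simp: Car_T)

sublocale T: inv_semigroup T by (rule inv_semigroup.intro[OF inverse_semigroup_T])

lemma f_star [simp]: "a \<in> Car S \<Longrightarrow> sinv T (f a) = f (sinv S a)"
  by (rule hom_star[OF S.inverse_semigroup inverse_semigroup_T]) auto

lemma nat_le_iff: "a \<in> Car S \<Longrightarrow> b \<in> Car S \<Longrightarrow> nat_le T (f a) (f b) \<longleftrightarrow> nat_le S a b"
  by (simp add: nat_le_def)

lemma is_zero_T: "is_zero T (f (szero S))"
  using S.zero_is_zero by (auto simp: is_zero_def Car_T)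

lemma szero_T: "szero T = f (szero S)"
proof -
  have "z = f (szero S)" if "is_zero T z" for z
    using that is_zero_T unfolding is_zero_def by metis
  with is_zero_T show ?thesis unfolding szero_def[of T] by (rule the_equality)
qed

lemma eq_zero_iff: "a \<in> Car S \<Longrightarrow> f a = szero T \<longleftrightarrow> a = szero S"
  by (simp add: szero_T)

lemma idempotents_T: "idempotents T = f ` idempotents S"
  by (auto simp: idempotents_def Car_T)

lemma is_sup_iff:
  assumes "A \<subseteq> Car S" "c \<in> Car S" shows "is_sup T (f ` A) (f c) \<longleftrightarrow> is_sup S A c"
  using assms by (auto simp: is_sup_def Car_T subset_iff)

lemma is_inf_iff:
  assumes "A \<subseteq> Car S" "c \<in> Car S" shows "is_inf T (f ` A) (f c) \<longleftrightarrow> is_inf S A c"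
  using assms by (auto simp: is_inf_def Car_T subset_iff)

lemma is_sup2_iff:
  "a \<in> Car S \<Longrightarrow> b \<in> Car S \<Longrightarrow> c \<in> Car S \<Longrightarrow> is_sup T {f a, f b} (f c) \<longleftrightarrow> is_sup S {a, b} c"
  using is_sup_iff[of "{a, b}" c] by simp

lemma is_inf2_iff:
  "a \<in> Car S \<Longrightarrow> b \<in> Car S \<Longrightarrow> c \<in> Car S \<Longrightarrow> is_inf T {f a, f b} (f c) \<longleftrightarrow> is_inf S {a, b} c"
  using is_inf_iff[of "{a, b}" c] by simp

lemma ex_is_sup2: "a \<in> Car S \<Longrightarrow> b \<in> Car S \<Longrightarrow> \<exists>c. is_sup S {a, b} c \<Longrightarrow> \<exists>d. is_sup T {f a, f b} d"
  using is_sup2_iff S.sup_Car by blast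

lemma sigma_ordered_T: "sigma_ordered T"
  unfolding sigma_ordered_def
proof (intro conjI)
  show "inverse_semigroup T" by (rule inverse_semigroup_T)
  show "\<exists>z. is_zero T z" using is_zero_T ..
  show "compatible_order T"
    unfolding compatible_order_def Car_T
    by (auto simp: nat_le_iff intro: S.incl_trans S.incl_antisym S.incl_le S.incl_left S.incl_right)
  show "\<forall>a\<in>Car T. szero T \<sqsubseteq>\<^bsub>T\<^esub> a" by (auto simp: Car_T szero_T)
  show "\<forall>a1\<in>Car T. \<forall>a2\<in>Car T. \<forall>c\<in>Car T. a1 \<sqsubseteq>\<^bsub>T\<^esub> c \<and> a2 \<sqsubseteq>\<^bsub>T\<^esub> c \<longrightarrow> (\<exists>d. is_sup T {a1, a2} d)"
    unfolding Car_T by (auto intro!: ex_is_sup2 intro: S.sup_bounded)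
  show "\<forall>c1\<in>Car T. \<forall>c2\<in>Car T. \<forall>c. \<forall>a\<in>Car T. is_sup T {c1, c2} c \<longrightarrow>
       is_sup T {a \<cdot>\<^bsub>T\<^esub> c1, a \<cdot>\<^bsub>T\<^esub> c2} (a \<cdot>\<^bsub>T\<^esub> c)"
  proof (intro ballI allI impI)
    fix c1 c2 c a assume c: "c1 \<in> Car T" "c2 \<in> Car T" "a \<in> Car T" "is_sup T {c1, c2} c"
    then have "c \<in> Car T" by (simp add: is_sup_def)
    with c obtain d1 d2 d b where "c1 = f d1" "c2 = f d2" "c = f d" "a = f b"
      "d1 \<in> Car S" "d2 \<in> Car S" "d \<in> Car S" "b \<in> Car S" unfolding Car_T by blast
    with c show "is_sup T {a \<cdot>\<^bsub>T\<^esub> c1, a \<cdot>\<^bsub>T\<^esub> c2} (a \<cdot>\<^bsub>T\<^esub> c)"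
      by (simp add: is_sup2_iff S.sup_left)
  qed
  show "\<forall>e\<in>idempotents T. \<forall>f\<in>idempotents T. e \<sqsubseteq>\<^bsub>T\<^esub> f \<longrightarrow>
       (\<exists>c\<in>idempotents T. is_sup T {e, c} f \<and> is_inf T {e, c} (szero T))"
    unfolding idempotents_T
    by (auto simp: S.idem_Car is_sup2_iff is_inf2_iff szero_T intro!: S.idem_complement)
  show "\<forall>a\<in>Car T. \<forall>b\<in>Car T.
       sinv T a \<cdot>\<^bsub>T\<^esub> b = szero T \<and> a \<cdot>\<^bsub>T\<^esub> sinv T b = szero T \<longrightarrow> (\<exists>d. is_sup T {a, b} d)"
    unfolding Car_T by (auto simp: eq_zero_iff intro!: ex_is_sup2 intro: S.sup_orthogonal)
  show "\<forall>t\<in>Car T. \<forall>a\<in>Car T. nat_le T t a \<longrightarrow>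
       (\<exists>z\<in>Car T. nat_le T t z \<and> z \<sqsubseteq>\<^bsub>T\<^esub> a \<and>
          (\<forall>x\<in>Car T. t \<cdot>\<^bsub>T\<^esub> x = szero T \<longleftrightarrow> z \<cdot>\<^bsub>T\<^esub> x = szero T))"
    unfolding Car_T using S.interpolation by (auto simp: nat_le_iff eq_zero_iff)
qed

lemma is_interpolator_iff:
  "a \<in> Car S \<Longrightarrow> t \<in> Car S \<Longrightarrow> p \<in> Car S \<Longrightarrow>
    is_interpolator T (f a) (f t) (f p) \<longleftrightarrow> is_interpolator S a t p"
  by (simp add: is_interpolator_def nat_le_iff eq_zero_iff Car_T)

lemma sigma_morphism_f: "sigma_morphism S T f"
proof (rule sigma_morphismI[OF sigma_ordered_T])
  show "is_sup T {f a, f b} (f c)" if "a \<in> Car S" "b \<in> Car S" "is_sup S {a, b} c" for a b c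
    using that S.sup_Car[OF that(3)] by (simp add: is_sup2_iff)
  show "f (interpolator S b a) = interpolator T (f b) (f a)"
    if ab: "a \<in> Car S" "b \<in> Car S" "nat_le S a b" for a b
  proof -
    interpret T: sigma T using sigma_ordered_T by (rule sigma_orderedD)
    have "is_interpolator T (f b) (f a) (f (interpolator S b a))"
      using S.is_interpolator_interpolator[OF ab(3,1,2)] S.interpolator_Car[OF ab(3,1,2)] ab
      by (simp add: is_interpolator_iff)
    then show ?thesis
      using ab by (intro T.interpolator_eqI[symmetric]) (auto simp: nat_le_iff)
  qed
  show "t \<in> joins T {t' \<in> Car T. \<exists>s\<in>Car S. t' \<sqsubseteq>\<^bsub>T\<^esub> f s}" if "t \<in> Car T" for t
  proof -
    obtain a where a: "a \<in> Car S" "t = f a" using \<open>t \<in> Car T\<close> Car_T by auto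
    then have "\<exists>s\<in>Car S. t \<sqsubseteq>\<^bsub>T\<^esub> f s" by (intro bexI[of _ a]) auto
    then show ?thesis using that by (intro joins.base) simp
  qed
qed (auto simp: szero_T Car_T)

end

lemma sigma_morphism_cong:
  assumes S: "sigma_ordered S" and T: "sigma_ordered T" and m: "sigma_morphism S T f"
    and e: "\<And>a. a \<in> Car S \<Longrightarrow> g a = f a"
  shows "sigma_morphism S T g"
  by (rule sigma_morphism_comp[OF S S T sigma_morphism_id[OF S] m]) (simp add: e)

text \<open>
  Of interest when \<open>f\<close> is injective on the carrier; then \<open>f\<close> is an isomorphism onto the image.
\<close>

definition image_ord :: "('v \<Rightarrow> 'w) \<Rightarrow> 'v ord_semigroup \<Rightarrow> 'w ord_semigroup" where
  "image_ord f S = \<lparr>Car = f ` Car S,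
     Times = (\<lambda>x y. f (inv_into (Car S) f x \<cdot>\<^bsub>S\<^esub> inv_into (Car S) f y)),
     Incl = (\<lambda>x y. inv_into (Car S) f x \<sqsubseteq>\<^bsub>S\<^esub> inv_into (Car S) f y)\<rparr>"

lemma ord_iso_image_ord: "inj_on f (Car S) \<Longrightarrow> ord_iso S (image_ord f S) f"
  by (auto simp: ord_iso_def image_ord_def bij_betw_def)

lemma SigmaOrd_simps [simp]:
  "Obj (SigmaOrd U) = {S. sigma_ordered S \<and> Car S \<in> U}"
  "Hom (SigmaOrd U) S T = {\<theta> \<in> extensional (Car S). sigma_morphism S T \<theta>}"
  "Ident (SigmaOrd U) S = (\<lambda>a\<in>Car S. a)"
  "Cmp (SigmaOrd U) R S T \<psi> \<theta> = compose (Car R) \<psi> \<theta>"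
  by (simp_all add: SigmaOrd_def)

lemma category_SigmaOrd: "category (SigmaOrd U)"
  unfolding category_def
proof (intro conjI ballI)
  fix X Y Z f g
  assume X: "X \<in> Obj (SigmaOrd U)" and Y: "Y \<in> Obj (SigmaOrd U)" and Z: "Z \<in> Obj (SigmaOrd U)"
    and f: "f \<in> Hom (SigmaOrd U) X Y" and g: "g \<in> Hom (SigmaOrd U) Y Z"
  then have "sigma_morphism X Z (compose (Car X) g f)"
    by (intro sigma_morphism_comp[of X Y Z f g]) (auto simp: compose_def)
  then show "Cmp (SigmaOrd U) X Y Z g f \<in> Hom (SigmaOrd U) X Z"
    by simp
next
  fix X Y f assume "f \<in> Hom (SigmaOrd U) X Y" "Y \<in> Obj (SigmaOrd U)"
  then have f: "f \<in> Car X \<rightarrow> Car Y" "f \<in> extensional (Car X)" by (auto simp: sigma_morphism_def)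
  show "Cmp (SigmaOrd U) X X Y f (Ident (SigmaOrd U) X) = f"
    using compose_Id[OF f] by simp
  show "Cmp (SigmaOrd U) X Y Y (Ident (SigmaOrd U) Y) f = f"
    using Id_compose[OF f] by simp
next
  fix W X Y Z f g h
  assume f: "f \<in> Hom (SigmaOrd U) W X"
  then have f: "f \<in> Car W \<rightarrow> Car X" by (auto simp: sigma_morphism_def)
  then show "Cmp (SigmaOrd U) W Y Z h (Cmp (SigmaOrd U) W X Y g f) =
      Cmp (SigmaOrd U) W X Z (Cmp (SigmaOrd U) X Y Z h g) f"
    by (auto simp: compose_def fun_eq_iff)
qed (auto intro: sigma_morphism_id)

lemma SigmaOrd_isoI:
  assumes S: "sigma_ordered S" and f: "ord_iso S T f"
  shows "cat_iso (SigmaOrd U) S T (restrict f (Car S))"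
proof -
  interpret iso_transport S T f by (rule iso_transport.intro[OF f S])
  let ?g = "inv_into (Car S) f"
  have bij: "bij_betw f (Car S) (Car T)" using f by (simp add: ord_iso_def)
  have T: "sigma_ordered T" by (rule sigma_ordered_T)
  have 1: "sigma_morphism S T (restrict f (Car S))"
    by (rule sigma_morphism_cong[OF S T sigma_morphism_f]) simp
  have "sigma_morphism T S ?g"
    by (rule iso_transport.sigma_morphism_f[OF iso_transport.intro[OF ord_iso_inv_into[OF f S] T]])
  then have 2: "sigma_morphism T S (restrict ?g (Car T))"
    by (rule sigma_morphism_cong[OF T S]) simp
  have "compose (Car S) (restrict ?g (Car T)) (restrict f (Car S)) = (\<lambda>a\<in>Car S. a)"
    using bij by (auto simp: compose_def fun_eq_iff bij_betw_inv_into_left)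
  moreover have "compose (Car T) (restrict f (Car S)) (restrict ?g (Car T)) = (\<lambda>a\<in>Car T. a)"
    using bij bij_betw_inv_into[OF bij]
    by (auto simp: compose_def fun_eq_iff bij_betw_inv_into_right bij_betw_apply)
  ultimately show ?thesis unfolding cat_iso_def using 1 2 by auto
qed

section \<open>Compact open bisections\<close>

lemma compactin_pointwise:
  assumes "compactin X K" "\<And>x. x \<in> K \<Longrightarrow> openin X (U x) \<and> x \<in> U x"
  shows "\<exists>F\<subseteq>K. finite F \<and> K \<subseteq> \<Union>(U ` F)"
proof -
  have "\<exists>\<F>. finite \<F> \<and> \<F> \<subseteq> U ` K \<and> K \<subseteq> \<Union>\<F>"
    by (rule compactinD[OF assms(1)]) (use assms(2) in auto)
  then obtain \<F> where "finite \<F>" "\<F> \<subseteq> U ` K" "K \<subseteq> \<Union>\<F>" by auto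
  then show ?thesis using finite_subset_image[of \<F> U K] by metis
qed

definition bisection :: "'w top_semigroupoid \<Rightarrow> 'w set \<Rightarrow> bool" where
  "bisection S A \<longleftrightarrow> openin (ArrTop S) A \<and> compactin (ArrTop S) A \<and>
    inj_on (src S) A \<and> inj_on (rng S) A"

definition set_mul :: "'w top_semigroupoid \<Rightarrow> 'w set \<Rightarrow> 'w set \<Rightarrow> 'w set" where
  "set_mul S A B = {Mul S a b |a b. a \<in> A \<and> b \<in> B \<and> src S a = rng S b}"

definition KB :: "'w top_semigroupoid \<Rightarrow> 'w set ord_semigroup" where
  "KB S = \<lparr>Car = {A. bisection S A}, Times = set_mul S, Incl = (\<subseteq>)\<rparr>"

lemma KB_simps [simp]:
  "Car (KB S) = {A. bisection S A}" "Times (KB S) = set_mul S" "Incl (KB S) = (\<subseteq>)"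
  by (simp_all add: KB_def)

locale ample =
  fixes S :: "'w top_semigroupoid"
  assumes ample: "ample_inverse_semigroupoid S"
begin

abbreviation "\<A> \<equiv> Arr S"
abbreviation "s \<equiv> src S"
abbreviation "r \<equiv> rng S"
abbreviation "m \<equiv> Mul S"
abbreviation "i \<equiv> sginv S"
abbreviation "AT \<equiv> ArrTop S"
abbreviation "VT \<equiv> VertTop S"

lemma top_sgpd: "topological_inverse_semigroupoid S"
  using ample by (simp add: ample_inverse_semigroupoid_def etale_inverse_semigroupoid_def)

lemma graph: "compatible_graph S" and inv_sgpd: "inverse_semigroupoid S"
  and sgpd: "is_semigroupoid S"
  using top_sgpd by (simp_all add: topological_inverse_semigroupoid_def inverse_semigroupoid_def)

lemma Dom2_iff: "a \<in> \<A> \<Longrightarrow> b \<in> \<A> \<Longrightarrow> (a, b) \<in> Dom2 S \<longleftrightarrow> s a = r b"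
  using graph by (simp add: compatible_graph_def)

lemma Dom2_Arr: "(a, b) \<in> Dom2 S \<Longrightarrow> a \<in> \<A> \<and> b \<in> \<A>"
  using sgpd by (auto simp: is_semigroupoid_def)

lemma mul_closed [simp]: "\<lbrakk>a \<in> \<A>; b \<in> \<A>; s a = r b\<rbrakk> \<Longrightarrow> m a b \<in> \<A>"
  using sgpd Dom2_iff[of a b] by (auto simp: is_semigroupoid_def)

lemma src_mul [simp]: "\<lbrakk>a \<in> \<A>; b \<in> \<A>; s a = r b\<rbrakk> \<Longrightarrow> s (m a b) = s b"
  and rng_mul [simp]: "\<lbrakk>a \<in> \<A>; b \<in> \<A>; s a = r b\<rbrakk> \<Longrightarrow> r (m a b) = r a"
  using graph Dom2_iff[of a b] by (auto simp: compatible_graph_def)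

lemma mul_assoc: "\<lbrakk>a \<in> \<A>; b \<in> \<A>; c \<in> \<A>; s a = r b; s b = r c\<rbrakk> \<Longrightarrow> m (m a b) c = m a (m b c)"
  using sgpd Dom2_iff[of a b] Dom2_iff[of b c] unfolding is_semigroupoid_def by blast

lemma inverse_ex1: "a \<in> \<A> \<Longrightarrow> \<exists>!b. is_sginv S a b"
  using inv_sgpd by (simp add: inverse_semigroupoid_def)

lemma is_sginv_i: "a \<in> \<A> \<Longrightarrow> is_sginv S a (i a)"
  unfolding sginv_def by (rule theI'[OF inverse_ex1])

lemma i_unique: "a \<in> \<A> \<Longrightarrow> is_sginv S a b \<Longrightarrow> i a = b"
  unfolding sginv_def by (rule the1_equality[OF inverse_ex1])

lemma i_closed [simp]: "a \<in> \<A> \<Longrightarrow> i a \<in> \<A>"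
  using is_sginv_i by (simp add: is_sginv_def)

lemma src_i [simp]: "a \<in> \<A> \<Longrightarrow> s (i a) = r a" and rng_i [simp]: "a \<in> \<A> \<Longrightarrow> r (i a) = s a"
  using is_sginv_i[of a] Dom2_iff[of a "i a"] Dom2_iff[of "i a" a] by (auto simp: is_sginv_def)

lemma mul_i_mul [simp]: "a \<in> \<A> \<Longrightarrow> m (m a (i a)) a = a"
  and i_mul_i [simp]: "a \<in> \<A> \<Longrightarrow> m (m (i a) a) (i a) = i a"
  using is_sginv_i[of a] by (auto simp: is_sginv_def)

lemma is_sginv_sym: "a \<in> \<A> \<Longrightarrow> is_sginv S a b \<Longrightarrow> is_sginv S b a"
  by (auto simp: is_sginv_def)

lemma i_i [simp]: "a \<in> \<A> \<Longrightarrow> i (i a) = a"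
  using is_sginv_i[of a] is_sginv_sym[of a] i_unique[of "i a" a] by simp

lemma i_eq [simp]: "a \<in> \<A> \<Longrightarrow> b \<in> \<A> \<Longrightarrow> i a = i b \<longleftrightarrow> a = b"
  by (metis i_i)

lemma topspace_AT [simp]: "topspace AT = \<A>" and topspace_VT [simp]: "topspace VT = Vert S"
  and cont_s: "continuous_map AT VT s" and cont_r: "continuous_map AT VT r"
  and cont_i: "continuous_map AT AT i"
  and cont_m: "continuous_map (subtopology (prod_topology AT AT)
         {(a, b). a \<in> \<A> \<and> b \<in> \<A> \<and> s a = r b}) AT (\<lambda>(a, b). m a b)"
  using top_sgpd by (simp_all add: topological_inverse_semigroupoid_def)

lemma src_Vert [simp]: "a \<in> \<A> \<Longrightarrow> s a \<in> Vert S" and rng_Vert [simp]: "a \<in> \<A> \<Longrightarrow> r a \<in> Vert S"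
  using graph by (auto simp: compatible_graph_def)

lemma open_Arr: "openin AT U \<Longrightarrow> U \<subseteq> \<A>"
  using openin_subset by fastforce

lemma src_local_homeo:
  assumes "a \<in> \<A>"
  obtains U where "openin AT U" "a \<in> U" "openin VT (s ` U)"
    "homeomorphic_map (subtopology AT U) (subtopology VT (s ` U)) s"
  using ample assms
  by (auto simp: ample_inverse_semigroupoid_def etale_inverse_semigroupoid_def local_homeomorphism_map_def)

lemma src_local_inj:
  assumes "a \<in> \<A>"
  obtains U where "openin AT U" "a \<in> U" "inj_on s U"
proof -
  obtain U where U: "openin AT U" "a \<in> U"
    "homeomorphic_map (subtopology AT U) (subtopology VT (s ` U)) s"
    using src_local_homeo[OF assms] by metis
  have "inj_on s (topspace (subtopology AT U))"
    using U(3) by (rule homeomorphic_imp_injective_map)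
  then have "inj_on s U" using open_Arr[OF U(1)] by (simp add: Int_absorb1)
  with U that show ?thesis by blast
qed

lemma src_open:
  assumes W: "openin AT W" shows "openin VT (s ` W)"
proof (subst openin_subopen, intro ballI)
  fix x assume "x \<in> s ` W"
  then obtain a where a: "a \<in> W" "x = s a" by auto
  obtain U where U: "openin AT U" "a \<in> U" "openin VT (s ` U)"
    "homeomorphic_map (subtopology AT U) (subtopology VT (s ` U)) s"
    using src_local_homeo[of a] a open_Arr[OF W] by blast
  have "openin (subtopology AT U) (W \<inter> U)" using W by (auto simp: openin_subtopology)
  then have "openin (subtopology VT (s ` U)) (s ` (W \<inter> U))"
    using homeomorphic_imp_open_map[OF U(4)] by (simp add: open_map_def)
  then have "openin VT (s ` (W \<inter> U))" using U(3) openin_open_subtopology by blast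
  then show "\<exists>T. openin VT T \<and> x \<in> T \<and> T \<subseteq> s ` W" using a U(2) by blast
qed

lemma i_image:
  assumes "A \<subseteq> \<A>" shows "i ` A = {x \<in> \<A>. i x \<in> A}"
  using assms by (force simp: image_iff subset_iff)

lemma i_open: "openin AT W \<Longrightarrow> openin AT (i ` W)"
  using openin_continuous_map_preimage[OF cont_i] i_image[OF open_Arr] by fastforce

lemma src_i_image: "A \<subseteq> \<A> \<Longrightarrow> s ` (i ` A) = r ` A" and rng_i_image: "A \<subseteq> \<A> \<Longrightarrow> r ` (i ` A) = s ` A"
  by (force simp: image_image subset_iff intro: image_cong)+

lemma rng_open: "openin AT W \<Longrightarrow> openin VT (r ` W)"
  using src_open[OF i_open] src_i_image[OF open_Arr] by metis

lemma rng_local_inj: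
  assumes a: "a \<in> \<A>"
  obtains U where "openin AT U" "a \<in> U" "inj_on r U"
proof -
  obtain U where U: "openin AT U" "i a \<in> U" "inj_on s U"
    using src_local_inj[of "i a"] a by auto
  have "inj_on r (i ` U)"
  proof (rule inj_onI)
    fix x y assume "x \<in> i ` U" "y \<in> i ` U" and xy: "r x = r y"
    then obtain u v where uv: "u \<in> U" "v \<in> U" "x = i u" "y = i v" by auto
    then have "u \<in> \<A>" "v \<in> \<A>" using open_Arr[OF U(1)] by auto
    then show "x = y" using uv xy U(3) by (simp add: inj_on_eq_iff)
  qed
  moreover have "a \<in> i ` U" using U(2) a by (force simp: image_iff)
  ultimately show ?thesis using that i_open[OF U(1)] by blast
qed

lemma Vert_compact_open:
  assumes W: "openin VT W" and x: "x \<in> W"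
  obtains K where "openin VT K" "compactin VT K" "x \<in> K" "K \<subseteq> W"
proof -
  have "x \<in> topspace VT" using W x openin_subset by blast
  then obtain U C where UC: "openin VT U" "compactin VT C" "x \<in> U" "U \<subseteq> C"
    using ample by (auto simp: ample_inverse_semigroupoid_def locally_compact_space_def)
  have "zero_dimensional_space VT" using ample by (simp add: ample_inverse_semigroupoid_def)
  then obtain \<B> where B: "\<forall>B\<in>\<B>. openin VT B \<and> closedin VT B"
    "\<forall>V. openin VT V \<longrightarrow> (\<exists>\<V>\<subseteq>\<B>. V = \<Union>\<V>)"
    unfolding zero_dimensional_space_def by blast
  have "openin VT (W \<inter> U)" using W UC(1) by blast
  then obtain \<V> where "\<V> \<subseteq> \<B>" "W \<inter> U = \<Union>\<V>" using B(2) by blast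
  then obtain K where K: "K \<in> \<B>" "x \<in> K" "K \<subseteq> W \<inter> U" using x UC(3) by blast
  have "compactin VT K"
    by (rule closed_compactin[OF UC(2)]) (use K UC(4) B(1) in auto)
  then show ?thesis using that[of K] K B(1) by blast
qed

lemma Hausdorff_VT: "Hausdorff_space VT"
  using ample by (simp add: ample_inverse_semigroupoid_def)

lemma Vert_compact_closed: "compactin VT K \<Longrightarrow> closedin VT K"
  by (rule compactin_imp_closedin[OF Hausdorff_VT])

lemma src_preimage_open: "openin VT K \<Longrightarrow> openin AT {a \<in> \<A>. s a \<in> K}"
  and src_preimage_closed: "closedin VT K \<Longrightarrow> closedin AT {a \<in> \<A>. s a \<in> K}"
  and rng_preimage_open: "openin VT K \<Longrightarrow> openin AT {a \<in> \<A>. r a \<in> K}"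
  and rng_preimage_closed: "closedin VT K \<Longrightarrow> closedin AT {a \<in> \<A>. r a \<in> K}"
  using openin_continuous_map_preimage[OF cont_s] openin_continuous_map_preimage[OF cont_r]
    closedin_continuous_map_preimage[OF cont_s] closedin_continuous_map_preimage[OF cont_r] by auto

lemma src_homeo:
  assumes A: "openin AT A" and inj: "inj_on s A"
  shows "homeomorphic_map (subtopology AT A) (subtopology VT (s ` A)) s"
proof (rule bijective_open_imp_homeomorphic_map)
  have AA: "A \<subseteq> \<A>" using open_Arr[OF A] .
  then have sA: "s ` A \<subseteq> Vert S" by auto
  show "continuous_map (subtopology AT A) (subtopology VT (s ` A)) s"
    by (intro continuous_map_into_subtopology continuous_map_from_subtopology cont_s) auto
  show "open_map (subtopology AT A) (subtopology VT (s ` A)) s"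
    unfolding open_map_def openin_open_subtopology[OF A]
    using src_open by (auto simp: openin_open_subtopology[OF src_open[OF A]])
  show "s ` topspace (subtopology AT A) = topspace (subtopology VT (s ` A))"
    using AA sA by (simp add: Int_absorb1)
  show "inj_on s (topspace (subtopology AT A))" using AA inj by (simp add: Int_absorb1)
qed

text \<open>
  On an open set where the source is injective, it is a homeomorphism onto an open set of vertices, so
  compactness can be tested there.
\<close>

lemma compact_via_src:
  assumes A: "openin AT A" "inj_on s A" and B: "B \<subseteq> A" "compactin VT (s ` B)"
  shows "compactin AT B"
proof -
  have "compactin (subtopology AT A) B"
    unfolding homeomorphic_map_compactness_eq[OF src_homeo[OF A]]
    using open_Arr[OF A(1)] B by (auto simp: compactin_subtopology)
  then show ?thesis by (simp add: compactin_subtopology)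
qed

lemma bisection_Arr: "bisection S A \<Longrightarrow> A \<subseteq> \<A>"
  by (simp add: bisection_def open_Arr)

lemma bisection_in_Arr: "bisection S A \<Longrightarrow> a \<in> A \<Longrightarrow> a \<in> \<A>"
  using bisection_Arr by blast

lemma bisection_openin: "bisection S A \<Longrightarrow> openin AT A"
  and bisection_compactin: "bisection S A \<Longrightarrow> compactin AT A"
  by (simp_all add: bisection_def)

lemma bisection_src: "bisection S A \<Longrightarrow> a \<in> A \<Longrightarrow> b \<in> A \<Longrightarrow> s a = s b \<Longrightarrow> a = b"
  and bisection_rng: "bisection S A \<Longrightarrow> a \<in> A \<Longrightarrow> b \<in> A \<Longrightarrow> r a = r b \<Longrightarrow> a = b"
  unfolding bisection_def by (auto dest: inj_onD)

lemma bisection_subset: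
  "\<lbrakk>bisection S A; B \<subseteq> A; openin AT B; compactin AT B\<rbrakk> \<Longrightarrow> bisection S B"
  unfolding bisection_def by (meson inj_on_subset)

lemma bisection_empty [simp]: "bisection S {}"
  by (simp add: bisection_def)

lemma src_image_clopen: "bisection S A \<Longrightarrow> openin VT (s ` A)" "bisection S A \<Longrightarrow> compactin VT (s ` A)"
    "bisection S A \<Longrightarrow> closedin VT (s ` A)"
  using src_open image_compactin[OF _ cont_s] Vert_compact_closed by (auto simp: bisection_def)

text \<open>
  Take an open neighbourhood on which source and range are injective, and cut it down to the part over
  a compact open set of vertices.
\<close>

lemma bisection_base:
  assumes U: "openin AT U" and a: "a \<in> U"
  obtains A where "bisection S A" "a \<in> A" "A \<subseteq> U"
proof -
  have aA: "a \<in> \<A>" using open_Arr[OF U] a by auto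
  obtain U1 where U1: "openin AT U1" "a \<in> U1" "inj_on s U1" using src_local_inj[OF aA] .
  obtain U2 where U2: "openin AT U2" "a \<in> U2" "inj_on r U2" using rng_local_inj[OF aA] .
  let ?W = "U \<inter> U1 \<inter> U2"
  have W: "openin AT ?W" "a \<in> ?W" "inj_on s ?W" "inj_on r ?W"
    using U U1 U2 a by (auto intro: inj_on_subset)
  obtain K where K: "openin VT K" "compactin VT K" "s a \<in> K" "K \<subseteq> s ` ?W"
    using Vert_compact_open[OF src_open[OF W(1)], of "s a"] W(2) by auto
  let ?A = "?W \<inter> {a \<in> \<A>. s a \<in> K}"
  have "openin AT ?A" using W(1) src_preimage_open[OF K(1)] by blast
  moreover have "s ` ?A = K" using K(4) open_Arr[OF W(1)] by auto
  then have "compactin AT ?A" using compact_via_src[OF W(1,3), of ?A] K(2) by auto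
  moreover have "inj_on s ?A" "inj_on r ?A" using W(3,4) by (auto intro: inj_on_subset)
  ultimately have "bisection S ?A" by (simp add: bisection_def)
  then show ?thesis by (rule that) (use W(2) aA K(3) in auto)
qed

lemma bisection_in: "a \<in> \<A> \<Longrightarrow> (\<And>A. bisection S A \<Longrightarrow> a \<in> A \<Longrightarrow> thesis) \<Longrightarrow> thesis"
  using bisection_base[of \<A> a] openin_topspace[of AT] by auto

lemma bisection_restrict:
  assumes A: "bisection S A" and K: "openin VT K" "closedin VT K"
  shows "bisection S {a \<in> A. s a \<in> K}"
proof -
  have e: "{a \<in> A. s a \<in> K} = {a \<in> \<A>. s a \<in> K} \<inter> A" using bisection_Arr[OF A] by auto
  show ?thesis
  proof (rule bisection_subset[OF A])
    show "openin AT {a \<in> A. s a \<in> K}"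
      unfolding e using src_preimage_open[OF K(1)] bisection_openin[OF A] by blast
    show "compactin AT {a \<in> A. s a \<in> K}"
      unfolding e by (rule closed_Int_compactin[OF src_preimage_closed[OF K(2)] bisection_compactin[OF A]])
  qed auto
qed

text \<open>
  The source is injective on \<open>A\<close>, so \<open>A - B\<close> is the part of \<open>A\<close> over the complement of the source of \<open>B\<close>,
  and that source is clopen because the vertices form a Hausdorff space.
\<close>

lemma bisection_diff:
  assumes A: "bisection S A" and B: "bisection S B" and BA: "B \<subseteq> A"
  shows "bisection S (A - B)"
proof -
  have K: "openin VT (Vert S - s ` B)" "closedin VT (Vert S - s ` B)"
    using src_image_clopen[OF B] openin_diff[OF openin_topspace[of VT]] closedin_diff[OF closedin_topspace[of VT]]
    by simp_all
  have "A - B = {a \<in> A. s a \<in> Vert S - s ` B}"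
    using bisection_src[OF A] BA bisection_in_Arr[OF A] by (auto simp: image_iff)
  then show ?thesis using bisection_restrict[OF A K] by simp
qed

text \<open>The map \<open>b \<mapsto> ab\<close>, where \<open>a\<close> is the element of \<open>A\<close> that is composable with \<open>b\<close>.\<close>

definition translate :: "'w set \<Rightarrow> 'w \<Rightarrow> 'w" where
  "translate A b = m (inv_into A s (r b)) b"

lemma translate_eq: "bisection S A \<Longrightarrow> a \<in> A \<Longrightarrow> b \<in> \<A> \<Longrightarrow> s a = r b \<Longrightarrow> translate A b = m a b"
  unfolding translate_def bisection_def by (metis inv_into_f_f)

lemma cont_translate:
  assumes A: "bisection S A"
  shows "continuous_map (subtopology AT {b \<in> \<A>. r b \<in> s ` A}) AT (translate A)"
proof -
  let ?W = "{b \<in> \<A>. r b \<in> s ` A}" and ?P = "{(a, b). a \<in> \<A> \<and> b \<in> \<A> \<and> s a = r b}"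
  have inj: "inj_on s A" and oA: "openin AT A" using A by (simp_all add: bisection_def)
  have "homeomorphic_map (subtopology VT (s ` A)) (subtopology AT A) (inv_into A s)"
  proof -
    obtain g where g: "homeomorphic_maps (subtopology AT A) (subtopology VT (s ` A)) s g"
      using src_homeo[OF oA inj] homeomorphic_map_maps by blast
    have "g x = inv_into A s x" if "x \<in> s ` A" for x
      using g that open_Arr[OF oA] inj by (auto simp: homeomorphic_maps_def Int_absorb1)
    then show ?thesis
      using homeomorphic_map_eq[of "subtopology VT (s ` A)" "subtopology AT A" g] g
      by (auto simp: homeomorphic_maps_map)
  qed
  then have 1: "continuous_map (subtopology VT (s ` A)) AT (inv_into A s)"
    using homeomorphic_imp_continuous_map continuous_map_into_fulltopology by blast
  have 2: "continuous_map (subtopology AT ?W) (subtopology VT (s ` A)) r"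
    by (intro continuous_map_into_subtopology continuous_map_from_subtopology cont_r) auto
  have 3: "continuous_map (subtopology AT ?W) AT (inv_into A s \<circ> r)"
    by (rule continuous_map_compose[OF 2 1])
  have 4: "continuous_map (subtopology AT ?W) (prod_topology AT AT) (\<lambda>b. ((inv_into A s \<circ> r) b, b))"
    by (intro continuous_map_pairedI 3 continuous_map_from_subtopology continuous_map_id[unfolded id_def])
  have 5: "continuous_map (subtopology AT ?W) (subtopology (prod_topology AT AT) ?P)
      (\<lambda>b. ((inv_into A s \<circ> r) b, b))"
    using 4 by (rule continuous_map_into_subtopology)
      (auto intro: f_inv_into_f subsetD[OF bisection_Arr[OF A] inv_into_into])
  have "continuous_map (subtopology AT ?W) AT ((\<lambda>(a, b). m a b) \<circ> (\<lambda>b. ((inv_into A s \<circ> r) b, b)))"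
    by (rule continuous_map_compose[OF 5 cont_m])
  then show ?thesis by (simp add: translate_def[abs_def] comp_def)
qed

text \<open>
  Near \<open>g b\<close> the source map is injective, so an arrow close to \<open>g b\<close> that has the same source as \<open>c\<close> can only
  be \<open>g c\<close>.
\<close>

lemma open_over_src:
  assumes W: "openin AT W" and g: "continuous_map (subtopology AT W) AT g"
    and sg: "\<And>b. b \<in> W \<Longrightarrow> s (g b) = s b" and U: "openin AT U" "U \<subseteq> W"
  shows "openin AT (g ` U)"
proof (subst openin_subopen, intro ballI)
  fix y assume "y \<in> g ` U"
  then obtain b where b: "b \<in> U" "y = g b" by auto
  have gA: "g c \<in> \<A>" if "c \<in> W" for c
    using g that open_Arr[OF W] by (auto simp: continuous_map_def Int_absorb1)
  have "g b \<in> \<A>" using gA b U by auto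
  then obtain N where N: "openin AT N" "g b \<in> N" "inj_on s N" using src_local_inj by blast
  let ?U = "U \<inter> {c \<in> W. g c \<in> N}"
  have "openin (subtopology AT W) {c \<in> topspace (subtopology AT W). g c \<in> N}"
    by (rule openin_continuous_map_preimage[OF g N(1)])
  then have "openin AT {c \<in> W. g c \<in> N}"
    using open_Arr[OF W] by (simp add: openin_open_subtopology[OF W] Int_absorb1)
  then have oU: "openin AT ?U" using U by blast
  let ?T = "N \<inter> {n \<in> \<A>. s n \<in> s ` ?U}"
  have "openin AT ?T" using N(1) src_preimage_open[OF src_open[OF oU]] by blast
  moreover have "y \<in> ?T" using b N(2) U sg[of b] \<open>g b \<in> \<A>\<close> by auto
  moreover have "?T \<subseteq> g ` U"
  proof
    fix n assume n: "n \<in> ?T"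
    then obtain c where c: "c \<in> U" "c \<in> W" "g c \<in> N" "s n = s c" by auto
    then have "n = g c" using inj_onD[OF N(3), of n "g c"] n sg[of c] by auto
    then show "n \<in> g ` U" using c by auto
  qed
  ultimately show "\<exists>T. openin AT T \<and> y \<in> T \<and> T \<subseteq> g ` U" by blast
qed

lemma in_set_mul: "\<lbrakk>a \<in> A; b \<in> B; s a = r b\<rbrakk> \<Longrightarrow> m a b \<in> set_mul S A B"
  by (auto simp: set_mul_def)

lemma set_mulE:
  assumes "x \<in> set_mul S A B"
  obtains a b where "a \<in> A" "b \<in> B" "s a = r b" "x = m a b"
  using assms by (auto simp: set_mul_def)

text \<open>
  The product is the image of a compact open part of \<open>B\<close> under \<open>translate A\<close>, a continuous map that
  preserves sources.
\<close>

lemma bisection_mul: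
  assumes A: "bisection S A" and B: "bisection S B"
  shows "bisection S (set_mul S A B)"
proof -
  let ?W = "{b \<in> \<A>. r b \<in> s ` A}"
  note AA = bisection_in_Arr[OF A] and BA = bisection_in_Arr[OF B]
  have W: "openin AT ?W" "closedin AT ?W"
    using rng_preimage_open rng_preimage_closed src_image_clopen[OF A] by auto
  have s_translate: "s (translate A b) = s b" if "b \<in> ?W" for b
    using that AA translate_eq[OF A] by (auto simp: image_iff)
  have e: "set_mul S A B = translate A ` (?W \<inter> B)"
  proof (intro set_eqI iffI)
    fix x assume "x \<in> set_mul S A B"
    then obtain a b where "a \<in> A" "b \<in> B" "s a = r b" "x = m a b" by (rule set_mulE)
    moreover from this have "r b \<in> s ` A" by (metis imageI)
    ultimately show "x \<in> translate A ` (?W \<inter> B)"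
      using translate_eq[OF A, of a b] BA by (intro image_eqI[of _ _ b]) auto
  next
    fix x assume "x \<in> translate A ` (?W \<inter> B)"
    then obtain a b where "x = translate A b" "a \<in> A" "b \<in> B" "r b = s a" by auto
    then show "x \<in> set_mul S A B" using translate_eq[OF A, of a b] BA in_set_mul[of a A b B] by simp
  qed
  have "openin AT (?W \<inter> B)" using W bisection_openin[OF B] by blast
  then have "openin AT (set_mul S A B)"
    unfolding e using open_over_src[OF W(1) cont_translate[OF A] s_translate] by simp
  moreover have "compactin AT (?W \<inter> B)"
    by (rule closed_Int_compactin[OF W(2) bisection_compactin[OF B]])
  then have "compactin (subtopology AT ?W) (?W \<inter> B)" by (simp add: compactin_subtopology)
  then have "compactin AT (set_mul S A B)" unfolding e by (rule image_compactin[OF _ cont_translate[OF A]])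
  moreover have "inj_on s (set_mul S A B)"
  proof (rule inj_onI)
    fix x y assume "x \<in> set_mul S A B" "y \<in> set_mul S A B" and xy: "s x = s y"
    then obtain a b c d where x: "a \<in> A" "b \<in> B" "s a = r b" "x = m a b"
      and y: "c \<in> A" "d \<in> B" "s c = r d" "y = m c d" by (meson set_mulE)
    have "b = d" using xy x y AA BA bisection_src[OF B] by simp
    then show "x = y" using x y bisection_src[OF A, of a c] by simp
  qed
  moreover have "inj_on r (set_mul S A B)"
  proof (rule inj_onI)
    fix x y assume "x \<in> set_mul S A B" "y \<in> set_mul S A B" and xy: "r x = r y"
    then obtain a b c d where x: "a \<in> A" "b \<in> B" "s a = r b" "x = m a b"
      and y: "c \<in> A" "d \<in> B" "s c = r d" "y = m c d" by (meson set_mulE)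
    have "a = c" using xy x y AA BA bisection_rng[OF A] by simp
    then show "x = y" using x y bisection_rng[OF B, of b d] by simp
  qed
  ultimately show ?thesis by (simp add: bisection_def)
qed

lemma bisection_star:
  assumes A: "bisection S A" shows "bisection S (i ` A)"
proof -
  note AA = bisection_in_Arr[OF A]
  show ?thesis
    unfolding bisection_def
  proof (intro conjI)
    show "openin AT (i ` A)" by (rule i_open[OF bisection_openin[OF A]])
    show "compactin AT (i ` A)" by (rule image_compactin[OF bisection_compactin[OF A] cont_i])
    show "inj_on s (i ` A)" using bisection_rng[OF A] AA by (auto intro!: inj_onI)
    show "inj_on r (i ` A)" using bisection_src[OF A] AA by (auto intro!: inj_onI)
  qed
qed

lemma bisection_Un_finite:
  assumes "finite R" "\<And>A. A \<in> R \<Longrightarrow> bisection S A" "\<Union>R \<subseteq> B" "inj_on s B" "inj_on r B"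
  shows "bisection S (\<Union>R)"
  unfolding bisection_def
proof (intro conjI)
  show "openin AT (\<Union>R)" using assms(2) bisection_openin by blast
  show "compactin AT (\<Union>R)" using assms(1,2) bisection_compactin by (intro compactin_Union) auto
  show "inj_on s (\<Union>R)" "inj_on r (\<Union>R)" using assms(3-5) by (meson inj_on_subset)+
qed

lemma bisection_Un:
  assumes "bisection S A" "bisection S B" "A \<subseteq> C" "B \<subseteq> C" "inj_on s C" "inj_on r C"
  shows "bisection S (A \<union> B)"
  using bisection_Un_finite[of "{A, B}" C] assms by auto

text \<open>
  An upper bound of \<open>R\<close> is a bisection containing the union, which makes the union a bisection too.
\<close>

lemma is_sup_KB:
  assumes "finite R" "\<And>A. A \<in> R \<Longrightarrow> bisection S A"
  shows "is_sup (KB S) R C \<longleftrightarrow> bisection S C \<and> C = \<Union>R"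
proof
  assume C: "is_sup (KB S) R C"
  then have bC: "bisection S C" and "\<Union>R \<subseteq> C" by (auto simp: is_sup_def)
  then have "bisection S (\<Union>R)"
    using assms by (intro bisection_Un_finite[of R C]) (auto simp: bisection_def)
  then have "C \<subseteq> \<Union>R" using C unfolding is_sup_def by (auto simp: Sup_upper)
  with bC \<open>\<Union>R \<subseteq> C\<close> show "bisection S C \<and> C = \<Union>R" by auto
qed (auto simp: is_sup_def)

lemma is_sup_KB2:
  "bisection S A \<Longrightarrow> bisection S B \<Longrightarrow> is_sup (KB S) {A, B} C \<longleftrightarrow> bisection S C \<and> C = A \<union> B"
  using is_sup_KB[of "{A, B}" C] by auto

lemma set_mul_assoc:
  assumes "A \<subseteq> \<A>" "B \<subseteq> \<A>" "C \<subseteq> \<A>"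
  shows "set_mul S (set_mul S A B) C = set_mul S A (set_mul S B C)"
proof (intro set_eqI iffI)
  fix x assume "x \<in> set_mul S (set_mul S A B) C"
  then obtain a b c where *: "a \<in> A" "b \<in> B" "s a = r b" "c \<in> C" "s (m a b) = r c" "x = m (m a b) c"
    by (auto simp: set_mul_def)
  have [simp]: "a \<in> \<A>" "b \<in> \<A>" "c \<in> \<A>" using * assms by auto
  from * show "x \<in> set_mul S A (set_mul S B C)"
    by (auto simp: mul_assoc intro!: in_set_mul)
next
  fix x assume "x \<in> set_mul S A (set_mul S B C)"
  then obtain a b c where *: "a \<in> A" "b \<in> B" "s b = r c" "c \<in> C" "s a = r (m b c)" "x = m a (m b c)"
    by (auto simp: set_mul_def)
  have [simp]: "a \<in> \<A>" "b \<in> \<A>" "c \<in> \<A>" using * assms by auto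
  from * have "x = m (m a b) c" by (simp add: mul_assoc)
  with * show "x \<in> set_mul S (set_mul S A B) C"
    using in_set_mul[OF in_set_mul[of a A b B], of c C] by simp
qed

lemma set_mul_star_mul:
  assumes A: "bisection S A" shows "set_mul S (set_mul S A (i ` A)) A = A"
proof (intro set_eqI iffI)
  note AA = bisection_in_Arr[OF A]
  fix x assume "x \<in> set_mul S (set_mul S A (i ` A)) A"
  then obtain a b c where *: "a \<in> A" "b \<in> A" "s a = r (i b)" "c \<in> A" "s (m a (i b)) = r c"
    "x = m (m a (i b)) c"
    by (auto simp: set_mul_def)
  have "a = b" "b = c" using * AA bisection_src[OF A, of a b] bisection_rng[OF A, of b c] by auto
  then show "x \<in> A" using * AA by simp
next
  note AA = bisection_in_Arr[OF A]
  fix x assume x: "x \<in> A"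
  then have "m (m x (i x)) x \<in> set_mul S (set_mul S A (i ` A)) A"
    using AA by (intro in_set_mul) auto
  then show "x \<in> set_mul S (set_mul S A (i ` A)) A" using AA[OF x] by simp
qed

lemma is_inv_star: "bisection S A \<Longrightarrow> is_inv (KB S) A (i ` A)"
  using set_mul_star_mul[of A] set_mul_star_mul[OF bisection_star, of A]
  by (simp add: is_inv_def bisection_star image_image bisection_in_Arr cong: image_cong)

text \<open>
  In a product of three bisections, sources and ranges determine the outer factors. So \<open>ABA = A\<close> and
  \<open>BAB = B\<close> hold element by element.
\<close>

lemma is_inv_subset:
  assumes A: "bisection S A" and B: "bisection S B"
    and ABA: "set_mul S (set_mul S A B) A = A" and BAB: "set_mul S (set_mul S B A) B = B"
  shows "i ` A \<subseteq> B"
proof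
  note AA = bisection_in_Arr[OF A] and BA = bisection_in_Arr[OF B]
  fix x assume "x \<in> i ` A"
  then obtain a where a: "a \<in> A" "x = i a" by auto
  then have "a \<in> set_mul S (set_mul S A B) A" using ABA by simp
  then obtain a1 b a2 where 1: "a1 \<in> A" "b \<in> B" "s a1 = r b" "a2 \<in> A" "s (m a1 b) = r a2" "a = m (m a1 b) a2"
    by (auto simp: set_mul_def)
  note [simp] = AA[OF 1(1)] BA[OF 1(2)] AA[OF 1(4)]
  have "s a = s a2" "r a = r a1" using 1 by (metis src_mul rng_mul mul_closed BA AA)+
  then have e1: "a2 = a" "a1 = a" using 1(1,4) a bisection_src[OF A, of a2 a] bisection_rng[OF A, of a1 a] by auto
  note aba = 1(6)[symmetric, unfolded e1]
  have ab: "s a = r b" "s b = r a" using 1(3,5) AA[OF a(1)] unfolding e1 by simp_all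
  have "b \<in> set_mul S (set_mul S B A) B" using BAB 1 by simp
  then obtain b1 c b2 where 2: "b1 \<in> B" "c \<in> A" "s b1 = r c" "b2 \<in> B" "s (m b1 c) = r b2" "b = m (m b1 c) b2"
    by (auto simp: set_mul_def)
  note [simp] = BA[OF 2(1)] AA[OF 2(2)] BA[OF 2(4)] AA[OF a(1)]
  have "s b = s b2" "r b = r b1" using 2 by (metis src_mul rng_mul mul_closed BA AA)+
  then have e2: "b2 = b" "b1 = b" using 2(1,4) 1(2) bisection_src[OF B, of b2 b] bisection_rng[OF B, of b1 b] by auto
  note bcb = 2(6)[symmetric, unfolded e2]
  have "s b = r c" using 2(3) unfolding e2 .
  then have "c = a" using ab bisection_rng[OF A 2(2) a(1)] by simp
  then have "is_sginv S a b" using aba bcb ab by (simp add: is_sginv_def Dom2_iff)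
  then show "x \<in> B" using i_unique a 1(2) by auto
qed

lemma inverse_semigroup_KB: "inverse_semigroup (KB S)"
  unfolding inverse_semigroup_def
proof (intro conjI ballI)
  fix A assume "A \<in> Car (KB S)"
  then have A: "bisection S A" by simp
  show "\<exists>!B. is_inv (KB S) A B"
  proof (rule ex1I[of _ "i ` A"])
    show "is_inv (KB S) A (i ` A)" by (rule is_inv_star[OF A])
    fix B assume "is_inv (KB S) A B"
    then have B: "bisection S B" "set_mul S (set_mul S A B) A = A" "set_mul S (set_mul S B A) B = B"
      by (auto simp: is_inv_def)
    have "i ` A \<subseteq> B" by (rule is_inv_subset[OF A B])
    moreover have "i ` B \<subseteq> A" by (rule is_inv_subset[OF B(1) A B(3,2)])
    then have "B \<subseteq> i ` A" using i_image[OF bisection_Arr[OF A]] bisection_in_Arr[OF B(1)] by auto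
    ultimately show "B = i ` A" by auto
  qed
qed (simp_all add: bisection_mul set_mul_assoc bisection_Arr)

lemma sinv_KB: "bisection S A \<Longrightarrow> sinv (KB S) A = i ` A"
  using inv_semigroup.star_unique[OF inv_semigroup.intro[OF inverse_semigroup_KB]] is_inv_star by simp

lemma set_mul_empty [simp]: "set_mul S {} A = {}" "set_mul S A {} = {}"
  by (auto simp: set_mul_def)

lemma szero_KB: "szero (KB S) = {}"
proof -
  have "is_zero (KB S) {}" by (simp add: is_zero_def)
  moreover have "Z = {}" if "is_zero (KB S) Z" for Z
    using that unfolding is_zero_def by (metis KB_simps(1,2) bisection_empty mem_Collect_eq set_mul_empty(2))
  ultimately show ?thesis unfolding szero_def by (rule the_equality)
qed

lemma set_mul_eq_empty: "set_mul S A B = {} \<longleftrightarrow> s ` A \<inter> r ` B = {}"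
  by (auto simp: set_mul_def)

lemma nat_le_KB:
  assumes A: "bisection S A" and B: "bisection S B" and le: "nat_le (KB S) A B"
  shows "\<And>a. a \<in> A \<Longrightarrow> \<exists>b\<in>B. s b = s a \<and> r b = r a \<and> a = m b (m (i a) a)"
proof -
  fix a assume a: "a \<in> A"
  note AA = bisection_in_Arr[OF A] and BA = bisection_in_Arr[OF B]
  have "a \<in> set_mul S (set_mul S B (i ` A)) A" using le a by (simp add: nat_le_def sinv_KB[OF A])
  then obtain b c d where *: "b \<in> B" "c \<in> A" "s b = r (i c)" "d \<in> A" "s (m b (i c)) = r d" "a = m (m b (i c)) d"
    by (auto simp: set_mul_def)
  have "s (m b (i c)) = r c" using * AA BA by simp
  moreover have "s a = s d" using * by (metis src_mul mul_closed i_closed AA BA)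
  ultimately have "d = a" "c = d" using *(2,4,5) bisection_src[OF A, of d a] a bisection_rng[OF A, of c d] by auto
  then have ca: "c = a" and da: "d = a" by auto
  have 1: "a = m (m b (i a)) a" using *(6) unfolding ca da .
  have [simp]: "b \<in> \<A>" "a \<in> \<A>" using AA BA a *(1) by auto
  have sb: "s b = s a" using *(3) unfolding ca by simp
  then have "r (m (m b (i a)) a) = r b" by simp
  then have "r b = r a" using 1 by simp
  moreover have "m (m b (i a)) a = m b (m (i a) a)" using sb by (simp add: mul_assoc)
  ultimately show "\<exists>b\<in>B. s b = s a \<and> r b = r a \<and> a = m b (m (i a) a)"
    using *(1) sb 1 by metis
qed

lemma nat_le_KB_I:
  assumes A: "bisection S A" and B: "bisection S B"
    and *: "\<And>a. a \<in> A \<Longrightarrow> \<exists>b\<in>B. s b = s a \<and> a = m b (m (i a) a)"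
  shows "nat_le (KB S) A B"
proof -
  note AA = bisection_in_Arr[OF A] and BA = bisection_in_Arr[OF B]
  have "x \<in> set_mul S (set_mul S B (i ` A)) A" if x: "x \<in> A" for x
  proof -
    obtain b where b: "b \<in> B" "s b = s x" "x = m b (m (i x) x)" using *[OF x] by auto
    then have "m (m b (i x)) x \<in> set_mul S (set_mul S B (i ` A)) A"
      using AA[OF x] BA x by (intro in_set_mul) auto
    then show ?thesis using b AA[OF x] BA by (simp add: mul_assoc)
  qed
  moreover have "x \<in> A" if "x \<in> set_mul S (set_mul S B (i ` A)) A" for x
  proof -
    obtain b c d where 1: "b \<in> B" "c \<in> A" "s b = r (i c)" "d \<in> A" "s (m b (i c)) = r d" "x = m (m b (i c)) d"
      using \<open>x \<in> _\<close> by (auto simp: set_mul_def)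
    have d: "d = c" using 1 AA BA bisection_rng[OF A, of d c] by auto
    obtain b' where b': "b' \<in> B" "s b' = s c" "c = m b' (m (i c) c)" using *[OF 1(2)] by auto
    have C: "c \<in> \<A>" "b \<in> \<A>" using AA[OF 1(2)] BA[OF 1(1)] .
    have sbc: "s b = s c" using 1(3) C by simp
    then have "b' = b" using bisection_src[OF B b'(1) 1(1)] b'(2) by simp
    then have "m b (m (i c) c) = c" using b'(3) by metis
    moreover have "m (m b (i c)) c = m b (m (i c) c)" using C sbc by (simp add: mul_assoc)
    ultimately have "x = c" using 1(6) unfolding d by metis
    then show ?thesis using 1 by simp
  qed
  ultimately have "set_mul S (set_mul S B (i ` A)) A = A" by blast
  then show ?thesis by (simp add: nat_le_def sinv_KB[OF A])
qed

lemma idempotent_KB: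
  assumes A: "bisection S A"
  shows "A \<in> idempotents (KB S) \<longleftrightarrow> (\<forall>a\<in>A. r a = s a \<and> m a a = a)"
proof
  note AA = bisection_in_Arr[OF A]
  assume "A \<in> idempotents (KB S)"
  then have e: "set_mul S A A = A" by (simp add: idempotents_def)
  show "\<forall>a\<in>A. r a = s a \<and> m a a = a"
  proof
    fix a assume a: "a \<in> A"
    then have "a \<in> set_mul S A A" using e by simp
    then obtain b c where *: "b \<in> A" "c \<in> A" "s b = r c" "a = m b c" by (rule set_mulE)
    then have "s a = s c" "r a = r b" using AA by auto
    then have e: "b = a" "c = a" using a *(1,2) bisection_src[OF A, of c a] bisection_rng[OF A, of b a] by auto
    show "r a = s a \<and> m a a = a" using *(3,4) unfolding e by metis
  qed
next
  assume *: "\<forall>a\<in>A. r a = s a \<and> m a a = a"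
  have "set_mul S A A = A"
  proof (intro set_eqI iffI)
    fix x assume "x \<in> set_mul S A A"
    then obtain b c where 1: "b \<in> A" "c \<in> A" "s b = r c" "x = m b c" by (rule set_mulE)
    then have "b = c" using * bisection_src[OF A, of b c] by simp
    then show "x \<in> A" using 1 * by simp
  next
    fix x assume "x \<in> A"
    then show "x \<in> set_mul S A A" using * in_set_mul[of x A x A] by simp
  qed
  then show "A \<in> idempotents (KB S)" using A by (simp add: idempotents_def)
qed

text \<open>
  Right annihilators of bisections see their sources, and left annihilators their ranges. As \<open>T \<le> A\<close>, the part
  of \<open>A\<close> over the source of \<open>T\<close> also has the range of \<open>T\<close>.
\<close>

lemma is_interpolator_restrict:
  assumes T: "bisection S T" and A: "bisection S A" and le: "nat_le (KB S) T A"
  shows "is_interpolator (KB S) A T {a \<in> A. s a \<in> s ` T}" (is "is_interpolator _ _ _ ?Z")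
proof -
  have Z: "bisection S ?Z" using bisection_restrict[OF A] src_image_clopen[OF T] by simp
  note TA = nat_le_KB[OF T A le]
  have "s ` ?Z = s ` T" using TA by (force simp: image_iff)
  moreover have "r ` ?Z = r ` T"
  proof (intro set_eqI iffI)
    fix x assume "x \<in> r ` T"
    then obtain t where t: "t \<in> T" "x = r t" by auto
    obtain b where "b \<in> A" "s b = s t" "r b = r t" using TA[OF t(1)] by auto
    then show "x \<in> r ` ?Z" using t by (intro image_eqI[of _ _ b]) auto
  next
    fix x assume "x \<in> r ` ?Z"
    then obtain a t where at: "a \<in> A" "x = r a" "t \<in> T" "s a = s t" by auto
    obtain b where b: "b \<in> A" "s b = s t" "r b = r t" using TA[OF at(3)] by auto
    then have "b = a" using at bisection_src[OF A, of b a] by simp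
    then show "x \<in> r ` T" using b at by auto
  qed
  moreover have "nat_le (KB S) T ?Z"
  proof (rule nat_le_KB_I[OF T Z])
    fix t assume "t \<in> T"
    with TA[OF this] show "\<exists>b\<in>?Z. s b = s t \<and> t = m b (m (i t) t)" by (auto simp del: mul_i_mul)
  qed
  ultimately show ?thesis using Z by (simp add: is_interpolator_def szero_KB set_mul_eq_empty subset_iff)
qed

theorem sigma_ordered_KB: "sigma_ordered (KB S)"
  unfolding sigma_ordered_def
proof (intro conjI)
  show "inverse_semigroup (KB S)" by (rule inverse_semigroup_KB)
  show "\<exists>z. is_zero (KB S) z" by (rule exI[of _ "{}"]) (simp add: is_zero_def)
  show "compatible_order (KB S)"
    unfolding compatible_order_def
  proof (intro conjI ballI impI)
    fix A B assume "A \<in> Car (KB S)" "B \<in> Car (KB S)" and AB: "A \<sqsubseteq>\<^bsub>KB S\<^esub> B"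
    then have *: "bisection S A" "bisection S B" "A \<subseteq> B" by auto
    show "nat_le (KB S) A B"
    proof (rule nat_le_KB_I[OF *(1,2)])
      fix a assume "a \<in> A"
      then show "\<exists>b\<in>B. s b = s a \<and> a = m b (m (i a) a)"
        using bisection_in_Arr[OF *(1), of a] *(3)
        by (intro bexI[of _ a]) (auto simp flip: mul_assoc)
    qed
    fix X
    show "A \<cdot>\<^bsub>KB S\<^esub> X \<sqsubseteq>\<^bsub>KB S\<^esub> B \<cdot>\<^bsub>KB S\<^esub> X" "X \<cdot>\<^bsub>KB S\<^esub> A \<sqsubseteq>\<^bsub>KB S\<^esub> X \<cdot>\<^bsub>KB S\<^esub> B"
      using *(3) by (auto simp: set_mul_def)
  qed auto
  show "\<forall>a\<in>Car (KB S). szero (KB S) \<sqsubseteq>\<^bsub>KB S\<^esub> a" by (simp add: szero_KB)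
  show "\<forall>a1\<in>Car (KB S). \<forall>a2\<in>Car (KB S). \<forall>c\<in>Car (KB S). a1 \<sqsubseteq>\<^bsub>KB S\<^esub> c \<and> a2 \<sqsubseteq>\<^bsub>KB S\<^esub> c \<longrightarrow>
      (\<exists>d. is_sup (KB S) {a1, a2} d)"
    using bisection_Un by (auto simp: is_sup_KB2 bisection_def)
  show "\<forall>c1\<in>Car (KB S). \<forall>c2\<in>Car (KB S). \<forall>c. \<forall>a\<in>Car (KB S). is_sup (KB S) {c1, c2} c \<longrightarrow>
       is_sup (KB S) {a \<cdot>\<^bsub>KB S\<^esub> c1, a \<cdot>\<^bsub>KB S\<^esub> c2} (a \<cdot>\<^bsub>KB S\<^esub> c)"
  proof (intro ballI allI impI)
    fix c1 c2 c a assume *: "c1 \<in> Car (KB S)" "c2 \<in> Car (KB S)" "a \<in> Car (KB S)" "is_sup (KB S) {c1, c2} c"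
    then have c: "bisection S c" "c = c1 \<union> c2" by (auto simp: is_sup_KB2)
    moreover have "bisection S (set_mul S a c)" using * c(1) by (simp add: bisection_mul)
    moreover have "set_mul S a (c1 \<union> c2) = set_mul S a c1 \<union> set_mul S a c2" by (auto simp: set_mul_def)
    ultimately show "is_sup (KB S) {a \<cdot>\<^bsub>KB S\<^esub> c1, a \<cdot>\<^bsub>KB S\<^esub> c2} (a \<cdot>\<^bsub>KB S\<^esub> c)"
      using * by (simp add: is_sup_KB2 bisection_mul)
  qed
  show "\<forall>e\<in>idempotents (KB S). \<forall>f\<in>idempotents (KB S). e \<sqsubseteq>\<^bsub>KB S\<^esub> f \<longrightarrow>
       (\<exists>c\<in>idempotents (KB S). is_sup (KB S) {e, c} f \<and> is_inf (KB S) {e, c} (szero (KB S)))"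
  proof (intro ballI impI)
    fix e f assume e: "e \<in> idempotents (KB S)" and f: "f \<in> idempotents (KB S)" and "e \<sqsubseteq>\<^bsub>KB S\<^esub> f"
    then have ef: "e \<subseteq> f" "bisection S e" "bisection S f" by (auto simp: idempotents_def)
    have d: "bisection S (f - e)" by (rule bisection_diff[OF ef(3,2,1)])
    show "\<exists>c\<in>idempotents (KB S). is_sup (KB S) {e, c} f \<and> is_inf (KB S) {e, c} (szero (KB S))"
    proof (intro bexI[of _ "f - e"] conjI)
      show "is_sup (KB S) {e, f - e} f" using ef d by (auto simp: is_sup_KB2)
      show "is_inf (KB S) {e, f - e} (szero (KB S))" by (auto simp: is_inf_def szero_KB)
      show "f - e \<in> idempotents (KB S)"
        using f by (simp add: idempotent_KB d ef)
    qed
  qed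
  show "\<forall>a\<in>Car (KB S). \<forall>b\<in>Car (KB S).
       sinv (KB S) a \<cdot>\<^bsub>KB S\<^esub> b = szero (KB S) \<and> a \<cdot>\<^bsub>KB S\<^esub> sinv (KB S) b = szero (KB S) \<longrightarrow>
       (\<exists>d. is_sup (KB S) {a, b} d)"
  proof (intro ballI impI)
    fix a b assume a: "a \<in> Car (KB S)" and b: "b \<in> Car (KB S)" and
      "sinv (KB S) a \<cdot>\<^bsub>KB S\<^esub> b = szero (KB S) \<and> a \<cdot>\<^bsub>KB S\<^esub> sinv (KB S) b = szero (KB S)"
    then have *: "bisection S a" "bisection S b" "r ` a \<inter> r ` b = {}" "s ` a \<inter> s ` b = {}"
      by (auto simp: sinv_KB szero_KB set_mul_eq_empty src_i_image rng_i_image bisection_Arr)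
    have "inj_on s (a \<union> b)" "inj_on r (a \<union> b)"
      using * by (auto simp: bisection_def inj_on_Un)
    then have "bisection S (a \<union> b)" using *(1,2) by (intro bisection_Un[of a b "a \<union> b"]) auto
    then show "\<exists>d. is_sup (KB S) {a, b} d" using * by (auto simp: is_sup_KB2)
  qed
  show "\<forall>t\<in>Car (KB S). \<forall>a\<in>Car (KB S). nat_le (KB S) t a \<longrightarrow>
       (\<exists>z\<in>Car (KB S). nat_le (KB S) t z \<and> z \<sqsubseteq>\<^bsub>KB S\<^esub> a \<and>
          (\<forall>x\<in>Car (KB S). t \<cdot>\<^bsub>KB S\<^esub> x = szero (KB S) \<longleftrightarrow> z \<cdot>\<^bsub>KB S\<^esub> x = szero (KB S)))"
  proof (intro ballI impI)
    fix t a assume "t \<in> Car (KB S)" "a \<in> Car (KB S)" "nat_le (KB S) t a"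
    then have "is_interpolator (KB S) a t {x \<in> a. s x \<in> s ` t}"
      by (intro is_interpolator_restrict) auto
    then show "\<exists>z\<in>Car (KB S). nat_le (KB S) t z \<and> z \<sqsubseteq>\<^bsub>KB S\<^esub> a \<and>
          (\<forall>x\<in>Car (KB S). t \<cdot>\<^bsub>KB S\<^esub> x = szero (KB S) \<longleftrightarrow> z \<cdot>\<^bsub>KB S\<^esub> x = szero (KB S))"
      unfolding is_interpolator_def by (intro bexI[of _ "{x \<in> a. s x \<in> s ` t}"]) blast+
  qed
qed

lemma sigma_KB: "sigma (KB S)"
  by (rule sigma_orderedD[OF sigma_ordered_KB])

lemma interpolator_KB:
  assumes "bisection S T" "bisection S A" "nat_le (KB S) T A"
  shows "interpolator (KB S) A T = {a \<in> A. s a \<in> s ` T}"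
  using sigma.interpolator_eqI[OF sigma_KB is_interpolator_restrict[OF assms] assms(3)] assms by simp

end

section \<open>Covering homomorphisms and their inverse images\<close>

context ample
begin

lemma joins_KB_I:
  assumes t: "bisection S t" and X: "{} \<in> X" "X \<subseteq> Car (KB S)"
    and cover: "\<And>a. a \<in> t \<Longrightarrow> \<exists>A\<in>X. a \<in> A \<and> A \<subseteq> t"
  shows "t \<in> joins (KB S) X"
proof -
  obtain A where A: "\<And>a. a \<in> t \<Longrightarrow> A a \<in> X \<and> a \<in> A a \<and> A a \<subseteq> t" using cover by metis
  have Ab: "bisection S (A a)" if "a \<in> t" for a using A[OF that] X(2) by auto
  have "\<exists>F\<subseteq>t. finite F \<and> t \<subseteq> \<Union>(A ` F)"
    by (rule compactin_pointwise[OF bisection_compactin[OF t]]) (use A Ab bisection_openin in auto)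
  then obtain F where F: "F \<subseteq> t" "finite F" "t \<subseteq> \<Union>(A ` F)" by auto
  have "A a \<subseteq> t" if "a \<in> F" for a using A F(1) that by (meson subsetD)
  \<comment> \<open>The empty bisection keeps the family nonempty when \<open>t\<close> is empty.\<close>
  then have e: "t = \<Union>(insert {} (A ` F))" using F(3) by (simp add: UN_subset_iff subset_antisym)
  have "bisection S B" if "B \<in> insert {} (A ` F)" for B using that F(1) Ab by auto
  from is_sup_KB[of "insert {} (A ` F)", OF finite.insertI[OF finite_imageI[OF F(2)]] this]
  have "is_sup (KB S) (insert {} (A ` F)) t" using t e by metis
  then show ?thesis
    by (rule sigma.finite_sup_imp_joins[OF sigma_KB, rotated 4]) (use F(1,2) A X in auto)
qed

lemma joins_KB_D:
  assumes "t \<in> joins (KB S) X" "X \<subseteq> Car (KB S)" "a \<in> t"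
  shows "\<exists>A\<in>X. a \<in> A"
  using assms
proof (induction arbitrary: a rule: joins.induct)
  case (base x)
  then show ?case by auto
next
  case (join c d e)
  have "c \<in> Car (KB S)" "d \<in> Car (KB S)"
    using sigma.joins_Car[OF sigma_KB join.prems(1)] join.hyps by auto
  then have "e = c \<union> d" using join.hyps by (simp add: is_sup_KB2)
  then show ?case using join by auto
qed

lemma bisection_Hausdorff:
  assumes A: "bisection S A" shows "Hausdorff_space (subtopology AT A)"
proof -
  have "subtopology AT A homeomorphic_space subtopology VT (s ` A)"
    using src_homeo A by (auto simp: bisection_def homeomorphic_space)
  then show ?thesis
    using homeomorphic_Hausdorff_space Hausdorff_space_subtopology[OF Hausdorff_VT] by blast
qed

text \<open>
  Within one bisection, arrows are told apart by their sources, and vertices are separated by open sets.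
\<close>

lemma bisection_separates:
  assumes a: "a \<in> \<A>" and b: "b \<in> \<A>" and ab: "\<And>A. bisection S A \<Longrightarrow> a \<in> A \<Longrightarrow> b \<in> A"
  shows "a = b"
proof (rule ccontr)
  assume ne: "a \<noteq> b"
  obtain A where A: "bisection S A" "a \<in> A" using bisection_in[OF a] .
  have "b \<in> A" using ab A by blast
  then have "s a \<noteq> s b" using bisection_src[OF A] ne by blast
  then obtain U V where U: "openin VT U" "s a \<in> U" "s b \<in> V" "disjnt U V"
    using Hausdorff_VT a b unfolding Hausdorff_space_def by (metis src_Vert topspace_VT)
  have "openin AT {x \<in> \<A>. s x \<in> U}" by (rule src_preimage_open[OF U(1)])
  then obtain B where "bisection S B" "a \<in> B" "B \<subseteq> {x \<in> \<A>. s x \<in> U}"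
    using bisection_base[of _ a] a U(2) by blast
  then show False using ab U by (force simp: disjnt_iff)
qed

text \<open>
  A prime filter of compact open bisections has a limit: if no point of a member \<open>B0\<close> had all its small
  neighbourhoods in the filter, then \<open>B0\<close> would be a finite union of non-members.
\<close>

lemma prime_filter_point:
  assumes F: "\<And>B. B \<in> F \<Longrightarrow> bisection S B" and B0: "B0 \<in> F" and empty: "{} \<notin> F"
    and up: "\<And>A B. A \<in> F \<Longrightarrow> A \<subseteq> B \<Longrightarrow> bisection S B \<Longrightarrow> B \<in> F"
    and directed: "\<And>A B. A \<in> F \<Longrightarrow> B \<in> F \<Longrightarrow> \<exists>C\<in>F. C \<subseteq> A \<and> C \<subseteq> B"
    and prime: "\<And>A B. bisection S A \<Longrightarrow> bisection S B \<Longrightarrow> A \<union> B \<in> F \<Longrightarrow> A \<in> F \<or> B \<in> F"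
  shows "\<exists>a\<in>\<A>. \<forall>B. bisection S B \<longrightarrow> (B \<in> F \<longleftrightarrow> a \<in> B)"
proof -
  have b0: "bisection S B0" by (rule F[OF B0])
  have "\<exists>a\<in>B0. \<forall>A. bisection S A \<and> a \<in> A \<and> A \<subseteq> B0 \<longrightarrow> A \<in> F"
  proof (rule ccontr)
    assume "\<not> ?thesis"
    then obtain A where A: "\<And>a. a \<in> B0 \<Longrightarrow> bisection S (A a) \<and> a \<in> A a \<and> A a \<subseteq> B0 \<and> A a \<notin> F"
      by metis
    have "\<exists>G\<subseteq>B0. finite G \<and> B0 \<subseteq> \<Union>(A ` G)"
      by (rule compactin_pointwise[OF bisection_compactin[OF b0]]) (use A bisection_openin in auto)
    then obtain G where G: "G \<subseteq> B0" "finite G" "B0 \<subseteq> \<Union>(A ` G)" by auto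
    have "bisection S (\<Union>(A ` H)) \<and> \<Union>(A ` H) \<notin> F" if "H \<subseteq> B0" "finite H" for H
      using that(2,1)
    proof (induction rule: finite_induct)
      case empty
      then show ?case using \<open>{} \<notin> F\<close> by simp
    next
      case (insert a H)
      then have H: "bisection S (\<Union>(A ` H))" "\<Union>(A ` H) \<notin> F" and a: "bisection S (A a)" "A a \<notin> F" using A by auto
      have "A a \<subseteq> B0" "\<Union>(A ` H) \<subseteq> B0" using insert.prems A by blast+
      then have "bisection S (A a \<union> \<Union>(A ` H))"
        using b0 by (intro bisection_Un[OF a(1) H(1)]) (auto simp: bisection_def)
      then show ?case using prime[OF a(1) H(1)] H a by auto
    qed
    from this[OF G(1,2)] have "\<Union>(A ` G) \<notin> F" by blast
    moreover have "\<Union>(A ` G) = B0" using G A by blast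
    ultimately show False using B0 by simp
  qed
  then obtain a where a: "a \<in> B0" "\<And>A. bisection S A \<Longrightarrow> a \<in> A \<Longrightarrow> A \<subseteq> B0 \<Longrightarrow> A \<in> F" by blast
  have "B \<in> F \<longleftrightarrow> a \<in> B" if B: "bisection S B" for B
  proof
    assume "a \<in> B"
    then obtain A where "bisection S A" "a \<in> A" "A \<subseteq> B \<inter> B0"
      using bisection_base[of "B \<inter> B0" a] a(1) bisection_openin[OF B] bisection_openin[OF b0] by blast
    then show "B \<in> F" using a(2)[of A] up[of A B] B by blast
  next
    assume "B \<in> F"
    then obtain C where C: "C \<in> F" "C \<subseteq> B" "C \<subseteq> B0" using directed B0 by blast
    show "a \<in> B"
    proof (rule ccontr)
      assume "a \<notin> B"
      then have "B0 - C \<in> F" using a C bisection_diff[OF b0 F[OF C(1)] C(3)] by blast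
      then obtain D where "D \<in> F" "D \<subseteq> C" "D \<subseteq> B0 - C" using directed C(1) by blast
      then show False using empty by (metis Diff_disjoint disjoint_iff subset_empty subset_iff)
    qed
  qed
  then show ?thesis using a(1) bisection_in_Arr[OF b0] by blast
qed

end

definition amp_hom :: "'v top_semigroupoid \<Rightarrow> 'w top_semigroupoid \<Rightarrow> ('v \<Rightarrow> 'w) \<Rightarrow> bool" where
  "amp_hom S T \<phi> \<longleftrightarrow> covering_hom S T \<phi> \<and> continuous_map (ArrTop S) (ArrTop T) \<phi> \<and>
     compact_preimages (ArrTop S) (ArrTop T) \<phi>"

definition pre :: "'v top_semigroupoid \<Rightarrow> ('v \<Rightarrow> 'w) \<Rightarrow> 'w set \<Rightarrow> 'v set" where
  "pre S \<phi> B = {a \<in> Arr S. \<phi> a \<in> B}"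

lemma in_pre [simp]: "a \<in> pre S \<phi> B \<longleftrightarrow> a \<in> Arr S \<and> \<phi> a \<in> B"
  by (simp add: pre_def)

locale ample_pair = S: ample S + T: ample T for S :: "'v top_semigroupoid" and T :: "'w top_semigroupoid"
begin

lemma hom_Arr: "sgpd_hom S T \<phi> \<Longrightarrow> a \<in> Arr S \<Longrightarrow> \<phi> a \<in> Arr T"
  by (auto simp: sgpd_hom_def)

lemma hom_mul:
  assumes "sgpd_hom S T \<phi>" "a \<in> Arr S" "b \<in> Arr S" "src S a = rng S b"
  shows "src T (\<phi> a) = rng T (\<phi> b)" "\<phi> (Mul S a b) = Mul T (\<phi> a) (\<phi> b)"
  using assms S.Dom2_iff[of a b] T.Dom2_iff[of "\<phi> a" "\<phi> b"] by (auto simp: sgpd_hom_def)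

lemma hom_src:
  assumes h: "sgpd_hom S T \<phi>" and "a \<in> Arr S" "b \<in> Arr S" "src S a = src S b"
  shows "src T (\<phi> a) = src T (\<phi> b)"
  using hom_mul(1)[OF h, of a "sginv S b"] hom_mul(1)[OF h, of b "sginv S b"] assms by simp

lemma hom_rng:
  assumes h: "sgpd_hom S T \<phi>" and "a \<in> Arr S" "b \<in> Arr S" "rng S a = rng S b"
  shows "rng T (\<phi> a) = rng T (\<phi> b)"
  using hom_mul(1)[OF h, of "sginv S a" a] hom_mul(1)[OF h, of "sginv S a" b] assms by simp

text \<open>
  By surjectivity on stars, the elements \<open>b\<close> and \<open>c\<close> of a factorisation \<open>\<phi> a = bc\<close> are lifted from right
  to left; injectivity on stars identifies the product of the lifts with \<open>a\<close>.
\<close>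

lemma pre_mul:
  assumes c: "covering_hom S T \<phi>" and B: "B \<subseteq> Arr T" and C: "C \<subseteq> Arr T"
  shows "pre S \<phi> (set_mul T B C) = set_mul S (pre S \<phi> B) (pre S \<phi> C)"
proof (intro set_eqI iffI)
  have h: "sgpd_hom S T \<phi>" and inj: "star_injective S \<phi>" and surj: "star_surjective S T \<phi>"
    using c by (auto simp: covering_hom_def)
  note hA [simp] = hom_Arr[OF h]
  fix a
  {
    assume "a \<in> set_mul S (pre S \<phi> B) (pre S \<phi> C)"
    then obtain b c where "b \<in> Arr S" "c \<in> Arr S" "\<phi> b \<in> B" "\<phi> c \<in> C" "src S b = rng S c" "a = Mul S b c"
      by (auto simp: set_mul_def)
    then show "a \<in> pre S \<phi> (set_mul T B C)"
      using T.in_set_mul[of "\<phi> b" B "\<phi> c" C] by (simp add: hom_mul[OF h])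
  next
    assume "a \<in> pre S \<phi> (set_mul T B C)"
    then obtain b c where a: "a \<in> Arr S" and bc: "\<phi> a = Mul T b c" "b \<in> B" "c \<in> C" "src T b = rng T c"
      by (auto simp: set_mul_def)
    have [simp]: "b \<in> Arr T" "c \<in> Arr T" using bc B C by auto
    have "src T c = src T (\<phi> a)" using bc by simp
    then obtain c' where c': "c' \<in> Arr S" "src S c' = src S a" "\<phi> c' = c"
      using surj a unfolding star_surjective_def by (metis \<open>c \<in> Arr T\<close>)
    have "src T (\<phi> (sginv S c')) = rng T c"
      using hom_mul(1)[OF h, of "sginv S c'" c'] c' by simp
    then have "src T b = src T (\<phi> (sginv S c'))" using bc by simp
    then obtain b' where b': "b' \<in> Arr S" "src S b' = src S (sginv S c')" "\<phi> b' = b"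
      using surj S.i_closed[OF c'(1)] unfolding star_surjective_def by (metis \<open>b \<in> Arr T\<close>)
    have comp: "src S b' = rng S c'" using b' c' by simp
    have "\<phi> (Mul S b' c') = \<phi> a" using hom_mul(2)[OF h b'(1) c'(1) comp] b' c' bc by simp
    moreover have "src S (Mul S b' c') = src S a" using b' c' comp by simp
    ultimately have "a = Mul S b' c'"
      using inj a S.mul_closed[OF b'(1) c'(1) comp] unfolding star_injective_def by metis
    then show "a \<in> set_mul S (pre S \<phi> B) (pre S \<phi> C)"
      using S.in_set_mul[of b' "pre S \<phi> B" c' "pre S \<phi> C"] b' c' bc comp by simp
  }
qed

text \<open>
  Equality of sources is preserved by a homomorphism, since it is composability with a common inverse;
  the same goes for ranges. So injectivity on stars makes the inverse image of a bisection a bisection.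
\<close>

lemma bisection_pre:
  assumes \<phi>: "amp_hom S T \<phi>" and B: "bisection T B"
  shows "bisection S (pre S \<phi> B)"
  unfolding bisection_def
proof (intro conjI)
  have h: "sgpd_hom S T \<phi>" and inj: "star_injective S \<phi>"
    using \<phi> by (auto simp: amp_hom_def covering_hom_def)
  show "openin (ArrTop S) (pre S \<phi> B)"
    using \<phi> T.bisection_openin[OF B] openin_continuous_map_preimage[of "ArrTop S" "ArrTop T" \<phi> B]
    by (simp add: amp_hom_def pre_def)
  show "compactin (ArrTop S) (pre S \<phi> B)"
    using \<phi> T.bisection_compactin[OF B] by (simp add: amp_hom_def compact_preimages_def pre_def)
  show s: "inj_on (src S) (pre S \<phi> B)"
  proof (rule inj_onI)
    fix a b assume *: "a \<in> pre S \<phi> B" "b \<in> pre S \<phi> B" "src S a = src S b"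
    then have "\<phi> a = \<phi> b" using T.bisection_src[OF B] hom_src[OF h] by simp
    then show "a = b" using inj * by (simp add: star_injective_def)
  qed
  show "inj_on (rng S) (pre S \<phi> B)"
  proof (rule inj_onI)
    fix a b assume *: "a \<in> pre S \<phi> B" "b \<in> pre S \<phi> B" "rng S a = rng S b"
    then have e: "\<phi> a = \<phi> b" using T.bisection_rng[OF B] hom_rng[OF h] by simp
    have ab: "a \<in> Arr S" "b \<in> Arr S" using * by auto
    have i: "\<phi> (sginv S x) = sginv T (\<phi> x)" if x: "x \<in> Arr S" for x
    proof (rule T.i_unique[symmetric])
      have "is_sginv S x (sginv S x)" by (rule S.is_sginv_i[OF x])
      note [simp] = x hom_Arr[OF h]
      have "Mul T (Mul T (\<phi> x) (\<phi> (sginv S x))) (\<phi> x) = \<phi> (Mul S (Mul S x (sginv S x)) x)"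
        by (simp add: hom_mul(2)[OF h, symmetric] hom_mul(1)[OF h] del: S.mul_i_mul)
      moreover have "Mul T (Mul T (\<phi> (sginv S x)) (\<phi> x)) (\<phi> (sginv S x)) =
          \<phi> (Mul S (Mul S (sginv S x) x) (sginv S x))"
        by (simp add: hom_mul(2)[OF h, symmetric] hom_mul(1)[OF h] del: S.i_mul_i)
      ultimately show "is_sginv T (\<phi> x) (\<phi> (sginv S x))"
        by (simp add: is_sginv_def T.Dom2_iff hom_mul(1)[OF h])
    qed (simp add: hom_Arr[OF h x])
    have "sginv S a = sginv S b"
      using inj * ab e i[OF ab(1)] i[OF ab(2)] S.i_closed[OF ab(1)] S.i_closed[OF ab(2)]
      unfolding star_injective_def by (metis S.src_i)
    then show "a = b" using ab by simp
  qed
qed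

text \<open>
  The space of arrows need not be Hausdorff, and the intersection of two compact open bisections need not
  be compact. So the fourth and fifth conditions are obtained by covering compact sets, \<open>\<phi> ` t\<close>
  and \<open>t\<close> respectively, by small bisections.
\<close>

lemma sigma_morphism_pre:
  assumes \<phi>: "amp_hom S T \<phi>"
  shows "sigma_morphism (KB T) (KB S) (pre S \<phi>)"
proof (rule sigma_morphismI[OF S.sigma_ordered_KB])
  have c: "covering_hom S T \<phi>" and h: "sgpd_hom S T \<phi>" and surj: "star_surjective S T \<phi>"
    and cont: "continuous_map (ArrTop S) (ArrTop T) \<phi>"
    using \<phi> by (auto simp: amp_hom_def covering_hom_def)
  note b = bisection_pre[OF \<phi>]
  note hA [simp] = hom_Arr[OF h]
  show "pre S \<phi> B \<in> Car (KB S)" if "B \<in> Car (KB T)" for B using that b by simp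
  show "pre S \<phi> (B \<cdot>\<^bsub>KB T\<^esub> C) = pre S \<phi> B \<cdot>\<^bsub>KB S\<^esub> pre S \<phi> C"
    if "B \<in> Car (KB T)" "C \<in> Car (KB T)" for B C
    using that pre_mul[OF c] T.bisection_Arr by simp
  show "pre S \<phi> (szero (KB T)) = szero (KB S)" by (auto simp: S.szero_KB T.szero_KB)
  show "pre S \<phi> A \<sqsubseteq>\<^bsub>KB S\<^esub> pre S \<phi> B" if "A \<sqsubseteq>\<^bsub>KB T\<^esub> B" for A B using that by auto
  show "is_sup (KB S) {pre S \<phi> A, pre S \<phi> B} (pre S \<phi> C)"
    if "A \<in> Car (KB T)" "B \<in> Car (KB T)" "is_sup (KB T) {A, B} C" for A B C
    using that b by (auto simp: S.is_sup_KB2 T.is_sup_KB2)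
  note cnt = openin_continuous_map_preimage[OF cont]
  show "\<exists>C\<in>Car (KB T). C \<sqsubseteq>\<^bsub>KB T\<^esub> A \<and> C \<sqsubseteq>\<^bsub>KB T\<^esub> B \<and> t \<sqsubseteq>\<^bsub>KB S\<^esub> pre S \<phi> C"
    if "A \<in> Car (KB T)" "B \<in> Car (KB T)" "t \<in> Car (KB S)"
      "t \<sqsubseteq>\<^bsub>KB S\<^esub> pre S \<phi> A" "t \<sqsubseteq>\<^bsub>KB S\<^esub> pre S \<phi> B" for A B t
  proof -
    have *: "bisection T A" "bisection T B" "bisection S t" "\<phi> ` t \<subseteq> A \<inter> B" using that by auto
    have op: "openin (ArrTop T) (A \<inter> B)" using * T.bisection_openin by blast
    then have "\<exists>C. bisection T C \<and> y \<in> C \<and> C \<subseteq> A \<inter> B" if "y \<in> \<phi> ` t" for y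
      using T.bisection_base[OF op, of y] that *(4) by blast
    then obtain C where C: "\<And>y. y \<in> \<phi> ` t \<Longrightarrow> bisection T (C y) \<and> y \<in> C y \<and> C y \<subseteq> A \<inter> B" by metis
    have "\<exists>F\<subseteq>\<phi> ` t. finite F \<and> \<phi> ` t \<subseteq> \<Union>(C ` F)"
      by (rule compactin_pointwise[OF image_compactin[OF S.bisection_compactin[OF *(3)] cont]])
        (use C T.bisection_openin in auto)
    then obtain F where F: "F \<subseteq> \<phi> ` t" "finite F" "\<phi> ` t \<subseteq> \<Union>(C ` F)" by auto
    have FA: "\<Union>(C ` F) \<subseteq> A" "\<Union>(C ` F) \<subseteq> B" using F(1) C by blast+
    moreover have "bisection T (\<Union>(C ` F))"
      using F C FA *(1) by (intro T.bisection_Un_finite[of _ A]) (auto simp: bisection_def)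
    moreover have "t \<subseteq> pre S \<phi> (\<Union>(C ` F))"
      using F(3) S.bisection_in_Arr[OF *(3)] unfolding pre_def by blast
    ultimately show ?thesis by (intro bexI[of _ "\<Union>(C ` F)"]) simp_all
  qed
  show "pre S \<phi> (interpolator (KB T) B A) = interpolator (KB S) (pre S \<phi> B) (pre S \<phi> A)"
    if ab: "A \<in> Car (KB T)" "B \<in> Car (KB T)" "nat_le (KB T) A B" for A B
  proof -
    have *: "bisection T A" "bisection T B" using ab by auto
    have le: "nat_le (KB S) (pre S \<phi> A) (pre S \<phi> B)"
      using ab b pre_mul[OF c] T.bisection_Arr
      by (intro hom_nat_le[OF T.inverse_semigroup_KB S.inverse_semigroup_KB]) auto
    have "src T (\<phi> x) \<in> src T ` A \<longleftrightarrow> src S x \<in> src S ` pre S \<phi> A" if x: "x \<in> Arr S" for x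
    proof
      assume "src T (\<phi> x) \<in> src T ` A"
      then obtain a where a: "a \<in> A" "src T a = src T (\<phi> x)" by auto
      then have "a \<in> Arr T" using T.bisection_in_Arr[OF *(1)] by simp
      then obtain y where "y \<in> Arr S" "src S y = src S x" "\<phi> y = a"
        using surj x a(2) unfolding star_surjective_def by metis
      then show "src S x \<in> src S ` pre S \<phi> A" using a(1) by (intro image_eqI[of _ _ y]) auto
    next
      assume "src S x \<in> src S ` pre S \<phi> A"
      then obtain y where "y \<in> Arr S" "\<phi> y \<in> A" "src S x = src S y" by auto
      then show "src T (\<phi> x) \<in> src T ` A" using hom_src[OF h x, of y] by auto
    qed
    then show ?thesis
      unfolding T.interpolator_KB[OF * ab(3)] S.interpolator_KB[OF b b le, OF *]
      by (intro set_eqI) (simp cong: conj_cong)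
  qed
  show "t \<in> joins (KB S) {t' \<in> Car (KB S). \<exists>B\<in>Car (KB T). t' \<sqsubseteq>\<^bsub>KB S\<^esub> pre S \<phi> B}" (is "t \<in> joins _ ?X")
    if "t \<in> Car (KB S)" for t
  proof (rule S.joins_KB_I)
    show t: "bisection S t" using that by simp
    show "{} \<in> ?X" by (auto intro: exI[of _ "{}"])
    fix a assume a: "a \<in> t"
    then have aS: "a \<in> Arr S" using S.bisection_in_Arr[OF t] by blast
    obtain B where B: "bisection T B" "\<phi> a \<in> B" using T.bisection_in[OF hA[OF aS]] .
    have "openin (ArrTop S) (t \<inter> pre S \<phi> B)"
      using S.bisection_openin[OF t] S.bisection_openin[OF b[OF B(1)]] by blast
    then obtain A where "bisection S A" "a \<in> A" "A \<subseteq> t \<inter> pre S \<phi> B"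
      using S.bisection_base[of "t \<inter> pre S \<phi> B" a] a aS B(2) by auto
    then show "\<exists>A\<in>?X. a \<in> A \<and> A \<subseteq> t" using B(1) by (intro bexI[of _ A]) auto
  qed auto
qed

lemma pre_cancel:
  assumes \<phi>: "sgpd_hom S T \<phi>" and \<psi>: "sgpd_hom S T \<psi>"
    and e: "\<And>B. bisection T B \<Longrightarrow> pre S \<phi> B = pre S \<psi> B" and a: "a \<in> Arr S"
  shows "\<phi> a = \<psi> a"
proof (rule T.bisection_separates)
  show "\<psi> a \<in> B" if "bisection T B" "\<phi> a \<in> B" for B
    using e[OF that(1)] that(2) a by (auto simp: set_eq_iff)
qed (simp_all add: hom_Arr[OF \<phi>] hom_Arr[OF \<psi>] a)

end

section \<open>Every morphism between bisection semigroups is an inverse image\<close>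

locale KB_morphism = ample_pair S T for S :: "'v top_semigroupoid" and T :: "'w top_semigroupoid" +
  fixes \<theta>
  assumes \<theta>: "sigma_morphism (KB T) (KB S) \<theta>"
begin

lemma \<theta>_bisection [simp]: "bisection T B \<Longrightarrow> bisection S (\<theta> B)"
  using sigma_morphismD(1)[OF S.sigma_ordered_KB \<theta>, of B] by simp

lemma \<theta>_mul: "bisection T B \<Longrightarrow> bisection T C \<Longrightarrow> \<theta> (set_mul T B C) = set_mul S (\<theta> B) (\<theta> C)"
  using sigma_morphismD(2)[OF S.sigma_ordered_KB \<theta>, of B C] by simp

lemma \<theta>_empty [simp]: "\<theta> {} = {}"
  using sigma_morphismD(3)[OF S.sigma_ordered_KB \<theta>] by (simp add: S.szero_KB T.szero_KB)

lemma \<theta>_mono: "bisection T B \<Longrightarrow> bisection T C \<Longrightarrow> B \<subseteq> C \<Longrightarrow> \<theta> B \<subseteq> \<theta> C"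
  using sigma_morphismD(4)[OF S.sigma_ordered_KB \<theta>, of B C] by simp

lemma \<theta>_Un: "bisection T B \<Longrightarrow> bisection T C \<Longrightarrow> bisection T (B \<union> C) \<Longrightarrow> \<theta> (B \<union> C) = \<theta> B \<union> \<theta> C"
  using sigma_morphismD(5)[OF S.sigma_ordered_KB \<theta>, of B C "B \<union> C"]
  by (simp add: S.is_sup_KB2 T.is_sup_KB2)

lemma \<theta>_directed:
  assumes B: "bisection T B" and C: "bisection T C" and a: "a \<in> \<theta> B" "a \<in> \<theta> C"
  shows "\<exists>D. bisection T D \<and> D \<subseteq> B \<and> D \<subseteq> C \<and> a \<in> \<theta> D"
proof -
  have "openin (ArrTop S) (\<theta> B \<inter> \<theta> C)"
    using S.bisection_openin[OF \<theta>_bisection[OF B]] S.bisection_openin[OF \<theta>_bisection[OF C]] by blast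
  then obtain t where t: "bisection S t" "a \<in> t" "t \<subseteq> \<theta> B \<inter> \<theta> C"
    using S.bisection_base[of _ a] a by blast
  then show ?thesis
    using sigma_morphismD(6)[OF S.sigma_ordered_KB \<theta>, of B C t] B C by auto
qed

lemma \<theta>_covers:
  assumes a: "a \<in> Arr S" shows "\<exists>B. bisection T B \<and> a \<in> \<theta> B"
proof -
  obtain t where t: "bisection S t" "a \<in> t" using S.bisection_in[OF a] .
  have "t \<in> joins (KB S) {t' \<in> Car (KB S). \<exists>B\<in>Car (KB T). t' \<sqsubseteq>\<^bsub>KB S\<^esub> \<theta> B}"
    using sigma_morphismD(7)[OF S.sigma_ordered_KB \<theta>, of t] t by simp
  from S.joins_KB_D[OF this _ t(2)] show ?thesis by auto
qed

lemma point_ex: "a \<in> Arr S \<Longrightarrow> \<exists>t. t \<in> Arr T \<and> (\<forall>B. bisection T B \<longrightarrow> (a \<in> \<theta> B \<longleftrightarrow> t \<in> B))"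
proof -
  assume a: "a \<in> Arr S"
  let ?F = "{B. bisection T B \<and> a \<in> \<theta> B}"
  obtain B0 where B0: "B0 \<in> ?F" using \<theta>_covers[OF a] by blast
  have "\<exists>t\<in>Arr T. \<forall>B. bisection T B \<longrightarrow> (B \<in> ?F \<longleftrightarrow> t \<in> B)"
  proof (rule T.prime_filter_point[of ?F B0])
    show "B \<in> ?F" if "A \<in> ?F" "A \<subseteq> B" "bisection T B" for A B using that \<theta>_mono by blast
    show "\<exists>C\<in>?F. C \<subseteq> A \<and> C \<subseteq> B" if "A \<in> ?F" "B \<in> ?F" for A B
      using \<theta>_directed[of A B a] that by auto
    show "A \<in> ?F \<or> B \<in> ?F" if "bisection T A" "bisection T B" "A \<union> B \<in> ?F" for A B
      using \<theta>_Un[of A B] that by auto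
  qed (use B0 in auto)
  then show ?thesis by auto
qed

text \<open>
  For \<open>a \<in> Arr S\<close>, the bisections \<open>B\<close> with \<open>a \<in> \<theta> B\<close> form a prime filter, and \<open>\<phi> a\<close> is its limit.
\<close>

definition \<phi> :: "'v \<Rightarrow> 'w" where
  "\<phi> = (\<lambda>a\<in>Arr S. SOME t. t \<in> Arr T \<and> (\<forall>B. bisection T B \<longrightarrow> (a \<in> \<theta> B \<longleftrightarrow> t \<in> B)))"

lemma \<phi>_spec: "a \<in> Arr S \<Longrightarrow> \<phi> a \<in> Arr T \<and> (\<forall>B. bisection T B \<longrightarrow> (a \<in> \<theta> B \<longleftrightarrow> \<phi> a \<in> B))"
  unfolding \<phi>_def restrict_apply' by (rule someI_ex[OF point_ex])

lemma \<phi>_Arr [simp]: "a \<in> Arr S \<Longrightarrow> \<phi> a \<in> Arr T"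
  and \<theta>_iff: "a \<in> Arr S \<Longrightarrow> bisection T B \<Longrightarrow> a \<in> \<theta> B \<longleftrightarrow> \<phi> a \<in> B"
  using \<phi>_spec by simp_all

lemma \<phi>_extensional: "\<phi> \<in> extensional (Arr S)"
  by (simp add: \<phi>_def)

lemma \<theta>_pre: "bisection T B \<Longrightarrow> \<theta> B = pre S \<phi> B"
  using \<theta>_iff S.bisection_in_Arr[OF \<theta>_bisection] unfolding pre_def by blast

text \<open>
  Otherwise \<open>\<phi> a\<close> and \<open>\<phi> b\<close> would have neighbourhoods \<open>B\<close> and \<open>C\<close> with \<open>BC\<close> empty, yet \<open>ab\<close> lies in
  \<open>\<theta> (BC)\<close>.
\<close>

lemma \<phi>_comp:
  assumes a: "a \<in> Arr S" and b: "b \<in> Arr S" and ab: "src S a = rng S b"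
  shows "src T (\<phi> a) = rng T (\<phi> b)"
proof (rule ccontr)
  assume "src T (\<phi> a) \<noteq> rng T (\<phi> b)"
  then obtain U V where U: "openin (VertTop T) U" "openin (VertTop T) V" "src T (\<phi> a) \<in> U"
    "rng T (\<phi> b) \<in> V" "disjnt U V"
    using T.Hausdorff_VT a b unfolding Hausdorff_space_def by (metis T.src_Vert T.rng_Vert T.topspace_VT \<phi>_Arr)
  have "\<phi> a \<in> {x \<in> Arr T. src T x \<in> U}" "\<phi> b \<in> {x \<in> Arr T. rng T x \<in> V}" using a b U(3,4) by simp_all
  note * = T.bisection_base[OF T.src_preimage_open[OF U(1)] this(1)]
    T.bisection_base[OF T.rng_preimage_open[OF U(2)] this(2)]
  obtain B where B: "bisection T B" "\<phi> a \<in> B" "B \<subseteq> {x \<in> Arr T. src T x \<in> U}" using *(1) .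
  obtain C where C: "bisection T C" "\<phi> b \<in> C" "C \<subseteq> {x \<in> Arr T. rng T x \<in> V}" using *(2) .
  have "set_mul T B C = {}" unfolding T.set_mul_eq_empty using B(3) C(3) U(5) by (force simp: disjnt_iff)
  then have "set_mul S (\<theta> B) (\<theta> C) = {}" using \<theta>_mul[OF B(1) C(1)] by simp
  moreover have "Mul S a b \<in> set_mul S (\<theta> B) (\<theta> C)"
    using S.in_set_mul ab a b B C by (simp add: \<theta>_iff)
  ultimately show False by simp
qed

lemma \<phi>_src: "\<lbrakk>a \<in> Arr S; b \<in> Arr S; src S a = src S b\<rbrakk> \<Longrightarrow> src T (\<phi> a) = src T (\<phi> b)"
  using \<phi>_comp[of a "sginv S b"] \<phi>_comp[of b "sginv S b"] by simp

text \<open>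
  The arrow \<open>\<phi> (ab)\<close> lies in \<open>BC\<close>, and the only element of \<open>BC\<close> with the source of \<open>\<phi> b\<close> is the product of
  \<open>\<phi> a\<close> and \<open>\<phi> b\<close>.
\<close>

lemma \<phi>_mul:
  assumes a: "a \<in> Arr S" and b: "b \<in> Arr S" and ab: "src S a = rng S b"
  shows "\<phi> (Mul S a b) = Mul T (\<phi> a) (\<phi> b)"
proof -
  obtain B where B: "bisection T B" "\<phi> a \<in> B" using T.bisection_in[OF \<phi>_Arr[OF a]] .
  obtain C where C: "bisection T C" "\<phi> b \<in> C" using T.bisection_in[OF \<phi>_Arr[OF b]] .
  have m: "Mul S a b \<in> Arr S" using a b ab by simp
  have "Mul S a b \<in> set_mul S (\<theta> B) (\<theta> C)"
    using S.in_set_mul[of a "\<theta> B" b "\<theta> C"] a b ab B C by (simp add: \<theta>_iff)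
  then have "\<phi> (Mul S a b) \<in> set_mul T B C"
    using \<theta>_iff[OF m T.bisection_mul[OF B(1) C(1)]] \<theta>_mul[OF B(1) C(1)] by simp
  then obtain b' c' where *: "b' \<in> B" "c' \<in> C" "src T b' = rng T c'" "\<phi> (Mul S a b) = Mul T b' c'"
    by (rule T.set_mulE)
  note [simp] = T.bisection_in_Arr[OF B(1) *(1)] T.bisection_in_Arr[OF C(1) *(2)]
  have "src T c' = src T (\<phi> (Mul S a b))" using * by simp
  also have "\<dots> = src T (\<phi> b)" using a b ab by (intro \<phi>_src) simp_all
  finally have c: "c' = \<phi> b" using T.bisection_src[OF C(1) *(2) C(2)] by simp
  have "src T b' = src T (\<phi> a)" using *(3) c \<phi>_comp[OF a b ab] by simp
  then have "b' = \<phi> a" using T.bisection_src[OF B(1) *(1) B(2)] by simp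
  with c * show ?thesis by simp
qed

lemma sgpd_hom_\<phi>: "sgpd_hom S T \<phi>"
  unfolding sgpd_hom_def
proof (intro conjI ballI)
  show "\<phi> \<in> Arr S \<rightarrow> Arr T" by simp
  fix p assume p: "p \<in> Dom2 S"
  obtain a b where [simp]: "p = (a, b)" by (cases p)
  then have ab: "a \<in> Arr S" "b \<in> Arr S" "src S a = rng S b" using S.Dom2_Arr[of a b] S.Dom2_iff[of a b] p by auto
  then show "case p of (a, b) \<Rightarrow> (\<phi> a, \<phi> b) \<in> Dom2 T \<and> Mul T (\<phi> a) (\<phi> b) = \<phi> (Mul S a b)"
    by (simp add: T.Dom2_iff \<phi>_comp \<phi>_mul)
qed

lemma star_injective_\<phi>: "star_injective S \<phi>"
  unfolding star_injective_def
proof (intro ballI impI)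
  fix a b assume a: "a \<in> Arr S" and b: "b \<in> Arr S" and ab: "src S a = src S b \<and> \<phi> a = \<phi> b"
  obtain B where B: "bisection T B" "\<phi> a \<in> B" using T.bisection_in[OF \<phi>_Arr[OF a]] .
  show "a = b"
    using S.bisection_src[OF \<theta>_bisection[OF B(1)], of a b] a b ab B by (simp add: \<theta>_iff)
qed

text \<open>
  Preservation of interpolators gives surjectivity on stars: if \<open>t \<in> B\<close> and \<open>\<phi> a \<in> C\<close> have a common source,
  then \<open>\<phi> a\<close> lies in the interpolator of \<open>C B\<^sup>\<star> B \<le> C\<close>, so that \<open>a\<close> lies in the interpolator of its image,
  and the source of \<open>a\<close> is in the source of \<open>\<theta> B\<close>.
\<close>

lemma star_surjective_\<phi>: "star_surjective S T \<phi>"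
  unfolding star_surjective_def
proof (intro ballI impI)
  fix t a assume t: "t \<in> Arr T" and a: "a \<in> Arr S" and ta: "src T t = src T (\<phi> a)"
  obtain B where B: "bisection T B" "t \<in> B" using T.bisection_in[OF t] .
  obtain C where C: "bisection T C" "\<phi> a \<in> C" using T.bisection_in[OF \<phi>_Arr[OF a]] .
  let ?B' = "sginv T ` B"
  let ?D = "set_mul T (set_mul T C ?B') B"
  have bB': "bisection T ?B'" by (rule T.bisection_star[OF B(1)])
  have bD: "bisection T ?D" by (intro T.bisection_mul C(1) bB' B(1))
  note [simp] = \<phi>_Arr[OF a]
  have D: "?D = {Mul T (Mul T c (sginv T b)) b |c b. c \<in> C \<and> b \<in> B \<and> src T c = src T b}" (is "_ = ?E")
  proof (intro set_eqI iffI)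
    fix x assume "x \<in> ?D"
    then obtain c b d where *: "c \<in> C" "b \<in> B" "src T c = rng T (sginv T b)" "d \<in> B"
      "src T (Mul T c (sginv T b)) = rng T d" "x = Mul T (Mul T c (sginv T b)) d"
      by (auto simp: set_mul_def)
    note [simp] = T.bisection_in_Arr[OF C(1) *(1)] T.bisection_in_Arr[OF B(1) *(2)]
      T.bisection_in_Arr[OF B(1) *(4)]
    have "d = b" using T.bisection_rng[OF B(1) *(4,2)] * by simp
    then show "x \<in> ?E" using * by auto
  next
    fix x assume "x \<in> ?E"
    then obtain c b where *: "c \<in> C" "b \<in> B" "src T c = src T b" "x = Mul T (Mul T c (sginv T b)) b" by blast
    note [simp] = T.bisection_in_Arr[OF C(1) *(1)] T.bisection_in_Arr[OF B(1) *(2)]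
    have "Mul T c (sginv T b) \<in> set_mul T C ?B'" using * by (intro T.in_set_mul) auto
    then show "x \<in> ?D" unfolding *(4) using * by (intro T.in_set_mul) auto
  qed
  have le: "nat_le (KB T) ?D C"
  proof -
    interpret K: sigma "KB T" by (rule T.sigma_KB)
    have BC: "B \<in> Car (KB T)" "C \<in> Car (KB T)" using B C by auto
    have "?D = C \<cdot>\<^bsub>KB T\<^esub> (sinv (KB T) B \<cdot>\<^bsub>KB T\<^esub> B)"
      using K.mult_assoc[OF BC(2) K.star_closed[OF BC(1)] BC(1)] T.sinv_KB[OF B(1)] by simp
    moreover have "nat_le (KB T) (C \<cdot>\<^bsub>KB T\<^esub> (sinv (KB T) B \<cdot>\<^bsub>KB T\<^esub> B)) C"
      by (rule K.nat_le_mult_idem[OF BC(2,1)])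
    ultimately show ?thesis by simp
  qed
  have leS: "nat_le (KB S) (\<theta> ?D) (\<theta> C)"
    by (rule hom_nat_le[OF T.inverse_semigroup_KB S.inverse_semigroup_KB _ _ _ _ le])
      (use \<theta>_mul bD C(1) in auto)
  have "Mul T (Mul T (\<phi> a) (sginv T t)) t \<in> ?D" unfolding D using C(2) B(2) ta[symmetric] by blast
  moreover have "src T (Mul T (Mul T (\<phi> a) (sginv T t)) t) = src T (\<phi> a)" using t ta by simp
  ultimately have "src T (\<phi> a) \<in> src T ` ?D" by (metis imageI)
  then have "\<phi> a \<in> interpolator (KB T) C ?D" using T.interpolator_KB[OF bD C(1) le] C(2) by simp
  moreover have bI: "bisection T (interpolator (KB T) C ?D)"
    using sigma.interpolator_Car[OF T.sigma_KB le] bD C(1) by simp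
  ultimately have "a \<in> \<theta> (interpolator (KB T) C ?D)" using \<theta>_iff[OF a bI] by simp
  also have "\<theta> (interpolator (KB T) C ?D) = interpolator (KB S) (\<theta> C) (\<theta> ?D)"
    using sigma_morphismD(8)[OF S.sigma_ordered_KB \<theta>, of ?D C] bD C(1) le by simp
  finally have "src S a \<in> src S ` \<theta> ?D"
    using S.interpolator_KB[OF \<theta>_bisection[OF bD] \<theta>_bisection[OF C(1)] leS] by simp
  then obtain d where d: "d \<in> \<theta> ?D" "src S a = src S d" by auto
  have "\<theta> ?D = set_mul S (\<theta> (set_mul T C ?B')) (\<theta> B)"
    by (rule \<theta>_mul[OF T.bisection_mul[OF C(1) bB'] B(1)])
  then obtain x b where x: "x \<in> \<theta> (set_mul T C ?B')" "b \<in> \<theta> B" "src S x = rng S b" "d = Mul S x b"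
    using d(1) by (auto simp: set_mul_def)
  have "x \<in> Arr S" by (rule S.bisection_in_Arr[OF \<theta>_bisection[OF T.bisection_mul[OF C(1) bB']] x(1)])
  moreover have "b \<in> Arr S" by (rule S.bisection_in_Arr[OF \<theta>_bisection[OF B(1)] x(2)])
  ultimately have b: "b \<in> \<theta> B" "src S b = src S a" "b \<in> Arr S" using x d(2) by simp_all
  have "src T (\<phi> b) = src T t" using \<phi>_src[OF b(3) a b(2)] ta by simp
  then have "\<phi> b = t" using T.bisection_src[OF B(1), of "\<phi> b" t] B(2) \<theta>_iff[OF b(3) B(1)] b(1) by simp
  then show "\<exists>b\<in>Arr S. src S b = src S a \<and> \<phi> b = t" using b by blast
qed

lemma continuous_\<phi>: "continuous_map (ArrTop S) (ArrTop T) \<phi>"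
  unfolding continuous_map_def
proof (intro conjI allI impI)
  show "\<phi> \<in> topspace (ArrTop S) \<rightarrow> topspace (ArrTop T)" by simp
  fix U assume U: "openin (ArrTop T) U"
  show "openin (ArrTop S) {x \<in> topspace (ArrTop S). \<phi> x \<in> U}"
  proof (subst openin_subopen, intro ballI)
    fix x assume "x \<in> {x \<in> topspace (ArrTop S). \<phi> x \<in> U}"
    then have x: "x \<in> Arr S" "\<phi> x \<in> U" by auto
    obtain B where B: "bisection T B" "\<phi> x \<in> B" "B \<subseteq> U" using T.bisection_base[OF U x(2)] .
    show "\<exists>V. openin (ArrTop S) V \<and> x \<in> V \<and> V \<subseteq> {x \<in> topspace (ArrTop S). \<phi> x \<in> U}"
      using S.bisection_openin[OF \<theta>_bisection[OF B(1)]] B x by (intro exI[of _ "\<theta> B"]) (auto simp: \<theta>_pre)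
  qed
qed

text \<open>
  Properness is local on the target: \<open>\<phi>\<close> maps the compact space \<open>\<theta> B\<close> to the Hausdorff space \<open>B\<close>, so it is a
  closed map with compact fibres there.
\<close>

lemma compact_preimages_\<phi>: "compact_preimages (ArrTop S) (ArrTop T) \<phi>"
  unfolding compact_preimages_def
proof (intro allI impI)
  fix K assume K: "compactin (ArrTop T) K"
  have KT: "K \<subseteq> Arr T" using compactin_subset_topspace[OF K] by simp
  show "compactin (ArrTop S) {x \<in> topspace (ArrTop S). \<phi> x \<in> K}" (is "compactin _ ?P")
    unfolding compactin_def
  proof (intro conjI allI impI)
    fix \<U> assume \<U>: "(\<forall>U\<in>\<U>. openin (ArrTop S) U) \<and> ?P \<subseteq> \<Union>\<U>"
    have "\<exists>V \<F>. openin (ArrTop T) V \<and> t \<in> V \<and> finite \<F> \<and> \<F> \<subseteq> \<U> \<and> pre S \<phi> V \<subseteq> \<Union>\<F>" if tK: "t \<in> K" for t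
    proof -
      have t: "t \<in> Arr T" using tK KT by auto
      obtain B where B: "bisection T B" "t \<in> B" using T.bisection_in[OF t] .
      let ?X = "subtopology (ArrTop S) (\<theta> B)" and ?Y = "subtopology (ArrTop T) B"
      have BT: "B \<subseteq> Arr T" and \<theta>S: "\<theta> B \<subseteq> Arr S"
        using T.bisection_Arr[OF B(1)] S.bisection_Arr[OF \<theta>_bisection[OF B(1)]] .
      have top: "topspace ?X = \<theta> B" "topspace ?Y = B" using BT \<theta>S by auto
      have "compact_space ?X"
        using S.bisection_compactin[OF \<theta>_bisection[OF B(1)]] by (simp add: compact_space_subtopology)
      moreover have "kc_space ?Y" by (rule Hausdorff_imp_kc_space[OF T.bisection_Hausdorff[OF B(1)]])
      moreover have "continuous_map ?X ?Y \<phi>"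
        by (intro continuous_map_into_subtopology continuous_map_from_subtopology continuous_\<phi>)
          (use B in \<open>auto simp: \<theta>_pre\<close>)
      ultimately have pm: "proper_map ?X ?Y \<phi>" by (rule continuous_imp_proper_map)
      have "compactin ?X {x \<in> \<theta> B. \<phi> x = t}" using pm B(2) unfolding proper_map_def top by blast
      then have "compactin (ArrTop S) {x \<in> \<theta> B. \<phi> x = t}" by (auto simp: compactin_subtopology)
      moreover have "{x \<in> \<theta> B. \<phi> x = t} \<subseteq> \<Union>\<U>" using \<U> tK \<theta>S by auto
      ultimately obtain \<F> where \<F>: "finite \<F>" "\<F> \<subseteq> \<U>" "{x \<in> \<theta> B. \<phi> x = t} \<subseteq> \<Union>\<F>"
        using compactinD \<U> by metis
      have cl: "\<exists>V. openin ?Y V \<and> y \<in> V \<and> {x \<in> \<theta> B. \<phi> x \<in> V} \<subseteq> U"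
        if "openin ?X U" "y \<in> B" "{x \<in> \<theta> B. \<phi> x = y} \<subseteq> U" for U y
        using pm that unfolding proper_map_def closed_map_fibre_neighbourhood top by blast
      have "openin (ArrTop S) (\<theta> B \<inter> \<Union>\<F>)"
        using \<U> \<F>(2) S.bisection_openin[OF \<theta>_bisection[OF B(1)]] by blast
      then have o1: "openin ?X (\<theta> B \<inter> \<Union>\<F>)"
        using S.bisection_openin[OF \<theta>_bisection[OF B(1)]] by (simp add: openin_open_subtopology)
      have o2: "{x \<in> \<theta> B. \<phi> x = t} \<subseteq> \<theta> B \<inter> \<Union>\<F>" using \<F>(3) by auto
      from cl[OF o1 B(2) o2] obtain V where V: "openin ?Y V" "t \<in> V" "{x \<in> \<theta> B. \<phi> x \<in> V} \<subseteq> \<theta> B \<inter> \<Union>\<F>"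
        by blast
      have "openin (ArrTop T) V" "V \<subseteq> B"
        using V(1) T.bisection_openin[OF B(1)] by (auto simp: openin_open_subtopology)
      moreover have "pre S \<phi> V \<subseteq> \<Union>\<F>"
      proof
        fix x assume x: "x \<in> pre S \<phi> V"
        then have "x \<in> {x \<in> \<theta> B. \<phi> x \<in> V}" using \<open>V \<subseteq> B\<close> by (auto simp: \<theta>_pre[OF B(1)])
        then show "x \<in> \<Union>\<F>" using V(3) by blast
      qed
      ultimately show ?thesis using V(2) \<F> by blast
    qed
    then obtain V \<F> where V: "\<And>t. t \<in> K \<Longrightarrow> openin (ArrTop T) (V t) \<and> t \<in> V t \<and> finite (\<F> t) \<and> \<F> t \<subseteq> \<U> \<and>
      pre S \<phi> (V t) \<subseteq> \<Union>(\<F> t)" by metis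
    have "\<exists>F\<subseteq>K. finite F \<and> K \<subseteq> \<Union>(V ` F)"
      by (rule compactin_pointwise[OF K]) (use V in auto)
    then obtain F where F: "F \<subseteq> K" "finite F" "K \<subseteq> \<Union>(V ` F)" by auto
    show "\<exists>\<F>. finite \<F> \<and> \<F> \<subseteq> \<U> \<and> ?P \<subseteq> \<Union>\<F>"
    proof (intro exI[of _ "\<Union>(\<F> ` F)"] conjI)
      show "finite (\<Union>(\<F> ` F))" using F V by auto
      show "\<Union>(\<F> ` F) \<subseteq> \<U>" using F V by blast
      show "?P \<subseteq> \<Union>(\<Union>(\<F> ` F))"
      proof
        fix x assume x: "x \<in> ?P"
        then obtain t where "t \<in> F" "\<phi> x \<in> V t" using F by auto
        moreover have "x \<in> pre S \<phi> (V t)" using x \<open>\<phi> x \<in> V t\<close> by simp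
        ultimately show "x \<in> \<Union>(\<Union>(\<F> ` F))" using V[of t] F(1) by blast
      qed
    qed
  qed auto
qed

theorem amp_hom_\<phi>: "amp_hom S T \<phi>"
  using sgpd_hom_\<phi> star_injective_\<phi> star_surjective_\<phi> continuous_\<phi> compact_preimages_\<phi>
  by (simp add: amp_hom_def covering_hom_def)

end

subsection \<open>The functor of compact open bisections\<close>

lemma Amp_simps [simp]:
  "Obj (Amp U) = {S. ample_inverse_semigroupoid S \<and> Arr S \<in> U \<and> Vert S \<in> U}"
  "Hom (Amp U) S T = {\<phi> \<in> extensional (Arr S). amp_hom S T \<phi>}"
  "Ident (Amp U) S = (\<lambda>a\<in>Arr S. a)"
  "Cmp (Amp U) R S T \<psi> \<phi> = compose (Arr R) \<psi> \<phi>"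
  by (simp_all add: Amp_def amp_hom_def)

lemma amp_hom_cong:
  assumes S: "ample_inverse_semigroupoid S" and e: "\<And>a. a \<in> Arr S \<Longrightarrow> \<psi> a = \<phi> a" and \<phi>: "amp_hom S T \<phi>"
  shows "amp_hom S T \<psi>"
proof -
  interpret S: ample S by (rule ample.intro[OF S])
  have h: "sgpd_hom S T \<phi>" using \<phi> by (simp add: amp_hom_def covering_hom_def)
  have "sgpd_hom S T \<psi>"
    unfolding sgpd_hom_def
  proof (intro conjI ballI)
    show "\<psi> \<in> Arr S \<rightarrow> Arr T" using h e by (auto simp: sgpd_hom_def)
    fix p assume p: "p \<in> Dom2 S"
    obtain a b where pab: "p = (a, b)" by (cases p)
    have ab: "a \<in> Arr S" "b \<in> Arr S" using S.Dom2_Arr[of a b] p pab by auto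
    then have "Mul S a b \<in> Arr S" using S.Dom2_iff[of a b] p pab by simp
    then show "case p of (a, b) \<Rightarrow> (\<psi> a, \<psi> b) \<in> Dom2 T \<and> Mul T (\<psi> a) (\<psi> b) = \<psi> (Mul S a b)"
      using h ab p pab by (auto simp: sgpd_hom_def e)
  qed
  moreover have "star_injective S \<psi>" using \<phi> e by (simp add: amp_hom_def covering_hom_def star_injective_def)
  moreover have "star_surjective S T \<psi>" using \<phi> e by (simp add: amp_hom_def covering_hom_def star_surjective_def)
  moreover have "continuous_map (ArrTop S) (ArrTop T) \<psi>"
    using \<phi> e continuous_map_eq[of "ArrTop S" "ArrTop T" \<phi> \<psi>] by (simp add: amp_hom_def)
  moreover have "{x \<in> topspace (ArrTop S). \<psi> x \<in> K} = {x \<in> topspace (ArrTop S). \<phi> x \<in> K}" for K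
    using e by auto
  then have "compact_preimages (ArrTop S) (ArrTop T) \<psi>" using \<phi> by (simp add: amp_hom_def compact_preimages_def)
  ultimately show ?thesis by (simp add: amp_hom_def covering_hom_def)
qed

lemma amp_hom_id: "ample_inverse_semigroupoid S \<Longrightarrow> amp_hom S S (\<lambda>a\<in>Arr S. a)"
proof -
  assume S: "ample_inverse_semigroupoid S"
  interpret S: ample S by (rule ample.intro[OF S])
  have "{x \<in> Arr S. x \<in> K} = K" if "compactin (ArrTop S) K" for K
    using compactin_subset_topspace[OF that] by auto
  moreover have "sgpd_hom S S (\<lambda>a. a)" by (auto simp: sgpd_hom_def)
  ultimately have "amp_hom S S (\<lambda>a. a)"
    using continuous_map_id[of "ArrTop S"]
    by (auto simp: amp_hom_def covering_hom_def star_injective_def star_surjective_def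
        compact_preimages_def id_def)
  then show ?thesis by (rule amp_hom_cong[OF S, rotated]) simp
qed

lemma amp_hom_comp:
  assumes R: "ample_inverse_semigroupoid R" and S: "ample_inverse_semigroupoid S"
    and T: "ample_inverse_semigroupoid T" and \<phi>: "amp_hom R S \<phi>" and \<psi>: "amp_hom S T \<psi>"
  shows "amp_hom R T (compose (Arr R) \<psi> \<phi>)"
proof -
  interpret RS: ample_pair R S using R S by (simp add: ample_pair_def ample_def)
  interpret ST: ample_pair S T using S T by (simp add: ample_pair_def ample_def)
  have h: "sgpd_hom R S \<phi>" "sgpd_hom S T \<psi>" using \<phi> \<psi> by (auto simp: amp_hom_def covering_hom_def)
  note A = RS.hom_Arr[OF h(1)] ST.hom_Arr[OF h(2)]
  have "sgpd_hom R T (\<lambda>a. \<psi> (\<phi> a))"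
    unfolding sgpd_hom_def
  proof (intro conjI ballI)
    show "(\<lambda>a. \<psi> (\<phi> a)) \<in> Arr R \<rightarrow> Arr T" using A by auto
    fix p assume "p \<in> Dom2 R"
    then show "case p of (a, b) \<Rightarrow> (\<psi> (\<phi> a), \<psi> (\<phi> b)) \<in> Dom2 T \<and> Mul T (\<psi> (\<phi> a)) (\<psi> (\<phi> b)) = \<psi> (\<phi> (Mul R a b))"
      using h unfolding sgpd_hom_def by fastforce
  qed
  moreover have "star_injective R (\<lambda>a. \<psi> (\<phi> a))"
    unfolding star_injective_def
  proof (intro ballI impI)
    fix a b assume a: "a \<in> Arr R" and b: "b \<in> Arr R" and ab: "src R a = src R b \<and> \<psi> (\<phi> a) = \<psi> (\<phi> b)"
    then have "src S (\<phi> a) = src S (\<phi> b)" using RS.hom_src[OF h(1)] by blast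
    then have "\<phi> a = \<phi> b" using \<psi> ab A a b unfolding amp_hom_def covering_hom_def star_injective_def by blast
    then show "a = b" using \<phi> ab a b unfolding amp_hom_def covering_hom_def star_injective_def by blast
  qed
  moreover have "star_surjective R T (\<lambda>a. \<psi> (\<phi> a))"
    unfolding star_surjective_def
  proof (intro ballI impI)
    fix t a assume t: "t \<in> Arr T" and a: "a \<in> Arr R" and ta: "src T t = src T (\<psi> (\<phi> a))"
    obtain s where s: "s \<in> Arr S" "src S s = src S (\<phi> a)" "\<psi> s = t"
      using \<psi> t ta A(1)[OF a] unfolding amp_hom_def covering_hom_def star_surjective_def by blast
    obtain b where "b \<in> Arr R" "src R b = src R a" "\<phi> b = s"
      using \<phi> s(1,2) a unfolding amp_hom_def covering_hom_def star_surjective_def by blast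
    then show "\<exists>b\<in>Arr R. src R b = src R a \<and> \<psi> (\<phi> b) = t" using s(3) by blast
  qed
  moreover have "continuous_map (ArrTop R) (ArrTop T) (\<lambda>a. \<psi> (\<phi> a))"
    using continuous_map_compose[of "ArrTop R" "ArrTop S" \<phi> "ArrTop T" \<psi>] \<phi> \<psi>
    by (simp add: amp_hom_def comp_def)
  moreover have "compact_preimages (ArrTop R) (ArrTop T) (\<lambda>a. \<psi> (\<phi> a))"
    unfolding compact_preimages_def
  proof (intro allI impI)
    fix K assume "compactin (ArrTop T) K"
    then have "compactin (ArrTop R) {x \<in> topspace (ArrTop R). \<phi> x \<in> {x \<in> topspace (ArrTop S). \<psi> x \<in> K}}"
      using \<phi> \<psi> by (auto simp: amp_hom_def compact_preimages_def)
    moreover have "{x \<in> topspace (ArrTop R). \<phi> x \<in> {x \<in> topspace (ArrTop S). \<psi> x \<in> K}} =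
      {x \<in> topspace (ArrTop R). \<psi> (\<phi> x) \<in> K}" using A by auto
    ultimately show "compactin (ArrTop R) {x \<in> topspace (ArrTop R). \<psi> (\<phi> x) \<in> K}" by simp
  qed
  ultimately have "amp_hom R T (\<lambda>a. \<psi> (\<phi> a))" by (simp add: amp_hom_def covering_hom_def)
  then show ?thesis by (rule amp_hom_cong[OF R, rotated]) (simp add: compose_def)
qed

lemma amp_hom_funcset:
  "ample_inverse_semigroupoid S \<Longrightarrow> amp_hom S T \<phi> \<Longrightarrow> \<phi> \<in> Arr S \<rightarrow> Arr T"
  by (simp add: amp_hom_def covering_hom_def sgpd_hom_def)

lemma category_Amp: "category (Amp U)"
  unfolding category_def
proof (intro conjI ballI)
  fix X Y f assume "f \<in> Hom (Amp U) X Y" "X \<in> Obj (Amp U)"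
  then have f: "f \<in> Arr X \<rightarrow> Arr Y" "f \<in> extensional (Arr X)" by (auto simp: amp_hom_funcset)
  show "Cmp (Amp U) X X Y f (Ident (Amp U) X) = f" using compose_Id[OF f] by simp
  show "Cmp (Amp U) X Y Y (Ident (Amp U) Y) f = f" using Id_compose[OF f] by simp
next
  fix W X Y Z f g h
  assume "f \<in> Hom (Amp U) W X" "W \<in> Obj (Amp U)"
  then have "f \<in> Arr W \<rightarrow> Arr X" by (auto simp: amp_hom_funcset)
  then show "Cmp (Amp U) W Y Z h (Cmp (Amp U) W X Y g f) = Cmp (Amp U) W X Z (Cmp (Amp U) X Y Z h g) f"
    by (auto simp: compose_def fun_eq_iff)
qed (auto intro: amp_hom_id amp_hom_comp)

definition KB_functor :: "('w top_semigroupoid, 'w \<Rightarrow> 'w, 'w set ord_semigroup, 'w set \<Rightarrow> 'w set) cat_map" where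
  "KB_functor = \<lparr>FObj = KB, FHom = (\<lambda>T S \<phi>. restrict (pre S \<phi>) (Car (KB T)))\<rparr>"

lemma opposite_simps [simp]:
  "Obj (opposite C) = Obj C" "Hom (opposite C) X Y = Hom C Y X" "Ident (opposite C) = Ident C"
  "Cmp (opposite C) X Y Z g f = Cmp C Z Y X f g"
  by (simp_all add: opposite_def)

theorem fully_faithful_KB: "fully_faithful (opposite (Amp UNIV)) (SigmaOrd UNIV) KB_functor"
  unfolding fully_faithful_def is_functor_def
proof (intro conjI ballI)
  fix X :: "'a top_semigroupoid" assume "X \<in> Obj (opposite (Amp UNIV))"
  then interpret X: ample X by (simp add: ample_def)
  show "FObj KB_functor X \<in> Obj (SigmaOrd UNIV)" by (simp add: KB_functor_def X.sigma_ordered_KB)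
  show "FHom KB_functor X X (Ident (opposite (Amp UNIV)) X) = Ident (SigmaOrd UNIV) (FObj KB_functor X)"
    using X.bisection_in_Arr by (auto simp: KB_functor_def fun_eq_iff restrict_def)
next
  fix T S :: "'a top_semigroupoid" and \<phi>
  assume "T \<in> Obj (opposite (Amp UNIV))" "S \<in> Obj (opposite (Amp UNIV))" "\<phi> \<in> Hom (opposite (Amp UNIV)) T S"
  then interpret ample_pair S T by (simp add: ample_pair_def ample_def)
  have "sigma_morphism (KB T) (KB S) (pre S \<phi>)"
    using \<open>\<phi> \<in> _\<close> by (intro sigma_morphism_pre) simp
  then have "sigma_morphism (KB T) (KB S) (restrict (pre S \<phi>) (Car (KB T)))"
    by (rule sigma_morphism_cong[OF T.sigma_ordered_KB S.sigma_ordered_KB]) simp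
  then show "FHom KB_functor T S \<phi> \<in> Hom (SigmaOrd UNIV) (FObj KB_functor T) (FObj KB_functor S)"
    by (simp add: KB_functor_def)
next
  fix T S R :: "'a top_semigroupoid" and \<psi> \<phi>
  assume *: "T \<in> Obj (opposite (Amp UNIV))" "S \<in> Obj (opposite (Amp UNIV))" "R \<in> Obj (opposite (Amp UNIV))"
    "\<psi> \<in> Hom (opposite (Amp UNIV)) T S" "\<phi> \<in> Hom (opposite (Amp UNIV)) S R"
  interpret ST: ample_pair S T using * by (simp add: ample_pair_def ample_def)
  interpret RS: ample_pair R S using * by (simp add: ample_pair_def ample_def)
  have f: "\<phi> \<in> Arr R \<rightarrow> Arr S" using * by (auto simp: amp_hom_funcset)
  have "bisection S (pre S \<psi> B)" if "bisection T B" for B using * that by (intro ST.bisection_pre) simp_all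
  then show "FHom KB_functor T R (Cmp (opposite (Amp UNIV)) T S R \<phi> \<psi>) =
    Cmp (SigmaOrd UNIV) (FObj KB_functor T) (FObj KB_functor S) (FObj KB_functor R)
      (FHom KB_functor S R \<phi>) (FHom KB_functor T S \<psi>)"
    using f by (auto simp: KB_functor_def fun_eq_iff compose_def restrict_def)
next
  fix T S :: "'a top_semigroupoid"
  assume *: "T \<in> Obj (opposite (Amp UNIV))" "S \<in> Obj (opposite (Amp UNIV))"
  then interpret ample_pair S T by (simp add: ample_pair_def ample_def)
  show "bij_betw (FHom KB_functor T S) (Hom (opposite (Amp UNIV)) T S)
      (Hom (SigmaOrd UNIV) (FObj KB_functor T) (FObj KB_functor S))"
    unfolding bij_betw_def
  proof
    show "inj_on (FHom KB_functor T S) (Hom (opposite (Amp UNIV)) T S)"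
    proof (rule inj_onI)
      fix \<phi> \<psi> assume f: "\<phi> \<in> Hom (opposite (Amp UNIV)) T S" "\<psi> \<in> Hom (opposite (Amp UNIV)) T S"
        and e: "FHom KB_functor T S \<phi> = FHom KB_functor T S \<psi>"
      have "pre S \<phi> B = pre S \<psi> B" if "bisection T B" for B
        using fun_cong[OF e, of B] that by (simp add: KB_functor_def)
      then have "\<phi> a = \<psi> a" if "a \<in> Arr S" for a
        using f that by (intro pre_cancel) (auto simp: amp_hom_def covering_hom_def)
      then show "\<phi> = \<psi>" using f by (intro extensionalityI[of _ "Arr S"]) auto
    qed
    show "FHom KB_functor T S ` Hom (opposite (Amp UNIV)) T S =
      Hom (SigmaOrd UNIV) (FObj KB_functor T) (FObj KB_functor S)"
    proof (intro set_eqI iffI)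
      fix \<theta> assume "\<theta> \<in> Hom (SigmaOrd UNIV) (FObj KB_functor T) (FObj KB_functor S)"
      then have t: "\<theta> \<in> extensional (Car (KB T))" "sigma_morphism (KB T) (KB S) \<theta>" by (simp_all add: KB_functor_def)
      interpret KB_morphism S T \<theta> by unfold_locales (rule t(2))
      have "\<theta> = FHom KB_functor T S \<phi>"
        using t(1) \<theta>_pre by (intro extensionalityI[of _ "Car (KB T)"]) (auto simp: KB_functor_def)
      then show "\<theta> \<in> FHom KB_functor T S ` Hom (opposite (Amp UNIV)) T S"
        using amp_hom_\<phi> \<phi>_extensional by auto
    next
      fix \<theta> assume "\<theta> \<in> FHom KB_functor T S ` Hom (opposite (Amp UNIV)) T S"
      then obtain \<phi> where f: "amp_hom S T \<phi>" "\<theta> = restrict (pre S \<phi>) (Car (KB T))"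
        by (auto simp: KB_functor_def)
      have "sigma_morphism (KB T) (KB S) \<theta>"
        by (rule sigma_morphism_cong[OF T.sigma_ordered_KB S.sigma_ordered_KB sigma_morphism_pre[OF f(1)]])
          (simp add: f(2))
      then show "\<theta> \<in> Hom (SigmaOrd UNIV) (FObj KB_functor T) (FObj KB_functor S)"
        using f(2) by (simp add: KB_functor_def)
    qed
  qed
qed

section \<open>Prime filters of sources\<close>

context sigma
begin

definition source_filter :: "'w set \<Rightarrow> bool" where
  "source_filter v \<longleftrightarrow> v \<subseteq> Car S \<and> v \<noteq> {} \<and>
    (\<forall>a\<in>v. \<forall>b. a \<preceq> b \<longrightarrow> b \<in> v) \<and> (\<forall>a\<in>v. \<forall>b\<in>v. a \<cdot> (b\<^sup>\<star> \<cdot> b) \<in> v)"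

text \<open>
  In a semigroup of compact open bisections, the bisections whose source contains a given vertex form such
  a prime filter with respect to containment of sources.
\<close>

definition vertex :: "'w set \<Rightarrow> bool" where
  "vertex v \<longleftrightarrow> source_filter v \<and> \<zero> \<notin> v \<and>
    (\<forall>a\<in>Car S. \<forall>b\<in>Car S. \<forall>c\<in>v. is_sup S {a, b} c \<longrightarrow> a \<in> v \<or> b \<in> v)"

text \<open>
  The filter generated by \<open>v\<close> and \<open>b\<close>.
\<close>

lemma source_filter_extend:
  assumes v: "source_filter v" and b: "b \<in> Car S"
  shows "source_filter {x. \<exists>f\<in>v. f \<cdot> (b\<^sup>\<star> \<cdot> b) \<preceq> x}" (is "source_filter ?w")
    and "v \<subseteq> {x. \<exists>f\<in>v. f \<cdot> (b\<^sup>\<star> \<cdot> b) \<preceq> x}" and "b \<in> {x. \<exists>f\<in>v. f \<cdot> (b\<^sup>\<star> \<cdot> b) \<preceq> x}"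
proof -
  have vC: "f \<in> Car S" if "f \<in> v" for f using v that by (auto simp: source_filter_def)
  show 1: "v \<subseteq> ?w" using src_le_mult_idem(1)[OF vC b] by blast
  obtain f where "f \<in> v" using v by (auto simp: source_filter_def)
  then show "b \<in> ?w" using src_le_mult_idem(2)[OF vC b] by blast
  show "source_filter ?w"
    unfolding source_filter_def
  proof (intro conjI ballI allI impI)
    show "?w \<subseteq> Car S" by (auto simp: src_le_def)
    show "?w \<noteq> {}" using 1 \<open>f \<in> v\<close> by blast
    show "y \<in> ?w" if "x \<in> ?w" "x \<preceq> y" for x y using that src_le_trans by blast
    show "x \<cdot> (y\<^sup>\<star> \<cdot> y) \<in> ?w" if xy: "x \<in> ?w" "y \<in> ?w" for x y
    proof -
      obtain f g where f: "f \<in> v" "f \<cdot> (b\<^sup>\<star> \<cdot> b) \<preceq> x" and g: "g \<in> v" "g \<cdot> (b\<^sup>\<star> \<cdot> b) \<preceq> y" using xy by blast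
      note [simp] = vC[OF f(1)] vC[OF g(1)] b
      let ?h = "f \<cdot> (g\<^sup>\<star> \<cdot> g)"
      have "?h \<in> v" using v f g by (auto simp: source_filter_def)
      moreover have "?h \<cdot> (b\<^sup>\<star> \<cdot> b) \<preceq> f \<cdot> (b\<^sup>\<star> \<cdot> b)"
        by (rule src_le_mult_right[OF src_le_mult_idem(1)]) simp_all
      then have "?h \<cdot> (b\<^sup>\<star> \<cdot> b) \<preceq> x" using f(2) src_le_trans by blast
      moreover have "?h \<cdot> (b\<^sup>\<star> \<cdot> b) \<preceq> g \<cdot> (b\<^sup>\<star> \<cdot> b)"
        by (rule src_le_mult_right[OF src_le_mult_idem(2)]) simp_all
      then have "?h \<cdot> (b\<^sup>\<star> \<cdot> b) \<preceq> y" using g(2) src_le_trans by blast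
      ultimately show ?thesis using src_le_meet by blast
    qed
  qed
qed

text \<open>
  The prime ideal theorem for sources: a filter that is maximal among those disjoint from the ideal \<open>I\<close> is
  prime, because enlarging it by either of two elements outside would let it meet \<open>I\<close>.
\<close>

theorem vertex_avoiding_ideal:
  assumes I0: "\<zero> \<in> I" and down: "\<And>x y. x \<preceq> y \<Longrightarrow> y \<in> I \<Longrightarrow> x \<in> I"
    and sup: "\<And>x y z. x \<in> I \<Longrightarrow> y \<in> I \<Longrightarrow> x \<in> Car S \<Longrightarrow> y \<in> Car S \<Longrightarrow> is_sup S {x, y} z \<Longrightarrow> z \<in> I"
    and a: "a \<in> Car S" "a \<notin> I"
  shows "\<exists>v. vertex v \<and> a \<in> v \<and> v \<inter> I = {}"
proof -
  let ?A = "{v. source_filter v \<and> a \<in> v \<and> v \<inter> I = {}}"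
  have "source_filter {b. a \<preceq> b}"
    unfolding source_filter_def
    using a src_le_meet src_le_trans src_le_refl src_le_Car(2) by blast
  then have "{b. a \<preceq> b} \<in> ?A" using a down by auto
  then have ne: "?A \<noteq> {}" by blast
  have un: "\<Union>\<C> \<in> ?A" if C: "\<C> \<noteq> {}" "subset.chain ?A \<C>" for \<C>
  proof -
    have CA: "\<C> \<subseteq> ?A" and lin: "\<And>v w. v \<in> \<C> \<Longrightarrow> w \<in> \<C> \<Longrightarrow> v \<subseteq> w \<or> w \<subseteq> v"
      using C(2) by (auto simp: subset.chain_def)
    have F: "source_filter v" if "v \<in> \<C>" for v using CA that by blast
    have "source_filter (\<Union>\<C>)"
      unfolding source_filter_def
    proof (intro conjI ballI allI impI)
      show "\<Union>\<C> \<subseteq> Car S" using F unfolding source_filter_def by blast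
      show "\<Union>\<C> \<noteq> {}" using C(1) CA by blast
      show "y \<in> \<Union>\<C>" if "x \<in> \<Union>\<C>" "x \<preceq> y" for x y
        using that F unfolding source_filter_def by blast
      show "x \<cdot> (y\<^sup>\<star> \<cdot> y) \<in> \<Union>\<C>" if xy: "x \<in> \<Union>\<C>" "y \<in> \<Union>\<C>" for x y
      proof -
        obtain v w where "v \<in> \<C>" "w \<in> \<C>" "x \<in> v" "y \<in> w" using xy by blast
        then obtain u where "u \<in> \<C>" "x \<in> u" "y \<in> u" using lin by blast
        then have "x \<cdot> (y\<^sup>\<star> \<cdot> y) \<in> u" using F unfolding source_filter_def by blast
        then show ?thesis using \<open>u \<in> \<C>\<close> by blast
      qed
    qed
    then show ?thesis using C(1) CA by blast
  qed
  have "\<exists>v\<in>?A. \<forall>w\<in>?A. v \<subseteq> w \<longrightarrow> w = v" by (rule subset_Zorn_nonempty[OF ne un])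
  then obtain v where vA: "v \<in> ?A" and maxA: "\<forall>w\<in>?A. v \<subseteq> w \<longrightarrow> w = v" by (rule bexE)
  have v: "source_filter v" "a \<in> v" "v \<inter> I = {}" using vA by simp_all
  have max: "w = v" if "source_filter w" "a \<in> w" "w \<inter> I = {}" "v \<subseteq> w" for w
    using maxA that by simp
  have meets: "\<exists>f\<in>v. f \<cdot> (b\<^sup>\<star> \<cdot> b) \<in> I" if b: "b \<in> Car S" "b \<notin> v" for b
  proof -
    let ?w = "{x. \<exists>f\<in>v. f \<cdot> (b\<^sup>\<star> \<cdot> b) \<preceq> x}"
    have "?w \<noteq> v" using source_filter_extend(3)[OF v(1) b(1)] b(2) by blast
    then have "?w \<inter> I \<noteq> {}"
      using max[OF source_filter_extend(1)[OF v(1) b(1)]] source_filter_extend(2)[OF v(1) b(1)] v(2) by blast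
    then show ?thesis using down by blast
  qed
  have "vertex v"
    unfolding vertex_def
  proof (intro conjI ballI impI)
    show "source_filter v" by (rule v)
    show "\<zero> \<notin> v" using I0 v(3) by blast
    fix b c d assume b [simp]: "b \<in> Car S" and c [simp]: "c \<in> Car S" and d: "d \<in> v" and bcd: "is_sup S {b, c} d"
    note [simp] = sup_Car[OF bcd]
    show "b \<in> v \<or> c \<in> v"
    proof (rule ccontr)
      assume "\<not> (b \<in> v \<or> c \<in> v)"
      then obtain f g where f: "f \<in> v" "f \<cdot> (b\<^sup>\<star> \<cdot> b) \<in> I" and g: "g \<in> v" "g \<cdot> (c\<^sup>\<star> \<cdot> c) \<in> I"
        using meets by (metis b c)
      have [simp]: "f \<in> Car S" "g \<in> Car S" using v(1) f g by (auto simp: source_filter_def)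
      let ?h = "f \<cdot> (g\<^sup>\<star> \<cdot> g)"
      have bd: "b \<sqsubseteq> d" and cd: "c \<sqsubseteq> d" using sup_upper[OF bcd] by auto
      have "is_sup S {d\<^sup>\<star> \<cdot> b, d\<^sup>\<star> \<cdot> c} (d\<^sup>\<star> \<cdot> d)" by (rule sup_left[OF bcd]) simp_all
      then have "is_sup S {b\<^sup>\<star> \<cdot> b, c\<^sup>\<star> \<cdot> c} (d\<^sup>\<star> \<cdot> d)"
        using nat_le_dom(1)[OF incl_le[OF bd]] nat_le_dom(1)[OF incl_le[OF cd]] by simp
      then have s: "is_sup S {?h \<cdot> (b\<^sup>\<star> \<cdot> b), ?h \<cdot> (c\<^sup>\<star> \<cdot> c)} (?h \<cdot> (d\<^sup>\<star> \<cdot> d))"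
        by (rule sup_left) simp_all
      have "?h \<cdot> (b\<^sup>\<star> \<cdot> b) \<preceq> f \<cdot> (b\<^sup>\<star> \<cdot> b)"
        by (rule src_le_mult_right[OF src_le_mult_idem(1)]) simp_all
      then have h1: "?h \<cdot> (b\<^sup>\<star> \<cdot> b) \<in> I" using f(2) by (rule down)
      have "?h \<cdot> (c\<^sup>\<star> \<cdot> c) \<preceq> g \<cdot> (c\<^sup>\<star> \<cdot> c)"
        by (rule src_le_mult_right[OF src_le_mult_idem(2)]) simp_all
      then have h2: "?h \<cdot> (c\<^sup>\<star> \<cdot> c) \<in> I" using g(2) by (rule down)
      have "?h \<cdot> (d\<^sup>\<star> \<cdot> d) \<in> I" by (rule sup[OF h1 h2 _ _ s]) simp_all
      moreover have "?h \<in> v" using v(1) f(1) g(1) unfolding source_filter_def by blast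
      then have "?h \<cdot> (d\<^sup>\<star> \<cdot> d) \<in> v" using v(1) d unfolding source_filter_def by blast
      ultimately show False using v(3) by blast
    qed
  qed
  then show ?thesis using v by blast
qed

lemma vertex_nonzero:
  assumes "x \<in> Car S" "x \<noteq> \<zero>" shows "\<exists>v. vertex v \<and> x \<in> v"
proof -
  have "\<exists>v. vertex v \<and> x \<in> v \<and> v \<inter> {\<zero>} = {}"
  proof (rule vertex_avoiding_ideal)
    show "z \<in> {\<zero>}" if "x \<in> {\<zero>}" "y \<in> {\<zero>}" "is_sup S {x, y} z" for x y z
      using that sup_unique[OF that(3)] sup_zero[OF zero_Car] by auto
  qed (use assms src_le_zero in auto)
  then show ?thesis by blast
qed

lemma vertex_Car: "vertex v \<Longrightarrow> a \<in> v \<Longrightarrow> a \<in> Car S"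
  and vertex_up: "vertex v \<Longrightarrow> a \<in> v \<Longrightarrow> a \<preceq> b \<Longrightarrow> b \<in> v"
  and vertex_meet: "vertex v \<Longrightarrow> a \<in> v \<Longrightarrow> b \<in> v \<Longrightarrow> a \<cdot> (b\<^sup>\<star> \<cdot> b) \<in> v"
  and vertex_zero: "vertex v \<Longrightarrow> \<zero> \<notin> v"
  and vertex_nonempty: "vertex v \<Longrightarrow> \<exists>a. a \<in> v"
  by (auto simp: vertex_def source_filter_def)

lemma vertex_prime: "\<lbrakk>vertex v; c \<in> v; is_sup S {a, b} c; a \<in> Car S; b \<in> Car S\<rbrakk> \<Longrightarrow> a \<in> v \<or> b \<in> v"
  unfolding vertex_def by blast

lemma vertex_incl: "vertex v \<Longrightarrow> a \<in> v \<Longrightarrow> a \<sqsubseteq> b \<Longrightarrow> b \<in> Car S \<Longrightarrow> b \<in> v"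
  using vertex_up incl_src_le vertex_Car by blast

lemma vertex_mult: "vertex v \<Longrightarrow> b \<cdot> a \<in> v \<Longrightarrow> a \<in> Car S \<Longrightarrow> b \<in> Car S \<Longrightarrow> a \<in> v"
  using vertex_up src_le_mult by blast

lemma vertex_restrict:
  assumes v: "vertex v" and a: "a \<in> v" and b: "b \<in> v"
  shows "\<exists>c\<in>v. c \<sqsubseteq> a \<and> c \<preceq> b"
proof -
  note [simp] = vertex_Car[OF v a] vertex_Car[OF v b]
  obtain c where c: "c \<in> Car S" "c \<sqsubseteq> a" "c \<preceq> a \<cdot> (b\<^sup>\<star> \<cdot> b)" "a \<cdot> (b\<^sup>\<star> \<cdot> b) \<preceq> c"
    using source_restriction[of a b] by auto
  have "c \<in> v" using vertex_up[OF v vertex_meet[OF v a b] c(4)] .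
  moreover have "c \<preceq> b" using c(3) src_le_mult_idem(2)[of a b] src_le_trans by simp
  ultimately show ?thesis using c by blast
qed

lemma vertex_orthogonal: "vertex v \<Longrightarrow> a \<in> v \<Longrightarrow> b \<in> v \<Longrightarrow> a \<cdot> b\<^sup>\<star> \<noteq> \<zero>"
proof
  assume v: "vertex v" "a \<in> v" "b \<in> v" and 0: "a \<cdot> b\<^sup>\<star> = \<zero>"
  note [simp] = vertex_Car[OF v(1,2)] vertex_Car[OF v(1,3)]
  have "a \<cdot> b\<^sup>\<star> \<cdot> b = \<zero>" using 0 by simp
  then show False using vertex_meet[OF v] vertex_zero[OF v(1)] by simp
qed

text \<open>Splitting \<open>a\<close> into the part over the source of \<open>b\<close> and its complement.\<close>

lemma vertex_separate:
  assumes v: "vertex v" and a: "a \<in> v" and b [simp]: "b \<in> Car S" and bv: "b \<notin> v"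
  shows "\<exists>c\<in>v. c \<sqsubseteq> a \<and> b \<cdot> c\<^sup>\<star> = \<zero>"
proof -
  note [simp] = vertex_Car[OF v a]
  obtain z where z: "z \<in> Car S" "z \<sqsubseteq> a" "z \<preceq> a \<cdot> (b\<^sup>\<star> \<cdot> b)" "a \<cdot> (b\<^sup>\<star> \<cdot> b) \<preceq> z"
    using source_restriction[of a b] by auto
  obtain c where [simp]: "c \<in> Car S" and c: "c \<sqsubseteq> a" "is_sup S {z, c} a" "z \<cdot> c\<^sup>\<star> = \<zero>"
    using complement[OF z(2)] z(1) by auto
  have "z \<notin> v"
    using vertex_up[OF v _ z(3)] vertex_up[OF v _ src_le_mult_idem(2)[of a b]] bv by auto
  then have "c \<in> v" using vertex_prime[OF v a c(2)] z(1) by simp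
  have "a \<cdot> (b\<^sup>\<star> \<cdot> b) \<cdot> c\<^sup>\<star> = \<zero>" by (rule src_leD[OF z(4) c(3)]) simp
  then have "a\<^sup>\<star> \<cdot> (a \<cdot> (b\<^sup>\<star> \<cdot> (b \<cdot> c\<^sup>\<star>))) = \<zero>" by simp
  then have "b\<^sup>\<star> \<cdot> (b \<cdot> (a\<^sup>\<star> \<cdot> (a \<cdot> c\<^sup>\<star>))) = \<zero>" by (simp add: star_star_comm(2)[of a b])
  then have "b\<^sup>\<star> \<cdot> (b \<cdot> c\<^sup>\<star>) = \<zero>" using nat_le_absorb(2)[OF incl_le[OF c(1)]] by simp
  then have "b \<cdot> (b\<^sup>\<star> \<cdot> (b \<cdot> c\<^sup>\<star>)) = \<zero>" by simp
  then have "b \<cdot> c\<^sup>\<star> = \<zero>" by simp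
  then show ?thesis using c(1) \<open>c \<in> v\<close> by blast
qed

lemma vertex_separate_finite:
  assumes v: "vertex v" and a: "a \<in> v" and J: "finite J" "J \<subseteq> Car S" "J \<inter> v = {}"
  shows "\<exists>c\<in>v. c \<sqsubseteq> a \<and> (\<forall>j\<in>J. j \<cdot> c\<^sup>\<star> = \<zero>)"
  using J
proof (induction J rule: finite_induct)
  case empty
  then show ?case using a vertex_Car[OF v a] by (intro bexI[of _ a]) simp_all
next
  case (insert b J)
  then obtain c where c: "c \<in> v" "c \<sqsubseteq> a" "\<And>j. j \<in> J \<Longrightarrow> j \<cdot> c\<^sup>\<star> = \<zero>" by auto
  obtain d where d: "d \<in> v" "d \<sqsubseteq> c" "b \<cdot> d\<^sup>\<star> = \<zero>" using vertex_separate[OF v c(1), of b] insert by auto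
  note [simp] = vertex_Car[OF v c(1)] vertex_Car[OF v d(1)] vertex_Car[OF v a]
  have "j \<cdot> d\<^sup>\<star> = \<zero>" if j: "j \<in> J" for j
  proof -
    have [simp]: "j \<in> Car S" using j insert by auto
    have "j \<cdot> d\<^sup>\<star> = j \<cdot> c\<^sup>\<star> \<cdot> (c \<cdot> d\<^sup>\<star>)" using nat_le_absorb(2)[OF incl_le[OF d(2)]] by simp
    then show ?thesis using c(3)[OF j] by (simp del: mult_assoc)
  qed
  moreover have "d \<sqsubseteq> a" using incl_trans[OF d(2) c(2)] by simp
  ultimately show ?case using d by (intro bexI[of _ d]) auto
qed

subsection \<open>The action on vertices and germs\<close>

text \<open>If \<open>a\<close> is a bisection and \<open>v\<close> a point of its source, \<open>act a v\<close> is the corresponding point of its range.\<close>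

definition act :: "'w \<Rightarrow> 'w set \<Rightarrow> 'w set" where
  "act a v = {b \<in> Car S. b \<cdot> a \<in> v}"

lemma in_act: "b \<in> act a v \<longleftrightarrow> b \<in> Car S \<and> b \<cdot> a \<in> v"
  by (simp add: act_def)

lemma vertex_dom: "vertex v \<Longrightarrow> a \<in> v \<Longrightarrow> a\<^sup>\<star> \<cdot> a \<in> v"
  using vertex_up src_le_dom(2) vertex_Car by blast

lemma star_in_act: "vertex v \<Longrightarrow> a \<in> v \<Longrightarrow> a\<^sup>\<star> \<in> act a v"
  by (simp add: in_act vertex_dom vertex_Car)

lemma vertex_act:
  assumes v: "vertex v" and a: "a \<in> v" shows "vertex (act a v)"
proof -
  note [simp] = vertex_Car[OF v a]
  show ?thesis
    unfolding vertex_def source_filter_def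
  proof (intro conjI ballI allI impI)
    show "act a v \<subseteq> Car S" by (auto simp: in_act)
    show "act a v \<noteq> {}" using star_in_act[OF v a] by blast
    show "\<zero> \<notin> act a v" using vertex_zero[OF v] by (simp add: in_act)
    show "y \<in> act a v" if "x \<in> act a v" "x \<preceq> y" for x y
      using vertex_up[OF v _ src_le_mult_right[OF that(2), of a]] that src_le_Car[OF that(2)]
      by (simp add: in_act)
    show "x \<cdot> (y\<^sup>\<star> \<cdot> y) \<in> act a v" if "x \<in> act a v" "y \<in> act a v" for x y
    proof -
      have x [simp]: "x \<in> Car S" "y \<in> Car S" and "x \<cdot> a \<in> v" "y \<cdot> a \<in> v" using that by (auto simp: in_act)
      then have "x \<cdot> a \<cdot> ((y \<cdot> a)\<^sup>\<star> \<cdot> (y \<cdot> a)) \<in> v" using vertex_meet[OF v] by blast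
      also have "x \<cdot> a \<cdot> ((y \<cdot> a)\<^sup>\<star> \<cdot> (y \<cdot> a)) = x \<cdot> (y\<^sup>\<star> \<cdot> y) \<cdot> a"
        using star_star_comm(4)[of y a a] by simp
      finally show ?thesis by (simp add: in_act)
    qed
    show "x \<in> act a v \<or> y \<in> act a v" if "x \<in> Car S" "y \<in> Car S" "z \<in> act a v" "is_sup S {x, y} z" for x y z
      using vertex_prime[OF v _ sup_right[OF that(4,1,2), of a]] that by (simp add: in_act)
  qed
qed

lemma act_star_act:
  assumes v: "vertex v" and a: "a \<in> v" shows "act (a\<^sup>\<star>) (act a v) = v"
proof (intro set_eqI iffI)
  note [simp] = vertex_Car[OF v a]
  fix b assume "b \<in> act (a\<^sup>\<star>) (act a v)"
  then have b: "b \<in> Car S" and ba: "b \<cdot> (a\<^sup>\<star> \<cdot> a) \<in> v" by (auto simp: in_act)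
  show "b \<in> v" by (rule vertex_up[OF v ba src_le_mult_idem(1)]) (simp_all add: b)
next
  note [simp] = vertex_Car[OF v a]
  fix b assume b: "b \<in> v"
  then show "b \<in> act (a\<^sup>\<star>) (act a v)"
    using vertex_meet[OF v b a] vertex_Car[OF v b] by (simp add: in_act)
qed

lemma act_act_star:
  assumes v: "vertex v" and a: "a \<in> Car S" "a\<^sup>\<star> \<in> v" shows "act a (act (a\<^sup>\<star>) v) = v" "a \<in> act (a\<^sup>\<star>) v"
  using act_star_act[OF v a(2)] star_in_act[OF v a(2)] a(1) by simp_all

lemma mult_vertex_iff:
  "vertex v \<Longrightarrow> a \<in> Car S \<Longrightarrow> b \<in> Car S \<Longrightarrow> a \<cdot> b \<in> v \<longleftrightarrow> b \<in> v \<and> a \<in> act b v"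
  using vertex_mult by (auto simp: in_act)

lemma act_mult: "a \<in> Car S \<Longrightarrow> b \<in> Car S \<Longrightarrow> act (a \<cdot> b) v = act a (act b v)"
  by (auto simp: in_act)

lemma act_incl:
  assumes v: "vertex v" and c: "c \<in> v" and ca: "c \<sqsubseteq> a" and a [simp]: "a \<in> Car S"
  shows "act c v = act a v"
proof (intro set_eqI iffI)
  note [simp] = vertex_Car[OF v c]
  fix b
  {
    assume "b \<in> act c v"
    then show "b \<in> act a v"
      using vertex_incl[OF v _ incl_left[OF ca, of b]] by (simp add: in_act)
  next
    assume "b \<in> act a v"
    then have [simp]: "b \<in> Car S" and "b \<cdot> a \<in> v" by (auto simp: in_act)
    then have "b \<cdot> a \<cdot> (c\<^sup>\<star> \<cdot> c) \<in> v" using vertex_meet[OF v _ c] by blast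
    then show "b \<in> act c v" using nat_le_right[OF incl_le[OF ca]] by (simp add: in_act)
  }
qed

lemma act_idem:
  assumes v: "vertex v" and e: "e \<in> idempotents S" "e \<in> v" shows "act e v = v"
proof (intro set_eqI iffI)
  note [simp] = idem_Car[OF e(1)]
  have ee: "e\<^sup>\<star> \<cdot> e = e" by (simp add: idem_star[OF e(1)] idem_idem[OF e(1)])
  fix b
  {
    assume "b \<in> act e v"
    then have b: "b \<in> Car S" "b \<cdot> (e\<^sup>\<star> \<cdot> e) \<in> v" using ee by (auto simp: in_act)
    show "b \<in> v" by (rule vertex_up[OF v b(2) src_le_mult_idem(1)]) (simp_all add: b)
  next
    assume b: "b \<in> v"
    then show "b \<in> act e v" using vertex_meet[OF v b e(2)] vertex_Car[OF v b] ee by (simp add: in_act)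
  }
qed

text \<open>
  The elements that coincide with \<open>a\<close> near \<open>v\<close>. When \<open>a \<in> v\<close>, this set determines \<open>v\<close> as well, so it
  can serve as an arrow.
\<close>

definition germ :: "'w \<Rightarrow> 'w set \<Rightarrow> 'w set" where
  "germ a v = {b \<in> Car S. \<exists>c\<in>v. c \<sqsubseteq> a \<and> c \<sqsubseteq> b}"

lemma germ_Car: "germ a v \<subseteq> Car S"
  by (auto simp: germ_def)

lemma germ_self: "vertex v \<Longrightarrow> a \<in> v \<Longrightarrow> a \<in> germ a v"
  unfolding germ_def using vertex_Car incl_refl by blast

lemma germ_subset:
  assumes v: "vertex v" and a: "a \<in> v" and b: "b \<in> v" and c: "c \<in> v" "c \<sqsubseteq> a" "c \<sqsubseteq> b"
  shows "germ a v \<subseteq> germ b v"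
proof
  fix x assume "x \<in> germ a v"
  then obtain d where x: "x \<in> Car S" and d: "d \<in> v" "d \<sqsubseteq> a" "d \<sqsubseteq> x" by (auto simp: germ_def)
  note [simp] = vertex_Car[OF v a] vertex_Car[OF v b] vertex_Car[OF v c(1)] vertex_Car[OF v d(1)] x
  let ?e = "d \<cdot> (c\<^sup>\<star> \<cdot> c)"
  have "?e \<sqsubseteq> c" "?e \<sqsubseteq> d" using meet_incl[OF c(2) d(2)] by simp_all
  then have "?e \<sqsubseteq> b" "?e \<sqsubseteq> x" using incl_trans[OF _ c(3)] incl_trans[OF _ d(3)] by simp_all
  then show "x \<in> germ b v" using vertex_meet[OF v d(1) c(1)] x by (auto simp: germ_def)
qed

text \<open>
  Each \<open>x \<in> v\<close> has in its source that of the restriction of \<open>a\<close> to the source of \<open>x\<close>, which belongs to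
  the germ of \<open>a\<close>.
\<close>

lemma germ_vertex:
  assumes v: "vertex v" and a: "a \<in> v"
  shows "v = {x. \<exists>f\<in>germ a v. f \<preceq> x}"
proof (intro set_eqI iffI)
  fix x assume x: "x \<in> v"
  obtain c where c: "c \<in> v" "c \<sqsubseteq> a" "c \<preceq> x" using vertex_restrict[OF v a x] by auto
  then have "c \<in> germ a v" using vertex_Car[OF v] by (auto simp: germ_def)
  then show "x \<in> {x. \<exists>f\<in>germ a v. f \<preceq> x}" using c(3) by blast
next
  fix x assume "x \<in> {x. \<exists>f\<in>germ a v. f \<preceq> x}"
  then obtain f c where "f \<preceq> x" "f \<in> Car S" "c \<in> v" "c \<sqsubseteq> f" by (auto simp: germ_def)
  then show "x \<in> v" using vertex_incl[OF v] vertex_up[OF v] by blast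
qed

lemma germ_eq_iff:
  assumes v: "vertex v" and w: "vertex w" and a: "a \<in> v" and b: "b \<in> w"
  shows "germ a v = germ b w \<longleftrightarrow> v = w \<and> (\<exists>c\<in>v. c \<sqsubseteq> a \<and> c \<sqsubseteq> b)"
proof
  assume e: "germ a v = germ b w"
  then have "v = w" using germ_vertex[OF v a] germ_vertex[OF w b] by simp
  moreover have "b \<in> germ a v" using e germ_self[OF w b] by simp
  then have "\<exists>c\<in>v. c \<sqsubseteq> a \<and> c \<sqsubseteq> b" by (auto simp: germ_def)
  ultimately show "v = w \<and> (\<exists>c\<in>v. c \<sqsubseteq> a \<and> c \<sqsubseteq> b)" by blast
next
  assume "v = w \<and> (\<exists>c\<in>v. c \<sqsubseteq> a \<and> c \<sqsubseteq> b)"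
  then obtain c where "v = w" "c \<in> v" "c \<sqsubseteq> a" "c \<sqsubseteq> b" by blast
  then show "germ a v = germ b w"
    using germ_subset[OF v a] germ_subset[OF v _ a] b by blast
qed

end

section \<open>The spectrum of a Sigma-ordered inverse semigroup\<close>

definition base_topology :: "'a set set \<Rightarrow> 'a topology" where
  "base_topology \<B> = topology (\<lambda>U. U \<subseteq> \<Union>\<B> \<and> (\<forall>x\<in>U. \<exists>W\<in>\<B>. x \<in> W \<and> W \<subseteq> U))"

lemma openin_base_topology:
  assumes "\<And>V W x. V \<in> \<B> \<Longrightarrow> W \<in> \<B> \<Longrightarrow> x \<in> V \<inter> W \<Longrightarrow> \<exists>X\<in>\<B>. x \<in> X \<and> X \<subseteq> V \<inter> W"
  shows "openin (base_topology \<B>) U \<longleftrightarrow> U \<subseteq> \<Union>\<B> \<and> (\<forall>x\<in>U. \<exists>W\<in>\<B>. x \<in> W \<and> W \<subseteq> U)"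
proof -
  let ?L = "\<lambda>U. U \<subseteq> \<Union>\<B> \<and> (\<forall>x\<in>U. \<exists>W\<in>\<B>. x \<in> W \<and> W \<subseteq> U)"
  have "istopology ?L"
    unfolding istopology_def
  proof (rule conjI; intro allI impI)
    fix X Y assume X: "?L X" and Y: "?L Y"
    have "\<exists>W\<in>\<B>. x \<in> W \<and> W \<subseteq> X \<inter> Y" if "x \<in> X \<inter> Y" for x
    proof -
      obtain V W where "V \<in> \<B>" "x \<in> V" "V \<subseteq> X" "W \<in> \<B>" "x \<in> W" "W \<subseteq> Y" using X Y \<open>x \<in> X \<inter> Y\<close> by blast
      then show ?thesis using assms[of V W x] by blast
    qed
    then show "?L (X \<inter> Y)" using X by blast
  next
    fix \<K> assume K: "\<forall>X\<in>\<K>. ?L X"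
    have "\<exists>W\<in>\<B>. x \<in> W \<and> W \<subseteq> \<Union>\<K>" if "x \<in> \<Union>\<K>" for x
      using K that by (meson Sup_upper UnionE subset_trans)
    then show "?L (\<Union>\<K>)" using K by blast
  qed
  then show ?thesis by (simp add: base_topology_def topology_inverse')
qed

lemma topspace_base_topology:
  assumes "\<And>V W x. V \<in> \<B> \<Longrightarrow> W \<in> \<B> \<Longrightarrow> x \<in> V \<inter> W \<Longrightarrow> \<exists>X\<in>\<B>. x \<in> X \<and> X \<subseteq> V \<inter> W"
  shows "topspace (base_topology \<B>) = \<Union>\<B>"
proof
  show "topspace (base_topology \<B>) \<subseteq> \<Union>\<B>"
    using openin_topspace[of "base_topology \<B>"] openin_base_topology[OF assms] by blast
  have "openin (base_topology \<B>) (\<Union>\<B>)" using openin_base_topology[OF assms, of "\<Union>\<B>"] by blast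
  then show "\<Union>\<B> \<subseteq> topspace (base_topology \<B>)" by (rule openin_subset)
qed

text \<open>
  Vertices and germs are subsets of the semigroup; \<open>code\<close> names them by elements of an arbitrary type.
\<close>

locale spectrum = sigma S for S :: "'w ord_semigroup" (structure) +
  fixes code :: "'w set \<Rightarrow> 'p"
  assumes code: "inj_on code (Pow (Car S))"
begin

lemma code_eq: "v \<subseteq> Car S \<Longrightarrow> w \<subseteq> Car S \<Longrightarrow> code v = code w \<longleftrightarrow> v = w"
  using code by (auto simp: inj_on_eq_iff)

lemma code_vertex [simp]: "vertex v \<Longrightarrow> vertex w \<Longrightarrow> code v = code w \<longleftrightarrow> v = w"
  using vertex_Car by (intro code_eq) blast+

definition pt :: "'w \<Rightarrow> 'w set \<Rightarrow> 'p" where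
  "pt a v = code (germ a v)"

lemma pt_eq_iff:
  "\<lbrakk>vertex v; vertex w; a \<in> v; b \<in> w\<rbrakk> \<Longrightarrow> pt a v = pt b w \<longleftrightarrow> v = w \<and> (\<exists>c\<in>v. c \<sqsubseteq> a \<and> c \<sqsubseteq> b)"
  unfolding pt_def code_eq[OF germ_Car germ_Car] by (rule germ_eq_iff)

lemma pt_incl: "\<lbrakk>vertex v; c \<in> v; c \<sqsubseteq> a; a \<in> Car S\<rbrakk> \<Longrightarrow> pt c v = pt a v"
  using vertex_incl[of v c a] vertex_Car[of v c] incl_refl[of c] by (subst pt_eq_iff) blast+

definition Dset :: "'w \<Rightarrow> 'p set" where
  "Dset a = {code v |v. vertex v \<and> a \<in> v}"

definition hat :: "'w \<Rightarrow> 'p set" where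
  "hat a = {pt a v |v. vertex v \<and> a \<in> v}"

lemma code_in_Dset [simp]: "vertex v \<Longrightarrow> code v \<in> Dset a \<longleftrightarrow> a \<in> v"
  using code_vertex by (auto simp: Dset_def)

lemma DsetE: assumes "u \<in> Dset a" obtains v where "vertex v" "a \<in> v" "u = code v"
  using assms by (auto simp: Dset_def)

lemma pt_in_hat: "vertex v \<Longrightarrow> a \<in> v \<Longrightarrow> pt a v \<in> hat a"
  by (auto simp: hat_def)

lemma hatE: assumes "x \<in> hat a" obtains v where "vertex v" "a \<in> v" "x = pt a v"
  using assms by (auto simp: hat_def)

lemma pt_in_hat_iff: "\<lbrakk>vertex v; a \<in> v\<rbrakk> \<Longrightarrow> pt a v \<in> hat b \<longleftrightarrow> b \<in> v \<and> pt a v = pt b v"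
  by (auto simp: pt_in_hat elim!: hatE) (auto simp: pt_eq_iff)

lemma hat_mono:
  assumes "a \<sqsubseteq> b" "a \<in> Car S" "b \<in> Car S" shows "hat a \<subseteq> hat b"
proof
  fix x assume "x \<in> hat a"
  then obtain v where "vertex v" "a \<in> v" "x = pt a v" by (rule hatE)
  then show "x \<in> hat b" using pt_incl[of v a b] pt_in_hat[of v b] vertex_incl[of v a b] assms by simp
qed

text \<open>
  Source, range and product of germs are given on representatives.
\<close>

definition sp_src :: "'p \<Rightarrow> 'p" where
  "sp_src x = (THE u. \<exists>a v. vertex v \<and> a \<in> v \<and> x = pt a v \<and> u = code v)"

definition sp_rng :: "'p \<Rightarrow> 'p" where
  "sp_rng x = (THE u. \<exists>a v. vertex v \<and> a \<in> v \<and> x = pt a v \<and> u = code (act a v))"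

definition sp_mul :: "'p \<Rightarrow> 'p \<Rightarrow> 'p" where
  "sp_mul x y = (THE z. \<exists>a b v. vertex v \<and> b \<in> v \<and> a \<in> act b v \<and>
     x = pt a (act b v) \<and> y = pt b v \<and> z = pt (a \<cdot> b) v)"

lemma sp_src_pt [simp]:
  assumes "vertex v" "a \<in> v" shows "sp_src (pt a v) = code v"
  unfolding sp_src_def using assms by (intro the_equality) (auto simp: pt_eq_iff)

lemma sp_rng_pt [simp]:
  assumes v: "vertex v" and a: "a \<in> v" shows "sp_rng (pt a v) = code (act a v)"
  unfolding sp_rng_def
proof (rule the_equality)
  show "\<exists>b w. vertex w \<and> b \<in> w \<and> pt a v = pt b w \<and> code (act a v) = code (act b w)"
    using assms by blast
  fix u assume "\<exists>b w. vertex w \<and> b \<in> w \<and> pt a v = pt b w \<and> u = code (act b w)"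
  then obtain b w where *: "vertex w" "b \<in> w" "pt a v = pt b w" "u = code (act b w)" by blast
  then obtain c where "v = w" "c \<in> v" "c \<sqsubseteq> a" "c \<sqsubseteq> b" using pt_eq_iff[OF v *(1) a *(2)] by blast
  then have "act a v = act b w"
    using act_incl[OF v, of c a] act_incl[OF v, of c b] vertex_Car[OF v a] vertex_Car[OF *(1,2)] by simp
  then show "u = code (act a v)" using * by simp
qed

lemma sp_mul_pt:
  assumes v: "vertex v" and b: "b \<in> v" and w: "w = act b v" and a: "a \<in> w"
  shows "sp_mul (pt a w) (pt b v) = pt (a \<cdot> b) v"
  unfolding sp_mul_def
proof (rule the_equality)
  show "\<exists>a' b' v'. vertex v' \<and> b' \<in> v' \<and> a' \<in> act b' v' \<and>
     pt a w = pt a' (act b' v') \<and> pt b v = pt b' v' \<and> pt (a \<cdot> b) v = pt (a' \<cdot> b') v'"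
    using assms by blast
  fix z assume "\<exists>a' b' v'. vertex v' \<and> b' \<in> v' \<and> a' \<in> act b' v' \<and>
     pt a w = pt a' (act b' v') \<and> pt b v = pt b' v' \<and> z = pt (a' \<cdot> b') v'"
  then obtain a' b' v' where *: "vertex v'" "b' \<in> v'" "a' \<in> act b' v'"
     "pt a w = pt a' (act b' v')" "pt b v = pt b' v'" "z = pt (a' \<cdot> b') v'" by blast
  obtain c where c: "v = v'" "c \<in> v" "c \<sqsubseteq> b" "c \<sqsubseteq> b'"
    using pt_eq_iff[OF v *(1) b *(2)] *(5) by blast
  have vw: "vertex w" "vertex (act b' v')" using vertex_act v b w * by auto
  obtain d where d: "d \<in> w" "d \<sqsubseteq> a" "d \<sqsubseteq> a'"
    using pt_eq_iff[OF vw a *(3)] *(4) by blast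
  note [simp] = vertex_Car[OF v b] vertex_Car[OF v c(2)] vertex_Car[OF *(1,2)] vertex_Car[OF vw(1) a]
    vertex_Car[OF vw(1) d(1)] vertex_Car[OF vw(2) *(3)]
  have "d \<in> act c v" using d(1) w act_incl[OF v c(2,3)] by simp
  then have "d \<cdot> c \<in> v" by (simp add: in_act)
  moreover have "d \<cdot> c \<sqsubseteq> a \<cdot> b"
    using incl_trans[OF incl_right[OF d(2), of c] incl_left[OF c(3), of a]] by simp
  moreover have "d \<cdot> c \<sqsubseteq> a' \<cdot> b'"
    using incl_trans[OF incl_right[OF d(3), of c] incl_left[OF c(4), of a']] by simp
  ultimately show "z = pt (a \<cdot> b) v"
    using pt_incl[OF v, of "d \<cdot> c" "a \<cdot> b"] pt_incl[OF v, of "d \<cdot> c" "a' \<cdot> b'"] *(6) c(1) by simp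
qed

definition AS :: "'p set" where "AS = \<Union>(hat ` Car S)"
definition VS :: "'p set" where "VS = \<Union>(Dset ` Car S)"

lemma hat_subset: "a \<in> Car S \<Longrightarrow> hat a \<subseteq> AS" and Dset_subset: "a \<in> Car S \<Longrightarrow> Dset a \<subseteq> VS"
  by (auto simp: AS_def VS_def)

definition Spec :: "'p top_semigroupoid" where
  "Spec = \<lparr>Arr = AS,
     Dom2 = {(x, y). x \<in> AS \<and> y \<in> AS \<and> sp_src x = sp_rng y},
     Mul = sp_mul, Vert = VS, src = sp_src, rng = sp_rng,
     ArrTop = base_topology (hat ` Car S), VertTop = base_topology (Dset ` Car S)\<rparr>"

lemma Spec_simps [simp]:
  "Arr Spec = AS"
  "Dom2 Spec = {(x, y). x \<in> AS \<and> y \<in> AS \<and> sp_src x = sp_rng y}"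
  "Mul Spec = sp_mul" "Vert Spec = VS" "src Spec = sp_src" "rng Spec = sp_rng"
  "ArrTop Spec = base_topology (hat ` Car S)" "VertTop Spec = base_topology (Dset ` Car S)"
  by (simp_all add: Spec_def)

lemma pt_in_AS [simp]: "vertex v \<Longrightarrow> a \<in> v \<Longrightarrow> pt a v \<in> AS"
  using pt_in_hat vertex_Car unfolding AS_def by blast

lemma ASE:
  assumes "x \<in> AS" obtains a v where "vertex v" "a \<in> v" "x = pt a v" "a \<in> Car S"
  using assms by (auto simp: AS_def elim: hatE)

lemma VSE:
  assumes "u \<in> VS" obtains v where "vertex v" "u = code v"
  using assms by (auto simp: VS_def elim: DsetE)

lemma code_in_VS [simp]: "vertex v \<Longrightarrow> code v \<in> VS"
  using vertex_nonempty[of v] vertex_Car[of v] by (auto simp: VS_def)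

subsection \<open>The inverse semigroupoid of germs\<close>

lemma composableE:
  assumes "x \<in> AS" "y \<in> AS" "sp_src x = sp_rng y"
  obtains a b v where "vertex v" "b \<in> v" "vertex (act b v)" "a \<in> act b v" "x = pt a (act b v)" "y = pt b v"
    "a \<in> Car S" "b \<in> Car S"
proof -
  obtain a w where x: "vertex w" "a \<in> w" "x = pt a w" "a \<in> Car S" using assms(1) by (rule ASE)
  obtain b v where y: "vertex v" "b \<in> v" "y = pt b v" "b \<in> Car S" using assms(2) by (rule ASE)
  have "w = act b v" using assms(3) x y vertex_act[of v b] by simp
  then show ?thesis using that[of v b a] x y by simp
qed

lemma sp_mul_AS:
  assumes "x \<in> AS" "y \<in> AS" "sp_src x = sp_rng y"
  shows "sp_mul x y \<in> AS" "sp_src (sp_mul x y) = sp_src y" "sp_rng (sp_mul x y) = sp_rng x"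
proof -
  obtain a b v where *: "vertex v" "b \<in> v" "vertex (act b v)" "a \<in> act b v" "x = pt a (act b v)"
    "y = pt b v" "a \<in> Car S" "b \<in> Car S"
    using composableE[OF assms] .
  have ab: "a \<cdot> b \<in> v" using * by (simp add: in_act)
  have m: "sp_mul x y = pt (a \<cdot> b) v" using * sp_mul_pt by simp
  show "sp_mul x y \<in> AS" "sp_src (sp_mul x y) = sp_src y" "sp_rng (sp_mul x y) = sp_rng x"
    unfolding m using * ab by (simp_all add: act_mult)
qed

lemma sp_mul_assoc:
  assumes x: "x \<in> AS" and y: "y \<in> AS" and z: "z \<in> AS" and xy: "sp_src x = sp_rng y" and yz: "sp_src y = sp_rng z"
  shows "sp_mul (sp_mul x y) z = sp_mul x (sp_mul y z)"
proof -
  obtain b c v where *: "vertex v" "c \<in> v" "vertex (act c v)" "b \<in> act c v" "y = pt b (act c v)"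
    "z = pt c v" "b \<in> Car S" "c \<in> Car S"
    using composableE[OF y z yz] .
  obtain a w where x: "vertex w" "a \<in> w" "x = pt a w" "a \<in> Car S" using x by (rule ASE)
  have w: "w = act b (act c v)" using xy x * vertex_act[OF *(3,4)] by simp
  have bc: "b \<cdot> c \<in> v" and ab: "a \<cdot> b \<in> act c v" using * x w by (simp_all add: in_act)
  have "sp_mul x y = pt (a \<cdot> b) (act c v)" using sp_mul_pt[OF *(3,4) w x(2)] x * by simp
  moreover have "sp_mul y z = pt (b \<cdot> c) v" using sp_mul_pt[OF *(1,2) refl *(4)] * by simp
  moreover have "w = act (b \<cdot> c) v" using w * by (simp add: act_mult)
  ultimately show ?thesis
    using sp_mul_pt[OF *(1,2) refl ab] sp_mul_pt[OF *(1) bc _ x(2)] x * by simp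
qed

lemma is_semigroupoid_Spec: "is_semigroupoid Spec"
  unfolding is_semigroupoid_def
proof (intro conjI ballI)
  show "Dom2 Spec \<subseteq> Arr Spec \<times> Arr Spec" by auto
  show "case p of (x, y) \<Rightarrow> Mul Spec x y \<in> Arr Spec" if "p \<in> Dom2 Spec" for p
    using that sp_mul_AS(1) by (cases p) simp
  fix x y z assume "x \<in> Arr Spec" "y \<in> Arr Spec" "z \<in> Arr Spec"
  then have *: "x \<in> AS" "y \<in> AS" "z \<in> AS" by simp_all
  show "((x, y) \<in> Dom2 Spec \<and> (y, z) \<in> Dom2 Spec) = ((x, y) \<in> Dom2 Spec \<and> (Mul Spec x y, z) \<in> Dom2 Spec)"
    "((x, y) \<in> Dom2 Spec \<and> (y, z) \<in> Dom2 Spec) = ((y, z) \<in> Dom2 Spec \<and> (x, Mul Spec y z) \<in> Dom2 Spec)"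
    "(x, y) \<in> Dom2 Spec \<and> (y, z) \<in> Dom2 Spec \<longrightarrow> Mul Spec (Mul Spec x y) z = Mul Spec x (Mul Spec y z)"
    using * sp_mul_AS sp_mul_assoc by (auto)
qed

lemma compatible_graph_Spec: "compatible_graph Spec"
proof -
  have "VS = sp_src ` AS \<union> sp_rng ` AS"
  proof (intro set_eqI iffI)
    fix u assume "u \<in> VS"
    then obtain v where v: "vertex v" "u = code v" by (rule VSE)
    obtain a where a: "a \<in> v" using vertex_nonempty[OF v(1)] by blast
    have "u = sp_src (pt a v)" using v a by simp
    then show "u \<in> sp_src ` AS \<union> sp_rng ` AS" using pt_in_AS[OF v(1) a] by blast
  next
    fix u assume "u \<in> sp_src ` AS \<union> sp_rng ` AS"
    then obtain x where x: "x \<in> AS" "u = sp_src x \<or> u = sp_rng x" by blast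
    obtain a v where "vertex v" "a \<in> v" "x = pt a v" using x(1) by (rule ASE)
    then have "u = code v \<or> u = code (act a v)" "vertex (act a v)" using x(2) vertex_act by auto
    then show "u \<in> VS" using code_in_VS \<open>vertex v\<close> by metis
  qed
  then show ?thesis
    using sp_mul_AS by (auto simp: compatible_graph_def)
qed

lemma sginv_pt:
  assumes v: "vertex v" and a: "a \<in> v"
  shows "is_sginv Spec (pt a v) (pt (a\<^sup>\<star>) (act a v))"
proof -
  have aC [simp]: "a \<in> Car S" by (rule vertex_Car[OF v a])
  note w = vertex_act[OF v a] and s = star_in_act[OF v a] and sa = act_star_act[OF v a]
  have 1: "sp_mul (pt a v) (pt (a\<^sup>\<star>) (act a v)) = pt (a \<cdot> a\<^sup>\<star>) (act a v)"
    by (rule sp_mul_pt[OF w s sa[symmetric] a])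
  have 2: "sp_mul (pt (a\<^sup>\<star>) (act a v)) (pt a v) = pt (a\<^sup>\<star> \<cdot> a) v"
    by (rule sp_mul_pt[OF v a refl s])
  have "a \<cdot> a\<^sup>\<star> \<in> act a v" using a by (simp add: in_act)
  from sp_mul_pt[OF v a refl this]
  have 3: "sp_mul (pt (a \<cdot> a\<^sup>\<star>) (act a v)) (pt a v) = pt a v" by simp
  have "a\<^sup>\<star> \<cdot> a \<in> v" by (rule vertex_dom[OF v a])
  from sp_mul_pt[OF w s sa[symmetric] this]
  have 4: "sp_mul (pt (a\<^sup>\<star> \<cdot> a) v) (pt (a\<^sup>\<star>) (act a v)) = pt (a\<^sup>\<star>) (act a v)" by simp
  show ?thesis
    unfolding is_sginv_def using v a w s sa 1 2 3 4 pt_in_AS[OF v a] pt_in_AS[OF w s]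
    by simp
qed

text \<open>
  If \<open>pt e v\<close> is idempotent, then \<open>e\<close> and \<open>ee\<close> agree on some \<open>c \<in> v\<close>, and such a \<open>c\<close> is idempotent. So
  idempotent germs inherit commutativity from the idempotents of the semigroup.
\<close>

lemma idempotent_pt:
  assumes p: "p \<in> AS" "sp_src p = sp_rng p" "sp_mul p p = p"
  obtains e v where "vertex v" "e \<in> v" "e \<in> idempotents S" "p = pt e v"
proof -
  obtain e v where v: "vertex v" "e \<in> v" "p = pt e v" "e \<in> Car S" using p(1) by (rule ASE)
  have ae: "act e v = v" using p(2) v vertex_act[OF v(1,2)] by simp
  have "e \<in> act e v" using ae v(2) by simp
  then have "e \<cdot> e \<in> v" by (simp add: in_act)
  moreover have "pt (e \<cdot> e) v = pt e v"
    using sp_mul_pt[OF v(1,2) ae[symmetric] v(2)] p(3) unfolding v(3) by metis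
  ultimately obtain c where c: "c \<in> v" "c \<sqsubseteq> e \<cdot> e" "c \<sqsubseteq> e"
    using pt_eq_iff[OF v(1,1)] v(2) by blast
  note [simp] = vertex_Car[OF v(1) c(1)] v(4)
  note l = nat_le_facts[OF incl_le[OF c(3)]] and m = nat_le_facts[OF incl_le[OF c(2)]]
  have "e \<cdot> c = e \<cdot> (e \<cdot> (c\<^sup>\<star> \<cdot> c))" using l(1) by simp
  also have "\<dots> = c" using m(1) by simp
  finally have ec: "e \<cdot> c = c" .
  have "c \<cdot> c = c \<cdot> (c\<^sup>\<star> \<cdot> e) \<cdot> c" using l(4) by simp
  also have "\<dots> = c" using ec by simp
  finally have "c \<in> idempotents S" by (simp add: idemI)
  moreover have "p = pt c v" using pt_incl[OF v(1) c(1,3)] v by simp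
  ultimately show ?thesis using that v(1) c(1) by blast
qed

lemma idempotents_commute:
  assumes "p \<in> AS" "sp_src p = sp_rng p" "sp_mul p p = p"
    and "q \<in> AS" "sp_src q = sp_rng q" "sp_mul q q = q" and pq: "sp_src p = sp_src q"
  shows "sp_mul p q = sp_mul q p"
proof -
  obtain e v where e: "vertex v" "e \<in> v" "e \<in> idempotents S" "p = pt e v" using idempotent_pt[OF assms(1-3)] .
  obtain f w where f: "vertex w" "f \<in> w" "f \<in> idempotents S" "q = pt f w" using idempotent_pt[OF assms(4-6)] .
  have "w = v" using pq e f by simp
  have "sp_mul p q = pt (e \<cdot> f) v"
    using sp_mul_pt[OF f(1,2) act_idem[OF f(1,3,2), symmetric], of e] e f \<open>w = v\<close> by simp
  moreover have "sp_mul q p = pt (f \<cdot> e) v"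
    using sp_mul_pt[OF e(1,2) act_idem[OF e(1,3,2), symmetric], of f] e f \<open>w = v\<close> by simp
  ultimately show ?thesis using idem_comm[OF e(3) f(3)] by simp
qed

text \<open>
  Regularity and commuting idempotents force uniqueness: two inverses \<open>y\<close> and \<open>z\<close> of \<open>x\<close> both equal \<open>yxz\<close>.
\<close>

lemma is_sginv_unique:
  assumes x: "x \<in> AS" and y: "is_sginv Spec x y" and z: "is_sginv Spec x z"
  shows "y = z"
proof -
  have Y: "y \<in> AS" "sp_src x = sp_rng y" "sp_src y = sp_rng x" "sp_mul (sp_mul x y) x = x" "sp_mul (sp_mul y x) y = y"
    using y by (auto simp: is_sginv_def)
  have Z: "z \<in> AS" "sp_src x = sp_rng z" "sp_src z = sp_rng x" "sp_mul (sp_mul x z) x = x" "sp_mul (sp_mul z x) z = z"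
    using z by (auto simp: is_sginv_def)
  note [simp] = x Y(1) Y(2)[symmetric] Y(3) Z(1) Z(2)[symmetric] Z(3) sp_mul_AS
  note a = sp_mul_assoc
  have xyx: "sp_mul x (sp_mul y x) = x" and xzx: "sp_mul x (sp_mul z x) = x"
    and yxy: "sp_mul y (sp_mul x y) = y" and zxz: "sp_mul z (sp_mul x z) = z"
    using Y(4,5) Z(4,5) by (simp_all add: a)
  have i: "sp_mul (sp_mul x u) (sp_mul x u) = sp_mul x u" "sp_mul (sp_mul u x) (sp_mul u x) = sp_mul u x"
    if u: "u \<in> AS" "sp_src x = sp_rng u" "sp_src u = sp_rng x" "sp_mul x (sp_mul u x) = x" for u
  proof -
    note [simp] = u(1) u(2)[symmetric] u(3)
    have "sp_mul (sp_mul x u) (sp_mul x u) = sp_mul (sp_mul x (sp_mul u x)) u" by (simp add: a)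
    then show "sp_mul (sp_mul x u) (sp_mul x u) = sp_mul x u" by (simp add: u(4))
    have "sp_mul (sp_mul u x) (sp_mul u x) = sp_mul u (sp_mul x (sp_mul u x))" by (simp add: a)
    then show "sp_mul (sp_mul u x) (sp_mul u x) = sp_mul u x" by (simp add: u(4))
  qed
  have c1: "sp_mul (sp_mul x z) (sp_mul x y) = sp_mul (sp_mul x y) (sp_mul x z)"
    by (rule idempotents_commute) (simp_all add: i xyx xzx)
  have c2: "sp_mul (sp_mul z x) (sp_mul y x) = sp_mul (sp_mul y x) (sp_mul z x)"
    by (rule idempotents_commute) (simp_all add: i xyx xzx)
  have "y = sp_mul y (sp_mul (sp_mul x (sp_mul z x)) y)" by (simp only: xzx yxy)
  also have "\<dots> = sp_mul y (sp_mul (sp_mul x z) (sp_mul x y))" by (simp add: a)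
  also have "\<dots> = sp_mul (sp_mul y (sp_mul x y)) (sp_mul x z)" unfolding c1 by (simp add: a)
  finally have 1: "y = sp_mul y (sp_mul x z)" by (simp only: yxy)
  have "z = sp_mul z (sp_mul (sp_mul x (sp_mul y x)) z)" by (simp only: xyx zxz)
  also have "\<dots> = sp_mul (sp_mul (sp_mul z x) (sp_mul y x)) z" by (simp add: a)
  also have "\<dots> = sp_mul (sp_mul y x) (sp_mul z (sp_mul x z))" unfolding c2 by (simp add: a)
  finally have "z = sp_mul (sp_mul y x) z" by (simp only: zxz)
  then have "z = sp_mul y (sp_mul x z)" by (simp add: a)
  with 1 show ?thesis by metis
qed

lemma inverse_semigroupoid_Spec: "inverse_semigroupoid Spec"
  unfolding inverse_semigroupoid_def
proof (intro conjI ballI is_semigroupoid_Spec)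
  fix x assume "x \<in> Arr Spec"
  then have x: "x \<in> AS" by simp
  obtain a v where "vertex v" "a \<in> v" "x = pt a v" using x by (rule ASE)
  then have "is_sginv Spec x (pt (a\<^sup>\<star>) (act a v))" using sginv_pt by simp
  then show "\<exists>!y. is_sginv Spec x y" using is_sginv_unique[OF x] by blast
qed

lemma sginv_Spec [simp]: "vertex v \<Longrightarrow> a \<in> v \<Longrightarrow> sginv Spec (pt a v) = pt (a\<^sup>\<star>) (act a v)"
  unfolding sginv_def using sginv_pt is_sginv_unique pt_in_AS by (intro the_equality) blast+

subsection \<open>The topology of the spectrum\<close>

abbreviation "AT \<equiv> base_topology (hat ` Car S)"
abbreviation "VT \<equiv> base_topology (Dset ` Car S)"

lemma hat_base:
  assumes "V \<in> hat ` Car S" "W \<in> hat ` Car S" "x \<in> V \<inter> W"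
  shows "\<exists>X\<in>hat ` Car S. x \<in> X \<and> X \<subseteq> V \<inter> W"
proof -
  obtain a b where ab: "a \<in> Car S" "b \<in> Car S" "V = hat a" "W = hat b" using assms by blast
  obtain v where v: "vertex v" "a \<in> v" "x = pt a v" using assms ab by (auto elim: hatE)
  then have "b \<in> v" "pt a v = pt b v" using assms ab pt_in_hat_iff by auto
  then obtain c where c: "c \<in> v" "c \<sqsubseteq> a" "c \<sqsubseteq> b" using pt_eq_iff[OF v(1,1,2)] by blast
  note cC = vertex_Car[OF v(1) c(1)]
  have "x \<in> hat c" using pt_incl[OF v(1) c(1,2) ab(1)] pt_in_hat[OF v(1) c(1)] v(3) by simp
  then show ?thesis using hat_mono[OF c(2) cC] hat_mono[OF c(3) cC] ab cC by blast
qed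

lemma Dset_base:
  assumes "V \<in> Dset ` Car S" "W \<in> Dset ` Car S" "x \<in> V \<inter> W"
  shows "\<exists>X\<in>Dset ` Car S. x \<in> X \<and> X \<subseteq> V \<inter> W"
proof -
  obtain a b where ab: "a \<in> Car S" "b \<in> Car S" "V = Dset a" "W = Dset b" using assms by blast
  let ?c = "a \<cdot> (b\<^sup>\<star> \<cdot> b)"
  have "?c \<in> v \<longleftrightarrow> a \<in> v \<and> b \<in> v" if "vertex v" for v
    using that vertex_meet vertex_up src_le_mult_idem ab by blast
  then have "Dset ?c = V \<inter> W" unfolding ab(3,4) using code_vertex by (auto simp: Dset_def)
  then show ?thesis using assms(3) ab by (intro bexI[of _ "Dset ?c"]) auto
qed

lemma openin_AT: "openin AT U \<longleftrightarrow> U \<subseteq> AS \<and> (\<forall>x\<in>U. \<exists>a\<in>Car S. x \<in> hat a \<and> hat a \<subseteq> U)"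
  using openin_base_topology[OF hat_base, of U] by (simp add: AS_def)

lemma openin_VT: "openin VT U \<longleftrightarrow> U \<subseteq> VS \<and> (\<forall>x\<in>U. \<exists>a\<in>Car S. x \<in> Dset a \<and> Dset a \<subseteq> U)"
  using openin_base_topology[OF Dset_base, of U] by (simp add: VS_def)

lemma topspace_AT: "topspace AT = AS" and topspace_VT: "topspace VT = VS"
proof -
  show "topspace AT = AS" unfolding AS_def by (rule topspace_base_topology) (rule hat_base)
  show "topspace VT = VS" unfolding VS_def by (rule topspace_base_topology) (rule Dset_base)
qed

lemma open_hat: "a \<in> Car S \<Longrightarrow> openin AT (hat a)" and open_Dset: "a \<in> Car S \<Longrightarrow> openin VT (Dset a)"
  unfolding openin_AT openin_VT using hat_subset Dset_subset by blast+

lemma src_hat: "sp_src ` hat a = Dset a"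
proof (intro set_eqI iffI)
  fix u assume "u \<in> sp_src ` hat a"
  then show "u \<in> Dset a" by (auto elim!: hatE)
next
  fix u assume "u \<in> Dset a"
  then obtain v where "vertex v" "a \<in> v" "u = code v" by (rule DsetE)
  then show "u \<in> sp_src ` hat a" using pt_in_hat[of v a] by (intro image_eqI[of _ _ "pt a v"]) auto
qed

lemma inj_src_hat: "inj_on sp_src (hat a)"
  by (rule inj_onI) (auto elim!: hatE)

text \<open>
  Suppose that \<open>a\<close> is not covered by finitely many members of an open cover. The elements that are so
  covered, as measured by annihilators, form an ideal, and a vertex avoiding it is a point of
  \<open>Dset a\<close> that is missed by the whole cover.
\<close>

lemma compact_Dset:
  assumes a: "a \<in> Car S" shows "compactin VT (Dset a)"
  unfolding compactin_def
proof (intro conjI allI impI)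
  show "Dset a \<subseteq> topspace VT" using Dset_subset[OF a] topspace_VT by simp
  fix \<U> assume "(\<forall>U\<in>\<U>. openin VT U) \<and> Dset a \<subseteq> \<Union>\<U>"
  then have op: "\<And>U. U \<in> \<U> \<Longrightarrow> openin VT U" and cov: "Dset a \<subseteq> \<Union>\<U>" by auto
  define B where "B = {b \<in> Car S. \<exists>U\<in>\<U>. Dset b \<subseteq> U}"
  define I where "I = {x \<in> Car S. \<exists>J. finite J \<and> J \<subseteq> B \<and> (\<forall>y\<in>Car S. (\<forall>j\<in>J. j \<cdot> y = \<zero>) \<longrightarrow> x \<cdot> y = \<zero>)}"
  have "a \<in> I"
  proof (rule ccontr)
    assume "a \<notin> I"
    have "\<exists>v. vertex v \<and> a \<in> v \<and> v \<inter> I = {}"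
    proof (rule vertex_avoiding_ideal[OF _ _ _ a \<open>a \<notin> I\<close>])
      show "\<zero> \<in> I" unfolding I_def by (auto intro: exI[of _ "{}"])
      show "x \<in> I" if "x \<preceq> y" "y \<in> I" for x y
      proof -
        obtain J where J: "finite J" "J \<subseteq> B" "\<And>u. u \<in> Car S \<Longrightarrow> \<forall>j\<in>J. j \<cdot> u = \<zero> \<Longrightarrow> y \<cdot> u = \<zero>"
          using \<open>y \<in> I\<close> unfolding I_def by blast
        have "x \<cdot> u = \<zero>" if "u \<in> Car S" "\<forall>j\<in>J. j \<cdot> u = \<zero>" for u
          using src_leD[OF \<open>x \<preceq> y\<close> J(3)[OF that]] that(1) .
        then show ?thesis unfolding I_def using J(1,2) src_le_Car(1)[OF \<open>x \<preceq> y\<close>] by blast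
      qed
      show "z \<in> I" if xy: "x \<in> I" "y \<in> I" "x \<in> Car S" "y \<in> Car S" "is_sup S {x, y} z" for x y z
      proof -
        obtain J where J: "finite J" "J \<subseteq> B" "\<And>u. u \<in> Car S \<Longrightarrow> \<forall>j\<in>J. j \<cdot> u = \<zero> \<Longrightarrow> x \<cdot> u = \<zero>"
          using xy(1) unfolding I_def by blast
        obtain J' where J': "finite J'" "J' \<subseteq> B" "\<And>u. u \<in> Car S \<Longrightarrow> \<forall>j\<in>J'. j \<cdot> u = \<zero> \<Longrightarrow> y \<cdot> u = \<zero>"
          using xy(2) unfolding I_def by blast
        have "z \<cdot> u = \<zero>" if u: "u \<in> Car S" "\<forall>j\<in>J \<union> J'. j \<cdot> u = \<zero>" for u
        proof -
          have "is_sup S {x \<cdot> u, y \<cdot> u} (z \<cdot> u)" by (rule sup_right[OF xy(5,3,4) u(1)])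
          moreover have "x \<cdot> u = \<zero>" "y \<cdot> u = \<zero>" using J(3) J'(3) u by auto
          ultimately show ?thesis using sup_unique sup_zero[OF zero_Car] by simp
        qed
        moreover have "finite (J \<union> J')" "J \<union> J' \<subseteq> B" using J(1,2) J'(1,2) by auto
        ultimately show ?thesis unfolding I_def using sup_Car[OF xy(5)] by blast
      qed
    qed
    then obtain v where v: "vertex v" "a \<in> v" "v \<inter> I = {}" by blast
    then have "code v \<in> Dset a" by simp
    then obtain U where U: "U \<in> \<U>" "code v \<in> U" using cov by blast
    then obtain b where b: "b \<in> Car S" "code v \<in> Dset b" "Dset b \<subseteq> U" using op openin_VT by blast
    then have "b \<in> B" using U(1) unfolding B_def by blast
    then have "b \<in> I" unfolding I_def using b(1) by (auto intro!: exI[of _ "{b}"])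
    then show False using v b(2) by auto
  qed
  then obtain J where J: "finite J" "J \<subseteq> B" "\<And>y. y \<in> Car S \<Longrightarrow> \<forall>j\<in>J. j \<cdot> y = \<zero> \<Longrightarrow> a \<cdot> y = \<zero>"
    unfolding I_def by blast
  have JC: "J \<subseteq> Car S" using J(2) unfolding B_def by blast
  have hit: "\<exists>j\<in>J. j \<in> v" if v: "vertex v" "a \<in> v" for v
  proof (rule ccontr)
    assume "\<not> ?thesis"
    then obtain c where c: "c \<in> v" "c \<sqsubseteq> a" "\<forall>j\<in>J. j \<cdot> c\<^sup>\<star> = \<zero>"
      using vertex_separate_finite[OF v J(1) JC] by blast
    note [simp] = vertex_Car[OF v(1) c(1)]
    have "a \<cdot> c\<^sup>\<star> = \<zero>" using J(3)[of "c\<^sup>\<star>"] c(3) by simp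
    then show False using vertex_orthogonal[OF v(1) v(2) c(1)] by simp
  qed
  have "\<forall>j\<in>J. \<exists>U. U \<in> \<U> \<and> Dset j \<subseteq> U" using J(2) unfolding B_def by blast
  from bchoice[OF this] obtain U where U: "\<forall>j\<in>J. U j \<in> \<U> \<and> Dset j \<subseteq> U j" by blast
  show "\<exists>\<F>. finite \<F> \<and> \<F> \<subseteq> \<U> \<and> Dset a \<subseteq> \<Union>\<F>"
  proof (intro exI[of _ "U ` J"] conjI)
    show "finite (U ` J)" "U ` J \<subseteq> \<U>" using J(1) U by auto
    show "Dset a \<subseteq> \<Union>(U ` J)"
    proof
      fix u assume "u \<in> Dset a"
      then obtain v where v: "vertex v" "a \<in> v" "u = code v" by (rule DsetE)
      then obtain j where "j \<in> J" "u \<in> Dset j" using hit by auto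
      then show "u \<in> \<Union>(U ` J)" using U by blast
    qed
  qed
qed

lemma Hausdorff_VT: "Hausdorff_space VT"
  unfolding Hausdorff_space_def topspace_VT
proof (intro allI impI)
  have *: "\<exists>U V. openin VT U \<and> openin VT V \<and> code v \<in> U \<and> code w \<in> V \<and> disjnt U V"
    if v: "vertex v" and w: "vertex w" and b: "b \<in> w" "b \<notin> v" for v w b
  proof -
    obtain a where a: "a \<in> v" using vertex_nonempty[OF v] by blast
    have bC: "b \<in> Car S" by (rule vertex_Car[OF w b(1)])
    obtain c where c: "c \<in> v" "b \<cdot> c\<^sup>\<star> = \<zero>" using vertex_separate[OF v a bC b(2)] by blast
    have "disjnt (Dset c) (Dset b)"
      using vertex_orthogonal c(2) by (auto simp: disjnt_iff elim!: DsetE)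
    then show ?thesis
      using open_Dset[OF bC] open_Dset[OF vertex_Car[OF v c(1)]] v w b(1) c(1)
      by (intro exI[of _ "Dset c"] exI[of _ "Dset b"]) simp
  qed
  fix x y assume "x \<in> VS \<and> y \<in> VS \<and> x \<noteq> y"
  then have xy: "x \<in> VS" "y \<in> VS" "x \<noteq> y" by blast+
  obtain v where v: "vertex v" "x = code v" using xy(1) by (rule VSE)
  obtain w where w: "vertex w" "y = code w" using xy(2) by (rule VSE)
  have "v \<noteq> w" using xy v w by blast
  then consider b where "b \<in> w" "b \<notin> v" | b where "b \<in> v" "b \<notin> w" by blast
  then show "\<exists>U V. openin VT U \<and> openin VT V \<and> x \<in> U \<and> y \<in> V \<and> disjnt U V"
  proof cases
    case 1
    then show ?thesis using *[OF v(1) w(1)] v(2) w(2) by blast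
  next
    case 2
    then obtain U V where "openin VT U" "openin VT V" "code w \<in> U" "code v \<in> V" "disjnt U V"
      using *[OF w(1) v(1)] by blast
    then show ?thesis using v(2) w(2) disjnt_sym by blast
  qed
qed

lemma locally_compact_VT: "locally_compact_space VT"
  unfolding locally_compact_space_def topspace_VT
  unfolding VS_def using open_Dset compact_Dset by blast

lemma zero_dimensional_VT: "zero_dimensional_space VT"
  unfolding zero_dimensional_space_def
proof (rule exI[of _ "Dset ` Car S"], intro conjI ballI allI impI)
  fix B assume "B \<in> Dset ` Car S"
  then show "openin VT B" "closedin VT B"
    using open_Dset compact_Dset compactin_imp_closedin[OF Hausdorff_VT] by auto
next
  fix V assume "openin VT V"
  then have "V = \<Union>{B \<in> Dset ` Car S. B \<subseteq> V}" unfolding openin_VT by blast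
  then show "\<exists>\<V>\<subseteq>Dset ` Car S. V = \<Union>\<V>" by (intro exI[of _ "{B \<in> Dset ` Car S. B \<subseteq> V}"]) blast
qed

text \<open>
  Restricting \<open>a\<close> to the source of \<open>b\<close> gives a smaller neighbourhood of the germ, whose source lies in that
  of \<open>b\<close>.
\<close>

lemma continuous_src: "continuous_map AT VT sp_src"
  unfolding continuous_map_def topspace_AT topspace_VT
proof (intro conjI allI impI)
  show "sp_src \<in> AS \<rightarrow> VS"
  proof
    fix x assume "x \<in> AS"
    then obtain a v where "vertex v" "a \<in> v" "x = pt a v" by (rule ASE)
    then show "sp_src x \<in> VS" using code_in_VS[of v] by simp
  qed
  fix U assume U: "openin VT U"
  show "openin AT {x \<in> AS. sp_src x \<in> U}"
    unfolding openin_AT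
  proof (intro conjI ballI)
    fix x assume "x \<in> {x \<in> AS. sp_src x \<in> U}"
    then have x: "x \<in> AS" "sp_src x \<in> U" by blast+
    obtain a v where v: "vertex v" "a \<in> v" "x = pt a v" "a \<in> Car S" using x(1) by (rule ASE)
    then have "code v \<in> U" using x(2) by simp
    then obtain b where b: "b \<in> Car S" "code v \<in> Dset b" "Dset b \<subseteq> U" using U openin_VT by blast
    then obtain c where c: "c \<in> v" "c \<sqsubseteq> a" "c \<preceq> b" using vertex_restrict[OF v(1,2), of b] v(1) by auto
    have cC: "c \<in> Car S" by (rule vertex_Car[OF v(1) c(1)])
    have "x \<in> hat c" using pt_incl[OF v(1) c(1,2) v(4)] pt_in_hat[OF v(1) c(1)] v(3) by simp
    moreover have "Dset c \<subseteq> Dset b" using vertex_up[OF _ _ c(3)] by (auto elim!: DsetE)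
    then have "sp_src y \<in> U" if "y \<in> hat c" for y using that src_hat[of c] b(3) by blast
    then have "hat c \<subseteq> {x \<in> AS. sp_src x \<in> U}" using hat_subset[OF cC] by blast
    ultimately show "\<exists>c\<in>Car S. x \<in> hat c \<and> hat c \<subseteq> {x \<in> AS. sp_src x \<in> U}" using cC by blast
  qed blast
qed

lemma sginv_AS: "x \<in> AS \<Longrightarrow> sginv Spec x \<in> AS" and sginv_sginv: "x \<in> AS \<Longrightarrow> sginv Spec (sginv Spec x) = x"
  and rng_eq: "x \<in> AS \<Longrightarrow> sp_rng x = sp_src (sginv Spec x)"
  and hat_star: "x \<in> hat a \<Longrightarrow> a \<in> Car S \<Longrightarrow> sginv Spec x \<in> hat (a\<^sup>\<star>)"
proof -
  have *: "sginv Spec x \<in> AS \<and> sginv Spec (sginv Spec x) = x \<and> sp_rng x = sp_src (sginv Spec x) \<and>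
      sginv Spec x \<in> hat (a\<^sup>\<star>)"
    if v: "vertex v" "a \<in> v" "x = pt a v" for a v
    using v vertex_act[OF v(1,2)] star_in_act[OF v(1,2)] act_star_act[OF v(1,2)] vertex_Car[OF v(1,2)]
      pt_in_AS[OF vertex_act[OF v(1,2)] star_in_act[OF v(1,2)]]
      pt_in_hat[OF vertex_act[OF v(1,2)] star_in_act[OF v(1,2)]]
    by simp
  show "x \<in> AS \<Longrightarrow> sginv Spec x \<in> AS" "x \<in> AS \<Longrightarrow> sginv Spec (sginv Spec x) = x"
    "x \<in> AS \<Longrightarrow> sp_rng x = sp_src (sginv Spec x)"
    by (erule ASE, use * in blast)+
  show "x \<in> hat a \<Longrightarrow> a \<in> Car S \<Longrightarrow> sginv Spec x \<in> hat (a\<^sup>\<star>)"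
    by (erule hatE, use * in blast)
qed

lemma continuous_sginv: "continuous_map AT AT (sginv Spec)"
  unfolding continuous_map_def topspace_AT
proof (intro conjI allI impI)
  show "sginv Spec \<in> AS \<rightarrow> AS" using sginv_AS by blast
  fix U assume U: "openin AT U"
  show "openin AT {x \<in> AS. sginv Spec x \<in> U}"
    unfolding openin_AT
  proof (intro conjI ballI)
    fix x assume "x \<in> {x \<in> AS. sginv Spec x \<in> U}"
    then have x: "x \<in> AS" "sginv Spec x \<in> U" by blast+
    obtain a where a: "a \<in> Car S" "sginv Spec x \<in> hat a" "hat a \<subseteq> U" using U x(2) unfolding openin_AT by blast
    have "x \<in> hat (a\<^sup>\<star>)" using hat_star[OF a(2,1)] sginv_sginv[OF x(1)] by simp
    moreover have "sginv Spec y \<in> U" if "y \<in> hat (a\<^sup>\<star>)" for y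
      using hat_star[OF that] a by auto
    then have "hat (a\<^sup>\<star>) \<subseteq> {x \<in> AS. sginv Spec x \<in> U}" using hat_subset[OF star_closed[OF a(1)]] by blast
    ultimately show "\<exists>c\<in>Car S. x \<in> hat c \<and> hat c \<subseteq> {x \<in> AS. sginv Spec x \<in> U}"
      using a(1) star_closed by blast
  qed blast
qed

lemma continuous_rng: "continuous_map AT VT sp_rng"
proof -
  have "continuous_map AT VT (sp_src \<circ> sginv Spec)"
    by (rule continuous_map_compose[OF continuous_sginv continuous_src])
  then show ?thesis
    by (rule continuous_map_eq) (simp add: topspace_AT rng_eq)
qed

lemma set_mul_hat:
  assumes [simp]: "a \<in> Car S" "b \<in> Car S"
  shows "set_mul Spec (hat a) (hat b) = hat (a \<cdot> b)"
proof (intro set_eqI iffI)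
  fix x assume "x \<in> set_mul Spec (hat a) (hat b)"
  then obtain y z where yz: "y \<in> hat a" "z \<in> hat b" "sp_src y = sp_rng z" "x = sp_mul y z"
    by (auto simp: set_mul_def)
  obtain w where w: "vertex w" "a \<in> w" "y = pt a w" using yz(1) by (rule hatE)
  obtain v where v: "vertex v" "b \<in> v" "z = pt b v" using yz(2) by (rule hatE)
  have e: "w = act b v" using yz(3) w v vertex_act[OF v(1,2)] by simp
  then have "a \<cdot> b \<in> v" using w(2) by (simp add: in_act)
  then show "x \<in> hat (a \<cdot> b)" using sp_mul_pt[OF v(1,2) e w(2)] yz(4) w v pt_in_hat by simp
next
  fix x assume "x \<in> hat (a \<cdot> b)"
  then obtain v where v: "vertex v" "a \<cdot> b \<in> v" "x = pt (a \<cdot> b) v" by (rule hatE)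
  have b: "b \<in> v" "a \<in> act b v" using v mult_vertex_iff[of v a b] by auto
  note w = vertex_act[OF v(1) b(1)]
  have "x = sp_mul (pt a (act b v)) (pt b v)" using sp_mul_pt[OF v(1) b(1) refl b(2)] v by simp
  moreover have "sp_src (pt a (act b v)) = sp_rng (pt b v)" using w v b by simp
  ultimately show "x \<in> set_mul Spec (hat a) (hat b)"
    using pt_in_hat[OF w b(2)] pt_in_hat[OF v(1) b(1)] unfolding set_mul_def by auto
qed

text \<open>
  If \<open>pt (ab) v\<close> lies in \<open>hat d\<close>, it lies in \<open>hat c\<close> for some \<open>c\<close> contained in \<open>ab\<close> and in \<open>d\<close>. Shrinking \<open>b\<close> to
  the source of \<open>c\<close> makes all of \<open>hat a\<close> times \<open>hat b\<close> land in \<open>hat d\<close>.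
\<close>

lemma continuous_mul:
  "continuous_map (subtopology (prod_topology AT AT) {(x, y). x \<in> AS \<and> y \<in> AS \<and> sp_src x = sp_rng y}) AT
    (\<lambda>(x, y). sp_mul x y)" (is "continuous_map (subtopology ?X ?P) AT ?m")
proof -
  have top: "topspace (subtopology ?X ?P) = ?P" by (auto simp: topspace_AT)
  show ?thesis
    unfolding continuous_map_def top topspace_AT
  proof (intro conjI allI impI)
    show "?m \<in> ?P \<rightarrow> AS" by (auto intro: sp_mul_AS(1))
    fix U assume U: "openin AT U"
    show "openin (subtopology ?X ?P) {p \<in> ?P. ?m p \<in> U}"
    proof (subst openin_subopen, intro ballI)
      fix p assume pP: "p \<in> {p \<in> ?P. ?m p \<in> U}"
      obtain x y where pxy: "p = (x, y)" by (cases p)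
      have p: "p = (x, y)" "x \<in> AS" "y \<in> AS" "sp_src x = sp_rng y" "sp_mul x y \<in> U"
        using pP by (simp_all add: pxy)
      obtain a b v where v: "vertex v" "b \<in> v" "vertex (act b v)" "a \<in> act b v" "x = pt a (act b v)" "y = pt b v"
        "a \<in> Car S" "b \<in> Car S" using composableE[OF p(2-4)] .
      note [simp] = v(7,8)
      have m: "sp_mul x y = pt (a \<cdot> b) v" using sp_mul_pt[OF v(1,2) refl v(4)] v by simp
      have abv: "a \<cdot> b \<in> v" using v(4) by (simp add: in_act)
      obtain d where d: "d \<in> Car S" "pt (a \<cdot> b) v \<in> hat d" "hat d \<subseteq> U"
        using U p(5) m unfolding openin_AT by metis
      then have "d \<in> v" "pt (a \<cdot> b) v = pt d v" using pt_in_hat_iff[OF v(1) abv] by auto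
      then obtain c where c: "c \<in> v" "c \<sqsubseteq> a \<cdot> b" "c \<sqsubseteq> d" using pt_eq_iff[OF v(1,1) abv] by blast
      have [simp]: "c \<in> Car S" by (rule vertex_Car[OF v(1) c(1)])
      obtain b' where b': "b' \<in> v" "b' \<sqsubseteq> b" "b' \<preceq> c" using vertex_restrict[OF v(1,2) c(1)] by blast
      have [simp]: "b' \<in> Car S" by (rule vertex_Car[OF v(1) b'(1)])
      have "a \<cdot> b' \<sqsubseteq> a \<cdot> b" by (rule incl_left[OF b'(2)]) simp_all
      moreover have "a \<cdot> b' \<preceq> c" using src_le_trans[OF src_le_mult b'(3)] by simp
      ultimately have "a \<cdot> b' \<sqsubseteq> c" using src_le_imp_incl[OF _ c(2)] by simp
      then have "a \<cdot> b' \<sqsubseteq> d" using incl_trans[OF _ c(3)] d(1) by simp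
      then have "set_mul Spec (hat a) (hat b') \<subseteq> U"
        using hat_mono[of "a \<cdot> b'" d] d by (auto simp: set_mul_hat)
      then have sub: "(hat a \<times> hat b') \<inter> ?P \<subseteq> {p \<in> ?P. ?m p \<in> U}" by (auto simp: set_mul_def)
      have "openin ?X (hat a \<times> hat b')" by (simp add: openin_prod_Times_iff open_hat)
      then have "openin (subtopology ?X ?P) ((hat a \<times> hat b') \<inter> ?P)" by (auto simp: openin_subtopology)
      moreover have "y = pt b' v" using pt_incl[OF v(1) b'(1,2)] v(6) by simp
      then have "p \<in> (hat a \<times> hat b') \<inter> ?P"
        using p pt_in_hat[OF v(3,4)] pt_in_hat[OF v(1) b'(1)] v(5) by simp
      ultimately show "\<exists>T. openin (subtopology ?X ?P) T \<and> p \<in> T \<and> T \<subseteq> {p \<in> ?P. ?m p \<in> U}"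
        using sub by blast
    qed
  qed
qed

lemma homeo_hat:
  assumes a: "a \<in> Car S"
  shows "homeomorphic_map (subtopology AT (hat a)) (subtopology VT (Dset a)) sp_src"
proof (rule bijective_open_imp_homeomorphic_map)
  have top: "topspace (subtopology AT (hat a)) = hat a" "topspace (subtopology VT (Dset a)) = Dset a"
    using hat_subset[OF a] Dset_subset[OF a] by (auto simp: topspace_AT topspace_VT)
  show "continuous_map (subtopology AT (hat a)) (subtopology VT (Dset a)) sp_src"
    by (intro continuous_map_into_subtopology continuous_map_from_subtopology continuous_src)
      (use src_hat[of a] top in auto)
  show "sp_src ` topspace (subtopology AT (hat a)) = topspace (subtopology VT (Dset a))"
    unfolding top by (rule src_hat)
  show "inj_on sp_src (topspace (subtopology AT (hat a)))" unfolding top by (rule inj_src_hat)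
  show "open_map (subtopology AT (hat a)) (subtopology VT (Dset a)) sp_src"
    unfolding open_map_def openin_open_subtopology[OF open_hat[OF a]] openin_open_subtopology[OF open_Dset[OF a]]
  proof (intro allI impI conjI)
    fix U assume U: "openin AT U \<and> U \<subseteq> hat a"
    show "sp_src ` U \<subseteq> Dset a" using U src_hat[of a] by blast
    show "openin VT (sp_src ` U)"
    proof (subst openin_subopen, intro ballI)
      fix u assume "u \<in> sp_src ` U"
      then obtain x where x: "x \<in> U" "u = sp_src x" by blast
      obtain b where b: "b \<in> Car S" "x \<in> hat b" "hat b \<subseteq> U" using U x(1) unfolding openin_AT by blast
      then have "u \<in> Dset b" "Dset b \<subseteq> sp_src ` U" using x src_hat[of b] by blast+
      then show "\<exists>T. openin VT T \<and> u \<in> T \<and> T \<subseteq> sp_src ` U" using open_Dset[OF b(1)] by blast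
    qed
  qed
qed

theorem ample_Spec: "ample_inverse_semigroupoid Spec"
proof -
  have "topological_inverse_semigroupoid Spec"
    unfolding topological_inverse_semigroupoid_def
    using inverse_semigroupoid_Spec compatible_graph_Spec topspace_AT topspace_VT continuous_src
      continuous_rng continuous_mul continuous_sginv
    by simp
  moreover have "local_homeomorphism_map AT VT sp_src"
    unfolding local_homeomorphism_map_def topspace_AT
  proof
    fix x assume "x \<in> AS"
    then obtain a where a: "a \<in> Car S" "x \<in> hat a" unfolding AS_def by blast
    show "\<exists>U. openin AT U \<and> x \<in> U \<and> openin VT (sp_src ` U) \<and>
        homeomorphic_map (subtopology AT U) (subtopology VT (sp_src ` U)) sp_src"
      using a open_hat open_Dset homeo_hat by (intro exI[of _ "hat a"]) (simp add: src_hat)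
  qed
  ultimately show ?thesis
    using Hausdorff_VT locally_compact_VT zero_dimensional_VT
    by (simp add: ample_inverse_semigroupoid_def etale_inverse_semigroupoid_def)
qed

sublocale sp: ample Spec by (rule ample.intro[OF ample_Spec])

subsection \<open>The semigroup is recovered from its spectrum\<close>

lemma bisection_hat:
  assumes a: "a \<in> Car S" shows "bisection Spec (hat a)"
  unfolding bisection_def
proof (intro conjI)
  show o: "openin (ArrTop Spec) (hat a)" using open_hat[OF a] by simp
  show i: "inj_on (src Spec) (hat a)" using inj_src_hat by simp
  show "compactin (ArrTop Spec) (hat a)"
    using sp.compact_via_src[OF o i, of "hat a"] compact_Dset[OF a] src_hat[of a] by simp
  show "inj_on (rng Spec) (hat a)"
  proof (rule inj_onI)
    fix x y assume x: "x \<in> hat a" and y: "y \<in> hat a" and xy: "rng Spec x = rng Spec y"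
    obtain v where v: "vertex v" "a \<in> v" "x = pt a v" using x by (rule hatE)
    obtain w where w: "vertex w" "a \<in> w" "y = pt a w" using y by (rule hatE)
    have "act a v = act a w" using xy v w vertex_act by simp
    then have "v = w" using act_star_act[OF v(1,2)] act_star_act[OF w(1,2)] by metis
    then show "x = y" using v w by simp
  qed
qed

lemma hat_zero: "hat \<zero> = {}"
  using vertex_zero by (auto elim: hatE)

text \<open>
  The elements whose source lies in that of some common part of \<open>a\<close> and \<open>b\<close> form an ideal, which contains \<open>a\<close>
  only if \<open>a\<close> is contained in \<open>b\<close>. At a vertex of \<open>a\<close> avoiding this ideal, the germs of \<open>a\<close> and \<open>b\<close> differ.
\<close>

lemma hat_incl_iff:
  assumes [simp]: "a \<in> Car S" "b \<in> Car S" shows "hat a \<subseteq> hat b \<longleftrightarrow> a \<sqsubseteq> b"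
proof
  assume ab: "hat a \<subseteq> hat b"
  show "a \<sqsubseteq> b"
  proof (rule ccontr)
    assume nab: "\<not> a \<sqsubseteq> b"
    define I where "I = {x. \<exists>c\<in>Car S. c \<sqsubseteq> a \<and> c \<sqsubseteq> b \<and> x \<preceq> c}"
    have aI: "a \<notin> I"
    proof
      assume "a \<in> I"
      then obtain c where c: "c \<in> Car S" "c \<sqsubseteq> a" "c \<sqsubseteq> b" "a \<preceq> c" unfolding I_def by blast
      then have "a \<sqsubseteq> c" using src_le_imp_incl[of a a c] by simp
      then show False using incl_trans[OF _ c(3)] c(1) nab by simp
    qed
    have "\<exists>v. vertex v \<and> a \<in> v \<and> v \<inter> I = {}"
    proof (rule vertex_avoiding_ideal[OF _ _ _ _ aI])
      show "\<zero> \<in> I" unfolding I_def by (auto intro!: bexI[of _ \<zero>])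
      show "x \<in> I" if "x \<preceq> y" "y \<in> I" for x y using that src_le_trans unfolding I_def by blast
      show "z \<in> I" if xy: "x \<in> I" "y \<in> I" "is_sup S {x, y} z" for x y z
      proof -
        obtain c where c: "c \<in> Car S" "c \<sqsubseteq> a" "c \<sqsubseteq> b" "x \<preceq> c" using xy(1) unfolding I_def by blast
        obtain d where d: "d \<in> Car S" "d \<sqsubseteq> a" "d \<sqsubseteq> b" "y \<preceq> d" using xy(2) unfolding I_def by blast
        obtain e where e: "is_sup S {c, d} e" using sup_bounded[OF c(2) d(2) c(1) d(1)] by auto
        have eC: "e \<in> Car S" by (rule sup_Car[OF e])
        have "c \<sqsubseteq> e" "d \<sqsubseteq> e" using sup_upper[OF e] by auto
        then have "x \<preceq> e" "y \<preceq> e"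
          using src_le_trans[OF c(4) incl_src_le] src_le_trans[OF d(4) incl_src_le] c(1) d(1) eC by auto
        then have "z \<preceq> e" by (rule src_le_sup[OF xy(3)])
        moreover have "e \<sqsubseteq> a" "e \<sqsubseteq> b" using sup_least[OF e, of a] sup_least[OF e, of b] c d by auto
        ultimately show ?thesis unfolding I_def using eC by blast
      qed
    qed simp
    then obtain v where v: "vertex v" "a \<in> v" "v \<inter> I = {}" by blast
    then have "pt a v \<in> hat b" using ab pt_in_hat by blast
    then have "b \<in> v" "pt a v = pt b v" using pt_in_hat_iff[OF v(1,2)] by auto
    then obtain c where c: "c \<in> v" "c \<sqsubseteq> a" "c \<sqsubseteq> b" using pt_eq_iff[OF v(1,1,2)] by blast
    then have "c \<in> I" unfolding I_def using vertex_Car[OF v(1)] src_le_refl by blast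
    then show False using v(3) c(1) by blast
  qed
qed (simp add: hat_mono)

text \<open>
  Joins are only at hand for orthogonal elements and for elements with a common bound. By compactness, \<open>a\<close>
  and \<open>b\<close> have a common part \<open>s\<close> whose source is all of the intersection of their sources. The complement
  \<open>b'\<close> of \<open>s\<close> in \<open>b\<close> is orthogonal to \<open>a\<close>, and the join of \<open>a\<close> and \<open>b'\<close> contains \<open>b\<close>.
\<close>

lemma hat_join:
  assumes a [simp]: "a \<in> Car S" and b [simp]: "b \<in> Car S" and bd: "hat a \<subseteq> A" "hat b \<subseteq> A"
    and inj: "inj_on sp_src A" "inj_on sp_rng A"
  shows "\<exists>d\<in>Car S. hat d = hat a \<union> hat b"
proof -
  let ?t = "a \<cdot> (b\<^sup>\<star> \<cdot> b)"
  have common: "\<exists>c\<in>v. c \<sqsubseteq> a \<and> c \<sqsubseteq> b" if v: "vertex v" "a \<in> v" "b \<in> v" for v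
  proof -
    have "pt a v \<in> A" "pt b v \<in> A" using pt_in_hat v bd by blast+
    then have "pt a v = pt b v" using inj_onD[OF inj(1), of "pt a v" "pt b v"] v by simp
    then show ?thesis using pt_eq_iff[OF v(1,1,2,3)] by blast
  qed
  have "\<exists>c. \<forall>u\<in>Dset ?t. c u \<in> Car S \<and> c u \<sqsubseteq> a \<and> c u \<sqsubseteq> b \<and> u \<in> Dset (c u)"
  proof (rule bchoice, intro ballI)
    fix u assume "u \<in> Dset ?t"
    then obtain v where v: "vertex v" "?t \<in> v" "u = code v" by (rule DsetE)
    have "a \<in> v" "b \<in> v" using vertex_up[OF v(1,2)] src_le_mult_idem[of a b] by auto
    then obtain c where "c \<in> v" "c \<sqsubseteq> a" "c \<sqsubseteq> b" using common v(1) by blast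
    then show "\<exists>c. c \<in> Car S \<and> c \<sqsubseteq> a \<and> c \<sqsubseteq> b \<and> u \<in> Dset c" using v vertex_Car by auto
  qed
  then obtain c where c: "\<forall>u\<in>Dset ?t. c u \<in> Car S \<and> c u \<sqsubseteq> a \<and> c u \<sqsubseteq> b \<and> u \<in> Dset (c u)" by blast
  have "\<exists>F\<subseteq>Dset ?t. finite F \<and> Dset ?t \<subseteq> \<Union>((\<lambda>u. Dset (c u)) ` F)"
    by (rule compactin_pointwise[OF compact_Dset]) (use c open_Dset in auto)
  then obtain F where F: "F \<subseteq> Dset ?t" "finite F" "Dset ?t \<subseteq> \<Union>((\<lambda>u. Dset (c u)) ` F)" by blast
  \<comment> \<open>Adding \<open>0\<close> keeps the family nonempty when \<open>a\<close> and \<open>b\<close> have disjoint sources.\<close>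
  let ?R = "insert \<zero> (c ` F)"
  have R: "finite ?R" "?R \<noteq> {}" "?R \<subseteq> Car S" "\<forall>x\<in>?R. x \<sqsubseteq> a" "\<forall>x\<in>?R. x \<sqsubseteq> b" using F(1,2) c by auto
  obtain s where s: "is_sup S ?R s" using sup_finite_bounded[OF R(1-3) a R(4)] by blast
  have [simp]: "s \<in> Car S" by (rule sup_Car[OF s])
  have sa: "s \<sqsubseteq> a" and sb: "s \<sqsubseteq> b" using sup_least[OF s a] sup_least[OF s b] R(4,5) by blast+
  have in_s: "s \<in> v" if v: "vertex v" "a \<in> v" "b \<in> v" for v
  proof -
    have "code v \<in> Dset ?t" using v vertex_meet by simp
    then obtain u where u: "u \<in> F" "code v \<in> Dset (c u)" using F(3) by blast
    then have "c u \<in> v" "c u \<sqsubseteq> s" using v(1) sup_upper[OF s, of "c u"] by auto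
    then show ?thesis using vertex_incl[OF v(1)] by simp
  qed
  obtain b' where [simp]: "b' \<in> Car S" and b': "b' \<sqsubseteq> b" "is_sup S {s, b'} b" "s \<cdot> b'\<^sup>\<star> = \<zero>"
    using complement[OF sb] by auto
  have disj: False if v: "vertex v" "a \<in> v" "b' \<in> v" for v
  proof -
    have "b \<in> v" using vertex_incl[OF v(1,3) b'(1)] by simp
    then show False using vertex_orthogonal[OF v(1) in_s[OF v(1,2)] v(3)] b'(3) by simp
  qed
  have 1: "a \<cdot> b'\<^sup>\<star> = \<zero>"
  proof (rule ccontr)
    assume "a \<cdot> b'\<^sup>\<star> \<noteq> \<zero>"
    then obtain v where v: "vertex v" "a \<cdot> b'\<^sup>\<star> \<in> v" using vertex_nonzero[of "a \<cdot> b'\<^sup>\<star>"] by auto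
    then have "b'\<^sup>\<star> \<in> v" "a \<in> act (b'\<^sup>\<star>) v" using mult_vertex_iff[of v a "b'\<^sup>\<star>"] by auto
    moreover have "b' \<in> act (b'\<^sup>\<star>) v" using act_act_star(2)[OF v(1)] \<open>b'\<^sup>\<star> \<in> v\<close> by simp
    ultimately show False using disj[OF vertex_act[OF v(1)]] by blast
  qed
  have 2: "a\<^sup>\<star> \<cdot> b' = \<zero>"
  proof (rule ccontr)
    assume "a\<^sup>\<star> \<cdot> b' \<noteq> \<zero>"
    then obtain v where v: "vertex v" "a\<^sup>\<star> \<cdot> b' \<in> v" using vertex_nonzero[of "a\<^sup>\<star> \<cdot> b'"] by auto
    then have bv: "b' \<in> v" and aw: "a\<^sup>\<star> \<in> act b' v" using mult_vertex_iff[of v "a\<^sup>\<star>" b'] by auto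
    note w = vertex_act[OF v(1) bv]
    let ?u = "act (a\<^sup>\<star>) (act b' v)"
    have u: "vertex ?u" "act a ?u = act b' v" "a \<in> ?u"
      using vertex_act[OF w aw] act_act_star[OF w a aw] by auto
    have b: "b \<in> v" using vertex_incl[OF v(1) bv b'(1)] by simp
    have "sp_rng (pt b v) = code (act b' v)"
      using v(1) b act_incl[OF v(1) bv b'(1)] by simp
    moreover have "sp_rng (pt a ?u) = code (act b' v)" using u by simp
    moreover have "pt a ?u \<in> A" "pt b v \<in> A" using pt_in_hat u v b bd by blast+
    ultimately have "pt a ?u = pt b v" using inj_onD[OF inj(2)] by metis
    then have "?u = v" using pt_eq_iff[OF u(1) v(1) u(3) b] by blast
    then show False using disj[OF v(1) _ bv] u(3) by simp
  qed
  obtain d where d: "is_sup S {a, b'} d" using sup_orthogonal[OF 2 1] by auto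
  have [simp]: "d \<in> Car S" by (rule sup_Car[OF d])
  have ad: "a \<sqsubseteq> d" and bd': "b' \<sqsubseteq> d" using sup_upper[OF d] by auto
  have "b \<sqsubseteq> d"
    by (rule sup_least[OF b'(2)]) (use incl_trans[OF sa ad] bd' in auto)
  then have "hat a \<union> hat b \<subseteq> hat d" using ad by (simp add: hat_mono)
  moreover have "hat d \<subseteq> hat a \<union> hat b"
  proof
    fix x assume "x \<in> hat d"
    then obtain v where v: "vertex v" "d \<in> v" "x = pt d v" by (rule hatE)
    have "a \<in> v \<or> b' \<in> v" using vertex_prime[OF v(1,2) d] by simp
    then have "x \<in> hat a \<or> x \<in> hat b'"
      using pt_incl[OF v(1) _ ad] pt_incl[OF v(1) _ bd'] v(3) pt_in_hat[OF v(1)] by force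
    then show "x \<in> hat a \<union> hat b" using hat_mono[OF b'(1)] by auto
  qed
  ultimately show ?thesis by (intro bexI[of _ d]) auto
qed

text \<open>
  By compactness, a compact open bisection is a finite union of sets \<open>hat a\<close>; these are joined one by one.
\<close>

lemma bisection_is_hat:
  assumes A: "bisection Spec A" shows "\<exists>d\<in>Car S. hat d = A"
proof -
  have inj: "inj_on sp_src A" "inj_on sp_rng A" and op: "openin AT A" using A by (simp_all add: bisection_def)
  have "\<forall>x\<in>A. \<exists>a. a \<in> Car S \<and> x \<in> hat a \<and> hat a \<subseteq> A" using op unfolding openin_AT by blast
  from bchoice[OF this] obtain a where a: "\<forall>x\<in>A. a x \<in> Car S \<and> x \<in> hat (a x) \<and> hat (a x) \<subseteq> A" by blast
  have "\<exists>F\<subseteq>A. finite F \<and> A \<subseteq> \<Union>((\<lambda>x. hat (a x)) ` F)"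
    by (rule compactin_pointwise[of AT]) (use A a open_hat in \<open>auto simp: bisection_def\<close>)
  then obtain F where F: "F \<subseteq> A" "finite F" "A \<subseteq> \<Union>((\<lambda>x. hat (a x)) ` F)" by blast
  have "\<exists>d\<in>Car S. hat d = \<Union>((\<lambda>x. hat (a x)) ` H)" if "H \<subseteq> A" "finite H" for H
    using that(2,1)
  proof (induction rule: finite_induct)
    case empty
    then show ?case using hat_zero by (intro bexI[of _ \<zero>]) auto
  next
    case (insert x H)
    then obtain d where d: "d \<in> Car S" "hat d = \<Union>((\<lambda>x. hat (a x)) ` H)" by auto
    have x: "a x \<in> Car S" "hat (a x) \<subseteq> A" and "hat d \<subseteq> A" using a insert.prems d(2) by auto
    then obtain e where "e \<in> Car S" "hat e = hat (a x) \<union> hat d" using hat_join[OF x(1) d(1) x(2) _ inj] by blast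
    then show ?case using d(2) by auto
  qed
  from this[OF F(1,2)] obtain d where "d \<in> Car S" "hat d = \<Union>((\<lambda>x. hat (a x)) ` F)" by blast
  moreover have "\<Union>((\<lambda>x. hat (a x)) ` F) = A" using F a by blast
  ultimately show ?thesis by blast
qed

theorem ord_iso_hat: "ord_iso S (KB Spec) hat"
proof -
  have "inj_on hat (Car S)"
  proof (rule inj_onI)
    fix a b assume ab: "a \<in> Car S" "b \<in> Car S" "hat a = hat b"
    then have "a \<sqsubseteq> b" "b \<sqsubseteq> a" using hat_incl_iff[of a b] hat_incl_iff[of b a] by auto
    then show "a = b" using incl_antisym ab(1,2) by simp
  qed
  moreover have "hat ` Car S = Car (KB Spec)" using bisection_hat bisection_is_hat unfolding KB_simps(1) by blast
  ultimately show ?thesis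
    by (simp add: ord_iso_def bij_betw_def set_mul_hat hat_incl_iff)
qed

lemma Arr_Spec_lepoll: "Arr Spec \<subseteq> code ` Pow (Car S)" "Vert Spec \<subseteq> code ` Pow (Car S)"
  using germ_Car vertex_Car by (auto simp: pt_def elim!: ASE VSE)

end

section \<open>The equivalence\<close>

lemma ord_iso_comp:
  assumes "ord_iso R S f" "ord_iso S T g" shows "ord_iso R T (g \<circ> f)"
proof -
  have f: "bij_betw f (Car R) (Car S)" using assms(1) by (simp add: ord_iso_def)
  have g: "bij_betw g (Car S) (Car T)" using assms(2) by (simp add: ord_iso_def)
  have "f a \<in> Car S" if "a \<in> Car R" for a using bij_betw_apply[OF f that] .
  then show ?thesis using assms bij_betw_trans[OF f g] by (simp add: ord_iso_def)
qed

text \<open>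
  Semigroups of bisections consist of sets, so they have another type than the semigroups they are
  compared with. Passing to singletons makes both kinds objects of one category.
\<close>

definition singletons :: "('w ord_semigroup, 'w \<Rightarrow> 'w, 'w set ord_semigroup, 'w set \<Rightarrow> 'w set) cat_map" where
  "singletons = \<lparr>FObj = image_ord (\<lambda>a. {a}),
     FHom = (\<lambda>S T \<theta>. \<lambda>A\<in>(\<lambda>a. {a}) ` Car S. {\<theta> (the_elem A)})\<rparr>"

lemma ord_iso_singletons: "ord_iso S (image_ord (\<lambda>a. {a}) S) (\<lambda>a. {a})"
  by (rule ord_iso_image_ord) simp

lemma Car_image_ord [simp]: "Car (image_ord f S) = f ` Car S"
  by (simp add: image_ord_def)

lemma sigma_ordered_singletons: "sigma_ordered S \<Longrightarrow> sigma_ordered (image_ord (\<lambda>a. {a}) S)"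
  by (rule iso_transport.sigma_ordered_T[OF iso_transport.intro[OF ord_iso_singletons]])

lemma sigma_morphism_singleton:
  "sigma_ordered S \<Longrightarrow> sigma_morphism S (image_ord (\<lambda>a. {a}) S) (\<lambda>a. {a})"
  by (rule iso_transport.sigma_morphism_f[OF iso_transport.intro[OF ord_iso_singletons]])

lemma sigma_morphism_the_elem:
  assumes S: "sigma_ordered S" shows "sigma_morphism (image_ord (\<lambda>a. {a}) S) S the_elem"
proof -
  note i = ord_iso_inv_into[OF ord_iso_singletons S]
  have m: "sigma_morphism (image_ord (\<lambda>a. {a}) S) S (inv_into (Car S) (\<lambda>a. {a}))"
    by (rule iso_transport.sigma_morphism_f[OF iso_transport.intro[OF i sigma_ordered_singletons[OF S]]])
  have "inv_into (Car S) (\<lambda>a. {a}) {a} = a" if "a \<in> Car S" for a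
    using inv_into_f_f[of "\<lambda>a. {a}" "Car S" a] that by (simp add: inj_on_def)
  then show ?thesis
    by (intro sigma_morphism_cong[OF sigma_ordered_singletons[OF S] S m]) auto
qed

theorem fully_faithful_singletons: "fully_faithful (SigmaOrd UNIV) (SigmaOrd UNIV) singletons"
  unfolding fully_faithful_def is_functor_def
proof (intro conjI ballI)
  fix S :: "'a ord_semigroup" assume "S \<in> Obj (SigmaOrd UNIV)"
  then show "FObj singletons S \<in> Obj (SigmaOrd UNIV)"
    by (simp add: singletons_def sigma_ordered_singletons)
  show "FHom singletons S S (Ident (SigmaOrd UNIV) S) = Ident (SigmaOrd UNIV) (FObj singletons S)"
    by (auto simp: singletons_def fun_eq_iff restrict_def)
next
  fix S T :: "'a ord_semigroup" and \<theta>
  assume *: "S \<in> Obj (SigmaOrd UNIV)" "T \<in> Obj (SigmaOrd UNIV)" "\<theta> \<in> Hom (SigmaOrd UNIV) S T"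
  then have S: "sigma_ordered S" and T: "sigma_ordered T" and \<theta>: "sigma_morphism S T \<theta>" by auto
  note JS = sigma_ordered_singletons[OF S] and JT = sigma_ordered_singletons[OF T]
  have "sigma_morphism (image_ord (\<lambda>a. {a}) S) T (\<theta> \<circ> the_elem)"
    by (rule sigma_morphism_comp[OF JS S T sigma_morphism_the_elem[OF S] \<theta>]) simp
  then have "sigma_morphism (image_ord (\<lambda>a. {a}) S) (image_ord (\<lambda>a. {a}) T) (FHom singletons S T \<theta>)"
    by (rule sigma_morphism_comp[OF JS T JT _ sigma_morphism_singleton[OF T]]) (simp add: singletons_def)
  then show "FHom singletons S T \<theta> \<in> Hom (SigmaOrd UNIV) (FObj singletons S) (FObj singletons T)"
    by (simp add: singletons_def)
next
  fix R S T :: "'a ord_semigroup" and \<psi> \<theta>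
  assume "S \<in> Obj (SigmaOrd UNIV)" "\<psi> \<in> Hom (SigmaOrd UNIV) R S"
  then have "\<psi> \<in> Car R \<rightarrow> Car S" by (auto simp: sigma_morphism_def)
  then show "FHom singletons R T (Cmp (SigmaOrd UNIV) R S T \<theta> \<psi>) =
    Cmp (SigmaOrd UNIV) (FObj singletons R) (FObj singletons S) (FObj singletons T)
      (FHom singletons S T \<theta>) (FHom singletons R S \<psi>)"
    by (auto simp: singletons_def fun_eq_iff compose_def)
next
  fix S T :: "'a ord_semigroup"
  assume "S \<in> Obj (SigmaOrd UNIV)" "T \<in> Obj (SigmaOrd UNIV)"
  then have S: "sigma_ordered S" and T: "sigma_ordered T" by auto
  note JS = sigma_ordered_singletons[OF S] and JT = sigma_ordered_singletons[OF T]
  let ?J = "image_ord (\<lambda>a. {a})" and ?f = "FHom singletons S T"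
  have f: "?f \<theta> {a} = {\<theta> a}" if "a \<in> Car S" for \<theta> a using that by (simp add: singletons_def)
  have fe: "?f \<theta> \<in> extensional ((\<lambda>a. {a}) ` Car S)" for \<theta> by (simp add: singletons_def)
  have inj: "inj_on ?f (Hom (SigmaOrd UNIV) S T)"
  proof (rule inj_onI)
    fix \<theta> \<psi> assume *: "\<theta> \<in> Hom (SigmaOrd UNIV) S T" "\<psi> \<in> Hom (SigmaOrd UNIV) S T" "?f \<theta> = ?f \<psi>"
    have "\<theta> a = \<psi> a" if "a \<in> Car S" for a using f[OF that, of \<theta>] f[OF that, of \<psi>] *(3) by simp
    then show "\<theta> = \<psi>" using * by (intro extensionalityI[of _ "Car S"]) auto
  qed
  have "?f ` Hom (SigmaOrd UNIV) S T = Hom (SigmaOrd UNIV) (?J S) (?J T)"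
  proof (intro set_eqI iffI)
    fix \<eta> assume "\<eta> \<in> ?f ` Hom (SigmaOrd UNIV) S T"
    then obtain \<theta> where \<theta>: "sigma_morphism S T \<theta>" "\<eta> = ?f \<theta>" by auto
    have "sigma_morphism (?J S) T (\<theta> \<circ> the_elem)"
      by (rule sigma_morphism_comp[OF JS S T sigma_morphism_the_elem[OF S] \<theta>(1)]) simp
    then have "sigma_morphism (?J S) (?J T) \<eta>"
      by (rule sigma_morphism_comp[OF JS T JT _ sigma_morphism_singleton[OF T]])
        (auto simp: \<theta>(2) f)
    then show "\<eta> \<in> Hom (SigmaOrd UNIV) (?J S) (?J T)" using fe \<theta>(2) by simp
  next
    fix \<eta> assume "\<eta> \<in> Hom (SigmaOrd UNIV) (?J S) (?J T)"
    then have \<eta>: "\<eta> \<in> extensional ((\<lambda>a. {a}) ` Car S)" "sigma_morphism (?J S) (?J T) \<eta>" by simp_all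
    define \<theta> where "\<theta> = (\<lambda>a\<in>Car S. the_elem (\<eta> {a}))"
    have "sigma_morphism S (?J T) (\<lambda>a. \<eta> {a})"
      by (rule sigma_morphism_comp[OF S JS JT sigma_morphism_singleton[OF S] \<eta>(2)]) simp
    then have "sigma_morphism S T \<theta>"
      by (rule sigma_morphism_comp[OF S JT T _ sigma_morphism_the_elem[OF T]]) (simp add: \<theta>_def)
    moreover have "?f \<theta> = \<eta>"
    proof (rule extensionalityI[OF fe \<eta>(1)])
      fix A assume "A \<in> (\<lambda>a. {a}) ` Car S"
      then obtain a where a: "a \<in> Car S" "A = {a}" by auto
      then have "\<eta> A \<in> (\<lambda>a. {a}) ` Car T" using sigma_morphismD(1)[OF JT \<eta>(2), of A] by simp
      then show "?f \<theta> A = \<eta> A" using a f by (auto simp: \<theta>_def)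
    qed
    ultimately show "\<eta> \<in> ?f ` Hom (SigmaOrd UNIV) S T"
      by (intro image_eqI[of _ _ \<theta>]) (auto simp: \<theta>_def)
  qed
  then show "bij_betw ?f (Hom (SigmaOrd UNIV) S T) (Hom (SigmaOrd UNIV) (FObj singletons S) (FObj singletons T))"
    using inj by (simp add: bij_betw_def singletons_def)
qed

subsection \<open>Power sets within the universe\<close>

text \<open>
  Both constructions, bisections and spectrum, form sets of subsets of a given carrier in \<open>U\<close>. The condition says
  that these can be named by elements of the ambient type, and that the resulting carriers belong to \<open>V\<close>.
\<close>

definition powers_in :: "'w set set \<Rightarrow> 'w set set \<Rightarrow> bool" where
  "powers_in U V \<longleftrightarrow> (\<forall>A\<in>U. (\<exists>B::'w set. B \<approx> Pow A) \<and> (\<forall>B::'w set. B \<lesssim> Pow A \<longrightarrow> B \<in> V))"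

definition power_code :: "'w set \<Rightarrow> 'w set \<Rightarrow> 'w" where
  "power_code A = (SOME f. inj_on f (Pow A))"

lemma power_code_inj:
  assumes "powers_in U V" "A \<in> U" shows "inj_on (power_code A) (Pow A)"
proof -
  obtain B :: "'a set" where "B \<approx> Pow A" using assms by (auto simp: powers_in_def)
  then have "\<exists>f::'a set \<Rightarrow> 'a. inj_on f (Pow A)"
    using eqpoll_sym eqpoll_def bij_betw_def by metis
  then show ?thesis unfolding power_code_def by (rule someI_ex)
qed

lemma powers_in_image:
  assumes "powers_in U V" "A \<in> U" "X \<subseteq> f ` Pow A" shows "X \<in> V"
proof -
  have "X \<lesssim> f ` Pow A" by (rule subset_imp_lepoll[OF assms(3)])
  also have "f ` Pow A \<lesssim> Pow A" by (rule image_lepoll)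
  finally show ?thesis using assms(1,2) unfolding powers_in_def by blast
qed

definition KB_coded :: "'w top_semigroupoid \<Rightarrow> 'w ord_semigroup" where
  "KB_coded S = image_ord (power_code (Arr S)) (KB S)"

definition Spec_coded :: "'w ord_semigroup \<Rightarrow> 'w top_semigroupoid" where
  "Spec_coded S = spectrum.Spec S (power_code (Car S))"

lemma KB_coded:
  assumes U: "powers_in U V" and S: "S \<in> Obj (Amp U)"
  shows "KB_coded S \<in> Obj (SigmaOrd V)"
    and "\<exists>\<alpha>. cat_iso (SigmaOrd UNIV) (KB S) (image_ord (\<lambda>a. {a}) (KB_coded S)) \<alpha>"
proof -
  interpret ample S using S by (simp add: ample_def)
  let ?f = "power_code (Arr S)"
  have sub: "Car (KB S) \<subseteq> Pow (Arr S)" using bisection_Arr by auto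
  have "inj_on ?f (Car (KB S))"
    using power_code_inj[OF U] S inj_on_subset[OF _ sub] by auto
  then have i: "ord_iso (KB S) (KB_coded S) ?f" unfolding KB_coded_def by (rule ord_iso_image_ord)
  have "sigma_ordered (KB_coded S)"
    by (rule iso_transport.sigma_ordered_T[OF iso_transport.intro[OF i sigma_ordered_KB]])
  moreover have "Car (KB_coded S) \<in> V"
    using sub S by (intro powers_in_image[OF U, of "Arr S" _ ?f]) (auto simp: KB_coded_def)
  ultimately show "KB_coded S \<in> Obj (SigmaOrd V)" by simp
  show "\<exists>\<alpha>. cat_iso (SigmaOrd UNIV) (KB S) (image_ord (\<lambda>a. {a}) (KB_coded S)) \<alpha>"
    using SigmaOrd_isoI[OF sigma_ordered_KB ord_iso_comp[OF i ord_iso_singletons]] by blast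
qed

lemma Spec_coded:
  assumes U: "powers_in U V" and S: "S \<in> Obj (SigmaOrd U)"
  shows "Spec_coded S \<in> Obj (Amp V)"
    and "\<exists>\<beta>. cat_iso (SigmaOrd UNIV) (image_ord (\<lambda>a. {a}) S) (KB (Spec_coded S)) \<beta>"
proof -
  have so: "sigma_ordered S" using S by simp
  interpret spectrum S "power_code (Car S)"
    unfolding spectrum_def spectrum_axioms_def using sigma_orderedD[OF so] power_code_inj[OF U] S by simp
  show "Spec_coded S \<in> Obj (Amp V)"
    using ample_Spec Arr_Spec_lepoll powers_in_image[OF U, of "Car S" _ "power_code (Car S)"] S
    by (simp add: Spec_coded_def del: Spec_simps)
  show "\<exists>\<beta>. cat_iso (SigmaOrd UNIV) (image_ord (\<lambda>a. {a}) S) (KB (Spec_coded S)) \<beta>"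
    using SigmaOrd_isoI[OF sigma_ordered_singletons[OF so]
        ord_iso_comp[OF ord_iso_inv_into[OF ord_iso_singletons so] ord_iso_hat]]
    unfolding Spec_coded_def by blast
qed

lemma Amp_full_sub: "opposite (Amp U) = full_sub (opposite (Amp UNIV)) (Obj (Amp U))"
  by (simp add: opposite_def full_sub_def Amp_def)

lemma SigmaOrd_full_sub: "SigmaOrd U = full_sub (SigmaOrd UNIV) (Obj (SigmaOrd U))"
  by (simp add: full_sub_def SigmaOrd_def)

text \<open>
  Each of the two constructions passes to a power set and hence goes one step up in the chain.
\<close>

theorem duality:
  fixes U0 U1 U2 :: "'w set set"
  assumes U: "powers_in U0 U1" "powers_in U1 U2" "U0 \<subseteq> U1" "U1 \<subseteq> U2"
  shows "\<exists>F G \<eta> \<epsilon>.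
       is_functor (opposite (Amp U0)) (SigmaOrd U1) F \<and> is_functor (opposite (Amp U1)) (SigmaOrd U2) F \<and>
       is_functor (SigmaOrd U0) (opposite (Amp U1)) G \<and> is_functor (SigmaOrd U1) (opposite (Amp U2)) G \<and>
       natural_iso (opposite (Amp U0)) (opposite (Amp U2)) id_functor (comp_functor G F) \<eta> \<and>
       natural_iso (SigmaOrd U0) (SigmaOrd U2) (comp_functor F G) id_functor \<epsilon>"
proof -
  interpret common_target "opposite (Amp UNIV)" "SigmaOrd UNIV" "SigmaOrd UNIV" KB_functor singletons
    by (intro common_target.intro category_opposite category_Amp category_SigmaOrd
        fully_faithful_KB fully_faithful_singletons)
  have "\<forall>X\<in>Obj (Amp U1). \<exists>\<alpha>. cat_iso (SigmaOrd UNIV) (KB X) (image_ord (\<lambda>a. {a}) (KB_coded X)) \<alpha>"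
    using KB_coded(2)[OF U(2)] by blast
  from bchoice[OF this] obtain \<alpha> where
    a: "\<And>X. X \<in> Obj (Amp U1) \<Longrightarrow> cat_iso (SigmaOrd UNIV) (KB X) (image_ord (\<lambda>a. {a}) (KB_coded X)) (\<alpha> X)"
    by blast
  have "\<forall>Y\<in>Obj (SigmaOrd U1). \<exists>\<beta>. cat_iso (SigmaOrd UNIV) (image_ord (\<lambda>a. {a}) Y) (KB (Spec_coded Y)) \<beta>"
    using Spec_coded(2)[OF U(2)] by blast
  from bchoice[OF this] obtain \<beta> where
    b: "\<And>Y. Y \<in> Obj (SigmaOrd U1) \<Longrightarrow> cat_iso (SigmaOrd UNIV) (image_ord (\<lambda>a. {a}) Y) (KB (Spec_coded Y)) (\<beta> Y)"
    by blast
  have KJ: "FObj KB_functor = KB" "FObj singletons = image_ord (\<lambda>a. {a})"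
    by (simp_all add: KB_functor_def singletons_def)
  define P where "P U = Obj (SigmaOrd U)" for U :: "'w set set"
  have P: "SigmaOrd U = full_sub (SigmaOrd UNIV) (P U)" for U :: "'w set set"
    unfolding P_def by (rule SigmaOrd_full_sub)
  note sub = Amp_full_sub[of U0] Amp_full_sub[of U1] Amp_full_sub[of U2] P[of U0] P[of U1] P[of U2]
  show ?thesis
    unfolding sub
  proof (rule equivalence_of_full_subs[where F = KB_coded and G = Spec_coded and \<alpha> = \<alpha> and \<beta> = \<beta>])
    show "Obj (Amp U0) \<subseteq> Obj (Amp U1)" "Obj (Amp U1) \<subseteq> Obj (Amp U2)"
      "Obj (Amp U2) \<subseteq> Obj (opposite (Amp UNIV))" "P U0 \<subseteq> P U1"
      "P U1 \<subseteq> P U2" "P U2 \<subseteq> Obj (SigmaOrd UNIV)"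
      using U(3,4) by (auto simp: P_def)
    show "KB_coded X \<in> P U1" if "X \<in> Obj (Amp U0)" for X unfolding P_def by (rule KB_coded(1)[OF U(1) that])
    show "KB_coded X \<in> P U2" if "X \<in> Obj (Amp U1)" for X unfolding P_def by (rule KB_coded(1)[OF U(2) that])
    show "Spec_coded Y \<in> Obj (Amp U1)" if "Y \<in> P U0" for Y by (rule Spec_coded(1)[OF U(1) that[unfolded P_def]])
    show "Spec_coded Y \<in> Obj (Amp U2)" if "Y \<in> P U1" for Y by (rule Spec_coded(1)[OF U(2) that[unfolded P_def]])
    show "cat_iso (SigmaOrd UNIV) (FObj KB_functor X) (FObj singletons (KB_coded X)) (\<alpha> X)"
      if "X \<in> Obj (Amp U1)" for X unfolding KJ by (rule a[OF that])
    show "cat_iso (SigmaOrd UNIV) (FObj singletons Y) (FObj KB_functor (Spec_coded Y)) (\<beta> Y)"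
      if "Y \<in> P U1" for Y unfolding KJ by (rule b[OF that[unfolded P_def]])
  qed
qed

lemma powers_in_size:
  fixes A :: "'a set" and W :: "'b set"
  assumes A: "A \<lesssim> W" and W: "(UNIV :: 'b set set) \<lesssim> (UNIV :: 'a set)"
  shows "\<exists>B::'a set. B \<approx> Pow A" and "\<And>B::'a set. B \<lesssim> Pow A \<Longrightarrow> B \<lesssim> (UNIV :: 'b set set)"
proof -
  have P: "Pow A \<lesssim> (UNIV :: 'b set set)"
  proof -
    obtain f :: "'a \<Rightarrow> 'b" where "inj_on f A" using A by (auto simp: lepoll_def)
    then have "inj_on (\<lambda>X. f ` X) (Pow A)" by (rule inj_on_image_Pow)
    then show ?thesis unfolding lepoll_def by blast
  qed
  then have "Pow A \<lesssim> (UNIV :: 'a set)" using W lepoll_trans by blast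
  then obtain g :: "'a set \<Rightarrow> 'a" where "inj_on g (Pow A)" by (auto simp: lepoll_def)
  then have "g ` Pow A \<approx> Pow A" by (rule inj_on_image_eqpoll_self)
  then show "\<exists>B::'a set. B \<approx> Pow A" ..
  show "B \<lesssim> (UNIV :: 'b set set)" if "B \<lesssim> Pow A" for B :: "'a set" using that P lepoll_trans by blast
qed

lemma UNIV_lepoll_set: "(UNIV :: 'a set) \<lesssim> (UNIV :: 'a set set)"
  unfolding lepoll_def by (intro exI[of _ "\<lambda>x. {x}"]) (auto intro: inj_onI)

lemma powers_in_size_level:
  "powers_in (size_level 0 :: 'u set set set set) (size_level 1)"
  "powers_in (size_level 1 :: 'u set set set set) (size_level 2)"
  "(size_level 0 :: 'u set set set set) \<subseteq> size_level 1"
  "(size_level 1 :: 'u set set set set) \<subseteq> size_level 2"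
proof -
  have 0: "A \<lesssim> (UNIV :: 'u set) \<Longrightarrow> A \<lesssim> (UNIV :: 'u set set)" for A :: "'u set set set"
    using lepoll_trans[OF _ UNIV_lepoll_set] .
  show "powers_in (size_level 0 :: 'u set set set set) (size_level 1)"
    using powers_in_size[where 'a = "'u set set" and 'b = 'u and W = UNIV, OF _ UNIV_lepoll_set]
    by (simp add: powers_in_def size_level_def)
  show "powers_in (size_level 1 :: 'u set set set set) (size_level 2)"
    using powers_in_size(1)[where 'a = "'u set set" and 'b = "'u set" and W = UNIV, OF _ lepoll_refl]
    by (simp add: powers_in_def size_level_def)
  show "(size_level 0 :: 'u set set set set) \<subseteq> size_level 1"
    using 0 by (auto simp: size_level_def)
  show "(size_level 1 :: 'u set set set set) \<subseteq> size_level 2"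
    by (auto simp: size_level_def)
qed

theorem theorem5p22:
  fixes U :: "'w set set"
  shows "(universe U \<longrightarrow> equivalent_categories (opposite (Amp U)) (SigmaOrd U)) \<and>
    equivalent_up_to_size
      (\<lambda>i. opposite (Amp (size_level i :: 'u set set set set)))
      (\<lambda>i. SigmaOrd (size_level i :: 'u set set set set))"
proof
  show "universe U \<longrightarrow> equivalent_categories (opposite (Amp U)) (SigmaOrd U)"
  proof
    assume "universe U"
    then have "powers_in U U" by (simp add: universe_def powers_in_def)
    from duality[OF this this subset_refl subset_refl]
    show "equivalent_categories (opposite (Amp U)) (SigmaOrd U)"
      unfolding equivalent_categories_def
      using category_opposite[OF category_Amp] category_SigmaOrd by blast
  qed
  show "equivalent_up_to_size
      (\<lambda>i. opposite (Amp (size_level i :: 'u set set set set)))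
      (\<lambda>i. SigmaOrd (size_level i :: 'u set set set set))"
    unfolding equivalent_up_to_size_def
    using duality[OF powers_in_size_level] category_opposite[OF category_Amp] category_SigmaOrd by blast
qed

end
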